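(* Let $X=V(f)\subseteq\mathbb{P}^3$ be a smooth surface of degree $d\geq3$ over $\mathbb{C}$, and let $\Phi(f):\mathbb{P}^{3*}\dashrightarrow\mathcal{M}(d,2)$ be its hyperplane-section map. If $d=3$, then $\Phi(f)$ has maximal rank but is not generically finite onto its image. If $d\geq4$, then $\Phi(f)$ is generically finite onto its image.
   Context: $f\in\mathbb{C}[x_0,\ldots,x_3]$ is a homogeneous polynomial of degree $d$ defining $X$. $\mathcal{M}(d,2)$ is the coarse moduli space of smooth degree $d$ curves in $\mathbb{P}^2$, i.e. the geometric (GIT) quotient by $PGL_3(\mathbb{C})$ of the open subset of $\mathbb{P}(\mathbb{C}[x_1,x_2,x_3]_d)$ parametrizing smooth curves; $\dim\mathcal{M}(d,2)=\binom{d+2}{2}-9$. $U_f=\{H\in\mathbb{P}^{3*}\mid X\cap H\text{ is smooth}\}$ is nonempty and Zariski open, and $\Phi(f)$ is the rational map given on $U_f$ by $H\mapsto[X\cap H]$, where $X\cap H\subseteq H\simeq\mathbb{P}^2$. It has maximal rank if $\dim\operatorname{Im}\Phi(f)=\min\{3,\dim\mathcal{M}(d,2)\}$. It is generically finite onto its image if the general fiber of $\mathbb{P}^{3*}\dashrightarrow\operatorname{Im}\Phi(f)$ is finite, equivalently $\dim\operatorname{Im}\Phi(f)=3$. *)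

theory Defs
  imports "HOL-Analysis.Analysis" "HOL-Library.Poly_Mapping" "HOL-Library.Numeral_Type"
    "HOL-Library.Extended_Nat"
begin

section \<open>Polynomials in several variables\<close>

text \<open>Polynomials over \<open>\<complex>\<close> with variables indexed by \<open>'v\<close>: finitely supported families of
  coefficients, indexed by the exponent vectors of the monomials.\<close>

type_synonym 'v mpoly = "('v \<Rightarrow>\<^sub>0 nat) \<Rightarrow>\<^sub>0 complex"

definition mpoly_eval :: "'v mpoly \<Rightarrow> ('v \<Rightarrow> complex) \<Rightarrow> complex" where
  "mpoly_eval p x = (\<Sum>m\<in>Poly_Mapping.keys p. Poly_Mapping.lookup p m *
     (\<Prod>v\<in>Poly_Mapping.keys m. x v ^ Poly_Mapping.lookup m v))"

definition homogeneous :: "nat \<Rightarrow> 'v mpoly \<Rightarrow> bool" where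
  "homogeneous d p \<longleftrightarrow> (\<forall>m\<in>Poly_Mapping.keys p.
     (\<Sum>v\<in>Poly_Mapping.keys m. Poly_Mapping.lookup m v) = d)"

text \<open>If \<open>v\<close> does not occur in \<open>m\<close>, the truncated difference below is \<open>m\<close> itself, but then the
  coefficient \<open>lookup m v\<close> is \<open>0\<close>.\<close>

definition mpoly_partial :: "'v \<Rightarrow> 'v mpoly \<Rightarrow> 'v mpoly" where
  "mpoly_partial v p = (\<Sum>m\<in>Poly_Mapping.keys p.
     Poly_Mapping.single (m - Poly_Mapping.single v 1)
       (of_nat (Poly_Mapping.lookup m v) * Poly_Mapping.lookup p m))"

definition mpoly_subst :: "('v \<Rightarrow> 'w mpoly) \<Rightarrow> 'v mpoly \<Rightarrow> 'w mpoly" where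
  "mpoly_subst q p = (\<Sum>m\<in>Poly_Mapping.keys p. Poly_Mapping.single 0 (Poly_Mapping.lookup p m) *
     (\<Prod>v\<in>Poly_Mapping.keys m. q v ^ Poly_Mapping.lookup m v))"

text \<open>The polynomial \<open>y \<mapsto> p (A y)\<close>.\<close>

definition lin_subst :: "complex^'w^'v \<Rightarrow> 'v mpoly \<Rightarrow> 'w mpoly" where
  "lin_subst A = mpoly_subst (\<lambda>v. \<Sum>w\<in>UNIV. Poly_Mapping.single (Poly_Mapping.single w 1) (A $ v $ w))"

text \<open>Nonsingularity of the projective hypersurface \<open>V(p)\<close> of a homogeneous polynomial \<open>p\<close>
  (Jacobian criterion). The zero polynomial and non-reduced equations are not smooth.\<close>

definition smooth_form :: "'v mpoly \<Rightarrow> bool" where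
  "smooth_form p \<longleftrightarrow>
     (\<forall>x. x \<noteq> (\<lambda>_. 0) \<longrightarrow> mpoly_eval p x = 0 \<longrightarrow> (\<exists>v. mpoly_eval (mpoly_partial v p) x \<noteq> 0))"


section \<open>Projective spaces and the Zariski topology\<close>

definition proj_pt :: "('v \<Rightarrow> complex) \<Rightarrow> ('v \<Rightarrow> complex) set" where
  "proj_pt x = {(\<lambda>v. c * x v) | c. c \<noteq> 0}"

text \<open>The projectivization of a linear subspace \<open>W\<close> of a coordinate space.\<close>

definition proj :: "('v \<Rightarrow> complex) set \<Rightarrow> ('v \<Rightarrow> complex) set set" where
  "proj W = proj_pt ` (W - {\<lambda>_. 0})"

text \<open>The closed points of \<open>proj W\<close>, with the topology whose basis is given by the principal open
  sets \<open>{F \<noteq> 0}\<close> of the homogeneous polynomials \<open>F\<close> in the coordinates.\<close>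

definition zariski :: "('v \<Rightarrow> complex) set \<Rightarrow> ('v \<Rightarrow> complex) set topology" where
  "zariski W = topology_generated_by
     {{P \<in> proj W. \<forall>x\<in>P. mpoly_eval F x \<noteq> 0} | F n. homogeneous n F}"

abbreviation dual_P3 :: "(4 \<Rightarrow> complex) set topology" where
  "dual_P3 \<equiv> zariski UNIV"


section \<open>Dimension\<close>

definition irreducible_closed :: "'a topology \<Rightarrow> 'a set \<Rightarrow> bool" where
  "irreducible_closed X Z \<longleftrightarrow> closedin X Z \<and> Z \<noteq> {} \<and>
     (\<forall>A B. closedin X A \<and> closedin X B \<and> Z \<subseteq> A \<union> B \<longrightarrow> Z \<subseteq> A \<or> Z \<subseteq> B)"

text \<open>Krull dimension: the supremum of the lengths of chains of irreducible closed subsets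
  (the empty space gets the value \<open>0\<close>).\<close>

definition krull_dim :: "'a topology \<Rightarrow> enat" where
  "krull_dim X = Sup {enat n | n. \<exists>Z :: nat \<Rightarrow> 'a set.
     (\<forall>i\<le>n. irreducible_closed X (Z i)) \<and> (\<forall>i<n. Z i \<subset> Z (Suc i))}"


section \<open>The moduli space of smooth plane curves\<close>

text \<open>A plane curve of degree \<open>d\<close> is a point of \<open>proj (ternary_forms d)\<close>, the coordinates of a form
  being its coefficients. Accordingly the polynomials defining the Zariski topology on that space
  have variables indexed by the monomials of \<open>\<complex>[x\<^sub>1,x\<^sub>2,x\<^sub>3]\<close>.\<close>

definition ternary_forms :: "nat \<Rightarrow> ((3 \<Rightarrow>\<^sub>0 nat) \<Rightarrow> complex) set" where
  "ternary_forms d = {Poly_Mapping.lookup g | g :: 3 mpoly. homogeneous d g}"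

definition curve :: "3 mpoly \<Rightarrow> ((3 \<Rightarrow>\<^sub>0 nat) \<Rightarrow> complex) set" where
  "curve g = proj_pt (Poly_Mapping.lookup g)"

definition smooth_curves :: "nat \<Rightarrow> ((3 \<Rightarrow>\<^sub>0 nat) \<Rightarrow> complex) set topology" where
  "smooth_curves d =
     subtopology (zariski (ternary_forms d)) {curve g | g. homogeneous d g \<and> smooth_form g}"

text \<open>Orbits under projective coordinate changes. The group \<open>PGL\<^sub>3(\<complex>)\<close> acts through
  \<open>GL\<^sub>3(\<complex>)\<close>, as scalar matrices fix every point.\<close>

definition pgl_orbit ::
  "((3 \<Rightarrow>\<^sub>0 nat) \<Rightarrow> complex) set \<Rightarrow> ((3 \<Rightarrow>\<^sub>0 nat) \<Rightarrow> complex) set set" where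
  "pgl_orbit C = {curve (lin_subst A g) | g (A :: complex^3^3).
     Poly_Mapping.lookup g \<in> C \<and> invertible A}"

definition quotient_top :: "'a topology \<Rightarrow> ('a \<Rightarrow> 'b) \<Rightarrow> 'b topology" where
  "quotient_top X q = topology (\<lambda>U. U \<subseteq> q ` topspace X \<and> openin X {x \<in> topspace X. q x \<in> U})"

lemma openin_quotient_top:
  "openin (quotient_top X q) U \<longleftrightarrow>
     U \<subseteq> q ` topspace X \<and> openin X {x \<in> topspace X. q x \<in> U}"
proof -
  have "istopology (\<lambda>U. U \<subseteq> q ` topspace X \<and> openin X {x \<in> topspace X. q x \<in> U})"
    unfolding istopology_def
  proof (intro conjI allI impI)
    fix S T assume
      *: "S \<subseteq> q ` topspace X \<and> openin X {x \<in> topspace X. q x \<in> S}"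
         "T \<subseteq> q ` topspace X \<and> openin X {x \<in> topspace X. q x \<in> T}"
    have "{x \<in> topspace X. q x \<in> S \<inter> T} =
      {x \<in> topspace X. q x \<in> S} \<inter> {x \<in> topspace X. q x \<in> T}" by auto
    with * show "openin X {x \<in> topspace X. q x \<in> S \<inter> T}" by auto
    show "S \<inter> T \<subseteq> q ` topspace X" using * by auto
  next
    fix K assume *: "\<forall>S\<in>K. S \<subseteq> q ` topspace X \<and> openin X {x \<in> topspace X. q x \<in> S}"
    have "{x \<in> topspace X. q x \<in> \<Union>K} = (\<Union>S\<in>K. {x \<in> topspace X. q x \<in> S})" by auto
    with * show "openin X {x \<in> topspace X. q x \<in> \<Union>K}" by auto
    show "\<Union>K \<subseteq> q ` topspace X" using * by auto
  qed
  then show ?thesis by (simp add: quotient_top_def topology_inverse')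
qed

lemma topspace_quotient_top: "topspace (quotient_top X q) = q ` topspace X"
proof -
  have "{x \<in> topspace X. q x \<in> q ` topspace X} = topspace X" by auto
  then have "openin (quotient_top X q) (q ` topspace X)"
    by (simp add: openin_quotient_top)
  then show ?thesis
    by (metis openin_quotient_top openin_subset openin_topspace subset_antisym)
qed

lemma quotient_map_quotient_top: "quotient_map X (quotient_top X q) q"
  by (auto simp: quotient_map_def topspace_quotient_top openin_quotient_top)

text \<open>The closed points of the geometric quotient: its points are the orbits and it carries the
  quotient topology. The structure sheaf is not recorded, as dimensions and general fibres depend
  on the Zariski topology only.\<close>

definition moduli :: "nat \<Rightarrow> ((3 \<Rightarrow>\<^sub>0 nat) \<Rightarrow> complex) set set topology" where
  "moduli d = quotient_top (smooth_curves d) pgl_orbit"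


section \<open>The hyperplane-section map\<close>

text \<open>A point of the dual space is the class of the coefficient vectors of the equations of a
  hyperplane; \<open>A\<close> induces an isomorphism of \<open>\<P>\<^sup>2\<close> onto that hyperplane.\<close>

definition parametrizes :: "complex^3^4 \<Rightarrow> (4 \<Rightarrow> complex) set \<Rightarrow> bool" where
  "parametrizes A H \<longleftrightarrow> inj ((*v) A) \<and>
     range ((*v) A) = {x. \<forall>h\<in>H. (\<Sum>i\<in>UNIV. h i * x $ i) = 0}"

text \<open>The equation of \<open>V(f) \<inter> H\<close> in coordinates on \<open>H\<close>. Two choices of coordinates differ by an
  element of \<open>GL\<^sub>3(\<complex>)\<close>, so smoothness and the orbit do not depend on the choice.\<close>

definition plane_section :: "4 mpoly \<Rightarrow> (4 \<Rightarrow> complex) set \<Rightarrow> 3 mpoly" where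
  "plane_section f H = lin_subst (SOME A. parametrizes A H) f"

definition smooth_sections :: "4 mpoly \<Rightarrow> (4 \<Rightarrow> complex) set set" where
  "smooth_sections f = {H \<in> topspace dual_P3. smooth_form (plane_section f H)}"

definition \<Phi> :: "4 mpoly \<Rightarrow> (4 \<Rightarrow> complex) set \<Rightarrow> ((3 \<Rightarrow>\<^sub>0 nat) \<Rightarrow> complex) set set" where
  "\<Phi> f H = pgl_orbit (curve (plane_section f H))"

definition im_\<Phi> :: "nat \<Rightarrow> 4 mpoly \<Rightarrow> ((3 \<Rightarrow>\<^sub>0 nat) \<Rightarrow> complex) set set topology" where
  "im_\<Phi> d f = subtopology (moduli d) (\<Phi> f ` smooth_sections f)"

definition maximal_rank :: "nat \<Rightarrow> 4 mpoly \<Rightarrow> bool" where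
  "maximal_rank d f \<longleftrightarrow> krull_dim (im_\<Phi> d f) = min 3 (krull_dim (moduli d))"

text \<open>The general fibre is finite: the fibres over a dense open subset of the image are.\<close>

definition generically_finite :: "nat \<Rightarrow> 4 mpoly \<Rightarrow> bool" where
  "generically_finite d f \<longleftrightarrow> (\<exists>V. openin (im_\<Phi> d f) V \<and>
     im_\<Phi> d f closure_of V = topspace (im_\<Phi> d f) \<and>
     (\<forall>c\<in>V. finite {H \<in> smooth_sections f. \<Phi> f H = c}))"

end

theory Submission
  imports Defs "HOL-Complex_Analysis.Complex_Analysis"
    "HOL-Computational_Algebra.Fundamental_Theorem_Algebra"
begin

text \<open>For a plane \<open>y\<^sub>4 = a \<cdot> x\<close> let \<open>F\<close> be the restriction of \<open>\<nabla>f\<close> to it: four forms of degree \<open>d - 1\<close>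
without common zero. The derivative of \<open>A \<mapsto> f \<circ> A\<close> at the parametrization of this plane sends a
\<open>4 \<times> 3\<close> matrix \<open>N\<close> to \<open>F \<cdot> N x\<close>.

For \<open>d \<ge> 4\<close> it is injective for generic \<open>a\<close>. Otherwise kernels of constant dimension can be followed
along pencils of planes; the expansion of \<open>\<nabla>f\<close> transversally to the plane, together with a socle lemma
(if \<open>x\<^sub>j g\<close> lies in the span of the \<open>x\<^sub>k F\<^sub>i\<close> for all \<open>j\<close>, then \<open>g\<close> lies in the span of the \<open>F\<^sub>i\<close>), lifts a
kernel element to a matrix \<open>M \<noteq> 0\<close> with \<open>\<nabla>f(y) \<cdot> M y = 0\<close> on the whole space. A smooth form
of degree at least three has no such symmetry, as \<open>exp (t M)\<close> would be bounded. Injectivity makes the values of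
\<open>f \<circ> A\<close> at twelve suitable points algebraically independent functions of \<open>A\<close>, so the entries of \<open>A\<close> are
algebraic over them: a general section comes from finitely many planes.

For \<open>d = 3\<close> the same method, with constant vector fields instead of linear ones, shows that \<open>N \<mapsto> F \<cdot> N x\<close> is onto
the cubics, so the image of \<open>\<Phi> f\<close> is infinite. By Weierstrass normal forms the Aronhold invariants \<open>S\<close>, \<open>T\<close>
separate orbits, whence \<open>moduli 3\<close> is a curve. The condition
\<open>S\<^sup>3 T\<^sub>0\<^sup>2 = S\<^sub>0\<^sup>3 T\<^sup>2\<close> is a single equation on the three-dimensional family of planes, so every fibre is infinite.\<close>

text \<open>Special planes obstruct a direct argument: for the Fermat surface and the plane
  \<open>y 4 = 0\<close> the fourth component of \<open>F\<close> is zero, so the map has a kernel.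
  Hence only planes with kernels of minimal dimension are used, and kernels are compared on
  neighbouring planes. Vanishing to second order along the plane is the right level: a lift of
  \<open>N\<close> to a matrix \<open>M\<close> is free in its last column, and this freedom removes
  the first normal derivative of \<nabla>f(y) \<cdot> M y; the second one then vanishes because the
  span of the \<open>F\<close> contains no product of a nonzero form of positive degree with all
  variables. The degree enters through syzygies. Three general combinations of the \<open>F\<close>
  have only Koszul syzygies up to degree \<open>d - 1\<close>, and the socle lemma produces syzygies
  of degree three. For \<open>d = 3\<close> twelve entries of \<open>N\<close> face the
  ten-dimensional space of cubics, so surjectivity is the best that can hold. Forms are functions on
  coordinate spaces over arbitrary index types, so that one calculus covers forms in the
  coordinates, in the entries of a matrix, and in the values of an equation at the points of the
  plane. Transcendence degrees are replaced by counting monomials.\<close>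

type_synonym 'v cvec = "'v \<Rightarrow> complex"
type_synonym 'v cfun = "('v \<Rightarrow> complex) \<Rightarrow> complex"
abbreviation (input) zv where "zv \<equiv> \<lambda>_. 0"
abbreviation (input) "lookup \<equiv> Poly_Mapping.lookup"
abbreviation (input) "keys \<equiv> Poly_Mapping.keys"

section \<open>Forms and polynomials as functions\<close>

inductive form :: "nat \<Rightarrow> 'v cfun \<Rightarrow> bool" where
 form_const: "form 0 (%_. c)"
| form_step: "form n p \<Longrightarrow> form (Suc n) (%x. x v * p x)"
| form_add: "form n p \<Longrightarrow> form n q \<Longrightarrow> form n (%x. p x + q x)"

lemma form_scale: "form n p \<Longrightarrow> form n (%x. c * p x)"
proof (induction rule: form.induct)
 case (form_const a)
 show ?case using form.form_const[of "c * a"] by simp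
next
 case (form_step n p v)
 thus ?case using form.form_step[OF form_step.IH, of v] by (simp add: mult_ac)
next
 case (form_add n p q)
 thus ?case using form.form_add by (simp add: distrib_left)
qed

lemma form_zero: "form n zv"
proof (induction n)
 case 0
 show ?case by (rule form_const)
next
 case (Suc n)
 show ?case using form_step[OF Suc, of undefined] by simp
qed

lemma form_var: "form 1 (%x. x v)"
 using form_step[OF form_const[of 1], of v] by simp

lemma form_uminus: "form n p \<Longrightarrow> form n (%x. - p x)"
 using form_scale[of n p "-1"] by simp

lemma form_diff: "form n p \<Longrightarrow> form n q \<Longrightarrow> form n (%x. p x - q x)"
 using form_add[OF _ form_uminus] by fastforce

lemma form_mult: "form m p \<Longrightarrow> form n q \<Longrightarrow> form (m + n) (%x. p x * q x)"
proof (induction rule: form.induct)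
 case (form_const c)
 thus ?case using form_scale by simp
next
 case (form_step m p v)
 thus ?case using form.form_step[of "m + n" "%x. p x * q x" v] by (simp add: mult_ac)
next
 case (form_add m p1 p2)
 thus ?case using form.form_add[of "m + n" "%x. p1 x * q x" "%x. p2 x * q x"]
  by (simp add: distrib_right)
qed

lemma form_scale_right: "form n p \<Longrightarrow> form n (%x. p x * c)"
 using form_scale[of n p c] by (simp add: mult.commute)

lemma form_sum: "(\<And>i. i \<in> I \<Longrightarrow> form n (p i)) \<Longrightarrow> form n (%x. \<Sum>i\<in>I. p i x)"
proof (induction I rule: infinite_finite_induct)
 case (insert i I)
 thus ?case using form_add[of n "p i" "%x. \<Sum>i\<in>I. p i x"] by simp
qed (simp_all add: form_zero)

lemma form_power: "form n p \<Longrightarrow> form (k * n) (%x. p x ^ k)"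
proof (induction k)
 case 0
 thus ?case using form_const[of 1] by simp
next
 case (Suc k)
 thus ?case using form_mult[of n p "k * n" "%x. p x ^ k"] by simp
qed

lemma form_prod: "(\<And>i. i \<in> I \<Longrightarrow> form (n i) (p i)) \<Longrightarrow> form (\<Sum>i\<in>I. n i) (%x. \<Prod>i\<in>I. p i x)"
proof (induction I rule: infinite_finite_induct)
 case (insert i I)
 thus ?case using form_mult[of "n i" "p i" "\<Sum>i\<in>I. n i" "%x. \<Prod>i\<in>I. p i x"] by simp
qed (use form_const[of 1] in simp_all)

lemma form_0D: "form 0 p \<Longrightarrow> \<exists>c. p = (%_. c)"
proof (induction "0::nat" p rule: form.induct)
 case (form_add p q)
 thus ?case by auto
qed auto

lemma form_lin: "form 1 (%x. \<Sum>v\<in>A. c v * x v)"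
 by (intro form_sum form_scale form_var)

lemma form_1D:
 fixes p :: "'v::finite cfun"
 assumes "form 1 p" shows "\<exists>c. p = (%x. \<Sum>v\<in>UNIV. c v * x v)"
 using assms
proof (induction "1::nat" p rule: form.induct)
 case (form_step n p v)
 then obtain c where "p = (%_. c)" using form_0D by fastforce
 hence "(%x. x v * p x) = (%x. \<Sum>w\<in>UNIV. (if w = v then c else 0) * x w)"
  by (auto simp: if_distrib[of "%z. z * _"] sum.delta cong: if_cong)
 thus ?case by (intro exI[of _ "%w. if w = v then c else 0"])
next
 case (form_add p q)
 then obtain c c' where "p = (%x. \<Sum>v\<in>UNIV. c v * x v)" "q = (%x. \<Sum>v\<in>UNIV. c' v * x v)" by auto
 hence "(%x. p x + q x) = (%x. \<Sum>v\<in>UNIV. (c v + c' v) * x v)"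
  by (auto simp: sum.distrib distrib_right)
 thus ?case by (rule exI[of _ "%v. c v + c' v"])
qed auto

lemma form_homog: "form n p \<Longrightarrow> p (%v. c * x v) = c ^ n * p x"
 by (induction rule: form.induct) (auto simp: algebra_simps)

lemma form_at_0: "form n p \<Longrightarrow> n > 0 \<Longrightarrow> p zv = 0"
 using form_homog[of n p 0 "%_. 0"] by (simp add: zero_power)

lemma form_compose:
 assumes "form n p" "\<And>v. form k (h v)"
 shows "form (n * k) (%x. p (%v. h v x))"
 using assms(1)
proof (induction rule: form.induct)
 case (form_const c)
 thus ?case using form.form_const by simp
next
 case (form_step n p v)
 thus ?case using form_mult[OF assms(2)[of v] form_step.IH] by simp
next
 case (form_add n p q)
 show ?case by (rule form.form_add[OF form_add.IH])
qed

lemma form_compose_lin: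
 "form n p \<Longrightarrow> (\<And>v. form 1 (h v)) \<Longrightarrow> form n (%x. p (%v. h v x))"
 using form_compose[of n p 1 h] by simp

inductive polyf :: "'v cfun \<Rightarrow> bool" where
 polyf_const: "polyf (%_. c)"
| polyf_var: "polyf (%x. x v)"
| polyf_add: "polyf p \<Longrightarrow> polyf q \<Longrightarrow> polyf (%x. p x + q x)"
| polyf_mult: "polyf p \<Longrightarrow> polyf q \<Longrightarrow> polyf (%x. p x * q x)"

lemma polyf_uminus: "polyf p \<Longrightarrow> polyf (%x. - p x)"
 using polyf_mult[OF polyf_const[of "-1"]] by fastforce

lemma polyf_diff: "polyf p \<Longrightarrow> polyf q \<Longrightarrow> polyf (%x. p x - q x)"
 using polyf_add[OF _ polyf_uminus] by fastforce

lemma polyf_sum: "(\<And>i. i \<in> I \<Longrightarrow> polyf (p i)) \<Longrightarrow> polyf (%x. \<Sum>i\<in>I. p i x)"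
 by (induction I rule: infinite_finite_induct) (auto intro: polyf_const polyf_add)

lemma polyf_prod: "(\<And>i. i \<in> I \<Longrightarrow> polyf (p i)) \<Longrightarrow> polyf (%x. \<Prod>i\<in>I. p i x)"
 by (induction I rule: infinite_finite_induct) (auto intro: polyf_const polyf_mult)

lemma polyf_power: "polyf p \<Longrightarrow> polyf (%x. p x ^ k)"
 by (induction k) (auto intro: polyf_const polyf_mult)

lemma form_polyf: "form n p \<Longrightarrow> polyf p"
 by (induction rule: form.induct) (auto intro: polyf.intros)

lemma polyf_compose: "polyf p \<Longrightarrow> (\<And>v. polyf (h v)) \<Longrightarrow> polyf (%x. p (%v. h v x))"
 by (induction rule: polyf.induct) (auto intro: polyf.intros)

lemma polyf_line: "polyf p \<Longrightarrow> \<exists>q. \<forall>t. p (%v. u v + t * w v) = poly q t"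
proof (induction rule: polyf.induct)
 case (polyf_const c)
 show ?case by (rule exI[of _ "[:c:]"]) simp
next
 case (polyf_var v)
 show ?case by (rule exI[of _ "[:u v, w v:]"]) simp
next
 case (polyf_add p q)
 thus ?case by (metis poly_add)
next
 case (polyf_mult p q)
 thus ?case by (metis poly_mult)
qed

lemma form_line: "form n p \<Longrightarrow> \<exists>q. degree q \<le> n \<and> (\<forall>t. p (%v. u v + t * w v) = poly q t)"
proof (induction rule: form.induct)
 case (form_const c)
 show ?case by (rule exI[of _ "[:c:]"]) simp
next
 case (form_step n p v)
 then obtain q where "degree q \<le> n" "\<forall>t. p (%v. u v + t * w v) = poly q t" by blast
 moreover have "degree ([:u v, w v:] * q) \<le> Suc n"
  using degree_mult_le[of "[:u v, w v:]" q] \<open>degree q \<le> n\<close> by (simp split: if_splits)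
 ultimately show ?case by (intro exI[of _ "[:u v, w v:] * q"]) (simp add: algebra_simps)
next
 case (form_add n p q)
 thus ?case by (metis degree_add_le poly_add)
qed

lemma polyf_decomp: "polyf p \<Longrightarrow> \<exists>N P. (\<forall>i. form i (P i)) \<and> p = (%x. \<Sum>i\<le>(N::nat). P i x)"
proof (induction rule: polyf.induct)
 case (polyf_const c)
 show ?case
  by (rule exI[of _ 0], rule exI[of _ "%i x. if i = 0 then c else 0"])
   (auto intro: form_zero form_const)
next
 case (polyf_var v)
 have "form i (%x. if i = 1 then x v else 0)" for i
  using form_var[of v] by (cases "i = 1") (auto simp: form_zero)
 thus ?case
  by (intro exI[of _ 1] exI[of _ "%i x. if i = 1 then x v else 0"]) auto
next
 case (polyf_add p q)
 then obtain N P M Q where *: "\<forall>i. form i (P i)" "p = (%x. \<Sum>i\<le>(N::nat). P i x)"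
  "\<forall>i. form i (Q i)" "q = (%x. \<Sum>i\<le>(M::nat). Q i x)" by blast
 define R where "R i x = (if i \<le> N then P i x else 0) + (if i \<le> M then Q i x else 0)" for i x
 have "form i (R i)" for i
  unfolding R_def using * form_zero form_add form_scale
  by (cases "i \<le> N"; cases "i \<le> M") (auto simp: form_zero intro: form_add)
 moreover have "(\<Sum>i\<le>N. P i x) + (\<Sum>i\<le>M. Q i x) = (\<Sum>i\<le>max N M. R i x)" for x
 proof -
  have "(\<Sum>i\<le>N. P i x) = (\<Sum>i\<le>max N M. if i \<le> N then P i x else 0)"
   by (intro sum.mono_neutral_cong_left) auto
  moreover have "(\<Sum>i\<le>M. Q i x) = (\<Sum>i\<le>max N M. if i \<le> M then Q i x else 0)"
   by (intro sum.mono_neutral_cong_left) auto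
  ultimately show ?thesis by (simp add: R_def sum.distrib)
 qed
 ultimately show ?case using * by (intro exI[of _ "max N M"] exI[of _ R]) auto
next
 case (polyf_mult p q)
 then obtain N P M Q where *: "\<forall>i. form i (P i)" "p = (%x. \<Sum>i\<le>(N::nat). P i x)"
  "\<forall>i. form i (Q i)" "q = (%x. \<Sum>i\<le>(M::nat). Q i x)" by blast
 define R where "R k x = (\<Sum>(i,j) | i \<le> N \<and> j \<le> M \<and> i + j = k. P i x * Q j x)" for k x
 have "form k (R k)" for k
  unfolding R_def case_prod_beta using * by (intro form_sum) (auto intro: form_mult)
 moreover have "(\<Sum>i\<le>N. P i x) * (\<Sum>i\<le>M. Q i x) = (\<Sum>k\<le>N+M. R k x)" for x
 proof -
  have fin: "finite {(i,j). i \<le> N \<and> j \<le> M}"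
   by (rule finite_subset[of _ "{..N} \<times> {..M}"]) auto
  have "(\<Sum>k\<le>N+M. R k x) =
   (\<Sum>k\<le>N+M. \<Sum>z\<in>{z\<in>{..N}\<times>{..M}. fst z + snd z = k}. P (fst z) x * Q (snd z) x)"
   unfolding R_def by (intro sum.cong refl) (auto simp: case_prod_beta)
  also have "\<dots> = (\<Sum>z\<in>{..N}\<times>{..M}. P (fst z) x * Q (snd z) x)"
   by (rule sum.group) auto
  also have "\<dots> = (\<Sum>i\<le>N. \<Sum>j\<le>M. P i x * Q j x)"
   by (simp add: sum.cartesian_product case_prod_beta)
  finally show ?thesis by (simp add: sum_product)
 qed
 ultimately show ?case using * by (intro exI[of _ "N + M"] exI[of _ R]) auto
qed

lemma poly_zero_fun:
 fixes a :: "nat cvec"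
 assumes "\<And>s. (\<Sum>i\<le>N. a i * s ^ i) = 0" "i \<le> N"
 shows "a i = 0"
 using assms polyfun_eq_0[of a N] by auto

text \<open>Comparing the powers of \<open>s\<close> in \<open>p (s x)\<close> isolates the
  homogeneous component of degree \<open>n\<close>.\<close>

lemma polyf_homog_form:
 assumes "polyf p" "\<And>s x. p (%v. s * x v) = s ^ n * p x"
 shows "form n p"
proof -
 obtain N P where P: "\<forall>i. form i (P i)" "p = (%x. \<Sum>i\<le>(N::nat). P i x)"
  using polyf_decomp[OF assms(1)] by blast
 have "p x = (if n \<le> N then P n x else 0)" for x
 proof -
  define a where "a i = (if i \<le> N then P i x else 0) - (if i = n then p x else 0)" for i
  have "(\<Sum>i\<le>max N n. a i * s ^ i) = 0" for s
  proof -
   have "(\<Sum>i\<le>max N n. a i * s ^ i) = (\<Sum>i\<le>max N n. (if i \<le> N then P i x else 0) * s ^ i)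
     - (\<Sum>i\<le>max N n. (if i = n then p x else 0) * s ^ i)"
    by (simp add: a_def sum_subtractf left_diff_distrib)
   also have "(\<Sum>i\<le>max N n. (if i = n then p x else 0) * s ^ i) = s ^ n * p x"
    by (subst sum.cong[OF refl, of _ _ "%i. if i = n then s ^ n * p x else 0"]) auto
   also have "(\<Sum>i\<le>max N n. (if i \<le> N then P i x else 0) * s ^ i) = (\<Sum>i\<le>N. P i x * s ^ i)"
    by (intro sum.mono_neutral_cong_right) auto
   also have "(\<Sum>i\<le>N. P i x * s ^ i) = p (%v. s * x v)"
    using P(1) by (simp add: P(2) form_homog[OF P(1)[rule_format]] mult.commute)
   finally show ?thesis using assms(2) by simp
  qed
  hence "a n = 0" by (rule poly_zero_fun) simp
  thus ?thesis by (simp add: a_def)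
 qed
 hence "p = (if n \<le> N then P n else zv)" by auto
 thus ?thesis using P form_zero by metis
qed

text \<open>On the line from \<open>u\<close> to \<open>w\<close> both become nonzero polynomials in
  one variable, and so does their product.\<close>

lemma polyf_common_nonzero:
 assumes "polyf p" "polyf q" "p u \<noteq> 0" "q w \<noteq> 0"
 shows "\<exists>t. p (%v. u v + t * (w v - u v)) \<noteq> 0 \<and> q (%v. u v + t * (w v - u v)) \<noteq> 0"
proof -
 obtain P Q where P: "\<And>t. p (%v. u v + t * (w v - u v)) = poly P t"
  and Q: "\<And>t. q (%v. u v + t * (w v - u v)) = poly Q t"
  using polyf_line[OF assms(1)] polyf_line[OF assms(2)] by metis
 have "P \<noteq> 0" using P[of 0] assms(3) by auto
 moreover have "Q \<noteq> 0" using Q[of 1] assms(4) by auto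
 ultimately have "P * Q \<noteq> 0" by simp
 then obtain t where "poly (P * Q) t \<noteq> 0" using poly_all_0_iff_0 by blast
 thus ?thesis using P Q by (intro exI[of _ t]) auto
qed

lemma polyf_no_zero_div:
 assumes "polyf p" "polyf q" "\<And>x. p x * q x = 0"
 shows "(\<forall>x. p x = 0) \<or> (\<forall>x. q x = 0)"
proof (rule ccontr)
 assume "\<not> ?thesis"
 then obtain u w where "p u \<noteq> 0" "q w \<noteq> 0" by auto
 thus False using polyf_common_nonzero[OF assms(1,2)] assms(3) by (metis mult_eq_0_iff)
qed

lemma polyf_cancel:
 assumes "polyf p" "polyf q" "polyf r" "\<And>x. p x * q x = p x * r x" "p u \<noteq> 0"
 shows "q = r"
proof -
 have "\<And>x. p x * (q x - r x) = 0" using assms(4) by (simp add: right_diff_distrib)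
 hence "\<forall>x. q x - r x = 0"
  using polyf_no_zero_div[OF assms(1) polyf_diff[OF assms(2,3)]] assms(5) by blast
 thus ?thesis by auto
qed

text \<open>The substitution for \<open>x k\<close> projects onto the hyperplane where the linear
  form vanishes, so \<open>p\<close> and its pullback agree there and differ by a multiple of that
  form. The induction keeps track of the degree of the quotient, which is zero when \<open>n\<close>
  is.\<close>

lemma form_subst_diff:
 fixes c :: "'v::finite cvec"
 assumes "c k \<noteq> 0" "form n p"
 shows "\<exists>q. (\<forall>x. p x - p (x(k := x k - (\<Sum>v\<in>UNIV. c v * x v) / c k)) = (\<Sum>v\<in>UNIV. c v * x v) * q x) \<and>
  (case n of 0 \<Rightarrow> q = zv | Suc m \<Rightarrow> form m q)"
 using assms(2)
proof (induction rule: form.induct)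
 case (form_const a)
 show ?case by (rule exI[of _ "%_. 0"]) auto
next
 case (form_step n p v)
 let ?l = "%x. \<Sum>v\<in>UNIV. c v * x v" and ?s = "%x. x(k := x k - (\<Sum>v\<in>UNIV. c v * x v) / c k)"
 obtain q where q: "\<forall>x. p x - p (?s x) = ?l x * q x" "case n of 0 \<Rightarrow> q = zv | Suc m \<Rightarrow> form m q"
  using form_step.IH by blast
 define r where "r x = x v * q x + (if v = k then p (?s x) / c k else 0)" for x
 have sx: "?s x = (%v. x v - (if v = k then ?l x / c k else 0))" for x by auto
 have l1: "form 1 (%x. x v - (if v = k then ?l x / c k else 0))" for v
  using form_diff[OF form_var[of v] form_scale_right[OF form_lin[of c UNIV], of "1 / c k"]] form_var[of v]
  by (cases "v = k") auto
 have "form n (%x. p (?s x))"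
  unfolding sx by (rule form_compose_lin[OF form_step.hyps l1])
 moreover have "form n (%x. x v * q x)"
  using q(2) form.form_step by (cases n) (auto simp: form_zero)
 ultimately have r: "form n r"
  unfolding r_def using form_add form_scale_right[of n "%x. p (?s x)" "1 / c k"]
  by (cases "v = k") (auto simp: form_zero)
 have e: "x v * p x - (?s x) v * p (?s x) = ?l x * r x" for x
 proof -
  have e: "p x = ?l x * q x + p (?s x)" using q(1) by (metis diff_eq_eq)
  show ?thesis
  proof (cases "v = k")
   case True
   hence "x v * p x - (?s x) v * p (?s x) = x k * (p x - p (?s x)) + ?l x / c k * p (?s x)"
    by (simp add: algebra_simps)
   also have "\<dots> = x k * (?l x * q x) + ?l x / c k * p (?s x)" using q(1) by simp
   finally show ?thesis using True by (simp add: r_def algebra_simps)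
  next
   case False
   hence "x v * p x - (?s x) v * p (?s x) = x v * (p x - p (?s x))"
    by (simp add: algebra_simps)
   also have "\<dots> = x v * (?l x * q x)" using q(1) by simp
   finally show ?thesis using False by (simp add: r_def algebra_simps)
  qed
 qed
 show ?case
 proof (intro exI[of _ r] conjI allI)
  show "x v * p x - (?s x) v * p (?s x) = ?l x * r x" for x by (rule e)
  show "case Suc n of 0 \<Rightarrow> r = zv | Suc m \<Rightarrow> form m r" using r by simp
 qed
next
 case (form_add n p1 p2)
 let ?l = "%x. \<Sum>v\<in>UNIV. c v * x v"
 obtain q1 q2 where q: "\<forall>x. p1 x - p1 (x(k := x k - ?l x / c k)) = ?l x * q1 x"
  "case n of 0 \<Rightarrow> q1 = zv | Suc m \<Rightarrow> form m q1"
  "\<forall>x. p2 x - p2 (x(k := x k - ?l x / c k)) = ?l x * q2 x"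
  "case n of 0 \<Rightarrow> q2 = zv | Suc m \<Rightarrow> form m q2"
  using form_add.IH by blast
 show ?case
 proof (intro exI[of _ "%x. q1 x + q2 x"] conjI allI)
  fix x
  show "(p1 x + p2 x) - (p1 (x(k := x k - ?l x / c k)) + p2 (x(k := x k - ?l x / c k)))
   = ?l x * (q1 x + q2 x)"
   by (simp only: distrib_left add_diff_add q(1)[rule_format] q(3)[rule_format])
  show "case n of 0 \<Rightarrow> (%x. q1 x + q2 x) = zv | Suc m \<Rightarrow> form m (%x. q1 x + q2 x)"
  proof (cases n)
   case 0
   thus ?thesis using q(2,4) by simp
  next
   case (Suc m)
   thus ?thesis using q(2,4) form.form_add[of m q1 q2] by simp
  qed
 qed
qed

lemma form_linear_dvd:
 fixes c :: "'v::finite cvec"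
 assumes "c k \<noteq> 0" "form n p" "\<And>x. (\<Sum>v\<in>UNIV. c v * x v) = 0 \<Longrightarrow> p x = 0"
 shows "\<exists>q. p = (%x. (\<Sum>v\<in>UNIV. c v * x v) * q x) \<and> (case n of 0 \<Rightarrow> q = zv | Suc m \<Rightarrow> form m q)"
proof -
 let ?l = "%x. \<Sum>v\<in>UNIV. c v * x v" and ?s = "%x. x(k := x k - (\<Sum>v\<in>UNIV. c v * x v) / c k)"
 obtain q where q: "\<forall>x. p x - p (?s x) = ?l x * q x"
  "case n of 0 \<Rightarrow> q = zv | Suc m \<Rightarrow> form m q"
  using form_subst_diff[of c k n p] assms(1,2) by blast
 have "?l (?s x) = 0" for x
 proof -
  have "?l (?s x) = (\<Sum>v\<in>UNIV. c v * x v - (if v = k then ?l x else 0))"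
   using assms(1) by (intro sum.cong) (auto simp: algebra_simps)
  thus ?thesis by (simp add: sum_subtractf)
 qed
 hence "p (?s x) = 0" for x by (rule assms(3))
 thus ?thesis using q by (intro exI[of _ q]) auto
qed

section \<open>Homogeneous linear systems and spaces of forms\<close>

lemma homog_system:
 fixes M :: "'e \<Rightarrow> 'i cvec"
 assumes "finite E" "finite I" "card E < card I"
 shows "\<exists>c. (\<exists>i\<in>I. c i \<noteq> 0) \<and> (\<forall>e\<in>E. (\<Sum>i\<in>I. M e i * c i) = 0)"
 using assms
proof (induction E arbitrary: I M rule: finite_induct)
 case empty
 thus ?case by (intro exI[of _ "%_. 1"]) (auto simp: card_gt_0_iff)
next
 case (insert e E)
 show ?case
 proof (cases "\<forall>i\<in>I. M e i = 0")
  case True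
  have "card E < card I" using insert by simp
  from insert.IH[OF insert.prems(1) this, of M] show ?thesis using True by auto
 next
  case False
  then obtain i0 where i0: "i0 \<in> I" "M e i0 \<noteq> 0" by auto
  \<comment> \<open>Gaussian elimination: equation \<open>e\<close> is solved for the unknown
    \<open>i0\<close>, which is then substituted into the other equations.\<close>
  define I' where "I' = I - {i0}"
  have "card E < card I'" "finite I'" using insert i0 by (auto simp: I'_def)
  then obtain c where c: "\<exists>i\<in>I'. c i \<noteq> 0"
   "\<forall>e'\<in>E. (\<Sum>i\<in>I'. (M e' i - M e' i0 * M e i / M e i0) * c i) = 0"
   using insert.IH[of I' "%e' i. M e' i - M e' i0 * M e i / M e i0"] by auto
  define s where "s = (\<Sum>i\<in>I'. M e i * c i)"
  define c' where "c' = c(i0 := - s / M e i0)"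
  have sum: "(\<Sum>i\<in>I. M e' i * c' i) = (\<Sum>i\<in>I'. M e' i * c i) - M e' i0 * s / M e i0" for e'
  proof -
   have "(\<Sum>i\<in>I. M e' i * c' i) = M e' i0 * c' i0 + (\<Sum>i\<in>I'. M e' i * c' i)"
    unfolding I'_def using i0 insert.prems(1) by (simp add: sum.remove)
   also have "(\<Sum>i\<in>I'. M e' i * c' i) = (\<Sum>i\<in>I'. M e' i * c i)"
    by (intro sum.cong) (auto simp: c'_def I'_def)
   finally show ?thesis by (simp add: c'_def)
  qed
  have "(\<Sum>i\<in>I. M e' i * c' i) = 0" if "e' \<in> E" for e'
  proof -
   have "(\<Sum>i\<in>I'. M e' i * c i) - (\<Sum>i\<in>I'. M e' i0 / M e i0 * (M e i * c i)) =
     (\<Sum>i\<in>I'. (M e' i - M e' i0 * M e i / M e i0) * c i)"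
    unfolding sum_subtractf[symmetric] by (intro sum.cong) (auto simp: algebra_simps)
   also have "\<dots> = 0" using c(2) that by blast
   finally have "0 = (\<Sum>i\<in>I'. M e' i * c i) - (\<Sum>i\<in>I'. M e' i0 / M e i0 * (M e i * c i))"
    by simp
   moreover have "(\<Sum>i\<in>I'. M e' i0 / M e i0 * (M e i * c i)) = M e' i0 * s / M e i0"
    by (simp add: s_def sum_distrib_left sum_divide_distrib)
   ultimately show ?thesis by (simp add: sum)
  qed
  moreover have "(\<Sum>i\<in>I. M e i * c' i) = 0" using i0 by (simp add: sum s_def)
  moreover have "\<exists>i\<in>I. c' i \<noteq> 0" using c(1) by (auto simp: c'_def I'_def)
  ultimately show ?thesis by blast
 qed
qed

definition lin_comb :: "'a cvec set \<Rightarrow> 'a cvec \<Rightarrow> bool" where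
 "lin_comb B p \<longleftrightarrow> (\<exists>c. p = (%x. \<Sum>b\<in>B. c b * b x))"

lemma lin_comb_add: "lin_comb B p \<Longrightarrow> lin_comb B q \<Longrightarrow> lin_comb B (%x. p x + q x)"
 unfolding lin_comb_def
proof (elim exE)
 fix c c' assume "p = (%x. \<Sum>b\<in>B. c b * b x)" "q = (%x. \<Sum>b\<in>B. c' b * b x)"
 thus "\<exists>c. (%x. p x + q x) = (%x. \<Sum>b\<in>B. c b * b x)"
  by (intro exI[of _ "%b. c b + c' b"]) (simp add: distrib_right sum.distrib)
qed

lemma lin_comb_scale: "lin_comb B p \<Longrightarrow> lin_comb B (%x. k * p x)"
 unfolding lin_comb_def
proof (elim exE)
 fix c assume "p = (%x. \<Sum>b\<in>B. c b * b x)"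
 thus "\<exists>c. (%x. k * p x) = (%x. \<Sum>b\<in>B. c b * b x)"
  by (intro exI[of _ "%b. k * c b"]) (simp add: sum_distrib_left mult_ac)
qed

lemma lin_comb_base: "finite B \<Longrightarrow> p \<in> B \<Longrightarrow> lin_comb B p"
 unfolding lin_comb_def
 by (intro exI[of _ "%b. if b = p then 1 else 0"])
  (auto simp: if_distrib[of "%z. z * _"] sum.delta cong: if_cong)

lemma lin_comb_sum: "(\<And>i. i \<in> I \<Longrightarrow> lin_comb B (p i)) \<Longrightarrow> lin_comb B (%x. \<Sum>i\<in>I. p i x)"
proof (induction I rule: infinite_finite_induct)
 case (insert i I)
 thus ?case using lin_comb_add[of B "p i" "%x. \<Sum>i\<in>I. p i x"] by simp
qed (auto simp: lin_comb_def intro: exI[of _ "%_. 0"])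

lemma forms_finite_dim:
 "\<exists>B :: 'v::finite cfun set. finite B \<and> (\<forall>p. form n p \<longrightarrow> lin_comb B p)"
proof (induction n)
 case 0
 show ?case
 proof (intro exI[of _ "{%_. 1}"] conjI allI impI)
  fix p :: "'v cfun" assume "form 0 p"
  then obtain c where "p = (%_. c)" using form_0D by blast
  thus "lin_comb {%_. 1} p" unfolding lin_comb_def by (intro exI[of _ "%_. c"]) simp
 qed simp
next
 case (Suc n)
 then obtain B :: "'v cfun set"
  where B: "finite B" "\<And>p. form n p \<Longrightarrow> lin_comb B p" by blast
 define B' where "B' = (%(v, b) x. x v * b x :: complex) ` (UNIV \<times> B)"
 have fin: "finite B'" using B(1) by (simp add: B'_def)
 have "lin_comb B' p" if "form k p" "k = Suc n" for p k
  using that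
 proof (induction rule: form.induct)
  case (form_step m p v)
  then obtain c where c: "p = (%x. \<Sum>b\<in>B. c b * b x)" using B(2) unfolding lin_comb_def by auto
  have "lin_comb B' (%x. \<Sum>b\<in>B. c b * (x v * b x))"
   by (intro lin_comb_sum lin_comb_scale lin_comb_base[OF fin]) (auto simp: B'_def)
  moreover have "(%x. \<Sum>b\<in>B. c b * (x v * b x)) = (%x. x v * p x)"
   by (simp add: c sum_distrib_left mult_ac)
  ultimately show ?case by simp
 qed (auto intro: lin_comb_add)
 thus ?case using fin by (intro exI[of _ B']) auto
qed

lemma lin_comb_dependent:
 assumes "finite B" "finite I" "card B < card I" "\<And>i. i \<in> I \<Longrightarrow> lin_comb B (s i)"
 shows "\<exists>c. (\<exists>i\<in>I. c i \<noteq> 0) \<and> (\<forall>x. (\<Sum>i\<in>I. c i * s i x) = 0)"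
proof -
 have "\<forall>i\<in>I. \<exists>k. s i = (%x. \<Sum>b\<in>B. k b * b x)" using assms(4) by (simp add: lin_comb_def)
 then obtain k where k: "\<And>i. i \<in> I \<Longrightarrow> s i = (%x. \<Sum>b\<in>B. k i b * b x)" by metis
 obtain c where c: "\<exists>i\<in>I. c i \<noteq> 0" "\<forall>b\<in>B. (\<Sum>i\<in>I. k i b * c i) = 0"
  using homog_system[OF assms(1-3), of "%b i. k i b"] by blast
 have "(\<Sum>i\<in>I. c i * s i x) = 0" for x
 proof -
  have "(\<Sum>i\<in>I. c i * s i x) = (\<Sum>i\<in>I. \<Sum>b\<in>B. c i * (k i b * b x))"
   by (intro sum.cong refl) (simp add: k sum_distrib_left)
  also have "\<dots> = (\<Sum>b\<in>B. (\<Sum>i\<in>I. k i b * c i) * b x)"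
   by (subst sum.swap) (simp add: sum_distrib_left sum_distrib_right mult_ac)
  finally show ?thesis using c(2) by simp
 qed
 thus ?thesis using c(1) by blast
qed

text \<open>Degrees may be negative, and then only zero qualifies. Quotients thus always carry their
  expected degree, and vanishing for degree reasons becomes \<open>gform_neg\<close>.\<close>

definition gform :: "int \<Rightarrow> 'v cfun \<Rightarrow> bool" where
 "gform z p \<longleftrightarrow> (if z < 0 then p = zv else form (nat z) p)"

lemma gform_form: "form n p \<Longrightarrow> gform (int n) p" by (simp add: gform_def)
lemma form_gform: "gform (int n) p \<Longrightarrow> form n p" by (simp add: gform_def)
lemma gform_neg: "gform z p \<Longrightarrow> z < 0 \<Longrightarrow> p = zv" by (simp add: gform_def)
lemma gform_zero: "gform z zv" by (simp add: gform_def form_zero)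
lemma gform_polyf: "gform z p \<Longrightarrow> polyf p"
 by (auto simp: gform_def polyf_const intro: form_polyf split: if_splits)
lemma gform_add: "gform z p \<Longrightarrow> gform z q \<Longrightarrow> gform z (%x. p x + q x)"
 by (auto simp: gform_def intro: form_add)
lemma gform_scale: "gform z p \<Longrightarrow> gform z (%x. c * p x)"
 by (auto simp: gform_def intro: form_scale)
lemma gform_uminus: "gform z p \<Longrightarrow> gform z (%x. - p x)"
 using gform_scale[of z p "-1"] by simp
lemma gform_diff: "gform z p \<Longrightarrow> gform z q \<Longrightarrow> gform z (%x. p x - q x)"
 using gform_add[OF _ gform_uminus] by fastforce
lemma gform_mult: "gform y p \<Longrightarrow> gform z q \<Longrightarrow> k = y + z \<Longrightarrow> gform k (%x. p x * q x)"
 by (auto simp: gform_def form_zero nat_add_distrib intro: form_mult split: if_splits)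
lemma gform_sum: "(\<And>i. i \<in> I \<Longrightarrow> gform z (p i)) \<Longrightarrow> gform z (%x. \<Sum>i\<in>I. p i x)"
 by (induction I rule: infinite_finite_induct) (auto intro: gform_add gform_zero)
lemma gform_var: "gform 1 (%x. x v)" using form_var by (simp add: gform_def)
lemma gform_const: "gform 0 (%x. c)" using form_const by (simp add: gform_def)
lemma gform_0D: "gform 0 p \<Longrightarrow> \<exists>c. p = (%_. c)" using form_0D by (simp add: gform_def)
lemma gform_compose_lin: "gform z p \<Longrightarrow> (\<And>v. form 1 (h v)) \<Longrightarrow> gform z (%x. p (%v. h v x))"
 unfolding gform_def using form_compose_lin[of "nat z" p h] by (cases "z < 0") simp_all
lemma gform_homog_zero: "gform z p \<Longrightarrow> p x = 0 \<Longrightarrow> p (%v. c * x v) = 0"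
 unfolding gform_def using form_homog[of "nat z" p c x] by (cases "z < 0") simp_all

lemma gform_linear_dvd:
 fixes c :: "'v::finite cvec"
 assumes "c k \<noteq> 0" "gform z p" "\<And>x. (\<Sum>v\<in>UNIV. c v * x v) = 0 \<Longrightarrow> p x = 0"
 shows "\<exists>q. p = (%x. (\<Sum>v\<in>UNIV. c v * x v) * q x) \<and> gform (z - 1) q"
proof (cases "z < 0")
 case True
 thus ?thesis using assms(2) gform_zero by (intro exI[of _ "%_. 0"]) (auto simp: gform_def)
next
 case False
 then obtain q where "p = (%x. (\<Sum>v\<in>UNIV. c v * x v) * q x)"
  "case nat z of 0 \<Rightarrow> q = zv | Suc m \<Rightarrow> form m q"
  using form_linear_dvd[of c k "nat z" p] assms by (auto simp: gform_def)
 thus ?thesis using False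
  by (intro exI[of _ q]) (auto simp: gform_def nat_diff_distrib split: nat.splits)
qed

lemma gform_var_dvd:
 fixes w :: "'v::finite"
 assumes "gform z p" "\<And>x. x w = 0 \<Longrightarrow> p x = 0"
 shows "\<exists>q. p = (%x. x w * q x) \<and> gform (z - 1) q"
proof -
 have "(\<Sum>v\<in>UNIV. (if v = w then 1 else 0) * x v) = x w" for x :: "'v cvec"
  by (simp add: if_distrib[of "%z. z * _"] sum.delta cong: if_cong)
 thus ?thesis
  using gform_linear_dvd[of "%v. if v = w then 1 else 0" w z p] assms by simp
qed

subsection \<open>Binary forms\<close>

text \<open>The dehomogenization \<open>q\<close> has a root unless it is constant. If it is
  constant, \<open>p\<close> is a multiple of the \<open>n\<close>-th power of the second variable
  and vanishes at \<open>P 1 0\<close>.\<close>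

lemma bin_zero:
 fixes p :: "2 cfun"
 assumes "form n p" "n \<ge> 1"
 shows "\<exists>y. y \<noteq> zv \<and> p y = 0"
proof -
 define P where "P s t = (%v::2. if v = 1 then s else t :: complex)" for s t
 have lin: "(%v. P a b v + t * P c d v) = P (a + t * c) (b + t * d)" for a b c d t
  by (auto simp: P_def)
 have nz: "P s t \<noteq> zv" if "s \<noteq> 0 \<or> t \<noteq> 0" for s t
  using that by (auto simp: P_def fun_eq_iff) (metis zero_neq_one)+
 obtain q where q: "\<And>t. p (P t 1) = poly q t"
  using form_line[OF assms(1), of "P 0 1" "P 1 0"] by (auto simp: lin)
 obtain r where r: "\<And>t. p (P 1 t) = poly r t"
  using form_line[OF assms(1), of "P 1 0" "P 0 1"] by (auto simp: lin)
 show ?thesis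
 proof (cases "\<forall>t. poly q t = poly q 0")
  case False
  have "degree q \<noteq> 0"
  proof
   assume "degree q = 0"
   then obtain a where "q = [:a:]" using degree_eq_zeroE by blast
   thus False using False by simp
  qed
  then obtain z where "poly q z = 0" using alg_closed_imp_poly_has_root[of q] by auto
  thus ?thesis using q nz by (intro exI[of _ "P z 1"]) auto
 next
  case True
  hence c: "poly q t = poly q 0" for t by blast
  have "poly r s = s ^ n * poly q 0" if "s \<noteq> 0" for s
  proof -
   have "(%v. s * P (1/s) 1 v) = P 1 s" using that by (auto simp: P_def)
   hence "p (P 1 s) = s ^ n * p (P (1/s) 1)" using form_homog[OF assms(1), of s "P (1/s) 1"] by simp
   thus ?thesis using q r c by metis
  qed
  hence "UNIV - {0} \<subseteq> {s. poly (r - monom (poly q 0) n) s = 0}"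
   by (auto simp: poly_monom mult.commute)
  moreover have "infinite (UNIV - {0::complex})" by (simp add: infinite_UNIV_char_0)
  ultimately have "r - monom (poly q 0) n = 0"
   using poly_roots_finite finite_subset by blast
  hence "poly r 0 = 0" using assms(2) by (simp add: poly_monom)
  thus ?thesis using r nz by (intro exI[of _ "P 1 0"]) auto
 qed
qed

lemma bin_factor:
 fixes p :: "2 cfun"
 assumes "gform z p" "p y = 0" "y \<noteq> zv"
 shows "\<exists>q. gform (z - 1) q \<and> p = (%x. (y 2 * x 1 - y 1 * x 2) * q x)"
proof -
 define c where "c = (%v::2. if v = 1 then y 2 else - y 1)"
 have s: "(\<Sum>v\<in>UNIV. c v * x v) = y 2 * x 1 - y 1 * x 2" for x
  by (simp add: sum_2 c_def)
 have "\<exists>v. y v \<noteq> 0" using assms(3) by auto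
 hence y: "y 1 \<noteq> 0 \<or> y 2 \<noteq> 0" using exhaust_2 by metis
 hence "\<exists>k. c k \<noteq> 0" unfolding c_def by (metis neg_equal_0_iff_equal zero_neq_one)
 then obtain k where k: "c k \<noteq> 0" by blast
 have "p x = 0" if "(\<Sum>v\<in>UNIV. c v * x v) = 0" for x
 proof -
  have e: "y 2 * x 1 = y 1 * x 2" using that s by simp
  have "\<exists>a. x = (%v. a * y v)"
  proof (cases "y 1 = 0")
   case True
   hence "x v = x 2 / y 2 * y v" for v using exhaust_2[of v] e y by auto
   thus ?thesis by blast
  next
   case False
   hence "x v = x 1 / y 1 * y v" for v using exhaust_2[of v] e by (auto simp: field_simps)
   thus ?thesis by blast
  qed
  thus ?thesis using gform_homog_zero[OF assms(1,2)] by auto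
 qed
 from gform_linear_dvd[where c = c and k = k and z = z and p = p, OF k assms(1) this] show ?thesis by (auto simp: s)
qed

lemma bin_linear_nonzero:
 fixes y :: "2 cvec"
 assumes "y \<noteq> zv" shows "\<exists>x::2 cvec. y 2 * x 1 - y 1 * x 2 \<noteq> 0"
proof -
 have "\<exists>v. y v \<noteq> 0" using assms by auto
 hence y: "y 1 \<noteq> 0 \<or> y 2 \<noteq> 0" using exhaust_2 by metis
 thus ?thesis
 proof
  assume "y 2 \<noteq> 0"
  thus ?thesis by (intro exI[of _ "%v::2. if v = 1 then 1 else 0"]) simp
 next
  assume "y 1 \<noteq> 0"
  thus ?thesis by (intro exI[of _ "%v::2. if v = 1 then 0 else 1"]) simp
 qed
qed

lemma bin_linear_polyf: "polyf (%x::2 cvec. a * x 1 - b * x 2)"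
 by (intro polyf_diff polyf_mult polyf_const polyf_var)

text \<open>Induction on the degree of \<alpha>: at a zero of \<alpha> the form \<beta> is nonzero,
  so \<open>c\<close> vanishes there as well and the corresponding linear factor can be
  cancelled.\<close>

lemma bin_coprime_dvd:
 fixes \<alpha> \<beta> c h :: "2 cfun"
 assumes "form a \<alpha>" "form b \<beta>" "\<And>y. \<alpha> y = 0 \<Longrightarrow> \<beta> y = 0 \<Longrightarrow> y = zv"
  and "gform m c" "polyf h" "\<And>y. c y * \<beta> y = \<alpha> y * h y"
 shows "\<exists>c'. c = (%y. \<alpha> y * c' y) \<and> gform (m - int a) c'"
 using assms
proof (induction a arbitrary: \<alpha> c m)
 case 0
 then obtain k where k: "\<alpha> = (%_. k)" using form_0D by blast
 show ?case
 proof (cases "k = 0")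
  case False
  thus ?thesis using gform_scale[OF 0(4), of "1/k"] k
   by (intro exI[of _ "%y. 1/k * c y"]) auto
 next
  case True
  have "\<beta> (%_. 1) \<noteq> 0" using 0(3)[of "%_. 1"] k True fun_cong[of "%_::2. 1::complex" "%_. 0" 1] by auto
  moreover have "\<And>y. c y * \<beta> y = 0" using 0(6) k True by simp
  ultimately have "\<forall>y. c y = 0"
   using polyf_no_zero_div[OF gform_polyf[OF 0(4)] form_polyf[OF 0(2)]] by blast
  hence "c = zv" by auto
  thus ?thesis by (intro exI[of _ "%_. 0"]) (auto simp: gform_zero)
 qed
next
 case (Suc a)
 obtain y where y: "y \<noteq> zv" "\<alpha> y = 0" using bin_zero[OF Suc.prems(1)] by auto
 let ?l = "%x::2\<Rightarrow>complex. y 2 * x 1 - y 1 * x 2"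
 obtain \<alpha>' where \<alpha>': "gform (int (Suc a) - 1) \<alpha>'" "\<alpha> = (%x. ?l x * \<alpha>' x)"
  using bin_factor[OF gform_form[OF Suc.prems(1)] y(2,1)] by blast
 have f\<alpha>': "form a \<alpha>'" using \<alpha>'(1) by (intro form_gform) simp
 have "c y = 0" using Suc.prems(3)[OF y(2)] Suc.prems(6)[of y] y by auto
 then obtain c1 where c1: "gform (m - 1) c1" "c = (%x. ?l x * c1 x)"
  using bin_factor[OF Suc.prems(4) _ y(1)] by blast
 obtain x0 where x0: "?l x0 \<noteq> 0" using bin_linear_nonzero[OF y(1)] by blast
 have "(%x. c1 x * \<beta> x) = (%x. \<alpha>' x * h x)"
 proof (rule polyf_cancel[where p = ?l and u = x0])
  show "polyf ?l" by (rule bin_linear_polyf)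
  show "polyf (%x. c1 x * \<beta> x)" "polyf (%x. \<alpha>' x * h x)"
   by (intro polyf_mult gform_polyf[OF c1(1)] form_polyf[OF Suc.prems(2)] form_polyf[OF f\<alpha>']
     Suc.prems(5))+
  show "?l x * (c1 x * \<beta> x) = ?l x * (\<alpha>' x * h x)" for x
   using Suc.prems(6)[of x] c1(2) \<alpha>'(2) by (simp add: mult_ac)
 qed (rule x0)
 hence "\<And>x. c1 x * \<beta> x = \<alpha>' x * h x" by metis
 moreover have "\<And>y. \<alpha>' y = 0 \<Longrightarrow> \<beta> y = 0 \<Longrightarrow> y = zv" using Suc.prems(3) \<alpha>'(2) by auto
 ultimately obtain c' where "c1 = (%y. \<alpha>' y * c' y)" "gform (m - 1 - int a) c'"
  using Suc.IH[OF f\<alpha>' Suc.prems(2) _ c1(1) Suc.prems(5)] by blast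
 moreover have "c x = \<alpha> x * c' x" for x
  using fun_cong[OF c1(2), of x] fun_cong[OF \<alpha>'(2), of x] fun_cong[OF calculation(1), of x] by simp
 ultimately show ?case by (intro exI[of _ c']) (auto simp: diff_diff_eq)
qed

lemma bin_coprime_generate:
 fixes \<alpha> \<beta> h :: "2 cfun"
 assumes "form a \<alpha>" "form b \<beta>" "\<And>y. \<alpha> y = 0 \<Longrightarrow> \<beta> y = 0 \<Longrightarrow> y = zv"
  and "\<alpha> x0 \<noteq> 0" "gform n h" "n \<ge> int a + int b"
 shows "\<exists>u v. gform (n - int a) u \<and> gform (n - int b) v \<and> h = (%y. \<alpha> y * u y + \<beta> y * v y)"
 using assms
proof (induction a arbitrary: \<alpha>)
 case 0
 then obtain k where k: "\<alpha> = (%_. k)" using form_0D by blast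
 thus ?case using gform_scale[OF 0(5), of "1/k"] 0(4)
  by (intro exI[of _ "%y. 1/k * h y"] exI[of _ "%_. 0"]) (auto simp: gform_zero)
next
 case (Suc a)
 obtain y where y: "y \<noteq> zv" "\<alpha> y = 0" using bin_zero[OF Suc.prems(1)] by auto
 let ?l = "%x::2\<Rightarrow>complex. y 2 * x 1 - y 1 * x 2"
 obtain \<alpha>' where \<alpha>': "gform (int (Suc a) - 1) \<alpha>'" "\<alpha> = (%x. ?l x * \<alpha>' x)"
  using bin_factor[OF gform_form[OF Suc.prems(1)] y(2,1)] by blast
 have f\<alpha>': "form a \<alpha>'" using \<alpha>'(1) by (intro form_gform) simp
 obtain u v where uv: "gform (n - int a) u" "gform (n - int b) v" "h = (%y. \<alpha>' y * u y + \<beta> y * v y)"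
 proof -
  have "\<And>y. \<alpha>' y = 0 \<Longrightarrow> \<beta> y = 0 \<Longrightarrow> y = zv" using Suc.prems(3) \<alpha>'(2) by simp
  moreover have "\<alpha>' x0 \<noteq> 0" using Suc.prems(4) \<alpha>'(2) by auto
  moreover have "int a + int b \<le> n" using Suc.prems(6) by simp
  ultimately show ?thesis using Suc.IH[OF f\<alpha>' Suc.prems(2) _ _ Suc.prems(5)] that by blast
 qed
 have b: "\<beta> y \<noteq> 0" using Suc.prems(3) y by blast
 obtain j where j: "y j \<noteq> 0" using y(1) by auto
 \<comment> \<open>The form \<open>t\<close> corrects \<open>u\<close> by a multiple of \<beta> so
   that the result vanishes at \<open>y\<close> and takes up the factor that was split off from
   \<alpha>. Its degree \<open>k\<close> must not be negative, whence the bound on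
   \<open>n\<close>.\<close>
 define k where "k = nat (n - int a - int b)"
 have k: "int k = n - int a - int b" using Suc.prems(6) by (simp add: k_def)
 define t where "t x = - u y / \<beta> y * (1 / y j * x j) ^ k" for x :: "2 cvec"
 have "form k t" unfolding t_def
  using form_power[OF form_scale[OF form_var[of j], of "1 / y j"], of k] by (intro form_scale) simp
 hence gt: "gform (n - int a - int b) t" using gform_form k by metis
 have ty: "u y + \<beta> y * t y = 0" using b j by (simp add: t_def)
 have "gform (n - int a) (%x. u x + \<beta> x * t x)"
  by (intro gform_add uv gform_mult[OF gform_form[OF Suc.prems(2)] gt]) simp
 then obtain u' where u': "gform (n - int a - 1) u'" "(%x. u x + \<beta> x * t x) = (%x. ?l x * u' x)"
  using bin_factor[of "n - int a" "%x. u x + \<beta> x * t x", OF _ ty y(1)] by blast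
 have "gform (n - int b) (%x. v x - \<alpha>' x * t x)"
  by (intro gform_diff uv gform_mult[OF gform_form[OF f\<alpha>'] gt]) simp
 moreover have "h x = \<alpha> x * u' x + \<beta> x * (v x - \<alpha>' x * t x)" for x
 proof -
  have "\<alpha> x * u' x = \<alpha>' x * (u x + \<beta> x * t x)" using fun_cong[OF u'(2), of x] \<alpha>'(2) by simp
  thus ?thesis using uv(3) by (simp add: algebra_simps)
 qed
 moreover have "gform (n - int (Suc a)) u'" using u'(1) by (simp add: diff_diff_eq add.commute)
 ultimately show ?case by blast
qed

section \<open>Two ternary forms without common zero on a line\<close>

definition emb2 :: "2 cvec \<Rightarrow> 3 cvec" where
 "emb2 y = (%i. if i = 1 then y 1 else if i = 2 then y 2 else 0)"

definition pr2 :: "3 cvec \<Rightarrow> 2 cvec" where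
 "pr2 x = (%j. if j = 1 then x 1 else x 2)"

lemma emb2_pr2: "x 3 = 0 \<Longrightarrow> emb2 (pr2 x) = x"
proof
 fix i :: 3 assume "x 3 = 0"
 thus "emb2 (pr2 x) i = x i" using exhaust_3[of i] by (auto simp: emb2_def pr2_def)
qed

lemma pr2_emb2: "pr2 (emb2 y) = y"
proof
 fix j :: 2
 show "pr2 (emb2 y) j = y j" using exhaust_2[of j] by (auto simp: emb2_def pr2_def)
qed

lemma emb2_3: "emb2 y 3 = 0" by (simp add: emb2_def)

lemma emb2_0: "emb2 y = zv \<Longrightarrow> y = zv"
proof -
 assume "emb2 y = zv"
 hence "y = pr2 zv" using pr2_emb2[of y] by simp
 thus "y = zv" by (simp add: pr2_def)
qed

lemma gform_emb2: "gform z p \<Longrightarrow> gform z (%y. p (emb2 y))"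
proof -
 assume "gform z p"
 moreover have "form 1 (%y :: 2 cvec. if i = 1 then y 1 else if i = 2 then y 2 else 0)" for i :: 3
  using form_var[of "1::2"] form_var[of "2::2"] form_zero[of 1] by (cases "i = 1"; cases "i = 2") simp_all
 ultimately show "gform z (%y. p (emb2 y))"
  unfolding emb2_def by (rule gform_compose_lin[where h = "%i y. if i = 1 then y 1 else if i = 2 then y 2 else 0"])
qed

lemma gform_pr2: "gform z p \<Longrightarrow> gform z (%x. p (pr2 x))"
proof -
 assume "gform z p"
 moreover have "form 1 (%x :: 3 cvec. if j = 1 then x 1 else x 2)" for j :: 2
  using form_var[of "1::3"] form_var[of "2::3"] by (cases "j = 1") simp_all
 ultimately show "gform z (%x. p (pr2 x))"
  unfolding pr2_def by (rule gform_compose_lin[where h = "%j x. if j = 1 then x 1 else x 2"])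
qed

text \<open>The homogenization of \<open>q\<close> to degree \<open>N\<close>, with
  \<open>x i\<close> as the variable and \<open>x 3\<close> as the homogenizing one.\<close>

definition hom_poly :: "3 \<Rightarrow> nat \<Rightarrow> complex poly \<Rightarrow> 3 cfun" where
 "hom_poly i N q x = (\<Sum>j\<le>N. coeff q j * (x i ^ j * x 3 ^ (N - j)))"

lemma gform_hom_poly: "gform (int N) (hom_poly i N q)"
proof (rule gform_form)
 have "form N (%x. x i ^ j * x 3 ^ (N - j))" if "j \<le> N" for j
  using form_mult[OF form_power[OF form_var[of i], of j] form_power[OF form_var[of 3], of "N - j"]] that
  by simp
 thus "form N (hom_poly i N q)" unfolding hom_poly_def by (intro form_sum form_scale) auto
qed

lemma hom_poly_eq:
 assumes "degree q \<le> N" "x 3 \<noteq> 0"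
 shows "hom_poly i N q x = x 3 ^ N * poly q (x i / x 3)"
proof -
 have "poly q (x i / x 3) = (\<Sum>j\<le>N. coeff q j * (x i / x 3) ^ j)"
  unfolding poly_altdef using assms(1)
  by (intro sum.mono_neutral_left) (auto simp: coeff_eq_0)
 also have "x 3 ^ N * \<dots> = hom_poly i N q x"
  unfolding hom_poly_def sum_distrib_left
  using assms(2) by (intro sum.cong) (auto simp: power_divide power_diff field_simps)
 finally show ?thesis by simp
qed

lemma hom_poly_cong:
 assumes "polyf g" "\<And>x. x 3 \<noteq> 0 \<Longrightarrow> hom_poly i N q x = g x"
 shows "hom_poly i N q = g"
proof (rule polyf_cancel[where p = "%x. x 3" and u = "%_. 1"])
 show "polyf (%x::3 cvec. x 3)" by (rule polyf_var)
 show "polyf (hom_poly i N q)" using gform_hom_poly gform_polyf by blast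
 show "x 3 * hom_poly i N q x = x 3 * g x" for x using assms(2)[of x] by auto
qed (use assms in auto)

lemma hom_poly_mult:
 assumes "degree q \<le> N"
 shows "hom_poly i (Suc N) ([:- l, 1:] * q) = (%x. (x i - l * x 3) * hom_poly i N q x)"
proof (rule hom_poly_cong)
 show "polyf (%x. (x i - l * x 3) * hom_poly i N q x)"
  by (intro polyf_mult polyf_diff polyf_var polyf_const gform_polyf[OF gform_hom_poly])
 fix x :: "3 cvec" assume x: "x 3 \<noteq> 0"
 have "degree ([:- l, 1:] * q) \<le> Suc N"
  using degree_mult_le[of "[:- l, 1:]" q] assms by simp
 hence "hom_poly i (Suc N) ([:- l, 1:] * q) x = x 3 ^ Suc N * poly ([:- l, 1:] * q) (x i / x 3)"
  using x by (rule hom_poly_eq)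
 also have "\<dots> = x 3 ^ N * (x 3 * (x i / x 3 - l)) * poly q (x i / x 3)" by (simp add: algebra_simps)
 also have "x 3 * (x i / x 3 - l) = x i - l * x 3" using x by (simp add: field_simps)
 finally show "hom_poly i (Suc N) ([:- l, 1:] * q) x = (x i - l * x 3) * hom_poly i N q x"
  using hom_poly_eq[of q N x i] assms x by simp
qed

lemma hom_poly_Suc:
 assumes "degree q \<le> N"
 shows "hom_poly i (Suc N) q = (%x. x 3 * hom_poly i N q x)"
proof (rule hom_poly_cong)
 show "polyf (%x. x 3 * hom_poly i N q x)"
  by (intro polyf_mult polyf_var gform_polyf[OF gform_hom_poly])
 fix x :: "3 cvec" assume x: "x 3 \<noteq> 0"
 thus "hom_poly i (Suc N) q x = x 3 * hom_poly i N q x"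
  using hom_poly_eq[of q "Suc N" x i] hom_poly_eq[of q N x i] assms x by simp
qed

text \<open>Without common zeros on the line \<open>x 3 = 0\<close>, the forms \<open>f1\<close>,
  \<open>f2\<close>, \<open>x 3\<close> behave as a regular sequence, and all common zeros of
  \<open>f1\<close> and \<open>f2\<close> lie in the affine chart \<open>x 3 = 1\<close>.\<close>

locale ternary_pair =
 fixes f1 f2 :: "3 cfun" and e :: nat
 assumes f1: "form e f1" and f2: "form e f2" and e: "e \<ge> 1"
  and cop: "\<And>x. x 3 = 0 \<Longrightarrow> f1 x = 0 \<Longrightarrow> f2 x = 0 \<Longrightarrow> x = zv"
begin

lemma cop2: "f1 (emb2 y) = 0 \<Longrightarrow> f2 (emb2 y) = 0 \<Longrightarrow> y = zv"
 using cop[of "emb2 y"] emb2_3[of y] emb2_0[of y] by blast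

lemma form_f12_emb2: "form e (%y. f1 (emb2 y))" "form e (%y. f2 (emb2 y))"
 using gform_emb2[OF gform_form[OF f1]] gform_emb2[OF gform_form[OF f2]] form_gform by blast+

lemma f1_nonzero: "\<exists>y. f1 (emb2 y) \<noteq> 0"
proof (rule ccontr)
 assume "\<not> ?thesis"
 moreover obtain y where "y \<noteq> zv" "f2 (emb2 y) = 0" using bin_zero[OF form_f12_emb2(2) e] by blast
 ultimately show False using cop2 by blast
qed

lemma f2_nonzero: "\<exists>y. f2 (emb2 y) \<noteq> 0"
proof (rule ccontr)
 assume "\<not> ?thesis"
 moreover obtain y where "y \<noteq> zv" "f1 (emb2 y) = 0" using bin_zero[OF form_f12_emb2(1) e] by blast
 ultimately show False using cop2 by blast
qed

text \<open>On the line the two forms are coprime binary forms, so \<open>f2\<close> divides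
  \<open>a\<close>; the quotient is the Koszul coefficient.\<close>

lemma koszul_line:
 assumes "gform z a" "gform z b" "\<And>x. x 3 = 0 \<Longrightarrow> a x * f1 x + b x * f2 x = 0"
 shows "\<exists>c. gform (z - int e) c \<and> (\<forall>x. x 3 = 0 \<longrightarrow> a x = c x * f2 x \<and> b x = - (c x * f1 x))"
proof -
 have eq: "a (emb2 y) * f1 (emb2 y) = f2 (emb2 y) * - b (emb2 y)" for y
 proof -
  have "a (emb2 y) * f1 (emb2 y) + b (emb2 y) * f2 (emb2 y) = 0" by (intro assms(3) emb2_3)
  thus ?thesis by (simp add: eq_neg_iff_add_eq_0 mult.commute)
 qed
 have pb: "polyf (%y. - b (emb2 y))"
  by (intro polyf_uminus gform_polyf[OF gform_emb2[OF assms(2)]])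
 obtain c where c: "(%y. a (emb2 y)) = (%y. f2 (emb2 y) * c y)" "gform (z - int e) c"
  using bin_coprime_dvd[OF form_f12_emb2(2,1) _ gform_emb2[OF assms(1)] pb eq] cop2 by blast
 have "polyf (%y. c y * f1 (emb2 y) + b (emb2 y))"
  by (intro polyf_add polyf_mult gform_polyf[OF c(2)] form_polyf[OF form_f12_emb2(1)]
    gform_polyf[OF gform_emb2[OF assms(2)]])
 moreover have "f2 (emb2 y) * (c y * f1 (emb2 y) + b (emb2 y)) = 0" for y
  using eq[of y] fun_cong[OF c(1), of y] by (simp add: algebra_simps)
 ultimately have b0: "c y * f1 (emb2 y) + b (emb2 y) = 0" for y
  using polyf_no_zero_div[OF form_polyf[OF form_f12_emb2(2)]] f2_nonzero by blast
 show ?thesis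
 proof (intro exI[of _ "%x. c (pr2 x)"] conjI allI impI)
  show "gform (z - int e) (%x. c (pr2 x))" by (rule gform_pr2[OF c(2)])
  fix x :: "3 cvec" assume "x 3 = 0"
  hence x: "emb2 (pr2 x) = x" by (intro emb2_pr2)
  show "a x = c (pr2 x) * f2 x" using fun_cong[OF c(1), of "pr2 x"] x by simp
  show "b x = - (c (pr2 x) * f1 x)" using b0[of "pr2 x"] x by (simp add: eq_neg_iff_add_eq_0 add.commute)
 qed
qed

text \<open>The homogeneous part of degree \<open>z\<close> of the ideal generated by
  \<open>f1\<close> and \<open>f2\<close>.\<close>

definition idl :: "int \<Rightarrow> 3 cfun \<Rightarrow> bool" where
 "idl z p \<longleftrightarrow> (\<exists>u v. gform (z - int e) u \<and> gform (z - int e) v \<and> p = (%x. u x * f1 x + v x * f2 x))"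

lemma idlI: "gform (z - int e) u \<Longrightarrow> gform (z - int e) v \<Longrightarrow> (\<And>x. p x = u x * f1 x + v x * f2 x) \<Longrightarrow> idl z p"
 unfolding idl_def by blast

lemma idlE:
 assumes "idl z p"
 obtains u v where "gform (z - int e) u" "gform (z - int e) v" "\<And>x. p x = u x * f1 x + v x * f2 x"
 using assms unfolding idl_def by auto

lemma idl_add: "idl z p \<Longrightarrow> idl z q \<Longrightarrow> idl z (%x. p x + q x)"
proof (elim idlE)
 fix u v u' v'
 assume *: "gform (z - int e) u" "gform (z - int e) v" "\<And>x. p x = u x * f1 x + v x * f2 x"
  "gform (z - int e) u'" "gform (z - int e) v'" "\<And>x. q x = u' x * f1 x + v' x * f2 x"
 show ?thesis
  by (rule idlI[OF gform_add[OF *(1,4)] gform_add[OF *(2,5)]]) (simp add: *(3,6) algebra_simps)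
qed

lemma idl_mult: "gform y h \<Longrightarrow> idl z p \<Longrightarrow> k = y + z \<Longrightarrow> idl k (%x. h x * p x)"
proof (elim idlE)
 fix u v
 assume *: "gform y h" "k = y + z"
  "gform (z - int e) u" "gform (z - int e) v" "\<And>x. p x = u x * f1 x + v x * f2 x"
 show ?thesis
  by (rule idlI[of k "%x. h x * u x" "%x. h x * v x"])
   (auto simp: * algebra_simps intro!: gform_mult[OF *(1,3)] gform_mult[OF *(1,4)])
qed

lemma idl_scale: "idl z p \<Longrightarrow> idl z (%x. c * p x)"
 using idl_mult[OF gform_const] by simp

lemma idl_f: "idl (int e) f1" "idl (int e) f2"
 by (rule idlI[of _ "%_. 1" "%_. 0"]; simp add: gform_const gform_zero)
  (rule idlI[of _ "%_. 0" "%_. 1"]; simp add: gform_const gform_zero)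

text \<open>On the line \<open>x 3 = 0\<close> the coefficients \<open>u\<close>, \<open>v\<close>
  form a Koszul relation. Subtracting this relation does not change \<open>u * f1 + v * f2\<close>
  and makes both coefficients divisible by \<open>x 3\<close>.\<close>

lemma idl_nonzerodivisor:
 assumes "gform z m" "idl (z + 1) (%x. x 3 * m x)"
 shows "idl z m"
proof -
 obtain u v where uv: "gform (z + 1 - int e) u" "gform (z + 1 - int e) v"
  and eq: "\<And>x. x 3 * m x = u x * f1 x + v x * f2 x"
  using idlE[OF assms(2)] by metis
 have "x 3 = 0 \<Longrightarrow> u x * f1 x + v x * f2 x = 0" for x using eq[of x] by simp
 then obtain c where c: "gform (z + 1 - int e - int e) c"
  "\<And>x. x 3 = 0 \<Longrightarrow> u x = c x * f2 x \<and> v x = - (c x * f1 x)"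
  using koszul_line[OF uv] by blast
 have "gform (z + 1 - int e) (%x. u x - c x * f2 x)"
  by (intro gform_diff uv gform_mult[OF c(1) gform_form[OF f2]]) simp
 then obtain u' where u': "(%x. u x - c x * f2 x) = (%x. x 3 * u' x)" "gform (z + 1 - int e - 1) u'"
  using gform_var_dvd[of "z + 1 - int e" "%x. u x - c x * f2 x" 3] c(2) by (auto simp: algebra_simps)
 have "gform (z + 1 - int e) (%x. v x + c x * f1 x)"
  by (intro gform_add uv gform_mult[OF c(1) gform_form[OF f1]]) simp
 then obtain v' where v': "(%x. v x + c x * f1 x) = (%x. x 3 * v' x)" "gform (z + 1 - int e - 1) v'"
  using gform_var_dvd[of "z + 1 - int e" "%x. v x + c x * f1 x" 3] c(2) by (auto simp: algebra_simps)
 have uv': "gform (z - int e) u'" "gform (z - int e) v'" using u'(2) v'(2) by (simp_all add: algebra_simps)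
 have "m = (%x. u' x * f1 x + v' x * f2 x)"
 proof (rule polyf_cancel[where p = "%x. x 3" and u = "%_. 1"])
  show "polyf (%x. u' x * f1 x + v' x * f2 x)"
   by (intro polyf_add polyf_mult gform_polyf[OF uv'(1)] gform_polyf[OF uv'(2)] form_polyf[OF f1] form_polyf[OF f2])
  show "x 3 * m x = x 3 * (u' x * f1 x + v' x * f2 x)" for x
  proof -
   have uvx: "u x = x 3 * u' x + c x * f2 x" "v x = x 3 * v' x - c x * f1 x"
    using fun_cong[OF u'(1), of x] fun_cong[OF v'(1), of x] by (simp_all add: algebra_simps)
   hence "u x * f1 x + v x * f2 x = x 3 * (u' x * f1 x + v' x * f2 x)"
    by (simp only: uvx) (simp add: algebra_simps)
   thus ?thesis using eq[of x] by simp
  qed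
 qed (use gform_polyf[OF assms(1)] in \<open>auto intro: polyf_var\<close>)
 thus ?thesis using uv' idl_def by blast
qed

lemma idl_nonzerodivisor_power:
 assumes "gform z m" "idl (z + int k) (%x. x 3 ^ k * m x)"
 shows "idl z m"
 using assms(2)
proof (induction k)
 case 0
 thus ?case by simp
next
 case (Suc k)
 have "gform (z + int k) (%x. x 3 ^ k * m x)"
  using gform_mult[OF gform_form[OF form_power[OF form_var[of 3], of k]] assms(1), of "z + int k"] by simp
 moreover have "idl (z + int k + 1) (%x. x 3 * (x 3 ^ k * m x))"
  using Suc.prems by (simp add: algebra_simps)
 ultimately show ?case using idl_nonzerodivisor Suc.IH by blast
qed

text \<open>In degrees from \<open>2 * e\<close> on, the restrictions of \<open>f1\<close> and
  \<open>f2\<close> to the line generate all binary forms; what remains of \<open>p\<close> vanishes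
  on the line.\<close>

lemma idl_reduce:
 assumes "gform z p" "z \<ge> 2 * int e"
 shows "\<exists>q. gform (z - 1) q \<and> idl z (%x. p x - x 3 * q x)"
proof -
 obtain y where y: "f1 (emb2 y) \<noteq> 0" using f1_nonzero by blast
 obtain u v where uv: "gform (z - int e) u" "gform (z - int e) v"
  "(%y. p (emb2 y)) = (%y. f1 (emb2 y) * u y + f2 (emb2 y) * v y)"
  using bin_coprime_generate[OF form_f12_emb2 _ y gform_emb2[OF assms(1)]] cop2 assms(2) by fastforce
 have g: "gform z (%x. p x - (u (pr2 x) * f1 x + v (pr2 x) * f2 x))"
  by (intro gform_diff gform_add assms(1) gform_mult[OF gform_pr2[OF uv(1)] gform_form[OF f1]]
    gform_mult[OF gform_pr2[OF uv(2)] gform_form[OF f2]]) simp_all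
 have "p x - (u (pr2 x) * f1 x + v (pr2 x) * f2 x) = 0" if "x 3 = 0" for x
  using fun_cong[OF uv(3), of "pr2 x"] emb2_pr2[of x] that by simp
 then obtain q where q: "(%x. p x - (u (pr2 x) * f1 x + v (pr2 x) * f2 x)) = (%x. x 3 * q x)" "gform (z - 1) q"
  using gform_var_dvd[OF g] by blast
 have "idl z (%x. p x - x 3 * q x)"
  by (rule idlI[OF gform_pr2[OF uv(1)] gform_pr2[OF uv(2)]])
   (use fun_cong[OF q(1)] in \<open>simp add: algebra_simps\<close>)
 thus ?thesis using q(2) by blast
qed

text \<open>Modulo the ideal, forms of any large degree come from the fixed finite-dimensional space
  of forms of degree \<open>2 * e\<close>.\<close>

lemma idl_reduce_power:
 assumes "gform (2 * int e + int k) p"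
 shows "\<exists>s. form (2 * e) s \<and> idl (2 * int e + int k) (%x. p x - x 3 ^ k * s x)"
 using assms
proof (induction k arbitrary: p)
 case 0
 have "idl (2 * int e) (%x. p x - p x)"
  by (rule idlI[OF gform_zero gform_zero]) simp
 moreover have "form (2 * e) p" using 0 by (intro form_gform) simp
 ultimately show ?case by (intro exI[of _ p]) simp
next
 case (Suc k)
 obtain q where q: "gform (2 * int e + int (Suc k) - 1) q" "idl (2 * int e + int (Suc k)) (%x. p x - x 3 * q x)"
  using idl_reduce[OF Suc.prems] by auto
 have "gform (2 * int e + int k) q" using q(1) by simp
 then obtain s where s: "form (2 * e) s" "idl (2 * int e + int k) (%x. q x - x 3 ^ k * s x)"
  using Suc.IH by blast
 have "idl (2 * int e + int (Suc k)) (%x. x 3 * (q x - x 3 ^ k * s x))"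
  by (rule idl_mult[OF gform_var s(2)]) simp
 from idl_add[OF q(2) this] show ?case using s(1)
  by (intro exI[of _ s]) (simp add: algebra_simps)
qed

lemma idl_sum: "(\<And>i. i \<in> I \<Longrightarrow> idl z (p i)) \<Longrightarrow> idl z (%x. \<Sum>i\<in>I. p i x)"
proof (induction I rule: infinite_finite_induct)
 case (insert i I)
 thus ?case using idl_add[of z "p i" "%x. \<Sum>i\<in>I. p i x"] by simp
qed (auto intro: idlI[OF gform_zero gform_zero])

text \<open>The \<open>N + 1\<close> products of \<open>m\<close> with monomials in
  \<open>x i\<close> and \<open>x 3\<close> reduce to \<open>x 3 ^ k\<close> times forms of degree
  \<open>2 * e\<close>, and there are too many of them to be independent. So multiplication by
  \<open>x i / x 3\<close> satisfies a polynomial equation \<open>q\<close> on the class of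
  \<open>m\<close>.\<close>

lemma hom_poly_in_idl:
 assumes "gform z m" "z \<ge> 0"
 shows "\<exists>N q. q \<noteq> 0 \<and> degree q \<le> N \<and> idl (z + int N) (%x. hom_poly i N q x * m x)"
proof -
 obtain B :: "3 cfun set"
  where B: "finite B" "\<And>p. form (2 * e) p \<Longrightarrow> lin_comb B p" using forms_finite_dim by blast
 define N where "N = card B + 2 * e"
 define k where "k = nat z + card B"
 have zN: "z + int N = 2 * int e + int k" using assms(2) by (simp add: N_def k_def)
 define P where "P j x = x i ^ j * x 3 ^ (N - j) * m x" for j and x :: "3 cvec"
 have "gform (2 * int e + int k) (P j)" if "j \<le> N" for j
 proof -
  have "gform (int N) (%x. x i ^ j * x 3 ^ (N - j))"
   using form_mult[OF form_power[OF form_var[of i], of j] form_power[OF form_var[of 3], of "N - j"]] that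
   by (intro gform_form) simp
  thus ?thesis unfolding P_def using assms(1) by (rule gform_mult) (simp flip: zN)
 qed
 hence ex: "\<forall>j\<in>{..N}. \<exists>s. form (2 * e) s \<and> idl (2 * int e + int k) (%x. P j x - x 3 ^ k * s x)"
  using idl_reduce_power by blast
 then obtain s where s: "\<And>j. j \<in> {..N} \<Longrightarrow> form (2 * e) (s j)"
  "\<And>j. j \<in> {..N} \<Longrightarrow> idl (2 * int e + int k) (%x. P j x - x 3 ^ k * s j x)"
  using bchoice[OF ex] by blast
 have "card B < card {..N}" by (simp add: N_def)
 then obtain c where c: "\<exists>j\<in>{..N}. c j \<noteq> 0" "\<And>x. (\<Sum>j\<le>N. c j * s j x) = 0"
  using lin_comb_dependent[OF B(1), of "{..N}" s] B(2) s(1) by auto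
 have "idl (2 * int e + int k) (%x. \<Sum>j\<le>N. c j * (P j x - x 3 ^ k * s j x))"
  by (intro idl_sum idl_scale s(2))
 moreover have "(\<Sum>j\<le>N. c j * (P j x - x 3 ^ k * s j x)) = (\<Sum>j\<le>N. c j * P j x)" for x
 proof -
  have "(\<Sum>j\<le>N. c j * (P j x - x 3 ^ k * s j x)) = (\<Sum>j\<le>N. c j * P j x) - x 3 ^ k * (\<Sum>j\<le>N. c j * s j x)"
   by (simp add: right_diff_distrib sum_subtractf sum_distrib_left mult_ac)
  thus ?thesis by (simp add: c(2))
 qed
 ultimately have *: "idl (z + int N) (%x. \<Sum>j\<le>N. c j * P j x)" by (simp add: zN)
 define q where "q = (\<Sum>j\<le>N. monom (c j) j)"
 have cq: "coeff q j = (if j \<le> N then c j else 0)" for j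
  by (simp add: q_def coeff_sum)
 have "q \<noteq> 0" "degree q \<le> N" using c(1) cq by (metis atMost_iff coeff_0) (rule degree_le, simp add: cq)
 have "hom_poly i N q x * m x = (\<Sum>j\<le>N. c j * P j x)" for x
  by (simp add: hom_poly_def P_def cq sum_distrib_left mult_ac)
 hence "idl (z + int N) (%x. hom_poly i N q x * m x)" using * by simp
 thus ?thesis using \<open>q \<noteq> 0\<close> \<open>degree q \<le> N\<close> by blast
qed

text \<open>The linear factors of \<open>q\<close> are removed one by one; the last product outside
  the ideal is an eigenvector of multiplication by \<open>x i / x 3\<close>. A drop in degree is
  harmless because \<open>x 3\<close> is a nonzerodivisor.\<close>

lemma idl_eigen:
 assumes "gform z m" "\<not> idl z m" "q \<noteq> 0" "degree q \<le> N" "idl (z + int N) (%x. hom_poly i N q x * m x)"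
 shows "\<exists>l k h. form k h \<and> \<not> idl (int k + z) (%x. h x * m x) \<and>
  idl (int k + z + 1) (%x. (x i - l * x 3) * (h x * m x))"
 using assms(3-5)
proof (induction N arbitrary: q)
 case 0
 have "degree q = 0" using 0(2) by simp
 then obtain a where "q = [:a:]" by (rule degree_eq_zeroE)
 moreover have "a \<noteq> 0" using 0(1) calculation by auto
 ultimately have "idl z (%x. a * m x)" using 0 by (simp add: hom_poly_def)
 from idl_scale[OF this, of "1 / a"] show ?case using \<open>a \<noteq> 0\<close> assms(2) by simp
next
 case (Suc N)
 show ?case
 proof (cases "degree q \<le> N")
  case True
  have g: "gform (z + int N) (%x. hom_poly i N q x * m x)"
   by (rule gform_mult[OF gform_hom_poly assms(1)]) simp
  have "idl (z + int N + 1) (%x. x 3 * (hom_poly i N q x * m x))"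
   using Suc.prems(3) by (simp add: hom_poly_Suc[OF True] mult.assoc add.assoc add.commute[of 1])
  thus ?thesis using Suc.IH[OF Suc.prems(1) True] idl_nonzerodivisor[OF g] by blast
 next
  case False
  hence "degree q > 0" by simp
  then obtain l where "poly q l = 0" using alg_closed_imp_poly_has_root[of q] by auto
  then obtain q' where q': "q = [:- l, 1:] * q'" by (metis dvdE poly_eq_0_iff_dvd)
  have q0: "q' \<noteq> 0" using q' Suc.prems(1) by auto
  have dq: "degree q' \<le> N" using Suc.prems(2) q0 unfolding q' by (subst (asm) degree_mult_eq) auto
  have *: "idl (int N + z + 1) (%x. (x i - l * x 3) * (hom_poly i N q' x * m x))"
   using Suc.prems(3) by (simp add: q' hom_poly_mult[OF dq, simplified] mult.assoc algebra_simps)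
  show ?thesis
  proof (cases "idl (z + int N) (%x. hom_poly i N q' x * m x)")
   case True
   thus ?thesis by (rule Suc.IH[OF q0 dq])
  next
   case False
   hence "\<not> idl (int N + z) (%x. hom_poly i N q' x * m x)" by (simp add: add.commute)
   thus ?thesis using * form_gform[OF gform_hom_poly] by blast
  qed
 qed
qed

text \<open>A Nullstellensatz by simultaneous eigenvectors: some multiple \<open>m'\<close> of
  \<open>m\<close> is an eigenvector for \<open>x 1 / x 3\<close> and for \<open>x 2 / x 3\<close>,
  and \<open>v\<close> consists of the two eigenvalues and \<open>1\<close>.\<close>

lemma common_zero_of_quotient:
 assumes "gform z m" "z \<ge> 0" "\<not> idl z m"
 shows "\<exists>v. v 3 = 1 \<and> f1 v = 0 \<and> f2 v = 0 \<and> (\<forall>n h. form n h \<longrightarrow> idl (int n + z) (%x. h x * m x) \<longrightarrow> h v = 0)"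
proof -
 obtain N q where q: "q \<noteq> 0" "degree q \<le> N" "idl (z + int N) (%x. hom_poly 1 N q x * m x)"
  using hom_poly_in_idl[OF assms(1,2), of 1] by auto
 obtain l1 k1 h1 where h1: "form k1 h1" "\<not> idl (int k1 + z) (%x. h1 x * m x)"
  "idl (int k1 + z + 1) (%x. (x 1 - l1 * x 3) * (h1 x * m x))"
  using idl_eigen[OF assms(1,3) q] by blast
 have g1: "gform (int k1 + z) (%x. h1 x * m x)" by (rule gform_mult[OF gform_form[OF h1(1)] assms(1)]) simp
 obtain N' q' where q': "q' \<noteq> 0" "degree q' \<le> N'" "idl (int k1 + z + int N') (%x. hom_poly 2 N' q' x * (h1 x * m x))"
  using hom_poly_in_idl[OF g1, of 2] assms(2) by auto
 obtain l2 k2 h2 where h2: "form k2 h2" "\<not> idl (int k2 + (int k1 + z)) (%x. h2 x * (h1 x * m x))"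
  "idl (int k2 + (int k1 + z) + 1) (%x. (x 2 - l2 * x 3) * (h2 x * (h1 x * m x)))"
  using idl_eigen[OF g1 h1(2) q'] by blast
 define k where "k = int k2 + (int k1 + z)"
 define m' where "m' = (%x. h2 x * (h1 x * m x))"
 define v :: "3 cvec" where "v i = (if i = 1 then l1 else if i = 2 then l2 else 1)" for i
 have gm: "gform k m'" unfolding m'_def k_def by (rule gform_mult[OF gform_form[OF h2(1)] g1]) simp
 have nm: "\<not> idl k m'" using h2(2) by (simp add: k_def m'_def)
 have x1: "idl (k + 1) (%x. (x 1 - l1 * x 3) * m' x)"
  using idl_mult[OF gform_form[OF h2(1)] h1(3), of "k + 1"] by (simp add: k_def m'_def mult_ac)
 have x2: "idl (k + 1) (%x. (x 2 - l2 * x 3) * m' x)" using h2(3) by (simp add: k_def m'_def)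
 have xv: "idl (k + 1) (%x. (x w - v w * x 3) * m' x)" for w
  using exhaust_3[of w] x1 x2 idlI[OF gform_zero gform_zero, where z = "k + 1" and p = "%x. 0"] by (auto simp: v_def)
 \<comment> \<open>A form \<open>h\<close> acts on the eigenvector as the scalar \<open>h v\<close>,
   up to a power of \<open>x 3\<close>; so a form annihilating \<open>m'\<close> has to vanish at
   \<open>v\<close>.\<close>
 have ev: "idl (int n + k) (%x. h x * m' x - h v * x 3 ^ n * m' x)" if "form n h" for n h
  using that
 proof (induction rule: form.induct)
  case (form_const c)
  show ?case by (rule idlI[OF gform_zero gform_zero]) simp
 next
  case (form_step n p w)
  have a: "idl (int (Suc n) + k) (%x. x w * (p x * m' x - p v * x 3 ^ n * m' x))"
   by (rule idl_mult[OF gform_var form_step.IH]) simp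
  have "gform (int n) (%x. p v * x 3 ^ n)"
   using gform_scale[OF gform_form[OF form_power[OF form_var[of 3], of n]]] by simp
  hence b: "idl (int (Suc n) + k) (%x. (p v * x 3 ^ n) * ((x w - v w * x 3) * m' x))"
   by (rule idl_mult[OF _ xv]) simp
  show ?case using idl_add[OF a b] by (simp add: algebra_simps)
 next
  case (form_add n p q)
  show ?case using idl_add[OF form_add.IH] by (simp add: algebra_simps)
 qed
 have zero: "h v = 0" if "form n h" "idl (int n + k) (%x. h x * m' x)" for n h
 proof (rule ccontr)
  assume nz: "h v \<noteq> 0"
  have "idl (int n + k) (%x. 1 / h v * (h x * m' x + (- 1) * (h x * m' x - h v * x 3 ^ n * m' x)))"
   by (intro idl_scale idl_add that(2) ev[OF that(1)])
  hence "idl (k + int n) (%x. x 3 ^ n * m' x)" using nz by (simp add: add.commute)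
  thus False using idl_nonzerodivisor_power[OF gm] nm by blast
 qed
 have hm': "idl (int n + k) (%x. h x * m' x)" if "form n h" "idl (int n + z) (%x. h x * m x)" for n h
 proof -
  have "gform (int k1 + int k2) (%x. h1 x * h2 x)"
   by (rule gform_mult[OF gform_form[OF h1(1)] gform_form[OF h2(1)]]) simp
  from idl_mult[OF this that(2), of "int n + k"] show ?thesis by (simp add: k_def m'_def mult_ac)
 qed
 have "idl (int e + k) (%x. f1 x * m' x)" "idl (int e + k) (%x. f2 x * m' x)"
  using idl_mult[OF gm idl_f(1), of "int e + k"] idl_mult[OF gm idl_f(2), of "int e + k"]
  by (simp_all add: mult.commute add.commute)
 hence "f1 v = 0" "f2 v = 0" using zero[OF f1] zero[OF f2] by blast+
 moreover have "v 3 = 1" by (simp add: v_def)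
 ultimately show ?thesis using zero hm' by blast
qed

lemma common_zero: "\<exists>v. v 3 = 1 \<and> f1 v = 0 \<and> f2 v = 0"
proof -
 have "\<not> idl 0 (%_. 1)"
 proof
  assume "idl 0 (%_. 1)"
  then obtain u v where "gform (0 - int e) u" "gform (0 - int e) v" "\<And>x. 1 = u x * f1 x + v x * f2 x"
   using idlE by metis
  moreover have "0 - int e < 0" using e by simp
  ultimately show False using gform_neg by (metis add_0 mult_zero_left zero_neq_one)
 qed
 thus ?thesis using common_zero_of_quotient[OF gform_const] by blast
qed

text \<open>For \<open>m = 1\<close> the homogenized polynomial itself lies in the ideal, so the
  \<open>i\<close>-th coordinate of a common zero is a root of \<open>q\<close>.\<close>

lemma finite_common_zeros: "finite {x. x 3 = 1 \<and> f1 x = 0 \<and> f2 x = 0}"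
proof -
 have "\<exists>R. finite R \<and> (\<forall>x. x 3 = 1 \<and> f1 x = 0 \<and> f2 x = 0 \<longrightarrow> x i \<in> R)" for i
 proof -
  obtain N q where q: "q \<noteq> 0" "degree q \<le> N" "idl (0 + int N) (%x. hom_poly i N q x * 1)"
   using hom_poly_in_idl[OF gform_const, of i 1] by auto
  have "poly q (x i) = 0" if "x 3 = 1" "f1 x = 0" "f2 x = 0" for x
  proof -
   obtain u v where "\<And>x. hom_poly i N q x * 1 = u x * f1 x + v x * f2 x" using idlE[OF q(3)] by metis
   from this[of x] have "hom_poly i N q x = 0" using that by simp
   thus ?thesis using hom_poly_eq[OF q(2), of x i] that by simp
  qed
  thus ?thesis using poly_roots_finite[OF q(1)] by (intro exI[of _ "{a. poly q a = 0}"]) auto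
 qed
 then obtain R where R: "\<And>i. finite (R i)" "\<And>i x. x 3 = 1 \<and> f1 x = 0 \<and> f2 x = 0 \<Longrightarrow> x i \<in> R i" by metis
 have "finite (PiE UNIV R)" using R(1) by (intro finite_PiE) auto
 thus ?thesis by (rule finite_subset[rotated]) (use R(2) in auto)
qed

text \<open>Below degree \<open>e\<close> the Koszul coefficient has negative degree, so
  \<open>a\<close> and \<open>b\<close> vanish on the line \<open>x 3 = 0\<close>. Division by
  \<open>x 3\<close> gives a syzygy of smaller degree.\<close>

lemma syzygy2_zero:
 assumes "gform z a" "gform z b" "z < int e" "\<And>x. a x * f1 x + b x * f2 x = 0"
 shows "a = zv \<and> b = zv"
proof (cases "z < 0")
 case True
 thus ?thesis using assms gform_neg by blast
next
 case False
 then obtain n where "z = int n" using nonneg_int_cases by (metis not_less)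
 thus ?thesis using assms
 proof (induction n arbitrary: z a b)
  case (0)
  then obtain k l where k: "a = (%_. k)" "b = (%_. l)" using gform_0D by fastforce
  obtain c where c: "gform (z - int e) c" "\<forall>x. x 3 = 0 \<longrightarrow> a x = c x * f2 x \<and> b x = - (c x * f1 x)"
   using koszul_line[OF 0(2,3)] 0(5) by blast
  have "c = zv" using gform_neg[OF c(1)] 0 by simp
  hence "a zv = 0" "b zv = 0" using c(2) by simp_all
  thus ?case using k by auto
 next
  case (Suc n)
  obtain c where c: "gform (z - int e) c" "\<forall>x. x 3 = 0 \<longrightarrow> a x = c x * f2 x \<and> b x = - (c x * f1 x)"
   using koszul_line[OF Suc.prems(2,3)] Suc.prems(5) by blast
  have "c = zv" using gform_neg[OF c(1)] Suc.prems by simp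
  hence "\<And>x. x 3 = 0 \<Longrightarrow> a x = 0" "\<And>x. x 3 = 0 \<Longrightarrow> b x = 0" using c(2) by simp_all
  hence "\<exists>q. a = (%x. x 3 * q x) \<and> gform (z - 1) q" "\<exists>q. b = (%x. x 3 * q x) \<and> gform (z - 1) q"
   using gform_var_dvd[of z a 3] gform_var_dvd[of z b 3] Suc.prems(2,3) by blast+
  then obtain a' b' where ab: "a = (%x. x 3 * a' x)" "gform (z - 1) a'" "b = (%x. x 3 * b' x)" "gform (z - 1) b'"
   by blast
  have "polyf (%x. a' x * f1 x + b' x * f2 x)"
   by (intro polyf_add polyf_mult gform_polyf[OF ab(2)] gform_polyf[OF ab(4)] form_polyf[OF f1] form_polyf[OF f2])
  moreover have "x 3 * (a' x * f1 x + b' x * f2 x) = 0" for x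
   using Suc.prems(5)[of x] ab by (simp add: algebra_simps)
  ultimately have "(\<forall>x::3 cvec. x 3 = 0) \<or> (\<forall>x. a' x * f1 x + b' x * f2 x = 0)"
   by (rule polyf_no_zero_div[OF polyf_var[of 3]])
  hence "\<And>x. a' x * f1 x + b' x * f2 x = 0" using zero_neq_one by fastforce
  hence "a' = zv \<and> b' = zv" using Suc.IH[of "z - 1" a' b'] Suc.prems ab by simp
  thus ?case using ab by auto
 qed
qed

end

section \<open>Syzygies of three ternary forms without common zero\<close>

locale ternary_triple = ternary_pair +
 fixes f3 :: "3 cfun"
 assumes f3: "form e f3"
  and no_zero: "\<And>x. f1 x = 0 \<Longrightarrow> f2 x = 0 \<Longrightarrow> f3 x = 0 \<Longrightarrow> x = zv"
begin

text \<open>The syzygy puts \<open>f3 * p3\<close> into the ideal of \<open>f1\<close> and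
  \<open>f2\<close>. If \<open>p3\<close> were outside, the point of
  \<open>common_zero_of_quotient\<close> would be a common zero of all three forms.\<close>

lemma syzygy3_idl:
 assumes "gform z p1" "gform z p2" "gform z p3" "\<And>x. p1 x * f1 x + p2 x * f2 x + p3 x * f3 x = 0"
 shows "idl z p3"
proof (cases "z < 0")
 case True
 thus ?thesis using gform_neg[OF assms(3)] idlI[OF gform_zero gform_zero, where z = z and p = p3] by simp
next
 case False
 show ?thesis
 proof (rule ccontr)
  assume n: "\<not> idl z p3"
  obtain v where v: "v 3 = 1" "f1 v = 0" "f2 v = 0"
   "\<And>n h. form n h \<Longrightarrow> idl (int n + z) (%x. h x * p3 x) \<Longrightarrow> h v = 0"
   using common_zero_of_quotient[OF assms(3) _ n] False by auto
  have "idl (int e + z) (%x. f3 x * p3 x)"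
  proof (rule idlI)
   show "gform (int e + z - int e) (%x. - p1 x)" "gform (int e + z - int e) (%x. - p2 x)"
    using gform_uminus[OF assms(1)] gform_uminus[OF assms(2)] by simp_all
   show "f3 x * p3 x = - p1 x * f1 x + - p2 x * f2 x" for x
    using assms(4)[of x] by (simp add: algebra_simps eq_neg_iff_add_eq_0)
  qed
  hence "f3 v = 0" using v(4)[OF f3] by blast
  hence "v = zv" using no_zero v by blast
  thus False using v(1) by simp
 qed
qed

lemma syzygy3_zero:
 assumes "gform z p1" "gform z p2" "gform z p3" "z < int e" "\<And>x. p1 x * f1 x + p2 x * f2 x + p3 x * f3 x = 0"
 shows "p1 = zv \<and> p2 = zv \<and> p3 = zv"
proof -
 obtain u v where uv: "gform (z - int e) u" "gform (z - int e) v" "\<And>x. p3 x = u x * f1 x + v x * f2 x"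
  using idlE[OF syzygy3_idl[OF assms(1-3,5)]] by metis
 have "u = zv" "v = zv" using gform_neg[OF uv(1)] gform_neg[OF uv(2)] assms(4) by simp_all
 hence p3: "p3 = zv" using uv by auto
 hence "p1 = zv \<and> p2 = zv" using assms(5) by (intro syzygy2_zero[OF assms(1,2,4)]) simp
 thus ?thesis using p3 by blast
qed

text \<open>In degree \<open>e\<close> the coefficients expressing \<open>p3\<close> by
  \<open>f1\<close> and \<open>f2\<close> are constants. Koszul relations with these constants
  remove \<open>p3\<close>; one more Koszul relation makes the other two coefficients divisible by
  \<open>x 3\<close>, and the quotients vanish by \<open>syzygy2_zero\<close>.\<close>

lemma syzygy3_koszul:
 assumes "gform (int e) p1" "gform (int e) p2" "gform (int e) p3" "\<And>x. p1 x * f1 x + p2 x * f2 x + p3 x * f3 x = 0"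
 shows "\<exists>k1 k2 k3. \<forall>x. p1 x = k2 * f3 x - k3 * f2 x \<and> p2 x = k3 * f1 x - k1 * f3 x \<and> p3 x = k1 * f2 x - k2 * f1 x"
proof -
 obtain u v where "gform (int e - int e) u" "gform (int e - int e) v" "\<And>x. p3 x = u x * f1 x + v x * f2 x"
  using idlE[OF syzygy3_idl[OF assms]] by metis
 then obtain a b where ab: "\<And>x. p3 x = a * f1 x + b * f2 x" using gform_0D[of u] gform_0D[of v] by auto
 have g: "gform (int e) (%x. p1 x + a * f3 x)" "gform (int e) (%x. p2 x + b * f3 x)"
  by (intro gform_add assms gform_scale gform_form[OF f3])+
 have eq: "(p1 x + a * f3 x) * f1 x + (p2 x + b * f3 x) * f2 x = 0" for x
  using assms(4)[of x] by (simp add: ab algebra_simps)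
 obtain c where c: "gform (int e - int e) c"
  "\<forall>x. x 3 = 0 \<longrightarrow> p1 x + a * f3 x = c x * f2 x \<and> p2 x + b * f3 x = - (c x * f1 x)"
  using koszul_line[OF g] eq by blast
 obtain k where k: "c = (%_. k)" using gform_0D c(1) by fastforce
 have h: "gform (int e) (%x. p1 x + a * f3 x - k * f2 x)" "gform (int e) (%x. p2 x + b * f3 x + k * f1 x)"
  by (intro gform_add gform_diff g gform_scale gform_form[OF f2] gform_form[OF f1])+
 obtain a' where a': "(%x. p1 x + a * f3 x - k * f2 x) = (%x. x 3 * a' x)" "gform (int e - 1) a'"
  using gform_var_dvd[OF h(1), of 3] c(2) k by auto
 obtain b' where b': "(%x. p2 x + b * f3 x + k * f1 x) = (%x. x 3 * b' x)" "gform (int e - 1) b'"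
  using gform_var_dvd[OF h(2), of 3] c(2) k by auto
 have "polyf (%x. a' x * f1 x + b' x * f2 x)"
  by (intro polyf_add polyf_mult gform_polyf[OF a'(2)] gform_polyf[OF b'(2)] form_polyf[OF f1] form_polyf[OF f2])
 moreover have "x 3 * (a' x * f1 x + b' x * f2 x) = 0" for x
 proof -
  have "x 3 * (a' x * f1 x + b' x * f2 x) = (x 3 * a' x) * f1 x + (x 3 * b' x) * f2 x" by (simp add: algebra_simps)
  also have "\<dots> = (p1 x + a * f3 x - k * f2 x) * f1 x + (p2 x + b * f3 x + k * f1 x) * f2 x"
   using fun_cong[OF a'(1), of x] fun_cong[OF b'(1), of x] by simp
  also have "\<dots> = 0" using eq[of x] by (simp add: algebra_simps)
  finally show ?thesis .
 qed
 ultimately have "(\<forall>x::3 cvec. x 3 = 0) \<or> (\<forall>x. a' x * f1 x + b' x * f2 x = 0)"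
  by (rule polyf_no_zero_div[OF polyf_var[of 3]])
 hence "\<And>x. a' x * f1 x + b' x * f2 x = 0" using zero_neq_one by fastforce
 hence "a' = zv \<and> b' = zv" by (intro syzygy2_zero[OF a'(2) b'(2)]) auto
 hence "p1 x + a * f3 x - k * f2 x = 0" "p2 x + b * f3 x + k * f1 x = 0" for x
  using fun_cong[OF a'(1), of x] fun_cong[OF b'(1), of x] by auto
 thus ?thesis using ab
  by (rule_tac x = b in exI, rule_tac x = "- a" in exI, rule_tac x = "- k" in exI)
   (simp add: algebra_simps eq_neg_iff_add_eq_0)
qed

end

section \<open>Linear combinations in general position\<close>

lemma avoid_hyperplanes:
 fixes U :: "'i::finite cvec set"
 assumes "finite U" "\<And>u. u \<in> U \<Longrightarrow> u \<noteq> zv"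
 shows "\<exists>w. \<forall>u\<in>U. (\<Sum>i\<in>UNIV. u i * w i) \<noteq> 0"
 using assms
proof (induction U rule: finite_induct)
 case (insert u U)
 then obtain w where w: "\<forall>u\<in>U. (\<Sum>i\<in>UNIV. u i * w i) \<noteq> 0" by auto
 obtain k where k: "u k \<noteq> 0" using insert.prems[of u] by auto
 have p: "polyf (%w. \<Prod>u\<in>U. \<Sum>i\<in>UNIV. u i * w i)" "polyf (%w. \<Sum>i\<in>UNIV. u i * w i)"
  by (intro polyf_prod polyf_sum polyf_mult polyf_const polyf_var)+
 have a: "(\<Prod>u\<in>U. \<Sum>i\<in>UNIV. u i * w i) \<noteq> 0" using w insert.hyps(1) by auto
 have b: "(\<Sum>i\<in>UNIV. u i * (if i = k then 1 else 0)) \<noteq> 0"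
  using k by (simp add: if_distrib[of "%z. _ * z"] sum.delta cong: if_cong)
 from polyf_common_nonzero[where p = "%w. \<Prod>u\<in>U. \<Sum>i\<in>UNIV. u i * w i" and q = "%w. \<Sum>i\<in>UNIV. u i * w i"
   and u = w and w = "%i. if i = k then 1 else 0", OF p a b] obtain w' where
  "(\<Prod>u\<in>U. \<Sum>i\<in>UNIV. u i * w' i) \<noteq> 0" "(\<Sum>i\<in>UNIV. u i * w' i) \<noteq> 0" by auto
 thus ?case using insert.hyps(1) by (intro exI[of _ w']) auto
qed simp

lemma bin_finite_zeros:
 fixes p :: "2 cfun"
 assumes "form n p" "p x0 \<noteq> 0"
 shows "\<exists>Y. finite Y \<and> (\<forall>y\<in>Y. y \<noteq> zv) \<and> (\<forall>y. p y = 0 \<longrightarrow> (\<exists>c. \<exists>z\<in>Y. y = (%j. c * z j)) \<or> y = zv)"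
 using assms
proof (induction n arbitrary: p)
 case 0
 then obtain c where "p = (%_. c)" using form_0D by blast
 thus ?case using 0 by (intro exI[of _ "{}"]) auto
next
 case (Suc n)
 obtain y where y: "y \<noteq> zv" "p y = 0" using bin_zero[OF Suc.prems(1)] by auto
 obtain q where q: "gform (int (Suc n) - 1) q" "p = (%x. (y 2 * x 1 - y 1 * x 2) * q x)"
  using bin_factor[OF gform_form[OF Suc.prems(1)] y(2,1)] by blast
 have fq: "form n q" using q(1) by (intro form_gform) simp
 have q0: "q x0 \<noteq> 0" using Suc.prems(2) q(2) by auto
 obtain Y where Y: "finite Y" "\<forall>y\<in>Y. y \<noteq> zv"
  "\<forall>y. q y = 0 \<longrightarrow> (\<exists>c. \<exists>z\<in>Y. y = (%j. c * z j)) \<or> y = zv"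
  using Suc.IH[OF fq q0] by auto
 have "(\<exists>c. \<exists>z\<in>insert y Y. x = (%j. c * z j)) \<or> x = zv" if "p x = 0" for x
 proof (cases "q x = 0")
  case True
  thus ?thesis using Y(3) by blast
 next
  case False
  hence e: "y 2 * x 1 = y 1 * x 2" using that q(2) by simp
  have "\<exists>a. x = (%v. a * y v)"
  proof (cases "y 1 = 0")
   case True
   hence "y 2 \<noteq> 0" using y(1) exhaust_2 by (metis ext)
   hence "x v = x 2 / y 2 * y v" for v using exhaust_2[of v] e True by auto
   thus ?thesis by blast
  next
   case False
   hence "x v = x 1 / y 1 * y v" for v using exhaust_2[of v] e by (auto simp: field_simps)
   thus ?thesis by blast
  qed
  thus ?thesis by blast
 qed
 thus ?case using Y y(1) by (intro exI[of _ "insert y Y"]) auto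
qed

definition dotp :: "'i::finite cvec \<Rightarrow> 'i cfun" where
 "dotp u w = (\<Sum>i\<in>UNIV. u i * w i)"

lemma dotp_commute: "dotp u w = dotp w u"
 by (simp add: dotp_def mult.commute)
lemma dotp_add_right: "dotp u (%i. v i + w i) = dotp u v + dotp u w"
 by (simp add: dotp_def distrib_left sum.distrib)
lemma dotp_scale_right: "dotp u (%i. c * w i) = c * dotp u w"
 by (simp add: dotp_def sum_distrib_left mult_ac)
lemma dotp_add_left: "dotp (%i. v i + w i) u = dotp v u + dotp w u"
 by (simp add: dotp_def distrib_right sum.distrib)
lemma dotp_scale_left: "dotp (%i. c * w i) u = c * dotp w u"
 by (simp add: dotp_def sum_distrib_left mult_ac)
lemma dotp_sum_right: "dotp u (%i. \<Sum>k\<in>K. w k i) = (\<Sum>k\<in>K. dotp u (w k))"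
 by (simp add: dotp_def sum_distrib_left) (rule sum.swap)
lemma dotp_zero_right: "dotp u zv = 0" by (simp add: dotp_def)
lemma dotp_zero_left: "dotp zv u = 0" by (simp add: dotp_def)

lemma gform_dotp: "(\<And>i. gform z (F i)) \<Longrightarrow> gform z (%x. dotp w (%i. F i x))"
 unfolding dotp_def by (intro gform_sum gform_scale)
lemma form_dotp: "(\<And>i. form n (F i)) \<Longrightarrow> form n (%x. dotp w (%i. F i x))"
 unfolding dotp_def by (intro form_sum form_scale)
lemma gform_dotp_var: "gform 1 (dotp w)"
 unfolding dotp_def[abs_def] by (intro gform_sum gform_scale gform_var)
lemma form_dotp_var: "form 1 (dotp w)"
 by (rule form_gform) (simp add: gform_dotp_var)

lemma dotp_nonzero: "u \<noteq> zv \<Longrightarrow> \<exists>w. dotp u w \<noteq> 0"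
 using avoid_hyperplanes[of "{u}"] by (auto simp: dotp_def)

lemma avoid_dotp:
 assumes "finite U" "\<And>u. u \<in> U \<Longrightarrow> u \<noteq> zv"
 shows "\<exists>w. \<forall>u\<in>U. dotp u w \<noteq> 0"
 using avoid_hyperplanes[OF assms] by (simp add: dotp_def)

lemma annihilator:
 fixes W :: "'i::finite cvec set"
 assumes "finite W" "card W < CARD('i)"
 shows "\<exists>u. u \<noteq> zv \<and> (\<forall>w\<in>W. dotp u w = 0)"
proof -
 obtain c where "\<exists>i\<in>UNIV. c i \<noteq> (0::complex)" "\<forall>w\<in>W. (\<Sum>i\<in>UNIV. w i * c i) = 0"
  using homog_system[OF assms(1) finite assms(2), of "%w i. w i"] by blast
 thus ?thesis by (intro exI[of _ c]) (auto simp: dotp_def mult.commute)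
qed

lemma bin_generic_first:
 fixes F :: "'i::finite \<Rightarrow> 2 cfun"
 assumes "finite U" "\<And>u. u \<in> U \<Longrightarrow> u \<noteq> zv"
  and "\<And>y. (\<And>i. F i y = 0) \<Longrightarrow> y = zv"
 shows "\<exists>s. (\<forall>u\<in>U. dotp u s \<noteq> 0) \<and> (\<exists>y. dotp s (%i. F i y) \<noteq> 0)"
proof -
 define v where "v = (%i. F i (%_. 1))"
 have "v \<noteq> zv"
 proof
  assume "v = zv"
  hence "\<And>i. F i (%_. 1) = 0" unfolding v_def by metis
  from assms(3)[OF this] show False by (metis zero_neq_one)
 qed
 then obtain s where "\<forall>u\<in>insert v U. dotp u s \<noteq> 0"
  using avoid_dotp[of "insert v U"] assms(1,2) by auto
 thus ?thesis
  by (intro exI[of _ s] conjI exI[of _ "%_. 1"]) (auto simp: v_def dotp_commute[of s])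
qed

text \<open>Up to scaling the first combination has finitely many zeros; \<open>t\<close> only has
  to avoid the hyperplanes orthogonal to the values of \<open>F\<close> at these zeros.\<close>

lemma bin_generic_second:
 fixes F :: "'i::finite \<Rightarrow> 2 cfun"
 assumes "finite U" "\<And>u. u \<in> U \<Longrightarrow> u \<noteq> zv" "\<And>i. form n (F i)"
  and "\<And>y. (\<And>i. F i y = 0) \<Longrightarrow> y = zv" "dotp s (%i. F i y0) \<noteq> 0"
 shows "\<exists>t. (\<forall>u\<in>U. dotp u t \<noteq> 0) \<and>
  (\<forall>y. dotp s (%i. F i y) = 0 \<longrightarrow> dotp t (%i. F i y) = 0 \<longrightarrow> y = zv)"
proof -
 obtain Y where Y: "finite Y" "\<And>y. y \<in> Y \<Longrightarrow> y \<noteq> zv"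
  "\<And>y. dotp s (%i. F i y) = 0 \<Longrightarrow> (\<exists>c. \<exists>z\<in>Y. y = (%j. c * z j)) \<or> y = zv"
  using bin_finite_zeros[OF form_dotp[where F = F and w = s, OF assms(3)] assms(5)] by metis
 define V where "V = (%y i. F i y) ` Y"
 have "v \<noteq> zv" if "v \<in> V" for v
 proof
  assume v: "v = zv"
  from that obtain y where y: "y \<in> Y" "v = (%i. F i y)" by (auto simp: V_def)
  have "\<And>i. F i y = 0" using y v by metis
  thus False using assms(4) Y(2)[OF y(1)] by blast
 qed
 then obtain t where t: "\<forall>u\<in>U \<union> V. dotp u t \<noteq> 0"
  using avoid_dotp[of "U \<union> V"] assms(1,2) Y(1) by (auto simp: V_def)
 have "y = zv" if y: "dotp s (%i. F i y) = 0" "dotp t (%i. F i y) = 0" for y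
 proof (rule ccontr)
  assume n: "y \<noteq> zv"
  then obtain c z where z: "z \<in> Y" "y = (%j. c * z j)" using Y(3)[OF y(1)] by blast
  have "c \<noteq> 0" using n z by auto
  have "(%i. F i y) = (%i. c ^ n * F i z)" using form_homog[OF assms(3)] z(2) by auto
  hence "c ^ n * dotp t (%i. F i z) = 0" using y(2) by (simp add: dotp_scale_right)
  hence "dotp (%i. F i z) t = 0" using \<open>c \<noteq> 0\<close> by (simp add: dotp_commute)
  thus False using t z(1) by (auto simp: V_def)
 qed
 thus ?thesis using t by blast
qed

text \<open>Choose two combinations of the \<open>F i\<close> without common zero. By
  proportionality the first divides the same combination of the \<open>r i\<close>, and the quotient
  serves for all \<open>i\<close>.\<close>

lemma bin_cross_zero:
 fixes F r :: "'i::finite \<Rightarrow> 2 cfun"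
 assumes "\<And>i. form n (F i)" "\<And>y. (\<And>i. F i y = 0) \<Longrightarrow> y = zv"
  and "\<And>i. gform z (r i)" "\<And>i j y. r i y * F j y = r j y * F i y"
 shows "\<exists>q. gform (z - int n) q \<and> (\<forall>i y. r i y = q y * F i y)"
proof -
 obtain s y0 where s: "dotp s (%i. F i y0) \<noteq> 0" using bin_generic_first[of "{}" F] assms(2) by auto
 obtain t where t: "\<And>y. dotp s (%i. F i y) = 0 \<Longrightarrow> dotp t (%i. F i y) = 0 \<Longrightarrow> y = zv"
  using bin_generic_second[where U = "{}" and F = F and n = n, OF _ _ assms(1) assms(2) s] by auto
 have eq: "dotp s (%i. r i y) * F j y = r j y * dotp s (%i. F i y)" for j y
 proof -
  have "dotp s (%i. r i y) * F j y = (\<Sum>i\<in>UNIV. s i * (r i y * F j y))"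
   by (simp add: dotp_def sum_distrib_left mult_ac)
  also have "\<dots> = (\<Sum>i\<in>UNIV. s i * (r j y * F i y))" by (simp only: assms(4)[of _ y j])
  finally show ?thesis by (simp add: dotp_def sum_distrib_left mult_ac)
 qed
 have eq2: "dotp s (%i. r i y) * dotp t (%i. F i y) = dotp s (%i. F i y) * dotp t (%i. r i y)" for y
 proof -
  have "dotp s (%i. r i y) * dotp t (%i. F i y) = (\<Sum>j\<in>UNIV. t j * (dotp s (%i. r i y) * F j y))"
   by (simp add: dotp_def[of t] sum_distrib_left mult_ac)
  also have "\<dots> = dotp s (%i. F i y) * dotp t (%i. r i y)"
   by (simp only: eq) (simp add: dotp_def[of t] sum_distrib_left mult_ac)
  finally show ?thesis .
 qed
 obtain c where c: "(%y. dotp s (%i. r i y)) = (%y. dotp s (%i. F i y) * c y)" "gform (z - int n) c"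
  using bin_coprime_dvd[where \<alpha> = "%y. dotp s (%i. F i y)" and \<beta> = "%y. dotp t (%i. F i y)",
    OF form_dotp[where F = F, OF assms(1)] form_dotp[where F = F, OF assms(1)] t
     gform_dotp[where F = r, OF assms(3)] gform_polyf[OF gform_dotp[where F = r, OF assms(3)]] eq2]
  by blast
 have "r j y = c y * F j y" for j y
 proof -
  have "r j = (%y. c y * F j y)"
  proof (rule polyf_cancel[where p = "%y. dotp s (%i. F i y)"])
   show "polyf (%y. dotp s (%i. F i y))" using form_polyf[OF form_dotp[where F = F, OF assms(1)]] .
   show "polyf (r j)" using gform_polyf[OF assms(3)] .
   show "polyf (%y. c y * F j y)" by (intro polyf_mult gform_polyf[OF c(2)] form_polyf[OF assms(1)])
   show "dotp s (%i. F i y) * r j y = dotp s (%i. F i y) * (c y * F j y)" for y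
    using eq[of y j] fun_cong[OF c(1), of y] by (metis mult.assoc mult.commute)
  qed (rule s)
  thus ?thesis by metis
 qed
 thus ?thesis using c(2) by blast
qed

lemma emb2_zero: "emb2 zv = zv"
 by (auto simp: emb2_def)

text \<open>A prescribed fourth basis vector \<open>n0\<close> is completed by three general ones.
  Each avoids a hyperplane through the vectors already fixed, for independence, and the vectors that
  would create common zeros: first on the line \<open>x 3 = 0\<close>, then at the finitely many
  affine zeros of \<open>f1\<close> and \<open>f2\<close>. The rows of \<open>B\<close> give the
  coordinates in this basis.\<close>

lemma generic_triple:
 fixes F :: "4 \<Rightarrow> 3 cfun"
 assumes F: "\<And>i. form e (F i)" and e: "e \<ge> 1" and nz: "\<And>x. (\<And>i. F i x = 0) \<Longrightarrow> x = zv"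
  and n0: "n0 \<noteq> zv"
 shows "\<exists>W B :: 4 \<Rightarrow> 4 cvec. W 4 = n0 \<and>
  ternary_triple (%x. dotp (W 1) (%i. F i x)) (%x. dotp (W 2) (%i. F i x)) e (%x. dotp (W 3) (%i. F i x)) \<and>
  (\<forall>w. w = (%i. \<Sum>k\<in>UNIV. dotp (B k) w * W k i)) \<and> dotp (B 4) n0 = 1"
proof -
 define F' where "F' = (%i y. F i (emb2 y))"
 have F': "form e (F' i)" for i
  unfolding F'_def using gform_emb2[OF gform_form[OF F]] form_gform by blast
 have nz': "y = zv" if "\<And>i. F' i y = 0" for y
  using nz[of "emb2 y"] that emb2_0[of y] by (simp add: F'_def)
 \<comment> \<open>Repeated entries such as \<open>{n0,n0,n0}\<close> let this bound serve all three
   applications of \<open>annihilator\<close>.\<close>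
 have c4: "card (insert a (insert b (insert c {}))) < CARD(4)" for a b c :: "4 cvec"
  using card_insert_le_m1[of 3 "{b,c}" a] card_insert_le_m1[of 2 "{c}" b] by simp
 obtain u1 where u1: "u1 \<noteq> zv" "dotp u1 n0 = 0"
  using annihilator[of "{n0,n0,n0}"] c4[of n0 n0 n0] by auto
 obtain w1 y0 where w1: "dotp u1 w1 \<noteq> 0" "dotp w1 (%i. F' i y0) \<noteq> 0"
  using bin_generic_first[of "{u1}" F'] u1 nz' by auto
 obtain u2 where u2: "u2 \<noteq> zv" "dotp u2 n0 = 0" "dotp u2 w1 = 0"
  using annihilator[of "{n0,n0,w1}"] c4[of n0 n0 w1] by auto
 obtain w2 where w2: "dotp u2 w2 \<noteq> 0"
  "\<And>y. dotp w1 (%i. F' i y) = 0 \<Longrightarrow> dotp w2 (%i. F' i y) = 0 \<Longrightarrow> y = zv"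
  using bin_generic_second[where U = "{u2}" and F = F' and n = e and s = w1 and ?y0.0 = y0] u2 nz' F' w1(2)
  by auto
 obtain u3 where u3: "u3 \<noteq> zv" "dotp u3 n0 = 0" "dotp u3 w1 = 0" "dotp u3 w2 = 0"
  using annihilator[of "{n0,w1,w2}"] c4[of n0 w1 w2] by auto
 define f1 where "f1 = (%x. dotp w1 (%i. F i x))"
 define f2 where "f2 = (%x. dotp w2 (%i. F i x))"
 interpret ternary_pair f1 f2 e
 proof
  show "form e f1" "form e f2" unfolding f1_def f2_def by (intro form_dotp F)+
  show "e \<ge> 1" by (rule e)
  fix x :: "3 cvec" assume x: "x 3 = 0" "f1 x = 0" "f2 x = 0"
  hence x': "emb2 (pr2 x) = x" by (intro emb2_pr2)
  have "pr2 x = zv"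
   using x(2,3) by (intro w2(2)) (simp_all add: F'_def x' f1_def f2_def)
  thus "x = zv" using x' emb2_zero by simp
 qed
 define V where "V = (%v i. F i v) ` {x. x 3 = 1 \<and> f1 x = 0 \<and> f2 x = 0}"
 have Vnz: "u \<noteq> zv" if u: "u \<in> V" for u
 proof
  assume "u = zv"
  then obtain v where v: "v 3 = 1" "(%i. F i v) = zv" using u by (auto simp: V_def)
  hence "v = zv" using nz[of v] by metis
  thus False using v(1) by simp
 qed
 have "finite V" unfolding V_def by (intro finite_imageI finite_common_zeros)
 then obtain w3 where w3: "\<forall>u\<in>insert u3 V. dotp u w3 \<noteq> 0"
  using avoid_dotp[of "insert u3 V"] u3(1) Vnz by blast
 define f3 where "f3 = (%x. dotp w3 (%i. F i x))"
 have f3: "form e f3" unfolding f3_def by (intro form_dotp F)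
 have tt: "ternary_triple f1 f2 e f3"
 proof
  show "form e f3" by (rule f3)
  fix x assume x: "f1 x = 0" "f2 x = 0" "f3 x = 0"
  show "x = zv"
  proof (cases "x 3 = 0")
   case True
   thus ?thesis using cop x by blast
  next
   case False
   define v where "v = (%i. 1 / x 3 * x i)"
   have v: "v 3 = 1" "f1 v = 0" "f2 v = 0" "f3 v = 0"
    using False x form_homog[OF f1, of "1 / x 3" x] form_homog[OF f2, of "1 / x 3" x]
     form_homog[OF f3, of "1 / x 3" x] by (simp_all add: v_def)
   hence "(%i. F i v) \<in> V" by (auto simp: V_def)
   hence "dotp (%i. F i v) w3 \<noteq> 0" using w3 by blast
   thus ?thesis using v(4) by (simp add: f3_def dotp_commute)
  qed
 qed
 define W where "W = (%k::4. if k = 1 then w1 else if k = 2 then w2 else if k = 3 then w3 else n0)"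
 have W: "W 1 = w1" "W 2 = w2" "W 3 = w3" "W 4 = n0" by (simp_all add: W_def)
 have dW: "(\<Sum>k\<in>UNIV. c k * W k i) = c 1 * w1 i + c 2 * w2 i + c 3 * w3 i + c 4 * n0 i" for c i
  by (simp add: sum_4 W)
 have indep: "c k = 0" if c: "\<And>i. (\<Sum>k\<in>UNIV. c k * W k i) = 0" for c :: "4 cvec" and k
 proof -
  have d: "c 1 * dotp u w1 + c 2 * dotp u w2 + c 3 * dotp u w3 + c 4 * dotp u n0 = 0" for u
  proof -
   have "dotp u (%i. c 1 * w1 i + c 2 * w2 i + c 3 * w3 i + c 4 * n0 i) = 0"
    using c by (simp add: dW dotp_zero_right)
   thus ?thesis by (simp add: dotp_add_right dotp_scale_right)
  qed
  have c3: "c 3 = 0" using d[of u3] u3 w3 by simp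
  have c2: "c 2 = 0" using d[of u2] u2 w2 c3 by simp
  have c1: "c 1 = 0" using d[of u1] u1 w1 c3 c2 by simp
  obtain i where "n0 i \<noteq> 0" using n0 by auto
  hence "c 4 = 0" using c[of i] dW c1 c2 c3 by simp
  thus ?thesis using c1 c2 c3 exhaust_4[of k] by auto
 qed
 have span: "\<exists>c. \<forall>i. w i = (\<Sum>k\<in>UNIV. c k * W k i)" for w :: "4 cvec"
 proof -
  obtain c where c: "\<exists>k\<in>UNIV. c k \<noteq> 0"
   "\<forall>i\<in>UNIV. (\<Sum>k\<in>UNIV. (case k of None \<Rightarrow> w i | Some k \<Rightarrow> W k i) * c k) = (0::complex)"
   using homog_system[where E = "UNIV :: 4 set" and I = "UNIV :: 4 option set"
     and M = "%i k. case k of None \<Rightarrow> w i | Some k \<Rightarrow> W k i"] by (auto simp: card_UNIV_option)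
  have c2: "w i * c None + (\<Sum>k\<in>UNIV. W k i * c (Some k)) = 0" for i
   using c(2) by (simp add: UNIV_option_conv sum.reindex)
  have "c None \<noteq> 0"
  proof
   assume n: "c None = 0"
   have "c (Some k) = 0" for k
    using c2 n by (intro indep[where c = "%k. c (Some k)"]) (simp add: mult.commute)
   thus False using c(1) n by (metis option.exhaust)
  qed
  hence "w i = (\<Sum>k\<in>UNIV. (- c (Some k) / c None) * W k i)" for i
  proof -
   have "(\<Sum>k\<in>UNIV. (- c (Some k) / c None) * W k i) = - (1 / c None) * (\<Sum>k\<in>UNIV. W k i * c (Some k))"
    by (simp add: sum_distrib_left mult_ac)
   also have "(\<Sum>k\<in>UNIV. W k i * c (Some k)) = - (w i * c None)"
    using c2[of i] by (simp add: eq_neg_iff_add_eq_0 add.commute)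
   finally show ?thesis using \<open>c None \<noteq> 0\<close> by simp
  qed
  thus ?thesis by (intro exI[of _ "%k. - c (Some k) / c None"]) simp
 qed
 have "\<forall>j. \<exists>c. \<forall>i. (if i = j then 1 else 0) = (\<Sum>k\<in>UNIV. c k * W k i)"
  by (intro allI span)
 from choice[OF this] obtain C where C: "\<And>j i. (if i = j then 1 else 0) = (\<Sum>k\<in>UNIV. C j k * W k i)"
  by blast
 define B where "B = (%k j. C j k)"
 have B: "w i = (\<Sum>k\<in>UNIV. dotp (B k) w * W k i)" for w i
 proof -
  have "(\<Sum>k\<in>UNIV. dotp (B k) w * W k i) = (\<Sum>k\<in>UNIV. \<Sum>j\<in>UNIV. w j * (C j k * W k i))"
   by (simp add: dotp_def B_def sum_distrib_left mult_ac)
  also have "\<dots> = (\<Sum>j\<in>UNIV. w j * (\<Sum>k\<in>UNIV. C j k * W k i))"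
   by (subst sum.swap) (simp add: sum_distrib_left)
  also have "\<dots> = (\<Sum>j\<in>UNIV. w j * (if i = j then 1 else 0))" by (simp only: C)
  also have "\<dots> = w i" by (simp add: if_distrib[of "%z. _ * z"] sum.delta cong: if_cong)
  finally show ?thesis by simp
 qed
 have d0: "(\<Sum>k\<in>UNIV. (dotp (B k) n0 - (if k = 4 then 1 else 0)) * W k i) = 0" for i
 proof -
  have "(\<Sum>k\<in>UNIV. (dotp (B k) n0 - (if k = 4 then 1 else 0)) * W k i) =
    (\<Sum>k\<in>UNIV. dotp (B k) n0 * W k i) - W 4 i"
   by (simp add: sum_4 algebra_simps)
  thus ?thesis using B[of n0 i] by (simp add: W)
 qed
 have "dotp (B 4) n0 - (if (4::4) = 4 then 1 else 0) = 0"
  using indep[of "%k. dotp (B k) n0 - (if k = 4 then 1 else 0)" 4, OF d0] .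
 hence "dotp (B 4) n0 = 1" by simp
 moreover have "\<forall>w. w = (%i. \<Sum>k\<in>UNIV. dotp (B k) w * W k i)" using B by blast
 ultimately show ?thesis using tt W unfolding f1_def f2_def f3_def
  by (rule_tac x = W in exI, rule_tac x = B in exI) simp
qed

lemma form_1_gform: "gform 1 p \<Longrightarrow> form 1 p"
 by (rule form_gform) simp

lemma gform_1_unit:
 assumes "gform 1 p" shows "p = dotp (%v. p (%w. if w = v then 1 else 0))"
proof -
 have "form 1 p" by (rule form_1_gform[OF assms])
 then obtain c where c: "p = (%x. \<Sum>v\<in>UNIV. c v * x v)" using form_1D by blast
 have "p (%w. if w = v then 1 else 0) = c v" for v
  unfolding c by (simp add: if_distrib[of "%z. _ * z"] sum.delta cong: if_cong)
 thus ?thesis by (simp add: c dotp_def[abs_def])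
qed

text \<open>Coordinates on the projective line where \<open>M\<close> vanishes; they turn
  computations modulo the linear form \<open>M\<close> into computations with binary forms.\<close>

lemma kernel_line:
 fixes M :: "3 cvec"
 assumes "M \<noteq> zv"
 shows "\<exists>(b :: 2 cvec \<Rightarrow> 3 cvec) (m :: 2 \<Rightarrow> 3 cvec). (\<forall>v. form 1 (%y. b y v)) \<and>
  (\<forall>y. dotp M (b y) = 0) \<and> (\<forall>y j. dotp (m j) (b y) = y j) \<and>
  (\<forall>x. dotp M x = 0 \<longrightarrow> b (%j. dotp (m j) x) = x)"
proof -
 obtain k where k: "M k \<noteq> 0" using assms by auto
 have "\<exists>i1 i2 :: 3. i1 \<noteq> k \<and> i2 \<noteq> k \<and> i1 \<noteq> i2 \<and> UNIV = {k, i1, i2}"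
 proof -
  have ne: "(1::3) \<noteq> 2" "(1::3) \<noteq> 3" "(2::3) \<noteq> 3" by simp_all
  have u: "UNIV = {1, 2, 3 :: 3}" "UNIV = {2, 1, 3 :: 3}" "UNIV = {3, 1, 2 :: 3}" using UNIV_3 by blast+
  consider "k = 1" | "k = 2" | "k = 3" using exhaust_3[of k] by blast
  thus ?thesis
  proof cases
   case 1
   thus ?thesis using ne u by (rule_tac x = 2 in exI, rule_tac x = 3 in exI) metis
  next
   case 2
   thus ?thesis using ne u by (rule_tac x = 1 in exI, rule_tac x = 3 in exI) metis
  next
   case 3
   thus ?thesis using ne u by (rule_tac x = 1 in exI, rule_tac x = 2 in exI) metis
  qed
 qed
 then obtain i1 i2 where i: "i1 \<noteq> k" "i2 \<noteq> k" "i1 \<noteq> i2" "UNIV = {k, i1, i2}" by blast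
 have s: "dotp u x = u k * x k + (u i1 * x i1 + u i2 * x i2)" for u x
  unfolding dotp_def i(4) using i(1-3) by simp
 define b where "b = (%(y :: 2 cvec) v. if v = i1 then y 1 else if v = i2 then y 2
  else - (M i1 / M k) * y 1 - (M i2 / M k) * y 2)"
 define m where "m = (%(j :: 2) v. if j = 1 then (if v = i1 then 1 else 0) else (if v = i2 then 1 else (0 :: complex)))"
 have f: "form 1 (%y :: 2 cvec. c1 * y 1 - c2 * y 2)" for c1 c2
  by (intro form_diff form_scale form_var)
 have "form 1 (%y. b y v)" for v
  unfolding b_def using f[of "- (M i1 / M k)" "M i2 / M k"] form_var[of "1::2"] form_var[of "2::2"]
  by (cases "v = i1"; cases "v = i2") simp_all
 moreover have "dotp M (b y) = 0" for y
  unfolding s b_def using i k by (simp add: field_simps)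
 moreover have "dotp (m j) (b y) = y j" for y j
  unfolding s b_def m_def using i exhaust_2[of j] by auto
 moreover have "b (%j. dotp (m j) x) = x" if "dotp M x = 0" for x
 proof
  fix v
  have "M k * x k = - (M i1 * x i1) - M i2 * x i2" using that unfolding s by (simp add: algebra_simps eq_neg_iff_add_eq_0)
  hence "x k = - (M i1 / M k) * x i1 - (M i2 / M k) * x i2" using k by (simp add: field_simps)
  moreover have "dotp (m 1) x = x i1" "dotp (m 2) x = x i2" using i by (simp_all add: s m_def)
  moreover have "v \<in> {k, i1, i2}" using i(4) by blast
  ultimately show "b (%j. dotp (m j) x) v = x v" using i(1-3) by (auto simp: b_def)
 qed
 ultimately show ?thesis by blast
qed

section \<open>The socle of the span of three or four forms\<close>

context ternary_triple
begin

definition f :: "3 \<Rightarrow> 3 cfun" where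
 "f i = (if i = 1 then f1 else if i = 2 then f2 else f3)"

lemma f_simps: "f 1 = f1" "f 2 = f2" "f 3 = f3"
 by (simp_all add: f_def)

lemma form_f: "form e (f i)"
 by (simp add: f_def f1 f2 f3)

lemma f_no_zero: "(\<And>i. f i x = 0) \<Longrightarrow> x = zv"
 using no_zero f_simps by metis

lemma syzygy_zero:
 assumes "\<And>i. gform z (p i)" "z < int e" "\<And>x. (\<Sum>i\<in>UNIV. p i x * f i x) = 0"
 shows "p i = zv"
 using syzygy3_zero[OF assms(1,1,1,2), of 1 2 3] assms(3) exhaust_3[of i] by (auto simp: sum_3 f_simps)

lemma syzygy_koszul:
 assumes "\<And>i. gform z (p i)" "z \<le> int e" "\<And>x. (\<Sum>i\<in>UNIV. p i x * f i x) = 0"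
 shows "\<exists>k :: 3 cvec. \<forall>x. p 1 x = k 2 * f 3 x - k 3 * f 2 x \<and> p 2 x = k 3 * f 1 x - k 1 * f 3 x \<and>
  p 3 x = k 1 * f 2 x - k 2 * f 1 x"
proof (cases "z < int e")
 case True
 hence "p i = zv" for i using syzygy_zero[OF assms(1) True assms(3)] by blast
 thus ?thesis by (intro exI[of _ "%_. 0"]) simp
next
 case False
 hence z: "z = int e" using assms(2) by simp
 obtain k1 k2 k3 where k: "\<forall>x. p 1 x = k2 * f3 x - k3 * f2 x \<and> p 2 x = k3 * f1 x - k1 * f3 x \<and> p 3 x = k1 * f2 x - k2 * f1 x"
  using syzygy3_koszul[of "p 1" "p 2" "p 3"] assms z by (auto simp: sum_3 f_simps)
 thus ?thesis
  by (intro exI[of _ "%i::3. if i = 1 then k1 else if i = 2 then k2 else k3"]) (simp add: f_simps)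
qed

lemma cross_zero:
 assumes "\<And>i. gform z (r i)" "z < int e" "\<And>i j x. r i x * f j x = r j x * f i x"
 shows "r i = zv"
proof -
 have "r 2 x * f1 x + (- r 1 x) * f2 x = 0" for x using assms(3)[of 2 x 1] by (simp add: f_simps)
 hence r12: "r 2 = zv" "(%x. - r 1 x) = zv"
  using syzygy2_zero[OF assms(1) gform_uminus[OF assms(1)] assms(2), of 2 1] by blast+
 have r1: "r 1 x = 0" for x using fun_cong[OF r12(2), of x] by simp
 have "f1 x * r 3 x = 0" for x using assms(3)[of 3 x 1] r1 by (simp add: f_simps mult.commute)
 hence "(\<forall>x. f1 x = 0) \<or> (\<forall>x. r 3 x = 0)"
  by (rule polyf_no_zero_div[OF form_polyf[OF f1] gform_polyf[OF assms(1)]])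
 hence "\<forall>x. r 3 x = 0" using f1_nonzero by blast
 hence "r 3 = zv" by auto
 moreover have "r 1 = zv" using r1 by auto
 ultimately show ?thesis using r12(1) exhaust_3[of i] by auto
qed

text \<open>Eliminating \<open>g\<close> from the equations for \<open>j\<close> and
  \<open>k\<close> gives quadratic syzygies \<open>p j k\<close>, which are Koszul with constant
  coefficients \<open>h\<close>. Their alternating sum \<open>r\<close> is linear and proportional
  to the \<open>f i\<close>, hence zero, and so \<open>h\<close> is zero. Therefore
  \<open>dotp (C 1 i)\<close> is a multiple of \<open>x 1\<close>, which can be cancelled.\<close>

lemma no_socle:
 fixes C :: "3 \<Rightarrow> 3 \<Rightarrow> 3 cvec"
 assumes "e \<ge> 2" "form e g" "\<And>j x. x j * g x = (\<Sum>i\<in>UNIV. dotp (C j i) x * f i x)"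
 shows "\<exists>c. g = (%x. \<Sum>i\<in>UNIV. c i * f i x)"
proof -
 define p where "p = (%j k i (x :: 3 cvec). x k * dotp (C j i) x - x j * dotp (C k i) x)"
 have gp: "gform 2 (p j k i)" for j k i
  unfolding p_def by (intro gform_diff gform_mult[OF gform_var gform_dotp_var]) simp_all
 have e2: "2 \<le> int e" using assms(1) by simp
 have syz: "(\<Sum>i\<in>UNIV. p j k i x * f i x) = 0" for j k x
 proof -
  have "(\<Sum>i\<in>UNIV. p j k i x * f i x) = x k * (\<Sum>i\<in>UNIV. dotp (C j i) x * f i x) - x j * (\<Sum>i\<in>UNIV. dotp (C k i) x * f i x)"
   by (simp add: p_def sum_3 algebra_simps)
  also have "\<dots> = x k * (x j * g x) - x j * (x k * g x)" by (simp only: assms(3))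
  finally show ?thesis by simp
 qed
 have "\<forall>j k. \<exists>h :: 3 cvec. \<forall>x. p j k 1 x = h 2 * f 3 x - h 3 * f 2 x \<and> p j k 2 x = h 3 * f 1 x - h 1 * f 3 x \<and>
  p j k 3 x = h 1 * f 2 x - h 2 * f 1 x"
  using syzygy_koszul[OF gp e2 syz] by blast
 then obtain h :: "3 \<Rightarrow> 3 \<Rightarrow> 3 cvec" where h: "\<And>j k x. p j k 1 x = h j k 2 * f 3 x - h j k 3 * f 2 x"
  "\<And>j k x. p j k 2 x = h j k 3 * f 1 x - h j k 1 * f 3 x"
  "\<And>j k x. p j k 3 x = h j k 1 * f 2 x - h j k 2 * f 1 x" by metis
 define r where "r = (%i (x :: 3 cvec). x 3 * h 1 2 i - x 2 * h 1 3 i + x 1 * h 2 3 i)"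
 have gr: "gform 1 (r i)" for i
  unfolding r_def by (subst (1 2 3) mult.commute) (intro gform_add gform_diff gform_scale gform_var)
 have pc: "x 3 * p 1 2 i x - x 2 * p 1 3 i x + x 1 * p 2 3 i x = 0" for i x
  by (simp add: p_def algebra_simps)
 have rc: "r 2 x * f 3 x = r 3 x * f 2 x" "r 3 x * f 1 x = r 1 x * f 3 x" "r 1 x * f 2 x = r 2 x * f 1 x" for x
  using pc[of x 1] pc[of x 2] pc[of x 3] by (simp_all add: h r_def algebra_simps)
 have rcross: "r i x * f j x = r j x * f i x" for i j x
  using exhaust_3[of i] exhaust_3[of j] rc[of x] by auto
 have r0: "r i = zv" for i
  using cross_zero[OF gr _ rcross] e2 by simp
 have "h 2 3 i = 0" for i using fun_cong[OF r0[of i], of "%w. if w = 1 then 1 else 0"] by (simp add: r_def)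
 moreover have "h 1 3 i = 0" for i using fun_cong[OF r0[of i], of "%w. if w = 2 then 1 else 0"] by (simp add: r_def)
 moreover have "h 1 2 i = 0" for i using fun_cong[OF r0[of i], of "%w. if w = 3 then 1 else 0"] by (simp add: r_def)
 ultimately have "p 1 2 i x = 0" "p 1 3 i x = 0" "p 2 3 i x = 0" for i x
  using h exhaust_3[of i] by auto
 hence eqs: "x 2 * dotp (C 1 i) x = x 1 * dotp (C 2 i) x" "x 3 * dotp (C 1 i) x = x 1 * dotp (C 3 i) x" for i x
  by (simp_all add: p_def)
 have c0: "C 1 i 2 = 0" "C 1 i 3 = 0" for i
  using eqs(1)[of "%w. if w = 2 then 1 else 0" i] eqs(2)[of "%w. if w = 3 then 1 else 0" i]
  by (simp_all add: dotp_def sum_3)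
 hence d1: "dotp (C 1 i) x = C 1 i 1 * x 1" for i x by (simp add: dotp_def sum_3)
 have "x 1 * g x = x 1 * (\<Sum>i\<in>UNIV. C 1 i 1 * f i x)" for x
  using assms(3)[of x 1] by (simp add: d1 sum_distrib_left mult_ac)
 hence "g = (%x. \<Sum>i\<in>UNIV. C 1 i 1 * f i x)"
  by (intro polyf_cancel[where p = "%x. x 1" and u = "%_. 1" and q = g])
   (auto intro!: polyf_var form_polyf[OF assms(2)] polyf_sum polyf_mult polyf_const form_polyf[OF form_f])
 thus ?thesis by (rule exI[of _ "%i. C 1 i 1"])
qed

text \<open>The form \<open>f4\<close> depends on the \<open>f i\<close> only after multiplication
  by \<open>M\<close>, so it cannot simply be eliminated. The argument works on the line
  \<open>M = 0\<close> and shows that there the coefficients of \<open>g\<close> are proportional to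
  those of the linear syzygy; subtracting a multiple of the latter leaves an equation divisible by
  \<open>M\<close>.\<close>

lemma socle_syzygy:
 fixes L :: "3 \<Rightarrow> 3 cvec" and M :: "3 cvec"
  and C :: "3 \<Rightarrow> 3 \<Rightarrow> 3 cvec" and D :: "3 \<Rightarrow> 3 cvec"
 assumes e3: "e \<ge> 3" and f4: "form e f4" and g: "form e g" and M: "M \<noteq> zv"
  and lin: "\<And>x. (\<Sum>i\<in>UNIV. dotp (L i) x * f i x) + dotp M x * f4 x = 0"
  and soc: "\<And>j x. x j * g x = (\<Sum>i\<in>UNIV. dotp (C j i) x * f i x) + dotp (D j) x * f4 x"
 shows "\<exists>c c4. g = (%x. (\<Sum>i\<in>UNIV. c i * f i x) + c4 * f4 x)"
proof -
 have e2: "e \<ge> 2" using e3 by simp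
 obtain b :: "2 cvec \<Rightarrow> 3 cvec" and m :: "2 \<Rightarrow> 3 cvec"
  where b: "\<And>v. form 1 (%y. b y v)" "\<And>y. dotp M (b y) = 0" "\<And>y j. dotp (m j) (b y) = y j"
   "\<And>x. dotp M x = 0 \<Longrightarrow> b (%j. dotp (m j) x) = x"
  using kernel_line[OF M] by blast
 have b0: "y = zv" if "b y = zv" for y
 proof
  fix j show "y j = 0" using b(3)[of j y] that by (simp add: dotp_zero_right)
 qed
 have gb: "gform z (%y. p (b y))" if "gform z p" for z p
  by (rule gform_compose_lin[where h = "%v y. b y v", OF that b(1)])
 have van: "\<exists>q. gform (z - 1) q \<and> p = (%x. dotp M x * q x)" if p: "gform z p" "\<And>y. p (b y) = 0" for z p
 proof -
  obtain k where k: "M k \<noteq> 0" using M by auto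
  have "p x = 0" if "(\<Sum>v\<in>UNIV. M v * x v) = 0" for x
   using p(2)[of "%j. dotp (m j) x"] b(4)[of x] that by (simp add: dotp_def)
  thus ?thesis using gform_linear_dvd[where c = M and k = k and z = z and p = p, OF k p(1)]
   by (auto simp: dotp_def)
 qed
 have van1: "\<exists>k. \<forall>x. p x = k * dotp M x" if p: "gform 1 p" "\<And>y. p (b y) = 0" for p
 proof -
  obtain q where q: "gform (1 - 1) q" "p = (%x. dotp M x * q x)" using van[OF p] by blast
  obtain k where "q = (%_. k)" using q(1) gform_0D by fastforce
  thus ?thesis using q(2) by (intro exI[of _ k]) simp
 qed
 obtain x0 where x0: "dotp M x0 \<noteq> 0" using dotp_nonzero[OF M] by blast
 have cancel: "p = q" if "polyf p" "polyf q" "\<And>x. dotp M x * p x = dotp M x * q x" for p q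
  by (rule polyf_cancel[where p = "dotp M" and u = x0, OF gform_polyf[OF gform_dotp_var] that x0])
 have fb: "form e (%y. f i (b y))" for i using gb[OF gform_form[OF form_f]] form_gform by blast
 have fb0: "y = zv" if "\<And>i. f i (b y) = 0" for y
  using b0 f_no_zero[OF that] by blast
 have pf: "polyf (%x. \<Sum>i\<in>UNIV. k i * f i x)" for k
  by (intro polyf_sum polyf_mult polyf_const form_polyf[OF form_f])
 define cC where "cC = (%(n :: 3 cvec) i v. \<Sum>j\<in>UNIV. n j * C j i v)"
 define dD where "dD = (%(n :: 3 cvec) v. \<Sum>j\<in>UNIV. n j * D j v)"
 have socn: "dotp n x * g x = (\<Sum>i\<in>UNIV. dotp (cC n i) x * f i x) + dotp (dD n) x * f4 x" for n x
 proof -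
  have "dotp n x * g x = (\<Sum>j\<in>UNIV. n j * (x j * g x))" by (simp add: dotp_def sum_distrib_left mult_ac)
  also have "\<dots> = (\<Sum>j\<in>UNIV. \<Sum>i\<in>UNIV. n j * (dotp (C j i) x * f i x)) + (\<Sum>j\<in>UNIV. n j * (dotp (D j) x * f4 x))"
   by (simp add: soc distrib_left sum.distrib sum_distrib_left)
  also have "(\<Sum>j\<in>UNIV. \<Sum>i\<in>UNIV. n j * (dotp (C j i) x * f i x)) = (\<Sum>i\<in>UNIV. \<Sum>j\<in>UNIV. n j * (dotp (C j i) x * f i x))"
   by (rule sum.swap)
  also have "\<dots> = (\<Sum>i\<in>UNIV. dotp (cC n i) x * f i x)"
  proof (rule sum.cong[OF refl])
   fix i
   have "dotp (cC n i) x = (\<Sum>j\<in>UNIV. n j * dotp (C j i) x)"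
    unfolding cC_def dotp_commute[of _ x] by (simp add: dotp_sum_right dotp_scale_right)
   thus "(\<Sum>j\<in>UNIV. n j * (dotp (C j i) x * f i x)) = dotp (cC n i) x * f i x"
    by (simp add: sum_distrib_right mult.assoc)
  qed
  also have "(\<Sum>j\<in>UNIV. n j * (dotp (D j) x * f4 x)) = dotp (dD n) x * f4 x"
  proof -
   have "dotp (dD n) x = (\<Sum>j\<in>UNIV. n j * dotp (D j) x)"
    unfolding dD_def dotp_commute[of _ x] by (simp add: dotp_sum_right dotp_scale_right)
   thus ?thesis by (simp add: sum_distrib_right mult.assoc)
  qed
  finally show ?thesis .
 qed
 \<comment> \<open>Eliminating \<open>g\<close> from the equations for \<open>M\<close> and
   \<open>n\<close>, and then \<open>f4\<close> by means of \<open>lin\<close>, leaves syzygies of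
   the \<open>f i\<close>. Their degree three is within the Koszul range because of
   \<open>e3\<close>.\<close>
 define p where "p = (%n i x. dotp M x * (dotp n x * dotp (cC M i) x - dotp M x * dotp (cC n i) x)
   - (dotp n x * dotp (dD M) x - dotp M x * dotp (dD n) x) * dotp (L i) x)"
 have gp: "gform 3 (p n i)" for n i
 proof -
  have g2: "gform 2 (%x. dotp u x * dotp v x - dotp u' x * dotp v' x)" for u v u' v' :: "3 cvec"
   by (intro gform_diff gform_mult[OF gform_dotp_var gform_dotp_var]) simp_all
  show ?thesis unfolding p_def
   by (intro gform_diff gform_mult[OF gform_dotp_var g2] gform_mult[OF g2 gform_dotp_var]) simp_all
 qed
 have syz: "(\<Sum>i\<in>UNIV. p n i x * f i x) = 0" for n x
 proof -
  have "(\<Sum>i\<in>UNIV. p n i x * f i x) = dotp M x * (dotp n x * (\<Sum>i\<in>UNIV. dotp (cC M i) x * f i x) -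
    dotp M x * (\<Sum>i\<in>UNIV. dotp (cC n i) x * f i x))
   - (dotp n x * dotp (dD M) x - dotp M x * dotp (dD n) x) * (\<Sum>i\<in>UNIV. dotp (L i) x * f i x)"
   by (simp add: p_def sum_3 algebra_simps)
  moreover have "(\<Sum>i\<in>UNIV. dotp (cC M i) x * f i x) = dotp M x * g x - dotp (dD M) x * f4 x"
   "(\<Sum>i\<in>UNIV. dotp (cC n i) x * f i x) = dotp n x * g x - dotp (dD n) x * f4 x"
   "(\<Sum>i\<in>UNIV. dotp (L i) x * f i x) = - (dotp M x * f4 x)"
   using socn[of M x] socn[of n x] lin[of x] by (simp_all add: eq_neg_iff_add_eq_0)
  ultimately show ?thesis by (simp add: algebra_simps)
 qed
 have "\<forall>n. \<exists>k :: 3 cvec. \<forall>x. p n 1 x = k 2 * f 3 x - k 3 * f 2 x \<and> p n 2 x = k 3 * f 1 x - k 1 * f 3 x \<and>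
  p n 3 x = k 1 * f 2 x - k 2 * f 1 x"
  using syzygy_koszul[OF gp _ syz] e3 by simp
 from choice[OF this] obtain h :: "3 cvec \<Rightarrow> 3 cvec" where
  h: "\<And>n x. p n 1 x = h n 2 * f 3 x - h n 3 * f 2 x"
    "\<And>n x. p n 2 x = h n 3 * f 1 x - h n 1 * f 3 x"
    "\<And>n x. p n 3 x = h n 1 * f 2 x - h n 2 * f 1 x" by blast
 have pb: "p (m j) i (b y) = - (y j * dotp (dD M) (b y) * dotp (L i) (b y))" for j i y
  by (simp add: p_def b)
 \<comment> \<open>By \<open>pb\<close> the restrictions for \<open>m 1\<close> and
   \<open>m 2\<close> are proportional. The linear vector \<open>r\<close> that measures this for
   the Koszul coefficients is itself proportional to the \<open>f i\<close>, hence zero for degree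
   reasons.\<close>
 define r where "r = (%i (y :: 2 cvec). y 2 * h (m 1) i - y 1 * h (m 2) i)"
 have gr: "gform 1 (r i)" for i
  unfolding r_def by (subst (1 2) mult.commute) (intro gform_diff gform_scale gform_var)
 have peq: "y 2 * p (m 1) i (b y) = y 1 * p (m 2) i (b y)" for i y by (simp add: pb)
 have rc: "r 2 y * f 3 (b y) = r 3 y * f 2 (b y)" "r 3 y * f 1 (b y) = r 1 y * f 3 (b y)"
  "r 1 y * f 2 (b y) = r 2 y * f 1 (b y)" for y
  using peq[of y 1] peq[of y 2] peq[of y 3] by (simp_all add: h r_def algebra_simps)
 have rcross: "r i y * f j (b y) = r j y * f i (b y)" for i j y
  using exhaust_3[of i] exhaust_3[of j] rc[of y] by auto
 obtain q where q: "gform (1 - int e) q" "\<forall>i y. r i y = q y * f i (b y)"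
  using bin_cross_zero[where F = "%i y. f i (b y)" and r = r, OF fb fb0 gr rcross] by blast
 have r0: "r i y = 0" for i y using q gform_neg[OF q(1)] e3 by simp
 have h1: "h (m 1) i = 0" for i using r0[of i "%j. if j = 1 then 0 else 1"] by (simp add: r_def)
 have "p (m 1) i x = 0" for i x using h[of "m 1" x] h1 exhaust_3[of i] by auto
 hence "y 1 * (dotp (dD M) (b y) * dotp (L i) (b y)) = 0" for i y using pb[of 1 i y] by (simp add: mult.assoc)
 moreover have "polyf (%y. dotp (dD M) (b y) * dotp (L i) (b y))" for i
  by (intro polyf_mult gform_polyf[OF gb[OF gform_dotp_var]])
 ultimately have "(\<forall>y :: 2 cvec. y 1 = 0) \<or> (\<forall>y. dotp (dD M) (b y) * dotp (L i) (b y) = 0)" for i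
  by (intro polyf_no_zero_div[OF polyf_var[of 1]])
 moreover have "\<not> (\<forall>y :: 2 cvec. y 1 = 0)" by (auto intro: exI[of _ "%_. 1"])
 ultimately have dL: "dotp (dD M) (b y) * dotp (L i) (b y) = 0" for i y by blast
 show ?thesis
 proof (cases "\<forall>i y. dotp (L i) (b y) = 0")
  \<comment> \<open>All \<open>L i\<close> are multiples of \<open>M\<close>, so \<open>f4\<close>
    lies in the span of the \<open>f i\<close> and three forms remain.\<close>
  case True
  have "\<exists>k. \<forall>x. dotp (L i) x = k * dotp M x" for i using van1[OF gform_dotp_var] True by blast
  then obtain k where k: "\<And>i x. dotp (L i) x = k i * dotp M x" by metis
  have "f4 = (%x. - (\<Sum>i\<in>UNIV. k i * f i x))"
  proof (rule cancel)
   show "polyf f4" by (rule form_polyf[OF f4])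
   show "polyf (%x. - (\<Sum>i\<in>UNIV. k i * f i x))" by (intro polyf_uminus pf)
   show "dotp M x * f4 x = dotp M x * - (\<Sum>i\<in>UNIV. k i * f i x)" for x
    using lin[of x] by (simp add: k sum_3 algebra_simps eq_neg_iff_add_eq_0)
  qed
  hence f4': "f4 x = - (\<Sum>i\<in>UNIV. k i * f i x)" for x by simp
  have "x j * g x = (\<Sum>i\<in>UNIV. dotp (%v. C j i v + (- k i) * D j v) x * f i x)" for j x
   unfolding soc f4' dotp_add_left dotp_scale_left by (simp add: sum_3 algebra_simps)
  then obtain c where "g = (%x. \<Sum>i\<in>UNIV. c i * f i x)"
   using no_socle[where C = "%j i v. C j i v + (- k i) * D j v", OF e2 g] by blast
  thus ?thesis by (intro exI[of _ c] exI[of _ 0]) simp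
 next
  case False
  then obtain i0 y1 where i0: "dotp (L i0) (b y1) \<noteq> 0" by blast
  have "(\<forall>y. dotp (dD M) (b y) = 0) \<or> (\<forall>y. dotp (L i0) (b y) = 0)"
   by (rule polyf_no_zero_div[OF gform_polyf[OF gb[OF gform_dotp_var]] gform_polyf[OF gb[OF gform_dotp_var]] dL])
  then obtain k4 where k4: "\<And>x. dotp (dD M) x = k4 * dotp M x" using i0 van1[OF gform_dotp_var] by blast
  \<comment> \<open>Since \<open>dotp (dD M)\<close> is a multiple of \<open>M\<close>, subtracting
    \<open>k4 * f4\<close> from \<open>g\<close> removes \<open>f4\<close> from the equation for
    \<open>M\<close>.\<close>
  define g1 where "g1 = (%x. g x - k4 * f4 x)"
  have pg1: "polyf g1" unfolding g1_def
   by (intro polyf_diff polyf_mult polyf_const form_polyf[OF g] form_polyf[OF f4])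
  define c where "c = (%i. dotp (cC M i))"
  define l where "l = (%i. dotp (L i))"
  have gc: "gform 1 (c i)" and gl: "gform 1 (l i)" for i unfolding c_def l_def by (rule gform_dotp_var)+
  have lg1: "dotp M x * g1 x = (\<Sum>i\<in>UNIV. c i x * f i x)" for x
   using socn[of M x] by (simp add: g1_def k4 c_def algebra_simps)
  have llin: "(\<Sum>i\<in>UNIV. l i x * f i x) = - (dotp M x * f4 x)" for x
   using lin[of x] by (simp add: l_def eq_neg_iff_add_eq_0)
  have cb: "(\<Sum>i\<in>UNIV. c i (b y) * f i (b y)) = 0" and lb: "(\<Sum>i\<in>UNIV. l i (b y) * f i (b y)) = 0" for y
   using lg1[of "b y"] llin[of "b y"] b(2) by simp_all
  have cl: "c i (b y) * l j (b y) = c j (b y) * l i (b y)" for i j y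
  proof -
   \<comment> \<open>The cross product of \<open>c\<close> and \<open>l\<close> on the line. Both
     are orthogonal to the vector of the \<open>f i\<close>, so \<open>R\<close> is proportional to
     that vector; being quadratic, it is zero.\<close>
   define R where "R = (%(i :: 3) y. if i = 1 then c 2 (b y) * l 3 (b y) - c 3 (b y) * l 2 (b y)
    else if i = 2 then c 3 (b y) * l 1 (b y) - c 1 (b y) * l 3 (b y)
    else c 1 (b y) * l 2 (b y) - c 2 (b y) * l 1 (b y))"
   have R: "R 1 y = c 2 (b y) * l 3 (b y) - c 3 (b y) * l 2 (b y)" "R 2 y = c 3 (b y) * l 1 (b y) - c 1 (b y) * l 3 (b y)"
    "R 3 y = c 1 (b y) * l 2 (b y) - c 2 (b y) * l 1 (b y)" for y
    by (simp_all add: R_def)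
   have "gform 2 (%y. c i (b y) * l j (b y) - c i' (b y) * l j' (b y))" for i j i' j'
    by (intro gform_diff gform_mult[OF gb[OF gc] gb[OF gl]]) simp_all
   hence gR: "gform 2 (R i)" for i unfolding R_def by (cases "i = 1"; cases "i = 2") simp_all
   have c1: "c 1 (b y) * f 1 (b y) + c 2 (b y) * f 2 (b y) + c 3 (b y) * f 3 (b y) = 0"
    "l 1 (b y) * f 1 (b y) + l 2 (b y) * f 2 (b y) + l 3 (b y) * f 3 (b y) = 0" for y
    using cb[of y] lb[of y] by (simp_all add: sum_3)
   have "R 2 y * f 3 (b y) - R 3 y * f 2 (b y) =
     l 1 (b y) * (c 1 (b y) * f 1 (b y) + c 2 (b y) * f 2 (b y) + c 3 (b y) * f 3 (b y)) -
     c 1 (b y) * (l 1 (b y) * f 1 (b y) + l 2 (b y) * f 2 (b y) + l 3 (b y) * f 3 (b y))"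
    "R 3 y * f 1 (b y) - R 1 y * f 3 (b y) =
     l 2 (b y) * (c 1 (b y) * f 1 (b y) + c 2 (b y) * f 2 (b y) + c 3 (b y) * f 3 (b y)) -
     c 2 (b y) * (l 1 (b y) * f 1 (b y) + l 2 (b y) * f 2 (b y) + l 3 (b y) * f 3 (b y))"
    "R 1 y * f 2 (b y) - R 2 y * f 1 (b y) =
     l 3 (b y) * (c 1 (b y) * f 1 (b y) + c 2 (b y) * f 2 (b y) + c 3 (b y) * f 3 (b y)) -
     c 3 (b y) * (l 1 (b y) * f 1 (b y) + l 2 (b y) * f 2 (b y) + l 3 (b y) * f 3 (b y))" for y
    unfolding R by (simp_all add: algebra_simps)
   hence rc: "R 2 y * f 3 (b y) = R 3 y * f 2 (b y)" "R 3 y * f 1 (b y) = R 1 y * f 3 (b y)"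
    "R 1 y * f 2 (b y) = R 2 y * f 1 (b y)" for y using c1 by simp_all
   have rcross: "R i y * f j (b y) = R j y * f i (b y)" for i j y
    using exhaust_3[of i] exhaust_3[of j] rc[of y] by auto
   obtain q where q: "gform (2 - int e) q" "\<forall>i y. R i y = q y * f i (b y)"
    using bin_cross_zero[where F = "%i y. f i (b y)" and r = R, OF fb fb0 gR rcross] by blast
   have "R i y = 0" for i y using q gform_neg[OF q(1)] e3 by simp
   from this[of 1 y] this[of 2 y] this[of 3 y] show ?thesis
    using exhaust_3[of i] exhaust_3[of j] by (auto simp: R)
  qed
  have lfb: "form 1 (%y. l i (b y))" for i by (rule form_1_gform[OF gb[OF gl]])
  have "\<exists>k. \<forall>i y. c i (b y) = k * l i (b y)"
  proof (cases "\<forall>y. (\<forall>i. l i (b y) = 0) \<longrightarrow> y = zv")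
   case True
   hence "\<And>y. (\<And>i. l i (b y) = 0) \<Longrightarrow> y = zv" by blast
   then obtain q where q: "gform (1 - int 1) q" "\<forall>i y. c i (b y) = q y * l i (b y)"
    using bin_cross_zero[where F = "%i y. l i (b y)" and r = "%i y. c i (b y)", OF lfb _ gb[OF gc] cl] by blast
   then obtain k where "q = (%_. k)" using gform_0D by fastforce
   thus ?thesis using q(2) by auto
  next
   \<comment> \<open>The \<open>l i\<close> have a common zero on the line, so there
     \<open>l\<close> and \<open>c\<close> are multiples \<open>mu\<close> and \<open>nu\<close> of
     one constant vector \<open>k\<close>. It remains to show that \<open>mu\<close> divides
     \<open>nu\<close>.\<close>
   case False
   then obtain y0 where y0: "y0 \<noteq> zv" "\<And>i. l i (b y0) = 0" by blast
   define mu where "mu = (%y :: 2 cvec. y0 2 * y 1 - y0 1 * y 2)"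
   have pmu: "polyf mu" unfolding mu_def by (rule bin_linear_polyf)
   have gmu: "gform 1 mu" unfolding mu_def by (intro gform_diff gform_scale gform_var)
   obtain ym where ym: "mu ym \<noteq> 0" using bin_linear_nonzero[OF y0(1)] by (auto simp: mu_def)
   have "\<exists>k. \<forall>y. l i (b y) = mu y * k" for i
   proof -
    obtain q where q: "gform (1 - 1) q" "(%y. l i (b y)) = (%y. mu y * q y)"
     using bin_factor[where p = "%y. l i (b y)", OF gb[OF gl] y0(2,1)] unfolding mu_def by blast
    obtain k where "q = (%_. k)" using gform_0D q(1) by fastforce
    thus ?thesis using fun_cong[OF q(2)] by (intro exI[of _ k]) simp
   qed
   then obtain k where k: "\<And>i y. l i (b y) = mu y * k i" by metis
   have ki0: "k i0 \<noteq> 0" using i0 k[of i0 y1] by (auto simp: l_def)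
   define nu where "nu = (%y. 1 / k i0 * c i0 (b y))"
   have gnu: "gform 1 nu" unfolding nu_def by (intro gform_scale gb gc)
   have cnu: "c i (b y) = nu y * k i" for i y
   proof -
    have "(%y. c i (b y) * k i0) = (%y. c i0 (b y) * k i)"
    proof (rule polyf_cancel[where p = mu and u = ym])
     show "mu y * (c i (b y) * k i0) = mu y * (c i0 (b y) * k i)" for y
      using cl[where i = i and j = i0 and y = y] by (simp add: k mult_ac)
    qed (auto intro!: pmu polyf_mult polyf_const gform_polyf[OF gb[OF gc]] ym)
    from fun_cong[OF this, of y] show ?thesis using ki0 by (simp add: nu_def field_simps)
   qed
   define a where "a = (%x j. dotp (m j) x)"
   have ab: "a (b y) = y" for y by (rule ext) (simp add: a_def b)
   have ga: "gform z (%x. p (a x))" if "gform z p" for z p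
    unfolding a_def by (rule gform_compose_lin[where h = "%j x. dotp (m j) x", OF that form_dotp_var])
   have "\<exists>k'. \<forall>x. l i x - mu (a x) * k i = k' * dotp M x" for i
    by (rule van1) (use gform_diff[OF gl gform_scale[OF ga[OF gmu], of "k i"]] in \<open>auto simp: k ab mult.commute\<close>)
   then obtain k' where k': "\<And>i x. l i x - mu (a x) * k i = k' i * dotp M x" by metis
   have "\<exists>k'. \<forall>x. c i x - nu (a x) * k i = k' * dotp M x" for i
    by (rule van1) (use gform_diff[OF gc gform_scale[OF ga[OF gnu], of "k i"]] in \<open>auto simp: cnu ab mult.commute\<close>)
   then obtain k'' where k'': "\<And>i x. c i x - nu (a x) * k i = k'' i * dotp M x" by metis
   have k'l: "l i x = mu (a x) * k i + k' i * dotp M x" "c i x = nu (a x) * k i + k'' i * dotp M x" for i x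
    using k'[of i x] k''[of i x] by (simp_all add: algebra_simps)
   \<comment> \<open>On the line \<open>k\<close> is a constant syzygy, so the combination
     \<open>ph\<close> is divisible by \<open>M\<close>; the quotient \<open>q\<close> expresses
     both \<open>f4\<close> and \<open>g1\<close>.\<close>
   define ph where "ph = (%x. \<Sum>i\<in>UNIV. k i * f i x)"
   have gph: "gform (int e) ph" unfolding ph_def by (intro gform_sum gform_scale gform_form[OF form_f])
   have "mu y * ph (b y) = 0" for y
    using lb[of y] by (simp add: k ph_def sum_3 algebra_simps)
   hence "(\<forall>y. mu y = 0) \<or> (\<forall>y. ph (b y) = 0)"
    by (rule polyf_no_zero_div[OF pmu gform_polyf[OF gb[OF gph]]])
   then obtain q where q: "gform (int e - 1) q" "ph = (%x. dotp M x * q x)"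
    using van[OF gph] ym by blast
   have pq: "polyf q" by (rule gform_polyf[OF q(1)])
   have pmua: "polyf (%x. mu (a x))" "polyf (%x. nu (a x))"
    by (rule gform_polyf[OF ga[OF gmu]], rule gform_polyf[OF ga[OF gnu]])
   have qx: "(\<Sum>i\<in>UNIV. k i * f i x) = dotp M x * q x" for x using fun_cong[OF q(2), of x] by (simp add: ph_def)
   have expand: "(\<Sum>i\<in>UNIV. (t * k i + k'' i * s) * f i x) = t * (dotp M x * q x) + s * (\<Sum>i\<in>UNIV. k'' i * f i x)"
    for t s x and k'' :: "3 cvec"
    unfolding qx[symmetric] by (simp add: sum_3 algebra_simps)
   have f4q: "f4 = (%x. - (mu (a x) * q x) - (\<Sum>i\<in>UNIV. k' i * f i x))"
   proof (rule cancel)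
    show "polyf (%x. - (mu (a x) * q x) - (\<Sum>i\<in>UNIV. k' i * f i x))"
     by (intro polyf_diff polyf_uminus polyf_mult pmua pq pf)
    show "dotp M x * f4 x = dotp M x * (- (mu (a x) * q x) - (\<Sum>i\<in>UNIV. k' i * f i x))" for x
     using llin[of x] unfolding k'l expand by (simp add: algebra_simps eq_neg_iff_add_eq_0)
   qed (rule form_polyf[OF f4])
   have g1q: "g1 = (%x. nu (a x) * q x + (\<Sum>i\<in>UNIV. k'' i * f i x))"
   proof (rule cancel)
    show "polyf (%x. nu (a x) * q x + (\<Sum>i\<in>UNIV. k'' i * f i x))"
     by (intro polyf_add polyf_mult pmua pq pf)
    show "dotp M x * g1 x = dotp M x * (nu (a x) * q x + (\<Sum>i\<in>UNIV. k'' i * f i x))" for x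
     unfolding lg1 k'l expand by (simp add: algebra_simps)
   qed (rule pg1)
   \<comment> \<open>The socle equation in the direction of \<open>nu\<close> expresses the multiple
     of \<open>q\<close> by \<open>nu ^ 2 + tau * mu\<close> through the \<open>f i\<close> with
     linear coefficients \<open>B\<close>. Multiplied by \<open>M\<close> this is a quadratic syzygy
     \<open>P\<close>, hence zero; at the zero \<open>y0\<close> of \<open>mu\<close> it gives
     \<open>nu y0 = 0\<close>.\<close>
   obtain n where n: "(%x. nu (a x)) = dotp n" using gform_1_unit[OF ga[OF gnu]] by blast
   have nux: "dotp n x = nu (a x)" for x using fun_cong[OF n, of x] by simp
   define tau where "tau = (%x. dotp (dD n) x - k4 * nu (a x))"
   have gtau: "gform 1 tau" unfolding tau_def by (intro gform_diff gform_scale gform_dotp_var ga gnu)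
   define B where "B = (%i x. dotp (cC n i) x - k'' i * nu (a x) - k' i * tau x)"
   have gB: "gform 1 (B i)" for i unfolding B_def by (intro gform_diff gform_scale gform_dotp_var ga gnu gtau)
   have Bq: "(nu (a x) * nu (a x) + tau x * mu (a x)) * q x = (\<Sum>i\<in>UNIV. B i x * f i x)" for x
   proof -
    have "g x = nu (a x) * q x + (\<Sum>i\<in>UNIV. k'' i * f i x) + k4 * f4 x"
     using fun_cong[OF g1q, of x] by (simp add: g1_def algebra_simps)
    hence "nu (a x) * (nu (a x) * q x + (\<Sum>i\<in>UNIV. k'' i * f i x) + k4 * f4 x) =
      (\<Sum>i\<in>UNIV. dotp (cC n i) x * f i x) + dotp (dD n) x * f4 x"
     using socn[of n x] nux by simp
    hence "nu (a x) * nu (a x) * q x = (\<Sum>i\<in>UNIV. dotp (cC n i) x * f i x)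
      - nu (a x) * (\<Sum>i\<in>UNIV. k'' i * f i x) + tau x * f4 x"
     by (simp add: tau_def algebra_simps)
    also have "tau x * f4 x = - (tau x * mu (a x) * q x) - tau x * (\<Sum>i\<in>UNIV. k' i * f i x)"
     by (subst f4q) (simp add: algebra_simps)
    finally show ?thesis by (simp add: B_def sum_3 algebra_simps)
   qed
   define P where "P = (%i x. (nu (a x) * nu (a x) + tau x * mu (a x)) * k i - dotp M x * B i x)"
   have gP: "gform 2 (P i)" for i
   proof -
    have "gform 2 (%x. nu (a x) * nu (a x) + tau x * mu (a x))"
     by (intro gform_add gform_mult[OF ga[OF gnu] ga[OF gnu]] gform_mult[OF gtau ga[OF gmu]]) simp_all
    from gform_scale[OF this, of "k i"] have "gform 2 (%x. (nu (a x) * nu (a x) + tau x * mu (a x)) * k i)"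
     by (simp add: mult.commute)
    thus ?thesis unfolding P_def
     by (intro gform_diff gform_mult[OF gform_dotp_var gB]) simp_all
   qed
   have "(\<Sum>i\<in>UNIV. P i x * f i x) = 0" for x
   proof -
    have "(\<Sum>i\<in>UNIV. P i x * f i x) = (nu (a x) * nu (a x) + tau x * mu (a x)) * (\<Sum>i\<in>UNIV. k i * f i x)
     - dotp M x * (\<Sum>i\<in>UNIV. B i x * f i x)"
     by (simp add: P_def sum_3 algebra_simps)
    thus ?thesis unfolding qx Bq[symmetric] by (simp add: mult_ac)
   qed
   hence "P i0 = zv" using e3 by (intro syzygy_zero[where z = 2 and p = P] gP) simp_all
   from fun_cong[OF this, of "b y0"] have "nu y0 * nu y0 + tau (b y0) * mu y0 = 0"
    using ki0 by (simp add: P_def b ab)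
   hence "nu y0 = 0" by (simp add: mu_def mult.commute)
   then obtain s where s: "gform (1 - 1) s" "nu = (%y. mu y * s y)"
    using bin_factor[OF gnu _ y0(1)] unfolding mu_def by blast
   obtain t where "s = (%_. t)" using gform_0D s(1) by fastforce
   hence "c i (b y) = t * l i (b y)" for i y using s(2) by (simp add: cnu k mult_ac)
   thus ?thesis by blast
  qed
  then obtain t where t: "\<And>i y. c i (b y) = t * l i (b y)" by blast
  have "\<exists>k. \<forall>x. c i x - t * l i x = k * dotp M x" for i
   by (rule van1) (use gform_diff[OF gc gform_scale[OF gl, of t]] in \<open>auto simp: t\<close>)
  then obtain k where k: "\<And>i x. c i x - t * l i x = k i * dotp M x" by metis
  have ck: "c i x = t * l i x + k i * dotp M x" for i x using k[of i x] by (simp add: algebra_simps)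
  have g1k: "g1 = (%x. (\<Sum>i\<in>UNIV. k i * f i x) - t * f4 x)"
  proof (rule cancel)
   show "polyf (%x. (\<Sum>i\<in>UNIV. k i * f i x) - t * f4 x)"
    by (intro polyf_diff pf polyf_mult polyf_const form_polyf[OF f4])
   show "dotp M x * g1 x = dotp M x * ((\<Sum>i\<in>UNIV. k i * f i x) - t * f4 x)" for x
   proof -
    have "(\<Sum>i\<in>UNIV. c i x * f i x) = t * (\<Sum>i\<in>UNIV. l i x * f i x) + dotp M x * (\<Sum>i\<in>UNIV. k i * f i x)"
     unfolding ck by (simp add: sum_3 algebra_simps)
    thus ?thesis unfolding lg1 llin by (simp add: algebra_simps)
   qed
  qed (rule pg1)
  have "g x = (\<Sum>i\<in>UNIV. k i * f i x) + (k4 - t) * f4 x" for x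
   using fun_cong[OF g1k, of x] by (simp add: g1_def algebra_simps)
  thus ?thesis by (intro exI[of _ k] exI[of _ "k4 - t"]) auto
 qed
qed

end

lemma dotp_expand:
 fixes W B :: "4 \<Rightarrow> 4 cvec"
 assumes "\<And>w. w = (%i. \<Sum>k\<in>UNIV. dotp (B k) w * W k i)"
 shows "dotp a y = (\<Sum>k\<in>UNIV. dotp (B k) a * dotp (W k) y)"
proof -
 have "dotp a y = dotp (%i. \<Sum>k\<in>UNIV. dotp (B k) a * W k i) y" using assms[of a] by metis
 also have "\<dots> = dotp y (%i. \<Sum>k\<in>UNIV. dotp (B k) a * W k i)" by (rule dotp_commute)
 finally show ?thesis by (simp add: dotp_sum_right dotp_scale_right dotp_commute[of y])
qed

lemma dotp_dotp:
 "dotp u (%i. dotp (N i) x) = dotp (%v. \<Sum>i\<in>UNIV. u i * N i v) x"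
proof -
 have "dotp (%v. \<Sum>i\<in>UNIV. u i * N i v) x = dotp x (%v. \<Sum>i\<in>UNIV. u i * N i v)" by (rule dotp_commute)
 also have "\<dots> = (\<Sum>i\<in>UNIV. u i * dotp x (N i))" by (simp add: dotp_sum_right dotp_scale_right)
 finally show ?thesis by (simp add: dotp_def[of u] dotp_commute[of x])
qed

lemma socle_of_syzygy:
 fixes F :: "4 \<Rightarrow> 3 cfun" and N :: "4 \<Rightarrow> 3 cvec" and C :: "3 \<Rightarrow> 4 \<Rightarrow> 3 cvec"
 assumes F: "\<And>i. form e (F i)" and e3: "e \<ge> 3" and nz: "\<And>x. (\<And>i. F i x = 0) \<Longrightarrow> x = zv"
  and N: "N i0 \<noteq> zv" "\<And>x. dotp (%i. dotp (N i) x) (%i. F i x) = 0"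
  and g: "form e g" "\<And>j x. x j * g x = dotp (%i. dotp (C j i) x) (%i. F i x)"
 shows "\<exists>w. g = (%x. dotp w (%i. F i x))"
proof -
 obtain x0 where x0: "dotp (N i0) x0 \<noteq> 0" using dotp_nonzero[OF N(1)] by blast
 \<comment> \<open>With the value of \<open>N\<close> at \<open>x0\<close> as fourth basis vector,
   the coefficient of \<open>f4\<close> in the syzygy takes the value
   \<open>dotp (B 4) n0 = 1\<close> at \<open>x0\<close> and is therefore not zero.\<close>
 define n0 where "n0 = (%i. dotp (N i) x0)"
 have n0: "n0 \<noteq> zv" using x0 unfolding n0_def by metis
 obtain W B :: "4 \<Rightarrow> 4 cvec" where WB: "W 4 = n0"
  "ternary_triple (%x. dotp (W 1) (%i. F i x)) (%x. dotp (W 2) (%i. F i x)) e (%x. dotp (W 3) (%i. F i x))"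
  "\<And>w. w = (%i. \<Sum>k\<in>UNIV. dotp (B k) w * W k i)" "dotp (B 4) n0 = 1"
  using generic_triple[where F = F and ?n0.0 = n0, OF F _ nz n0] e3 by auto
 interpret ternary_triple "%x. dotp (W 1) (%i. F i x)" "%x. dotp (W 2) (%i. F i x)" e "%x. dotp (W 3) (%i. F i x)"
  by (rule WB(2))
 define f4 where "f4 = (%x. dotp (W 4) (%i. F i x))"
 have f4: "form e f4" unfolding f4_def by (intro form_dotp F)
 have ex: "dotp (%i. dotp (N i) x) (%i. F i x) =
   (\<Sum>k\<in>UNIV. dotp (%v. \<Sum>i\<in>UNIV. B k i * N i v) x * dotp (W k) (%i. F i x))" for N :: "4 \<Rightarrow> 3 cvec" and x
  unfolding dotp_expand[where W = W and B = B, OF WB(3), of "%i. dotp (N i) x"] dotp_dotp ..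
 define io where "io = (%i::3. if i = 1 then 1 else if i = 2 then 2 else (3::4))"
 have io: "io 1 = 1" "io 2 = 2" "io 3 = 3" by (simp_all add: io_def)
 have ex2: "dotp (%i. dotp (N i) x) (%i. F i x) =
   (\<Sum>k\<in>UNIV. dotp (%v. \<Sum>i\<in>UNIV. B (io k) i * N i v) x * f k x) + dotp (%v. \<Sum>i\<in>UNIV. B 4 i * N i v) x * f4 x"
  for N :: "4 \<Rightarrow> 3 cvec" and x
  by (subst ex) (simp add: sum_4[of "%k. dotp _ _ * _ k"] sum_4[of "%k. dotp (_ k) _ * _ k"] sum_3[of "%k. dotp _ _ * f k x"]
    sum_3[of "%k. dotp (_ k) _ * f k x"] io f_simps f4_def)
 have M: "(%v. \<Sum>i\<in>UNIV. B 4 i * N i v) \<noteq> zv"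
 proof
  assume z: "(%v. \<Sum>i\<in>UNIV. B 4 i * N i v) = zv"
  have "dotp (B 4) n0 = dotp (%v. \<Sum>i\<in>UNIV. B 4 i * N i v) x0" by (simp add: n0_def dotp_dotp)
  thus False using WB(4) z by (simp add: dotp_zero_left)
 qed
 have "\<exists>c c4. g = (%x. (\<Sum>i\<in>UNIV. c i * f i x) + c4 * f4 x)"
 proof (rule socle_syzygy[OF e3 f4 g(1) M])
  show "(\<Sum>k\<in>UNIV. dotp (%v. \<Sum>i\<in>UNIV. B (io k) i * N i v) x * f k x) + dotp (%v. \<Sum>i\<in>UNIV. B 4 i * N i v) x * f4 x = 0" for x
   using N(2)[of x] ex2[of N x] by simp
  show "x j * g x = (\<Sum>k\<in>UNIV. dotp (%v. \<Sum>i\<in>UNIV. B (io k) i * C j i v) x * f k x) + dotp (%v. \<Sum>i\<in>UNIV. B 4 i * C j i v) x * f4 x" for j x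
   using g(2)[of x j] ex2[of "C j" x] by simp
 qed
 then obtain c c4 where c: "g = (%x. (\<Sum>i\<in>UNIV. c i * f i x) + c4 * f4 x)" by blast
 have "g x = dotp (%i. c 1 * W 1 i + (c 2 * W 2 i + (c 3 * W 3 i + c4 * W 4 i))) (%i. F i x)" for x
  unfolding c dotp_add_left dotp_scale_left by (simp add: sum_3 f_simps f4_def)
 thus ?thesis by blast
qed

text \<open>Powers equalize the degrees; then either the line \<open>x 3 = 0\<close> contains a
  common zero or \<open>common_zero\<close> supplies one off it.\<close>

lemma two_forms_zero:
 fixes p q :: "3 cfun"
 assumes "form m p" "form n q" "m \<ge> 1" "n \<ge> 1"
 shows "\<exists>x. x \<noteq> zv \<and> p x = 0 \<and> q x = 0"
proof (cases "\<exists>x. x 3 = 0 \<and> x \<noteq> zv \<and> p x = 0 \<and> q x = 0")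
 case True
 thus ?thesis by blast
next
 case False
 have "ternary_pair (%x. p x ^ n) (%x. q x ^ m) (n * m)"
 proof
  show "form (n * m) (%x. p x ^ n)" by (rule form_power[OF assms(1)])
  show "form (n * m) (%x. q x ^ m)" using form_power[OF assms(2), of m] by (simp add: mult.commute)
  show "1 \<le> n * m" using assms(3,4) by simp
  show "x = zv" if "x 3 = 0" "p x ^ n = 0" "q x ^ m = 0" for x
   using False that by auto
 qed
 from ternary_pair.common_zero[OF this] obtain v where v: "v 3 = 1" "p v ^ n = 0" "q v ^ m = 0" by blast
 have "v \<noteq> zv" using v(1) by auto
 thus ?thesis using v by auto
qed

lemma hyperplane_dependent:
 fixes w :: "'i::finite \<Rightarrow> 'i cvec"
 assumes "y \<noteq> zv" "\<And>k. dotp (w k) y = 0"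
 shows "\<exists>c. c \<noteq> zv \<and> (\<forall>i. (\<Sum>k\<in>UNIV. c k * w k i) = 0)"
proof -
 obtain i0 where i0: "y i0 \<noteq> 0" using assms(1) by auto
 have "card (UNIV - {i0}) < card (UNIV :: 'i set)" by (rule psubset_card_mono) auto
 then obtain c where c: "\<exists>k\<in>UNIV. c k \<noteq> 0" "\<forall>i\<in>UNIV - {i0}. (\<Sum>k\<in>UNIV. w k i * c k) = 0"
  using homog_system[of "UNIV - {i0}" UNIV "%i k. w k i"] by auto
 define s where "s = (%i. \<Sum>k\<in>UNIV. c k * w k i)"
 have s: "s i = 0" if "i \<noteq> i0" for i using c(2) that by (simp add: s_def mult.commute)
 have "(\<Sum>k\<in>UNIV. c k * dotp (w k) y) = (\<Sum>i\<in>UNIV. s i * y i)"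
  unfolding s_def dotp_def sum_distrib_left sum_distrib_right by (subst sum.swap) (simp add: mult_ac)
 also have "\<dots> = (\<Sum>i\<in>UNIV. if i = i0 then s i0 * y i0 else 0)" by (intro sum.cong) (auto simp: s)
 finally have "s i0 = 0" using i0 assms(2) by simp
 hence "s i = 0" for i using s by (cases "i = i0") auto
 thus ?thesis using c(1) by (intro exI[of _ c]) (auto simp: s_def)
qed

text \<open>Complete the three vectors \<open>w j\<close> by a further vector \<open>w4\<close>. At
  a common zero of \<open>q\<close> and the form of \<open>w4\<close> the nonzero vector of the
  \<open>F i\<close> is orthogonal to all four, so they are dependent. The choice of
  \<open>w4\<close> confines the dependence to the \<open>w j\<close>, and it says that a nonzero
  linear form annihilates \<open>q\<close>.\<close>

lemma no_cone_in_span: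
 fixes F :: "4 \<Rightarrow> 3 cfun"
 assumes F: "\<And>i. form e (F i)" and e: "e \<ge> 1" and nz: "\<And>x. (\<And>i. F i x = 0) \<Longrightarrow> x = zv"
  and q: "gform z q" "z \<ge> 1" "\<And>j. \<exists>w. \<forall>x. x j * q x = dotp w (%i. F i x)"
 shows "q = zv"
proof (rule ccontr)
 assume "q \<noteq> zv"
 then obtain xq where xq: "q xq \<noteq> 0" by auto
 have "\<forall>j. \<exists>w. \<forall>x. x j * q x = dotp w (%i. F i x)" using q(3) by blast
 from choice[OF this] obtain w where w: "\<And>j x. x j * q x = dotp (w j) (%i. F i x)" by blast
 have "card {w 1, w 2, w 3} < CARD(4)"
  using card_insert_le_m1[of 3 "{w 2, w 3}" "w 1"] card_insert_le_m1[of 2 "{w 3}" "w 2"] by simp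
 then obtain u where u: "u \<noteq> zv" "dotp u (w 1) = 0" "dotp u (w 2) = 0" "dotp u (w 3) = 0"
  using annihilator[of "{w 1, w 2, w 3}"] by auto
 obtain w4 where w4: "dotp u w4 \<noteq> 0" using dotp_nonzero[OF u(1)] by blast
 define W where "W = (%k::4. if k = 1 then w 1 else if k = 2 then w 2 else if k = 3 then w 3 else w4)"
 have W: "W 1 = w 1" "W 2 = w 2" "W 3 = w 3" "W 4 = w4" by (simp_all add: W_def)
 obtain n where n: "z = int n" using q(2) by (metis nonneg_int_cases order.trans zero_le_one)
 have fq: "form n q" using q(1) form_gform unfolding n by blast
 have f4: "form e (%x. dotp w4 (%i. F i x))" by (intro form_dotp F)
 have "n \<ge> 1" using q(2) n by simp
 from two_forms_zero[OF fq f4 this e] obtain x where x: "x \<noteq> zv" "q x = 0" "dotp w4 (%i. F i x) = 0" by blast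
 have y: "(%i. F i x) \<noteq> zv"
 proof
  assume "(%i. F i x) = zv"
  hence "\<And>i. F i x = 0" by metis
  thus False using nz x(1) by blast
 qed
 have "dotp (W k) (%i. F i x) = 0" for k
  using w[of x 1] w[of x 2] w[of x 3] x exhaust_4[of k] by (auto simp: W)
 from hyperplane_dependent[where w = W, OF y this] obtain c where
  c: "c \<noteq> zv" "\<And>i. (\<Sum>k\<in>UNIV. c k * W k i) = 0" by blast
 have c': "c 1 * w 1 i + c 2 * w 2 i + c 3 * w 3 i + c 4 * w4 i = 0" for i
  using c(2)[of i] by (simp add: sum_4 W)
 have "dotp u (%i. c 1 * w 1 i + c 2 * w 2 i + c 3 * w 3 i + c 4 * w4 i) = 0"
  unfolding c' by (rule dotp_zero_right)
 hence c4: "c 4 = 0" using u w4 by (simp add: dotp_add_right dotp_scale_right)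
 define l where "l = (%x :: 3 cvec. c 1 * x 1 + c 2 * x 2 + c 3 * x 3)"
 have "l x * q x = 0" for x
 proof -
  have "l x * q x = dotp (%i. c 1 * w 1 i + c 2 * w 2 i + c 3 * w 3 i + c 4 * w4 i) (%i. F i x)"
   unfolding dotp_add_left dotp_scale_left by (simp add: l_def c4 w[symmetric] algebra_simps)
  thus ?thesis unfolding c' by (simp add: dotp_zero_left)
 qed
 moreover have "polyf l" unfolding l_def by (intro polyf_add polyf_mult polyf_const polyf_var)
 ultimately have "(\<forall>x. l x = 0) \<or> (\<forall>x. q x = 0)"
  by (intro polyf_no_zero_div gform_polyf[OF q(1)])
 hence l: "l x = 0" for x using xq by blast
 have "c 1 = 0" "c 2 = 0" "c 3 = 0"
  using l[of "%v. if v = 1 then 1 else 0"] l[of "%v. if v = 2 then 1 else 0"] l[of "%v. if v = 3 then 1 else 0"]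
  by (simp_all add: l_def)
 hence "c k = 0" for k using c4 exhaust_4[of k] by auto
 thus False using c(1) by auto
qed

text \<open>The type \<open>(3 \<times> 3) option\<close> has ten elements, the dimension of the
  space of ternary cubics. The nine products of variables with three general quadrics are
  independent since there are no linear syzygies, and by \<open>no_socle\<close> some product of a
  variable with the fourth quadric lies outside their span.\<close>

lemma quadrics_generate_cubics:
 fixes F :: "4 \<Rightarrow> 3 cfun"
 assumes F: "\<And>i. form 2 (F i)" and nz: "\<And>x. (\<And>i. F i x = 0) \<Longrightarrow> x = zv"
  and ind: "\<And>w. (\<And>x. dotp w (%i. F i x) = 0) \<Longrightarrow> w = zv"
 shows "\<exists>N :: (3 \<times> 3) option \<Rightarrow> 4 \<Rightarrow> 3 cvec. \<forall>c.
  (\<forall>x. (\<Sum>k\<in>UNIV. c k * dotp (%i. dotp (N k i) x) (%i. F i x)) = 0) \<longrightarrow> c = zv"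
proof -
 define n0 where "n0 = (%_::4. 1::complex)"
 have n0: "n0 \<noteq> zv" unfolding n0_def by (metis zero_neq_one)
 obtain W B :: "4 \<Rightarrow> 4 cvec" where WB: "W 4 = n0"
  "ternary_triple (%x. dotp (W 1) (%i. F i x)) (%x. dotp (W 2) (%i. F i x)) 2 (%x. dotp (W 3) (%i. F i x))"
  "\<And>w. w = (%i. \<Sum>k\<in>UNIV. dotp (B k) w * W k i)" "dotp (B 4) n0 = 1"
  using generic_triple[where F = F and ?n0.0 = n0 and e = 2, OF F _ nz n0] by auto
 interpret ternary_triple "%x. dotp (W 1) (%i. F i x)" "%x. dotp (W 2) (%i. F i x)" 2 "%x. dotp (W 3) (%i. F i x)"
  by (rule WB(2))
 define f4 where "f4 = (%x. dotp (W 4) (%i. F i x))"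
 define io where "io = (%i::3. if i = 1 then 1 else if i = 2 then 2 else (3::4))"
 have io: "io 1 = 1" "io 2 = 2" "io 3 = 3" by (simp_all add: io_def)
 have fio: "dotp (W (io k)) (%i. F i x) = f k x" for k x
  using exhaust_3[of k] by (auto simp: io f_simps)
 have f4: "form 2 f4" unfolding f4_def by (intro form_dotp F)
 have Windep: "c k = 0" if "\<And>i. (\<Sum>k\<in>UNIV. c k * W k i) = 0" for c k
 proof (rule ccontr)
  assume "c k \<noteq> 0"
  have "card (UNIV - {k}) < CARD(4)" by (rule psubset_card_mono) auto
  moreover have "card (W ` (UNIV - {k})) \<le> card (UNIV - {k})" by (rule card_image_le) simp
  ultimately have "card (W ` (UNIV - {k})) < CARD(4)" by simp
  from annihilator[OF _ this] obtain u where u: "u \<noteq> zv" "\<And>w. w \<in> W ` (UNIV - {k}) \<Longrightarrow> dotp u w = 0" by auto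
  have "dotp u (%i. \<Sum>k\<in>UNIV. c k * W k i) = 0" using that by (simp add: dotp_zero_right)
  hence "(\<Sum>j\<in>UNIV. c j * dotp u (W j)) = 0" by (simp add: dotp_sum_right dotp_scale_right)
  moreover have "(\<Sum>j\<in>UNIV. c j * dotp u (W j)) = (\<Sum>j\<in>UNIV. if j = k then c k * dotp u (W k) else 0)"
   using u(2) by (intro sum.cong) auto
  ultimately have "dotp u (W k) = 0" using \<open>c k \<noteq> 0\<close> by simp
  hence uW: "dotp u (W j) = 0" for j using u(2) by (cases "j = k") auto
  have "dotp u w = 0" for w
   by (subst WB(3)) (simp add: dotp_sum_right dotp_scale_right uW)
  thus False using dotp_nonzero[OF u(1)] by blast
 qed
 have "\<exists>j. \<not> (\<exists>C :: 3 \<Rightarrow> 3 cvec. \<forall>x. x j * f4 x = (\<Sum>i\<in>UNIV. dotp (C i) x * f i x))"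
 proof (rule ccontr)
  assume "\<not> ?thesis"
  hence "\<forall>j. \<exists>C :: 3 \<Rightarrow> 3 cvec. \<forall>x. x j * f4 x = (\<Sum>i\<in>UNIV. dotp (C i) x * f i x)" by blast
  from choice[OF this] obtain C :: "3 \<Rightarrow> 3 \<Rightarrow> 3 cvec"
   where C: "\<And>j x. x j * f4 x = (\<Sum>i\<in>UNIV. dotp (C j i) x * f i x)" by blast
  obtain c where c: "f4 = (%x. \<Sum>i\<in>UNIV. c i * f i x)" using no_socle[OF _ f4 C] by auto
  define c' where "c' = (%k::4. if k = 1 then c 1 else if k = 2 then c 2 else if k = 3 then c 3 else - 1)"
  have "dotp (%i. c 1 * W 1 i + (c 2 * W 2 i + (c 3 * W 3 i + (- 1) * W 4 i))) (%i. F i x) = 0" for x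
   unfolding dotp_add_left dotp_scale_left using fun_cong[OF c, of x] by (simp add: sum_3 f_simps f4_def)
  from ind[OF this] have h: "c 1 * W 1 i + (c 2 * W 2 i + (c 3 * W 3 i + (- 1) * W 4 i)) = 0" for i by metis
  have "(\<Sum>k\<in>UNIV. c' k * W k i) = 0" for i using h[of i] by (simp add: sum_4 c'_def algebra_simps)
  from Windep[of c', OF this, of 4] show False by (simp add: c'_def)
 qed
 then obtain j where j: "\<And>C :: 3 \<Rightarrow> 3 cvec. \<not> (\<forall>x. x j * f4 x = (\<Sum>i\<in>UNIV. dotp (C i) x * f i x))" by blast
 define N where "N = (%(k :: (3 \<times> 3) option) i v. case k of None \<Rightarrow> if v = j then W 4 i else 0
  | Some (v', k') \<Rightarrow> if v = v' then W (io k') i else 0)"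
 have one: "dotp (%v. if v = v' then a else 0) x = a * x v'" for a and v' :: 3 and x
  by (simp add: dotp_def if_distrib[of "%z. z * _"] cong: if_cong)
 have N: "dotp (%i. dotp (N None i) x) (%i. F i x) = x j * f4 x"
  "dotp (%i. dotp (N (Some (v, k)) i) x) (%i. F i x) = x v * f k x" for x v k
  by (simp_all add: N_def one dotp_scale_left f4_def mult.commute[of "W _ _"] fio)
 have "c = zv" if c: "\<And>x. (\<Sum>k\<in>UNIV. c k * dotp (%i. dotp (N k i) x) (%i. F i x)) = 0" for c
 proof -
  have sum: "c None * (x j * f4 x) + (\<Sum>k\<in>UNIV. dotp (%v. c (Some (v, k))) x * f k x) = 0" for x
  proof -
   have "(\<Sum>k\<in>UNIV. c k * dotp (%i. dotp (N k i) x) (%i. F i x)) =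
     c None * (x j * f4 x) + (\<Sum>p\<in>UNIV. c (Some p) * dotp (%i. dotp (N (Some p) i) x) (%i. F i x))"
    by (simp add: UNIV_option_conv sum.reindex N(1))
   also have "(\<Sum>p\<in>UNIV. c (Some p) * dotp (%i. dotp (N (Some p) i) x) (%i. F i x)) =
     (\<Sum>v\<in>UNIV. \<Sum>k\<in>UNIV. c (Some (v, k)) * (x v * f k x))"
    unfolding sum.cartesian_product UNIV_Times_UNIV by (intro sum.cong) (auto simp: N(2))
   also have "\<dots> = (\<Sum>k\<in>UNIV. dotp (%v. c (Some (v, k))) x * f k x)"
    by (subst sum.swap) (simp add: dotp_def sum_distrib_right mult_ac)
   finally show ?thesis using c by simp
  qed
  have c0: "c None = 0"
  proof (rule ccontr)
   assume n: "c None \<noteq> 0"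
   have "x j * f4 x = (\<Sum>k\<in>UNIV. dotp (%v. (- 1 / c None) * c (Some (v, k))) x * f k x)" for x
   proof -
    have "(\<Sum>k\<in>UNIV. dotp (%v. (- 1 / c None) * c (Some (v, k))) x * f k x) =
      (- 1 / c None) * (\<Sum>k\<in>UNIV. dotp (%v. c (Some (v, k))) x * f k x)"
     unfolding dotp_scale_left by (simp add: sum_distrib_left mult_ac)
    also have "(\<Sum>k\<in>UNIV. dotp (%v. c (Some (v, k))) x * f k x) = - (c None * (x j * f4 x))"
     using sum[of x] by (simp add: eq_neg_iff_add_eq_0 add.commute)
    finally show ?thesis using n by simp
   qed
   thus False using j[of "%k v. (- 1 / c None) * c (Some (v, k))"] by blast
  qed
  have "dotp (%v. c (Some (v, k))) = zv" for k
   using sum c0 by (intro syzygy_zero[where z = 1 and p = "%k. dotp (%v. c (Some (v, k)))"] gform_dotp_var) simp_all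
  hence "(%v. c (Some (v, k))) = zv" for k using dotp_nonzero by metis
  hence "c (Some (v, k)) = 0" for v k by metis
  thus ?thesis using c0 by (metis option.exhaust surj_pair)
 qed
 thus ?thesis by blast
qed

section \<open>Partial derivatives\<close>

definition pd :: "'v \<Rightarrow> 'v cfun \<Rightarrow> 'v cfun" where
 "pd k p x = deriv (%t. p (x(k := t))) (x k)"

lemma polyf_differentiable:
 assumes "polyf p" shows "\<exists>D. ((%t. p (x(k := t))) has_field_derivative D) (at s)"
 using assms
proof (induction rule: polyf.induct)
 case (polyf_const c)
 show ?case by (rule exI, rule DERIV_const)
next
 case (polyf_var v)
 show ?case by (cases "v = k") (auto intro: DERIV_const DERIV_ident)
next
 case (polyf_add p q)
 from polyf_add.IH obtain D E where "((%t. p (x(k := t))) has_field_derivative D) (at s)"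
  "((%t. q (x(k := t))) has_field_derivative E) (at s)" by (elim exE)
 from DERIV_add[OF this] show ?case by (rule exI)
next
 case (polyf_mult p q)
 from polyf_mult.IH obtain D E where "((%t. p (x(k := t))) has_field_derivative D) (at s)"
  "((%t. q (x(k := t))) has_field_derivative E) (at s)" by (elim exE)
 from DERIV_mult[OF this] show ?case by (rule exI)
qed

lemma polyf_pd: "polyf p \<Longrightarrow> ((%t. p (x(k := t))) has_field_derivative pd k p x) (at (x k))"
 using polyf_differentiable[of p x k "x k"] DERIV_imp_deriv unfolding pd_def by blast

lemma pd_eqI: "((%t. p (x(k := t))) has_field_derivative D) (at (x k)) \<Longrightarrow> pd k p x = D"
 unfolding pd_def by (rule DERIV_imp_deriv)

lemma pd_const: "pd k (%_. c) x = 0"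
 by (rule pd_eqI) (rule DERIV_const)

lemma pd_var: "pd k (%x. x v) x = (if v = k then 1 else 0)"
 by (rule pd_eqI) (auto intro: DERIV_ident DERIV_const)

lemma pd_add: "polyf p \<Longrightarrow> polyf q \<Longrightarrow> pd k (%x. p x + q x) x = pd k p x + pd k q x"
 by (rule pd_eqI) (intro DERIV_add polyf_pd)

lemma pd_mult: "polyf p \<Longrightarrow> polyf q \<Longrightarrow> pd k (%x. p x * q x) x = pd k p x * q x + p x * pd k q x"
proof (rule pd_eqI)
 assume "polyf p" "polyf q"
 from DERIV_mult[OF polyf_pd[OF this(1), of x k] polyf_pd[OF this(2), of x k]]
 show "((%t. p (x(k := t)) * q (x(k := t))) has_field_derivative pd k p x * q x + p x * pd k q x) (at (x k))"
  by (simp add: mult.commute add.commute)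
qed

lemma pd_scale: "polyf p \<Longrightarrow> pd k (%x. c * p x) x = c * pd k p x"
 using pd_mult[OF polyf_const[of c], of p k x] by (simp add: pd_const)

lemma pd_sum: "(\<And>i. i \<in> I \<Longrightarrow> polyf (p i)) \<Longrightarrow> pd k (%x. \<Sum>i\<in>I. p i x) x = (\<Sum>i\<in>I. pd k (p i) x)"
proof (induction I rule: infinite_finite_induct)
 case (insert i I)
 thus ?case using pd_add[of "p i" "%x. \<Sum>i\<in>I. p i x" k x] polyf_sum[of I p] by simp
qed (simp_all add: pd_const)

lemma polyf_pd_polyf: "polyf p \<Longrightarrow> polyf (pd k p)"
proof (induction rule: polyf.induct)
 case (polyf_const c)
 have "pd k (%_. c) = zv" by (rule ext) (rule pd_const)
 thus ?case by (simp add: polyf.polyf_const)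
next
 case (polyf_var v)
 have "pd k (%x. x v) = (%_. if v = k then 1 else 0)" by (rule ext) (rule pd_var)
 thus ?case by (simp add: polyf.polyf_const)
next
 case (polyf_add p q)
 have "pd k (%x. p x + q x) = (%x. pd k p x + pd k q x)" by (rule ext) (rule pd_add[OF polyf_add.hyps])
 thus ?case using polyf.polyf_add[OF polyf_add.IH] by simp
next
 case (polyf_mult p q)
 have "pd k (%x. p x * q x) = (%x. pd k p x * q x + p x * pd k q x)" by (rule ext) (rule pd_mult[OF polyf_mult.hyps])
 moreover have "polyf (%x. pd k p x * q x + p x * pd k q x)"
  by (intro polyf.polyf_add polyf.polyf_mult polyf_mult)
 ultimately show ?case by simp
qed

lemma gform_pd: "form n p \<Longrightarrow> gform (int n - 1) (pd k p)"
proof (induction rule: form.induct)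
 case (form_const c)
 have "pd k (%_. c) = zv" by (rule ext) (rule pd_const)
 thus ?case by (simp add: gform_zero)
next
 case (form_step n p v)
 have "pd k (%x. x v * p x) = (%x. (if v = k then 1 else 0) * p x + x v * pd k p x)"
  by (rule ext) (simp add: pd_mult[OF polyf_var form_polyf[OF form_step.hyps]] pd_var)
 moreover have "gform (int (Suc n) - 1) (%x. (if v = k then 1 else 0) * p x + x v * pd k p x)"
  by (intro gform_add gform_scale gform_mult[OF gform_var form_step.IH])
   (use gform_form[OF form_step.hyps] in simp_all)
 ultimately show ?case by simp
next
 case (form_add n p q)
 have "pd k (%x. p x + q x) = (%x. pd k p x + pd k q x)"
  by (rule ext) (rule pd_add[OF form_polyf[OF form_add.hyps(1)] form_polyf[OF form_add.hyps(2)]])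
 thus ?case using gform_add[OF form_add.IH] by simp
qed

lemma form_pd: "form (Suc n) p \<Longrightarrow> form n (pd k p)"
 using gform_pd[of "Suc n" p k] by (intro form_gform) simp

lemma euler:
 fixes p :: "'v::finite cfun"
 shows "form n p \<Longrightarrow> dotp x (%v. pd v p x) = of_nat n * p x"
proof (induction rule: form.induct)
 case (form_const c)
 show ?case by (simp add: dotp_def pd_const)
next
 case (form_step n p v)
 have "dotp x (%k. pd k (%x. x v * p x) x) = (\<Sum>k\<in>UNIV. (if k = v then x v * p x else 0) + x v * (x k * pd k p x))"
  unfolding dotp_def
  by (intro sum.cong refl) (auto simp: pd_mult[OF polyf_var form_polyf[OF form_step.hyps]] pd_var algebra_simps)
 also have "\<dots> = x v * p x + x v * dotp x (%k. pd k p x)"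
  by (simp add: sum.distrib dotp_def sum_distrib_left)
 finally show ?case by (simp add: form_step.IH algebra_simps)
next
 case (form_add n p q)
 have "dotp x (%k. pd k (%x. p x + q x) x) = dotp x (%k. pd k p x) + dotp x (%k. pd k q x)"
  by (simp add: pd_add[OF form_polyf[OF form_add.hyps(1)] form_polyf[OF form_add.hyps(2)]] dotp_add_right)
 thus ?case by (simp add: form_add.IH algebra_simps)
qed

lemma pd_commute: "polyf p \<Longrightarrow> pd i (pd j p) x = pd j (pd i p) x"
proof (induction arbitrary: x rule: polyf.induct)
 case (polyf_const c)
 have "pd k (%_. c) = zv" for k by (rule ext) (rule pd_const)
 thus ?case by (simp add: pd_const)
next
 case (polyf_var v)
 have "pd k (%x. x v) = (%_. if v = k then 1 else 0)" for k by (rule ext) (rule pd_var)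
 thus ?case by (simp add: pd_const)
next
 case (polyf_add p q)
 have "pd k (%x. p x + q x) = (%x. pd k p x + pd k q x)" for k by (rule ext) (rule pd_add[OF polyf_add.hyps])
 thus ?case
  by (simp add: pd_add[OF polyf_pd_polyf[OF polyf_add.hyps(1)] polyf_pd_polyf[OF polyf_add.hyps(2)]] polyf_add.IH)
next
 case (polyf_mult p q)
 note P = polyf_mult.hyps polyf_pd_polyf[OF polyf_mult.hyps(1)] polyf_pd_polyf[OF polyf_mult.hyps(2)]
 have "pd k (%x. p x * q x) = (%x. pd k p x * q x + p x * pd k q x)" for k by (rule ext) (rule pd_mult[OF P(1,2)])
 moreover have "pd k' (%x. pd k p x * q x + p x * pd k q x) x =
   pd k' (pd k p) x * q x + pd k p x * pd k' q x + (pd k' p x * pd k q x + p x * pd k' (pd k q) x)" for k k'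
  using pd_add[OF polyf.polyf_mult[OF P(3) P(2)] polyf.polyf_mult[OF P(1) P(4)]]
  by (simp add: pd_mult[OF P(3) P(2)] pd_mult[OF P(1) P(4)])
 ultimately show ?case by (simp add: polyf_mult.IH algebra_simps)
qed

lemma polyf_curve:
 fixes p :: "'v::finite cfun"
 assumes "\<And>v. ((%t. z v t) has_field_derivative z' v) (at t)"
 shows "polyf p \<Longrightarrow> ((%t. p (%v. z v t)) has_field_derivative dotp z' (%v. pd v p (%v. z v t))) (at t)"
proof (induction rule: polyf.induct)
 case (polyf_const c)
 show ?case by (simp add: pd_const dotp_zero_right)
next
 case (polyf_var v)
 have "dotp z' (%w. pd w (%x. x v) (%v. z v t)) = z' v"
  by (simp add: pd_var dotp_def if_distrib[of "%z. _ * z"] cong: if_cong)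
 thus ?case using assms[of v] by simp
next
 case (polyf_add p q)
 show ?case
  unfolding pd_add[OF polyf_add.hyps] dotp_add_right by (rule DERIV_add[OF polyf_add.IH])
next
 case (polyf_mult p q)
 have "dotp z' (%v. pd v (%x. p x * q x) (%v. z v t)) =
  dotp z' (%v. pd v p (%v. z v t)) * q (%v. z v t) + dotp z' (%v. pd v q (%v. z v t)) * p (%v. z v t)"
  unfolding pd_mult[OF polyf_mult.hyps] by (simp add: dotp_def sum.distrib sum_distrib_left algebra_simps)
 thus ?case using DERIV_mult[OF polyf_mult.IH] by simp
qed

section \<open>Kernels of linear maps depending on a parameter\<close>

lemma scaleR_vec: "r *\<^sub>R v = complex_of_real r *s v"
 by (simp add: vec_eq_iff scaleR_conv_of_real[where 'a = complex] del: scaleR_conv_of_real)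

lemma vec_complement:
 fixes K :: "(complex^'m) set"
 assumes "vec.subspace K"
 shows "\<exists>V. vec.subspace V \<and> V \<inter> K = {0} \<and> vec.dim V + vec.dim K = CARD('m)"
proof -
 obtain B where B: "B \<subseteq> K" "vec.independent B" "K \<subseteq> vec.span B" "card B = vec.dim K"
  using vec.basis_exists[of K] by blast
 define C where "C = vec.extend_basis B"
 have C: "B \<subseteq> C" "vec.independent C" "vec.span C = UNIV"
  unfolding C_def using vec.extend_basis_superset[OF B(2)] vec.independent_extend_basis[OF B(2)]
   vec.span_extend_basis[OF B(2)] by auto
 have fC: "finite C" by (rule vec.finiteI_independent[OF C(2)])
 define V where "V = vec.span (C - B)"
 have sV: "vec.subspace V" unfolding V_def by (rule vec.subspace_span)
 have cC: "card C = CARD('m)"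
  using vec.dim_eq_card_independent[OF C(2)] vec.dim_span[of C] C(3) vec_dim_card by metis
 have "vec.independent (C - B)" using C(2) by (rule vec.independent_mono) auto
 hence dV: "vec.dim V = card (C - B)" unfolding V_def by (simp add: vec.dim_eq_card_independent)
 have "card (C - B) = card C - card B" using C(1) fC by (simp add: card_Diff_subset finite_subset)
 hence sum: "vec.dim V + vec.dim K = CARD('m)"
  using dV B(4) cC card_mono[OF fC C(1)] by simp
 have KB: "K = vec.span B" using B(1,3) assms by (metis subset_antisym vec.span_minimal)
 have "{x + y |x y. x \<in> V \<and> y \<in> K} = vec.span ((C - B) \<union> B)"
  unfolding V_def KB by (rule vec.span_Un[symmetric])
 also have "(C - B) \<union> B = C" using C(1) by auto
 finally have "{x + y |x y. x \<in> V \<and> y \<in> K} = UNIV" using C(3) by simp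
 hence "vec.dim (UNIV :: (complex^'m) set) + vec.dim (V \<inter> K) = vec.dim V + vec.dim K"
  using vec.dim_sums_Int[OF sV assms] by metis
 hence "vec.dim (V \<inter> K) = 0" using sum unfolding vec_dim_card by linarith
 hence "V \<inter> K \<subseteq> {0}" by (simp add: vec.dim_eq_0)
 hence "V \<inter> K = {0}" using vec.subspace_0[OF sV] vec.subspace_0[OF assms] by auto
 thus ?thesis using sV sum by blast
qed

lemma vec_subspace_closed:
 fixes V :: "(complex^'m) set"
 assumes "vec.subspace V" shows "closed V"
proof -
 have "subspace V"
  unfolding subspace_def using assms by (auto simp: scaleR_vec vec.subspace_def)
 thus ?thesis by (rule closed_subspace)
qed

text \<open>By compactness of the unit sphere of \<open>V\<close> finitely many test points
  \<open>Z\<close> detect all its vectors in the limit, and with a positive lower bound \<delta>.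
  Perturbations smaller than \<delta> keep the map injective on \<open>V\<close>.\<close>

lemma inj_eventually:
 fixes V :: "(complex^'m) set" and \<psi> :: "'t \<Rightarrow> 'm \<Rightarrow> 'z cvec"
 assumes "closed V" "\<And>v r. v \<in> V \<Longrightarrow> r *\<^sub>R v \<in> V"
  and lim: "\<And>k z. ((%t. \<psi> t k z) \<longlongrightarrow> \<psi>0 k z) F"
  and inj: "\<And>v. v \<in> V \<Longrightarrow> (\<And>z. (\<Sum>k\<in>UNIV. v $ k * \<psi>0 k z) = 0) \<Longrightarrow> v = 0"
 shows "\<forall>\<^sub>F t in F. \<forall>v\<in>V. (\<forall>z. (\<Sum>k\<in>UNIV. v $ k * \<psi> t k z) = 0) \<longrightarrow> v = 0"
proof -
 define S where "S = V \<inter> sphere 0 1"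
 define g where "g = (%z v. \<Sum>k\<in>UNIV. v $ k * \<psi>0 k z)"
 have cg: "continuous_on A (g z)" for z A unfolding g_def by (intro continuous_intros)
 have S: "compact S" unfolding S_def by (intro closed_Int_compact assms(1) compact_sphere)
 have "S \<subseteq> \<Union>((%z. {v. g z v \<noteq> 0}) ` UNIV)"
 proof
  fix v assume v: "v \<in> S"
  hence "v \<noteq> 0" by (auto simp: S_def)
  hence "\<not> (\<forall>z. g z v = 0)" using inj[of v] v by (auto simp: g_def S_def)
  thus "v \<in> \<Union>((%z. {v. g z v \<noteq> 0}) ` UNIV)" by auto
 qed
 moreover have "open {v. g z v \<noteq> 0}" for z
  using open_Collect_neq[OF cg[of UNIV z] continuous_on_const[of UNIV 0]] by simp
 ultimately obtain Z where Z: "finite Z" "S \<subseteq> (\<Union>z\<in>Z. {v. g z v \<noteq> 0})"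
  using compactE_image[OF S, of UNIV "%z. {v. g z v \<noteq> 0}"] by auto
 define h where "h = (%v. \<Sum>z\<in>Z. norm (g z v))"
 have "\<exists>\<delta>>0. \<forall>v\<in>S. \<delta> \<le> h v"
 proof (cases "S = {}")
  case True
  thus ?thesis by (intro exI[of _ 1]) auto
 next
  case False
  have "continuous_on S h" unfolding h_def by (intro continuous_on_sum continuous_on_norm cg)
  then obtain v0 where v0: "v0 \<in> S" "\<forall>v\<in>S. h v0 \<le> h v" using continuous_attains_inf[OF S False] by blast
  obtain z where "z \<in> Z" "g z v0 \<noteq> 0" using Z(2) v0(1) by auto
  hence "h v0 > 0" unfolding h_def by (intro sum_pos2[OF Z(1)]) auto
  thus ?thesis using v0(2) by blast
 qed
 then obtain \<delta> where \<delta>: "\<delta> > 0" "\<And>v. v \<in> S \<Longrightarrow> \<delta> \<le> h v" by blast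
 define H where "H = (%t. \<Sum>z\<in>Z. \<Sum>k\<in>UNIV. norm (\<psi> t k z - \<psi>0 k z))"
 have "((%t. norm (\<psi> t k z - \<psi>0 k z)) \<longlongrightarrow> norm (\<psi>0 k z - \<psi>0 k z)) F" for k z
  by (intro tendsto_intros lim)
 hence "(H \<longlongrightarrow> (\<Sum>z\<in>Z. \<Sum>k\<in>(UNIV :: 'm set). 0)) F"
  unfolding H_def by (intro tendsto_sum) simp
 hence "\<forall>\<^sub>F t in F. H t < \<delta>" using \<delta>(1) by (intro order_tendstoD) auto
 thus ?thesis
 proof (rule eventually_mono)
  fix t assume H: "H t < \<delta>"
  show "\<forall>v\<in>V. (\<forall>z. (\<Sum>k\<in>UNIV. v $ k * \<psi> t k z) = 0) \<longrightarrow> v = 0"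
  proof (intro ballI impI, rule ccontr)
   fix v assume v: "v \<in> V" "\<forall>z. (\<Sum>k\<in>UNIV. v $ k * \<psi> t k z) = 0" "v \<noteq> 0"
   define w where "w = (1 / norm v) *\<^sub>R v"
   have w: "w \<in> S" using assms(2)[OF v(1)] v(3) by (auto simp: S_def w_def)
   have wz: "(\<Sum>k\<in>UNIV. w $ k * \<psi> t k z) = 0" for z
   proof -
    have "(\<Sum>k\<in>UNIV. w $ k * \<psi> t k z) = of_real (1 / norm v) * (\<Sum>k\<in>UNIV. v $ k * \<psi> t k z)"
     by (simp add: w_def scaleR_vec sum_distrib_left mult_ac)
    thus ?thesis using v(2) by simp
   qed
   have nk: "norm (w $ k) \<le> 1" for k using Finite_Cartesian_Product.norm_nth_le[of w k] w by (auto simp: S_def)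
   have "norm (g z w) \<le> (\<Sum>k\<in>UNIV. norm (\<psi> t k z - \<psi>0 k z))" for z
   proof -
    have "g z w = (\<Sum>k\<in>UNIV. w $ k * (\<psi>0 k z - \<psi> t k z))"
     using wz[of z] by (simp add: g_def right_diff_distrib sum_subtractf)
    also have "norm \<dots> \<le> (\<Sum>k\<in>UNIV. norm (w $ k * (\<psi>0 k z - \<psi> t k z)))" by (rule norm_sum)
    also have "\<dots> \<le> (\<Sum>k\<in>UNIV. norm (\<psi> t k z - \<psi>0 k z))"
    proof (rule sum_mono)
     fix k
     have "norm (w $ k) * norm (\<psi>0 k z - \<psi> t k z) \<le> 1 * norm (\<psi>0 k z - \<psi> t k z)"
      by (rule mult_right_mono[OF nk]) simp
     thus "norm (w $ k * (\<psi>0 k z - \<psi> t k z)) \<le> norm (\<psi> t k z - \<psi>0 k z)"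
      by (simp add: norm_mult norm_minus_commute)
    qed
    finally show ?thesis .
   qed
   hence "h w \<le> H t" unfolding h_def H_def by (intro sum_mono)
   thus False using \<delta>(2)[OF w] H by simp
  qed
 qed
qed

text \<open>The linear relations between the functions \<open>\<phi> k\<close>. The target is a
  space of functions on an arbitrary set, so no basis of it has to be followed along the
  parameter.\<close>

definition ker_sp :: "('m::finite \<Rightarrow> 'z cvec) \<Rightarrow> (complex^'m) set" where
 "ker_sp \<phi> = {v. \<forall>z. (\<Sum>k\<in>UNIV. v $ k * \<phi> k z) = 0}"

lemma subspace_ker_sp: "vec.subspace (ker_sp \<phi>)"
 unfolding vec.subspace_def ker_sp_def
proof (intro conjI ballI allI, goal_cases)
 case 1
 thus ?case by simp
next
 case (2 x y)
 thus ?case by (simp add: distrib_right sum.distrib)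
next
 case (3 c x)
 have "(\<Sum>k\<in>UNIV. (c *s x) $ k * \<phi> k z) = c * (\<Sum>k\<in>UNIV. x $ k * \<phi> k z)" for z
  by (simp add: sum_distrib_left mult.assoc)
 thus ?case using 3 by simp
qed

lemma vec_dim_disjoint:
 fixes V K :: "(complex^'m) set"
 assumes "vec.subspace V" "vec.subspace K" "V \<inter> K = {0}"
 shows "vec.dim V + vec.dim K \<le> CARD('m)"
 using vec.dim_sums_Int[OF assms(1,2)] assms(3) dim_subset_UNIV_cart_gen[of "{x + y |x y. x \<in> V \<and> y \<in> K}"]
 by simp

text \<open>A complement of the kernel at \<open>0\<close> is mapped injectively, and this persists
  for small \<open>t\<close>; so the later kernels meet the complement trivially.\<close>

lemma kernel_dim_semicont:
 fixes \<phi> :: "complex \<Rightarrow> 'm::finite \<Rightarrow> 'z cvec"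
 assumes "\<And>k z. ((%t. \<phi> t k z) \<longlongrightarrow> \<phi> 0 k z) (at 0)"
 shows "\<forall>\<^sub>F t in at 0. vec.dim (ker_sp (\<phi> t)) \<le> vec.dim (ker_sp (\<phi> 0))"
proof -
 obtain V where V: "vec.subspace V" "V \<inter> ker_sp (\<phi> 0) = {0}" "vec.dim V + vec.dim (ker_sp (\<phi> 0)) = CARD('m)"
  using vec_complement[OF subspace_ker_sp] by blast
 have "\<forall>\<^sub>F t in at 0. \<forall>v\<in>V. (\<forall>z. (\<Sum>k\<in>UNIV. v $ k * \<phi> t k z) = 0) \<longrightarrow> v = 0"
 proof (rule inj_eventually[OF vec_subspace_closed[OF V(1)] _ assms])
  show "r *\<^sub>R v \<in> V" if "v \<in> V" for v r using V(1) that by (simp add: scaleR_vec vec.subspace_def)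
  show "v = 0" if "v \<in> V" "\<And>z. (\<Sum>k\<in>UNIV. v $ k * \<phi> 0 k z) = 0" for v
   using V(2) that by (auto simp: ker_sp_def)
 qed
 thus ?thesis
 proof (rule eventually_mono)
  fix t assume "\<forall>v\<in>V. (\<forall>z. (\<Sum>k\<in>UNIV. v $ k * \<phi> t k z) = 0) \<longrightarrow> v = 0"
  hence "V \<inter> ker_sp (\<phi> t) = {0}"
   using vec.subspace_0[OF V(1)] vec.subspace_0[OF subspace_ker_sp[of "\<phi> t"]] by (auto simp: ker_sp_def)
  from vec_dim_disjoint[OF V(1) subspace_ker_sp this] show "vec.dim (ker_sp (\<phi> t)) \<le> vec.dim (ker_sp (\<phi> 0))"
   using V(3) by simp
 qed
qed

text \<open>If the kernel of a linear map depending on a parameter does not drop in dimension, then every kernel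
 vector can be deformed to first order along with the parameter.\<close>

lemma kernel_deform:
 fixes \<phi> :: "complex \<Rightarrow> 'm::finite \<Rightarrow> 'z cvec" and \<phi>' :: "'m \<Rightarrow> 'z cvec"
  and M :: "complex^'m"
 assumes der: "\<And>k z. ((%t. \<phi> t k z) has_field_derivative \<phi>' k z) (at 0)"
  and dim: "\<forall>\<^sub>F t in at 0. vec.dim (ker_sp (\<phi> 0)) \<le> vec.dim (ker_sp (\<phi> t))"
  and M: "M \<in> ker_sp (\<phi> 0)"
 shows "\<exists>M' :: complex^'m. \<forall>z. (\<Sum>k\<in>UNIV. M $ k * \<phi>' k z) + (\<Sum>k\<in>UNIV. M' $ k * \<phi> 0 k z) = 0"
proof (rule ccontr)
 assume contra: "\<not> ?thesis"
 obtain V where V: "vec.subspace V" "V \<inter> ker_sp (\<phi> 0) = {0}" "vec.dim V + vec.dim (ker_sp (\<phi> 0)) = CARD('m)"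
  using vec_complement[OF subspace_ker_sp] by blast
 have lim: "((%t. \<phi> t k z) \<longlongrightarrow> \<phi> 0 k z) (at 0)" for k z
  using DERIV_isCont[OF der] by (simp add: isCont_def)
 \<comment> \<open>To a complement of the kernel the vector \<open>M\<close> is adjoined, with image
   divided by \<open>t\<close>. If no \<open>M'\<close> existed, the enlarged map would be injective
   in the limit and hence for small \<open>t\<close>, so the kernel would drop in dimension.\<close>
 define \<psi> where "\<psi> = (%t k z. case k of Some k' \<Rightarrow> \<phi> t k' z | None \<Rightarrow> (\<Sum>k\<in>UNIV. M $ k * \<phi> t k z) / t)"
 define \<psi>0 where "\<psi>0 = (%k z. case k of Some k' \<Rightarrow> \<phi> 0 k' z | None \<Rightarrow> (\<Sum>k\<in>UNIV. M $ k * \<phi>' k z))"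
 define pr where "pr = (%u :: complex^('m option). (\<chi> k. u $ Some k))"
 define V' where "V' = {u. pr u \<in> V}"
 have prc: "continuous_on UNIV pr" unfolding pr_def by (intro continuous_intros)
 have pr_scale: "pr (r *\<^sub>R u) = r *\<^sub>R pr u" for r u by (simp add: pr_def vec_eq_iff)
 have split: "(\<Sum>k\<in>UNIV. u $ k * F k) = u $ None * F None + (\<Sum>k\<in>UNIV. pr u $ k * F (Some k))"
  for u and F :: "'m option \<Rightarrow> complex"
  by (simp add: UNIV_option_conv sum.reindex pr_def)
 have "\<forall>\<^sub>F t in at 0. \<forall>u\<in>V'. (\<forall>z. (\<Sum>k\<in>UNIV. u $ k * \<psi> t k z) = 0) \<longrightarrow> u = 0"
 proof (rule inj_eventually[where ?\<psi>0.0 = \<psi>0])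
  show "closed V'" unfolding V'_def
   using continuous_closed_vimage[OF vec_subspace_closed[OF V(1)], of pr] prc
   by (simp add: vimage_def continuous_on_eq_continuous_at)
  show "r *\<^sub>R v \<in> V'" if "v \<in> V'" for v r
  proof -
   have "r *\<^sub>R pr v \<in> V" using V(1) that by (simp add: V'_def scaleR_vec vec.subspace_def)
   thus ?thesis by (simp only: V'_def mem_Collect_eq pr_scale)
  qed
  show "((%t. \<psi> t k z) \<longlongrightarrow> \<psi>0 k z) (at 0)" for k z
  proof (cases k)
   case None
   have "((%t. \<Sum>k\<in>UNIV. M $ k * \<phi> t k z) has_field_derivative (\<Sum>k\<in>UNIV. M $ k * \<phi>' k z)) (at 0)"
    by (intro DERIV_sum DERIV_cmult der)
   hence "((%t. (\<Sum>k\<in>UNIV. M $ k * \<phi> t k z) / t) \<longlongrightarrow> (\<Sum>k\<in>UNIV. M $ k * \<phi>' k z)) (at 0)"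
    using M by (simp add: has_field_derivative_iff ker_sp_def)
   thus ?thesis by (simp add: \<psi>_def \<psi>0_def None)
  next
   case (Some k')
   thus ?thesis using lim by (simp add: \<psi>_def \<psi>0_def)
  qed
  fix u assume u: "u \<in> V'" "\<And>z. (\<Sum>k\<in>UNIV. u $ k * \<psi>0 k z) = 0"
  have u2: "u $ None * (\<Sum>k\<in>UNIV. M $ k * \<phi>' k z) + (\<Sum>k\<in>UNIV. pr u $ k * \<phi> 0 k z) = 0" for z
   using u(2)[of z] by (simp add: split \<psi>0_def)
  have u0: "u $ None = 0"
  proof (rule ccontr)
   assume n: "u $ None \<noteq> 0"
   have "(\<Sum>k\<in>UNIV. M $ k * \<phi>' k z) + (\<Sum>k\<in>UNIV. ((1 / u $ None) *s pr u) $ k * \<phi> 0 k z) = 0" for z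
   proof -
    have "(\<Sum>k\<in>UNIV. ((1 / u $ None) *s pr u) $ k * \<phi> 0 k z) = (1 / u $ None) * (\<Sum>k\<in>UNIV. pr u $ k * \<phi> 0 k z)"
     by (simp add: sum_distrib_left)
    also have "(\<Sum>k\<in>UNIV. pr u $ k * \<phi> 0 k z) = - (u $ None * (\<Sum>k\<in>UNIV. M $ k * \<phi>' k z))"
     using u2[of z] by (simp add: eq_neg_iff_add_eq_0 add.commute)
    finally show ?thesis using n by simp
   qed
   thus False using contra by blast
  qed
  hence "pr u \<in> ker_sp (\<phi> 0)" using u2 by (simp add: ker_sp_def)
  hence "pr u = 0" using u(1) V(2) by (auto simp: V'_def)
  hence "u $ k = 0" for k using u0 by (cases k) (auto simp: pr_def vec_eq_iff)
  thus "u = 0" by (simp add: vec_eq_iff)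
 qed
 hence "\<forall>\<^sub>F t in at 0. vec.dim (ker_sp (\<phi> t)) < vec.dim (ker_sp (\<phi> 0))"
  using eventually_neq_at_within[of 0 0 UNIV]
 proof (rule eventually_elim2)
  fix t :: complex assume inj: "\<forall>u\<in>V'. (\<forall>z. (\<Sum>k\<in>UNIV. u $ k * \<psi> t k z) = 0) \<longrightarrow> u = 0" and t: "t \<noteq> 0"
  have key: "v = 0 \<and> c = 0" if v: "v \<in> V" "v + c *s M \<in> ker_sp (\<phi> t)" for v c
  proof -
   define u :: "complex^('m option)" where "u = (\<chi> k. case k of None \<Rightarrow> c * t | Some k' \<Rightarrow> v $ k')"
   have pu: "pr u = v" "u $ None = c * t" by (simp_all add: pr_def u_def vec_eq_iff)
   have "(\<Sum>k\<in>UNIV. u $ k * \<psi> t k z) = 0" for z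
   proof -
    have "(\<Sum>k\<in>UNIV. u $ k * \<psi> t k z) = (\<Sum>k\<in>UNIV. (v + c *s M) $ k * \<phi> t k z)"
    proof -
     have "(\<Sum>k\<in>UNIV. (v + c *s M) $ k * \<phi> t k z) =
       (\<Sum>k\<in>UNIV. v $ k * \<phi> t k z) + c * (\<Sum>k\<in>UNIV. M $ k * \<phi> t k z)"
      by (simp add: distrib_right sum.distrib sum_distrib_left mult.assoc)
     thus ?thesis using t by (simp add: split pu \<psi>_def)
    qed
    thus ?thesis using v(2) by (simp add: ker_sp_def)
   qed
   moreover have "u \<in> V'" using v(1) pu by (simp add: V'_def)
   ultimately have "u = 0" using inj by blast
   hence "pr u = 0" "u $ None = 0" by (simp_all add: pr_def vec_eq_iff)
   thus ?thesis using pu t by simp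
  qed
  have nM: "M \<notin> V"
  proof
   assume "M \<in> V"
   hence M0: "M = 0" using V(2) M by auto
   have "0 + 1 *s M \<in> ker_sp (\<phi> t)" using vec.subspace_0[OF subspace_ker_sp[of "\<phi> t"]] M0 by simp
   thus False using key[OF vec.subspace_0[OF V(1)], of 1] by simp
  qed
  define V1 where "V1 = vec.span (insert M V)"
  have s1: "vec.subspace V1" unfolding V1_def by (rule vec.subspace_span)
  have "V1 \<inter> ker_sp (\<phi> t) = {0}"
  proof -
   have "x = 0" if x: "x \<in> V1" "x \<in> ker_sp (\<phi> t)" for x
   proof -
    obtain c where "x - c *s M \<in> vec.span V" using x(1) vec.span_breakdown_eq unfolding V1_def by blast
    hence "x - c *s M \<in> V" using V(1) vec.span_eq_iff by blast
    from key[OF this, of c] show ?thesis using x(2) by simp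
   qed
   thus ?thesis using vec.subspace_0[OF s1] vec.subspace_0[OF subspace_ker_sp[of "\<phi> t"]] by blast
  qed
  from vec_dim_disjoint[OF s1 subspace_ker_sp this] have "vec.dim V1 + vec.dim (ker_sp (\<phi> t)) \<le> CARD('m)" .
  moreover have "vec.dim V1 = vec.dim V + 1"
  proof -
   have "vec.span V = V" using V(1) vec.span_eq_iff by blast
   thus ?thesis unfolding V1_def vec.dim_span vec.dim_insert using nM by metis
  qed
  ultimately show "vec.dim (ker_sp (\<phi> t)) < vec.dim (ker_sp (\<phi> 0))" using V(3) by simp
 qed
 with dim have "\<forall>\<^sub>F t in at (0::complex). False" by eventually_elim simp
 thus False by simp
qed

subsection \<open>Taylor coefficients along a pencil of hyperplanes\<close>

text \<open>Coordinates adapted to the plane \<open>y 4 = dotp a x\<close>, which is given by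
  \<open>s = 0\<close>; changing \<open>a\<close> amounts to a shift of \<open>s\<close>, see
  \<open>emb4_shift\<close>.\<close>

definition emb4 :: "3 cvec \<Rightarrow> 3 cvec \<Rightarrow> complex \<Rightarrow> 4 cvec" where
 "emb4 a x s = (%i. if i = 1 then x 1 else if i = 2 then x 2 else if i = 3 then x 3 else dotp a x + s)"

lemma emb4_simps: "emb4 a x s 1 = x 1" "emb4 a x s 2 = x 2" "emb4 a x s 3 = x 3" "emb4 a x s 4 = dotp a x + s"
 by (simp_all add: emb4_def)

lemma emb4_surj: "\<exists>x s. y = emb4 a x s"
proof -
 define x where "x = (%j::3. if j = 1 then y 1 else if j = 2 then y 2 else y 3)"
 have "y i = emb4 a x (y 4 - dotp a x) i" for i
  using exhaust_4[of i] by (auto simp: emb4_simps) (simp_all add: x_def)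
 hence "y = emb4 a x (y 4 - dotp a x)" by blast
 thus ?thesis by blast
qed

lemma emb4_zero: "emb4 a x 0 = zv \<Longrightarrow> x = zv"
proof
 fix j :: 3 assume e: "emb4 a x 0 = zv"
 have "emb4 a x 0 1 = 0" "emb4 a x 0 2 = 0" "emb4 a x 0 3 = 0" using e by simp_all
 thus "x j = 0" using exhaust_3[of j] by (auto simp: emb4_simps)
qed

lemma emb4_line: "emb4 a x s = (%i. emb4 a x 0 i + s * (if i = 4 then 1 else 0))"
proof
 fix i :: 4
 show "emb4 a x s i = emb4 a x 0 i + s * (if i = 4 then 1 else 0)"
  using exhaust_4[of i] by (auto simp: emb4_def)
qed

lemma emb4_shift: "emb4 (%j. a j + t * a' j) x s = emb4 a x (t * dotp a' x + s)"
proof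
 fix i :: 4
 show "emb4 (%j. a j + t * a' j) x s i = emb4 a x (t * dotp a' x + s) i"
  using exhaust_4[of i] by (auto simp: emb4_def dotp_add_left dotp_scale_left)
qed

lemma gform_emb4_var: "gform 1 (%x. emb4 a x 0 i)"
proof -
 have "gform 1 (%x. emb4 a x 0 1)" "gform 1 (%x. emb4 a x 0 2)" "gform 1 (%x. emb4 a x 0 3)" "gform 1 (%x. emb4 a x 0 4)"
  using gform_dotp_var[of a] by (simp_all add: emb4_simps gform_var)
 thus ?thesis using exhaust_4[of i] by auto
qed

text \<open>The restriction of \<open>p\<close> to the line transversal to the plane over
  \<open>x\<close>; for polynomial \<open>p\<close> the choice is unique. Its coefficients
  \<open>sc\<close> are the Taylor coefficients along the plane.\<close>

definition sl :: "4 cfun \<Rightarrow> 3 cvec \<Rightarrow> 3 cvec \<Rightarrow> complex poly" where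
 "sl p a x = (SOME q. \<forall>s. p (emb4 a x s) = poly q s)"

definition sc :: "4 cfun \<Rightarrow> 3 cvec \<Rightarrow> 3 cvec \<Rightarrow> nat cvec" where
 "sc p a x i = coeff (sl p a x) i"

lemma poly_sl: "polyf p \<Longrightarrow> p (emb4 a x s) = poly (sl p a x) s"
proof -
 assume "polyf p"
 then obtain q where "\<forall>t. p (%i. emb4 a x 0 i + t * (if i = 4 then 1 else 0)) = poly q t"
  using polyf_line[of p "emb4 a x 0" "%i. if i = 4 then 1 else 0"] by blast
 hence "\<exists>q. \<forall>s. p (emb4 a x s) = poly q s" unfolding emb4_line[symmetric] by blast
 from someI_ex[OF this] show ?thesis unfolding sl_def by blast
qed

lemma sl_eqI: "polyf p \<Longrightarrow> (\<And>s. p (emb4 a x s) = poly q s) \<Longrightarrow> sl p a x = q"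
 using poly_sl[of p a x] by (metis poly_eq_poly_eq_iff ext)

lemma sc_0: "polyf p \<Longrightarrow> sc p a x 0 = p (emb4 a x 0)"
 using poly_sl[of p a x 0] by (simp add: sc_def poly_0_coeff_0)

lemma sl_mult: "polyf p \<Longrightarrow> polyf q \<Longrightarrow> sl (%x. p x * q x) a x = sl p a x * sl q a x"
 by (intro sl_eqI polyf_mult) (simp_all add: poly_sl)

lemma sl_add: "polyf p \<Longrightarrow> polyf q \<Longrightarrow> sl (%x. p x + q x) a x = sl p a x + sl q a x"
 by (intro sl_eqI polyf_add) (simp_all add: poly_sl)

lemma sc_sum:
 assumes "\<And>k. k \<in> K \<Longrightarrow> polyf (p k)"
 shows "sc (%y. \<Sum>k\<in>K. c k * p k y) a x i = (\<Sum>k\<in>K. c k * sc (p k) a x i)"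
proof -
 have "sl (%y. \<Sum>k\<in>K. c k * p k y) a x = (\<Sum>k\<in>K. smult (c k) (sl (p k) a x))"
  using assms by (intro sl_eqI polyf_sum polyf_mult polyf_const) (simp_all add: poly_sum poly_sl)
 thus ?thesis by (simp add: sc_def coeff_sum)
qed

lemma sc_all_zero: "polyf p \<Longrightarrow> (\<And>i. sc p a x i = 0) \<Longrightarrow> p (emb4 a x s) = 0"
proof -
 assume p: "polyf p" and z: "\<And>i. sc p a x i = 0"
 have "sl p a x = 0" using z by (simp add: poly_eq_iff sc_def)
 thus ?thesis by (simp add: poly_sl[OF p])
qed

lemma sl_var: "sl (%y. y v) a x = [:emb4 a x 0 v, if v = 4 then 1 else 0:]"
 by (intro sl_eqI polyf_var) (subst emb4_line, simp)

lemma coeff_linear_mult: "coeff ([:c, b:] * q) i = c * coeff q i + b * (if i = 0 then 0 else coeff q (i - 1))"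
 for c b :: complex
 by (cases i) simp_all

lemma gform_sc: "form n p \<Longrightarrow> gform (int n - int i) (%x. sc p a x i)"
proof (induction arbitrary: i rule: form.induct)
 case (form_const c)
 have "sl (%_. c) a x = [:c:]" for x by (intro sl_eqI polyf_const) simp
 hence "(%x. sc (%_. c) a x i) = (%x. if i = 0 then c else 0)"
  by (auto simp: sc_def coeff_pCons split: nat.splits)
 thus ?case by (auto intro: gform_const gform_zero)
next
 case (form_step n p v)
 have pp: "polyf p" by (rule form_polyf[OF form_step.hyps])
 have e: "sc (%x. x v * p x) a x i = emb4 a x 0 v * sc p a x i +
   (if v = 4 then 1 else 0) * (if i = 0 then 0 else sc p a x (i - 1))" for x
  unfolding sc_def sl_mult[OF polyf_var pp] sl_var by (rule coeff_linear_mult)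
 have "gform (int (Suc n) - int i) (%x. if i = 0 then 0 else sc p a x (i - 1))"
  using form_step.IH[of "i - 1"] by (cases i) (simp_all add: gform_zero)
 thus ?case unfolding e
  by (intro gform_add gform_scale gform_mult[OF gform_emb4_var form_step.IH]) simp_all
next
 case (form_add n p q)
 have e: "sc (%x. p x + q x) a x i = sc p a x i + sc q a x i" for x
  unfolding sc_def sl_add[OF form_polyf[OF form_add.hyps(1)] form_polyf[OF form_add.hyps(2)]] by simp
 show ?case unfolding e by (intro gform_add form_add.IH)
qed

lemma pcompose_shift_deriv:
 fixes q :: "complex poly"
 shows "((%t. coeff (pcompose q [:t * c, 1:]) i) has_field_derivative of_nat (Suc i) * c * coeff q (Suc i)) (at 0)"
proof (induction q arbitrary: i)
 case 0
 thus ?case by simp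
next
 case (pCons a q)
 have id: "pcompose q [:0, 1:] = q" by (rule poly_ext) (simp add: poly_pcompose)
 have d1: "((%t. t * c * coeff (pcompose q [:t * c, 1:]) i) has_field_derivative c * coeff q i) (at 0)" for i
  using DERIV_mult[OF DERIV_cmult_right[OF DERIV_ident, of c] pCons.IH[of i]] by (simp add: id)
 show ?case
 proof (cases i)
  case 0
  have "((%t. a + t * c * coeff (pcompose q [:t * c, 1:]) 0) has_field_derivative 0 + c * coeff q 0) (at 0)"
   by (intro DERIV_add DERIV_const d1)
  thus ?thesis by (simp add: 0 pcompose_pCons)
 next
  case (Suc j)
  have "((%t. t * c * coeff (pcompose q [:t * c, 1:]) (Suc j) + coeff (pcompose q [:t * c, 1:]) j) has_field_derivative
    c * coeff q (Suc j) + of_nat (Suc j) * c * coeff q (Suc j)) (at 0)"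
   by (intro DERIV_add d1 pCons.IH)
  thus ?thesis by (simp add: Suc pcompose_pCons algebra_simps)
 qed
qed

text \<open>Moving the plane by \<open>t * a'\<close> shifts \<open>s\<close> by
  \<open>t * dotp a' x\<close>, so the derivative of a Taylor coefficient is a linear form times the
  next one. This is what turns deformations of kernel elements into statements about higher
  jets.\<close>

lemma sc_deriv:
 assumes "polyf p"
 shows "((%t. sc p (%j. a j + t * a' j) x i) has_field_derivative of_nat (Suc i) * dotp a' x * sc p a x (Suc i)) (at 0)"
proof -
 have "sl p (%j. a j + t * a' j) x = pcompose (sl p a x) [:t * dotp a' x, 1:]" for t
  by (intro sl_eqI assms) (simp add: poly_pcompose emb4_shift poly_sl[OF assms])
 thus ?thesis unfolding sc_def using pcompose_shift_deriv[of "sl p a x" "dotp a' x" i] by simp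
qed

text \<open>Order and point are packed into the single index \<open>z\<close>; the kernel
  \<open>jker\<close> then consists of the combinations of the \<open>\<phi> k\<close> that vanish
  to order \<open>j\<close> along the plane.\<close>

definition jet :: "('m::finite \<Rightarrow> 4 cfun) \<Rightarrow> nat \<Rightarrow> 3 cvec \<Rightarrow> 'm \<Rightarrow> nat \<times> 3 cvec \<Rightarrow> complex" where
 "jet \<phi> j a k z = (if fst z < j then sc (\<phi> k) a (snd z) (fst z) else 0)"

definition jker :: "('m::finite \<Rightarrow> 4 cfun) \<Rightarrow> nat \<Rightarrow> 3 cvec \<Rightarrow> (complex^'m) set" where
 "jker \<phi> j a = ker_sp (jet \<phi> j a)"

definition comb :: "('m::finite \<Rightarrow> 4 cfun) \<Rightarrow> complex^'m \<Rightarrow> 4 cfun" where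
 "comb \<phi> M y = (\<Sum>k\<in>UNIV. M $ k * \<phi> k y)"

locale jets =
 fixes \<phi> :: "'m::finite \<Rightarrow> 4 cfun"
 assumes polyf_\<phi>: "\<And>k. polyf (\<phi> k)"
begin

lemma polyf_comb: "polyf (comb \<phi> M)"
 unfolding comb_def[abs_def] by (intro polyf_sum polyf_mult polyf_const polyf_\<phi>)

lemma sc_comb: "sc (comb \<phi> M) a x i = (\<Sum>k\<in>UNIV. M $ k * sc (\<phi> k) a x i)"
 unfolding comb_def[abs_def] by (rule sc_sum) (rule polyf_\<phi>)

lemma jker_iff: "M \<in> jker \<phi> j a \<longleftrightarrow> (\<forall>i<j. \<forall>x. sc (comb \<phi> M) a x i = 0)"
proof -
 have "(\<Sum>k\<in>UNIV. M $ k * jet \<phi> j a k z) = (if fst z < j then sc (comb \<phi> M) a (snd z) (fst z) else 0)" for z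
  by (simp add: jet_def sc_comb)
 thus ?thesis by (auto simp: jker_def ker_sp_def)
qed

lemma jet_lim: "((%t. jet \<phi> j (%k. a k + t * a' k) k z) \<longlongrightarrow> jet \<phi> j a k z) (at 0)"
proof -
 have "isCont (%t. sc (\<phi> k) (%k. a k + t * a' k) (snd z) (fst z)) 0"
  by (rule DERIV_isCont[OF sc_deriv[OF polyf_\<phi>]])
 thus ?thesis by (simp add: isCont_def jet_def)
qed

lemma jker_semicont: "\<forall>\<^sub>F t in at 0. vec.dim (jker \<phi> j (%k. a k + t * a' k)) \<le> vec.dim (jker \<phi> j a)"
 using kernel_dim_semicont[of "%t. jet \<phi> j (%k. a k + t * a' k)"] jet_lim[of j a a'] by (simp add: jker_def)

lemma jker_deform:
 assumes "\<forall>\<^sub>F t in at 0. vec.dim (jker \<phi> j a) \<le> vec.dim (jker \<phi> j (%k. a k + t * a' k))"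
  and M: "M \<in> jker \<phi> j a"
 shows "\<exists>M'. \<forall>i<j. \<forall>x. of_nat (Suc i) * dotp a' x * sc (comb \<phi> M) a x (Suc i) + sc (comb \<phi> M') a x i = 0"
proof -
 define D where "D = (%k (z :: nat \<times> 3 cvec). if fst z < j then of_nat (Suc (fst z)) * dotp a' (snd z) * sc (\<phi> k) a (snd z) (Suc (fst z)) else 0)"
 have der: "((%t. jet \<phi> j (%k. a k + t * a' k) k z) has_field_derivative D k z) (at 0)" for k z
  using sc_deriv[OF polyf_\<phi>[of k], of a a' "snd z" "fst z"] by (cases "fst z < j") (simp_all add: jet_def D_def)
 obtain M' where M': "\<And>z. (\<Sum>k\<in>UNIV. M $ k * D k z) + (\<Sum>k\<in>UNIV. M' $ k * jet \<phi> j (%k. a k + 0 * a' k) k z) = 0"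
  using kernel_deform[of "%t. jet \<phi> j (%k. a k + t * a' k)" D M, OF der] assms by (auto simp: jker_def)
 show ?thesis
 proof (intro exI[of _ M'] allI impI)
  fix i x assume "i < j"
  thus "of_nat (Suc i) * dotp a' x * sc (comb \<phi> M) a x (Suc i) + sc (comb \<phi> M') a x i = 0"
   using M'[of "(i, x)"] by (simp add: D_def jet_def sc_comb sum_distrib_left mult_ac)
 qed
qed

lemma jker_antimono: "i \<le> j \<Longrightarrow> jker \<phi> j a \<subseteq> jker \<phi> i a"
 by (auto simp: jker_iff)

text \<open>If the kernels of the \<open>r\<close>-jets have constant dimension near every point of a set and agree with
 the kernels of the \<open>(r+1)\<close>-jets, then they are parallel, so their elements vanish identically.\<close>

lemma jker_stable:
 assumes S: "\<And>a a'. a \<in> S \<Longrightarrow> \<forall>\<^sub>F t in at 0. (%k. a k + t * a' k) \<in> S"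
  and dim: "\<And>a b. a \<in> S \<Longrightarrow> b \<in> S \<Longrightarrow> vec.dim (jker \<phi> r a) = vec.dim (jker \<phi> r b)"
  and r: "r \<ge> 1" "\<And>a. a \<in> S \<Longrightarrow> jker \<phi> r a \<subseteq> jker \<phi> (Suc r) a"
  and a: "a \<in> S" and M: "M \<in> jker \<phi> r a"
 shows "comb \<phi> M y = 0"
proof -
 have eq: "jker \<phi> (r + n) a = jker \<phi> r a" if "a \<in> S" for n a
  using that
 proof (induction n arbitrary: a)
  case 0
  thus ?case by simp
 next
  case (Suc n)
  show ?case
  proof (cases "n = 0")
   case True
   thus ?thesis using r(2)[OF Suc.prems] jker_antimono[of r "Suc r" a] by auto
  next
   case False
   then obtain m where n: "n = Suc m" by (cases n) auto
   let ?j = "r + n"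
   have "M \<in> jker \<phi> (Suc ?j) a" if M: "M \<in> jker \<phi> ?j a" for M
   proof -
    have "sc (comb \<phi> M) a x ?j = 0" for x
    proof -
     have "dotp a' x * sc (comb \<phi> M) a x ?j = 0" for a' x
     proof -
      have "\<forall>\<^sub>F t in at 0. vec.dim (jker \<phi> ?j a) \<le> vec.dim (jker \<phi> ?j (%k. a k + t * a' k))"
       using S[OF Suc.prems, of a']
      proof (rule eventually_mono)
       fix t assume t: "(%k. a k + t * a' k) \<in> S"
       show "vec.dim (jker \<phi> ?j a) \<le> vec.dim (jker \<phi> ?j (%k. a k + t * a' k))"
        using dim[OF Suc.prems t] Suc.IH[OF Suc.prems] Suc.IH[OF t] by simp
      qed
      from jker_deform[OF this M] obtain M' where
       M': "\<And>i x. i < ?j \<Longrightarrow> of_nat (Suc i) * dotp a' x * sc (comb \<phi> M) a x (Suc i) + sc (comb \<phi> M') a x i = 0"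
       by blast
      \<comment> \<open>The deformation \<open>M'\<close> is first seen to vanish to order
        \<open>r\<close>. The induction hypothesis raises this to order \<open>r + n\<close>, and
        the last of the deformation equations then kills the next coefficient of
        \<open>M\<close>.\<close>
      have "sc (comb \<phi> M') a x i = 0" if "i < r" for i x
      proof -
       have "sc (comb \<phi> M) a x (Suc i) = 0" using M that n by (simp add: jker_iff)
       thus ?thesis using M'[of i x] that by simp
      qed
      hence "M' \<in> jker \<phi> r a" by (simp add: jker_iff)
      hence "M' \<in> jker \<phi> ?j a" using Suc.IH[OF Suc.prems] by simp
      hence "sc (comb \<phi> M') a x (?j - 1) = 0" using r(1) by (simp add: jker_iff)
      hence "of_nat (Suc (?j - 1)) * (dotp a' x * sc (comb \<phi> M) a x (Suc (?j - 1))) = 0"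
       using M'[of "?j - 1" x] r(1) by (simp add: mult.assoc)
      moreover have "Suc (?j - 1) = ?j" using r(1) by simp
      ultimately show ?thesis using r(1) by (metis mult_eq_0_iff of_nat_eq_0_iff nat.simps(3))
     qed
     note z = this
     show "sc (comb \<phi> M) a x ?j = 0"
     proof -
      have g: "polyf (%x. sc (comb \<phi> M) a x ?j)"
      proof -
       obtain N P where P: "\<forall>i. form i (P i)" "comb \<phi> M = (%x. \<Sum>i\<le>(N::nat). 1 * P i x)"
        using polyf_decomp[OF polyf_comb[of M]] by auto
       have "sc (comb \<phi> M) a x ?j = (\<Sum>i\<le>N. 1 * sc (P i) a x ?j)" for x
        unfolding P(2) by (rule sc_sum) (use P(1) form_polyf in blast)
       thus ?thesis
        by (simp only:) (intro polyf_sum polyf_mult polyf_const gform_polyf[OF gform_sc[OF P(1)[rule_format]]])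
      qed
      have "x 1 * sc (comb \<phi> M) a x ?j = 0" for x
       using z[of "%v. if v = 1 then 1 else 0" x]
       by (simp add: dotp_def if_distrib[of "%z. z * _"] cong: if_cong)
      hence "(\<forall>x::3 cvec. x 1 = 0) \<or> (\<forall>x. sc (comb \<phi> M) a x ?j = 0)"
       by (rule polyf_no_zero_div[OF polyf_var g])
      moreover have "\<not> (\<forall>x::3 cvec. x 1 = 0)" by (auto intro: exI[of _ "%_. 1"])
      ultimately show ?thesis by blast
     qed
    qed
    thus ?thesis using M by (auto simp: jker_iff less_Suc_eq)
   qed
   hence "jker \<phi> (Suc ?j) a = jker \<phi> ?j a" using jker_antimono[of ?j "Suc ?j" a] by auto
   thus ?thesis using Suc.IH[OF Suc.prems] by simp
  qed
 qed
 have "sc (comb \<phi> M) a x i = 0" for x i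
 proof -
  have "M \<in> jker \<phi> (r + Suc i) a" unfolding eq[OF a] by (rule M)
  thus ?thesis by (simp add: jker_iff)
 qed
 thus ?thesis using sc_all_zero[OF polyf_comb] emb4_surj[of y a] by metis
qed

end

subsection \<open>Smooth forms have no linear vector field tangent to their fibres\<close>

definition mv :: "('v::finite \<Rightarrow> 'v cvec) \<Rightarrow> 'v cvec \<Rightarrow> 'v cvec" where
 "mv M x = (%i. dotp (M i) x)"

definition unitv :: "'v \<Rightarrow> 'v cvec" where
 "unitv j = (%i. if i = j then 1 else 0)"

lemma dotp_unitv: "dotp (unitv j) x = x j" for j :: "'v::finite"
proof -
 have "(if i = j then 1 else 0) * x i = (if i = j then x j else 0)" for i by simp
 thus ?thesis by (simp add: dotp_def unitv_def)
qed

text \<open>\<open>flow M w\<close> is the curve \<open>t \<mapsto> exp (t M) w\<close>.\<close>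

definition flow :: "('v::finite \<Rightarrow> 'v cvec) \<Rightarrow> 'v cvec \<Rightarrow> complex \<Rightarrow> 'v cvec" where
 "flow M w t = (%i. suminf (%n. (mv M ^^ n) w i / fact n * t ^ n))"

lemma flow_summable: "summable (%n. (mv M ^^ n) w i / fact n * t ^ n)"
proof -
 define B where "B = (\<Sum>i\<in>UNIV. \<Sum>j\<in>UNIV. norm (M i j))"
 define C where "C = (\<Sum>i\<in>UNIV. norm (w i))"
 have g: "norm ((mv M ^^ n) w i) \<le> B ^ n * C" for n i
 proof (induction n arbitrary: i)
  case 0
  show ?case using member_le_sum[of i UNIV "%i. norm (w i)"] by (simp add: C_def)
 next
  case (Suc n)
  have "norm ((mv M ^^ Suc n) w i) \<le> (\<Sum>j\<in>UNIV. norm (M i j) * (B ^ n * C))"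
   unfolding funpow.simps comp_def mv_def[of M "(mv M ^^ n) w"] dotp_def
   by (rule order.trans[OF norm_sum]) (intro sum_mono, simp add: norm_mult mult_left_mono Suc)
  also have "\<dots> = (\<Sum>j\<in>UNIV. norm (M i j)) * (B ^ n * C)" by (rule sum_distrib_right[symmetric])
  also have "\<dots> \<le> B * (B ^ n * C)"
   unfolding B_def using member_le_sum[of i UNIV "%i. \<Sum>j\<in>UNIV. norm (M i j)"]
   by (intro mult_right_mono) (auto simp: C_def sum_nonneg)
  finally show ?case by (simp add: mult.assoc)
 qed
 show ?thesis
 proof (rule summable_comparison_test')
  show "summable (%n. C * (inverse (fact n) * (B * norm t) ^ n))" by (intro summable_mult summable_exp)
  show "norm ((mv M ^^ n) w i / fact n * t ^ n) \<le> C * (inverse (fact n) * (B * norm t) ^ n)" for n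
   using mult_right_mono[OF g[of n i], of "norm t ^ n / fact n"]
   by (simp add: norm_mult norm_divide norm_power power_mult_distrib field_simps)
 qed
qed

lemma flow_0: "flow M w 0 = w"
 unfolding flow_def powser_zero by simp

lemma flow_deriv: "((%t. flow M w t i) has_field_derivative dotp (M i) (flow M w t)) (at t)"
proof -
 have "(%n. \<Sum>j\<in>UNIV. M i j * ((mv M ^^ n) w j / fact n * t ^ n)) sums dotp (M i) (flow M w t)"
  unfolding dotp_def flow_def by (intro sums_sum sums_mult summable_sums flow_summable)
 moreover have "(\<Sum>j\<in>UNIV. M i j * ((mv M ^^ n) w j / fact n * t ^ n)) = diffs (%n. (mv M ^^ n) w i / fact n) n * t ^ n" for n
 proof -
  have "of_nat (Suc n) * (a / fact (Suc n)) = a / fact n" for a :: complex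
   unfolding fact_Suc by (simp del: of_nat_Suc)
  hence "diffs (%n. (mv M ^^ n) w i / fact n) n = dotp (M i) ((mv M ^^ n) w) / fact n" by (simp add: diffs_def mv_def)
  thus ?thesis by (simp add: dotp_def sum_distrib_right sum_divide_distrib mult.assoc)
 qed
 ultimately have "dotp (M i) (flow M w t) = suminf (%n. diffs (%n. (mv M ^^ n) w i / fact n) n * t ^ n)" by (simp add: sums_iff)
 thus ?thesis unfolding flow_def using termdiffs_strong_converges_everywhere[OF flow_summable[of M w i]] by simp
qed

lemma polyf_tendsto:
 assumes "\<And>v. ((%t. x t v) \<longlongrightarrow> y v) F"
 shows "polyf p \<Longrightarrow> ((%t. p (x t)) \<longlongrightarrow> p y) F"
 by (induction rule: polyf.induct) (auto intro!: tendsto_intros assms)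

text \<open>The sum of the norms has a positive minimum on the unit sphere; homogeneity extends the
  bound.\<close>

lemma forms_proper:
 fixes F :: "'a::finite \<Rightarrow> 'v::finite cfun"
 assumes F: "\<And>a. form e (F a)" and e: "e \<ge> 1" and nz: "\<And>x. (\<And>a. F a x = 0) \<Longrightarrow> x = zv"
 shows "\<exists>c>0. \<forall>x i. c * norm (x i) ^ e \<le> (\<Sum>a\<in>UNIV. norm (F a x))"
proof -
 define \<phi> where "\<phi> = (%v :: complex^'v. \<Sum>a\<in>UNIV. norm (F a (%i. v $ i)))"
 have "continuous_on (sphere 0 1) \<phi>"
  unfolding \<phi>_def continuous_on_def
  by (intro ballI tendsto_sum tendsto_norm polyf_tendsto[OF _ form_polyf[OF F]] tendsto_vec_nth tendsto_ident_at)
 moreover have "axis undefined 1 \<in> sphere (0 :: complex^'v) 1" by (simp add: norm_axis_1)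
 ultimately obtain v0 where v0: "v0 \<in> sphere 0 1" "\<And>v. v \<in> sphere 0 1 \<Longrightarrow> \<phi> v0 \<le> \<phi> v"
  using continuous_attains_inf[of "sphere (0 :: complex^'v) 1" \<phi>] by auto
 have "\<phi> v0 \<noteq> 0"
 proof
  assume "\<phi> v0 = 0"
  hence "F a (%i. v0 $ i) = 0" for a by (simp add: \<phi>_def sum_nonneg_eq_0_iff)
  hence "(%i. v0 $ i) = zv" by (rule nz)
  hence "v0 = 0" by (simp add: vec_eq_iff fun_eq_iff)
  thus False using v0(1) by simp
 qed
 hence pos: "\<phi> v0 > 0" by (simp add: \<phi>_def sum_nonneg less_le)
 have "\<phi> v0 * norm (x i) ^ e \<le> (\<Sum>a\<in>UNIV. norm (F a x))" for x i
 proof (cases "x = zv")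
  case True
  thus ?thesis using e by (simp add: sum_nonneg power_0_left)
 next
  case False
  define u :: "complex^'v" where "u = (\<chi> i. x i)"
  have u: "u \<noteq> 0" using False by (auto simp: u_def vec_eq_iff)
  define v where "v = (1 / norm u) *\<^sub>R u"
  have "x = (%i. of_real (norm u) * v $ i)" using u by (simp add: v_def u_def fun_eq_iff scaleR_conv_of_real[where 'a = complex])
  hence "F a x = of_real (norm u) ^ e * F a (%i. v $ i)" for a using form_homog[OF F, of a "of_real (norm u)" "%i. v $ i"] by simp
  hence "(\<Sum>a\<in>UNIV. norm (F a x)) = norm u ^ e * \<phi> v" by (simp add: \<phi>_def norm_mult norm_power sum_distrib_left)
  moreover have "\<phi> v0 \<le> \<phi> v" using u by (intro v0(2)) (simp add: v_def)
  moreover have "norm (x i) \<le> norm u" using Finite_Cartesian_Product.norm_nth_le[of u i] by (simp add: u_def)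
  ultimately show ?thesis using pos
   by (simp add: mult.commute mult_mono power_mono)
 qed
 thus ?thesis using pos by blast
qed

text \<open>If \<open>f\<close> is constant along the flow of \<open>M\<close>, then \<open>\<nabla>f (exp (t M) y) = exp (- t M\<^sup>T) (\<nabla>f y)\<close>. As \<open>\<nabla>f\<close>
 grows like the \<open>e\<close>-th power of the norm, \<open>\<bar>exp (t M)\<bar>\<^sup>e\<close> is bounded by a multiple of \<open>\<bar>exp (- t M)\<bar>\<close> and vice
 versa; so \<open>exp (t M)\<close> is bounded, hence constant.\<close>

lemma no_linear_symmetry:
 fixes f :: "'v::finite cfun" and M :: "'v \<Rightarrow> 'v cvec"
 assumes f: "form (Suc e) f" and e: "e \<ge> 2" and nz: "\<And>x. (\<And>i. pd i f x = 0) \<Longrightarrow> x = zv"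
  and inv: "\<And>x. dotp (mv M x) (%i. pd i f x) = 0"
 shows "M = (%_ _. 0)"
proof -
 define F where "F = (%i. pd i f)"
 have F: "form e (F i)" for i unfolding F_def by (rule form_pd[OF f])
 have pF: "polyf (F i)" for i by (rule form_polyf[OF F])
 have dotpd: "pd k (dotp (M i)) x = M i k" for i k x
 proof -
  have "pd k (dotp (M i)) x = (\<Sum>j\<in>UNIV. M i j * (if j = k then 1 else 0))"
   unfolding dotp_def[abs_def] by (simp add: pd_sum polyf_mult polyf_const polyf_var pd_scale[OF polyf_var] pd_var)
  thus ?thesis by (simp add: if_distrib[of "%z. _ * z"] cong: if_cong)
 qed
 \<comment> \<open>Differentiating the invariance of the form with respect to \<open>x k\<close>:
   along the vector field the gradient changes by minus the transpose of \<open>M\<close>.\<close>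
 have E: "dotp (mv M x) (%i. pd i (F k) x) = - (\<Sum>i\<in>UNIV. M i k * F i x)" for x k
 proof -
  have pM: "polyf (dotp (M i))" for i by (rule form_polyf[OF form_dotp_var])
  have "(%x. \<Sum>i\<in>UNIV. dotp (M i) x * F i x) = zv"
   using inv by (intro ext) (simp add: dotp_def[of "mv M _"] mv_def F_def dotp_def[of "%i. dotp (M i) _"])
  hence "pd k (%x. \<Sum>i\<in>UNIV. dotp (M i) x * F i x) x = 0" using pd_const[of k 0 x] by simp
  also have "pd k (%x. \<Sum>i\<in>UNIV. dotp (M i) x * F i x) x = (\<Sum>i\<in>UNIV. pd k (%x. dotp (M i) x * F i x) x)"
   by (rule pd_sum) (intro polyf_mult pM pF)
  also have "\<dots> = (\<Sum>i\<in>UNIV. M i k * F i x + dotp (M i) x * pd k (F i) x)"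
   by (simp add: pd_mult[OF pM pF] dotpd)
  also have "\<dots> = (\<Sum>i\<in>UNIV. M i k * F i x) + dotp (mv M x) (%i. pd i (F k) x)"
   by (simp add: sum.distrib dotp_def[of "mv M x"] dotp_def[of "%i. dotp (M i) x"] mv_def F_def pd_commute[OF form_polyf[OF f], of k])
  finally show ?thesis by (simp add: eq_neg_iff_add_eq_0 add.commute)
 qed
 have dual: "F i (flow M y t) = (\<Sum>a\<in>UNIV. F a y * flow M (unitv i) (- t) a)" for i y t
 proof -
  \<comment> \<open>Pairing the gradient along the flow with the flow of \<open>unitv i\<close>
    makes the two transposed derivatives cancel. The constant \<open>h\<close> equals the left-hand
    side at \<open>s = t\<close> and the right-hand side at \<open>s = 0\<close>.\<close>
  define h where "h = (%s. \<Sum>a\<in>UNIV. F a (flow M y s) * flow M (unitv i) (s - t) a)"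
  have "(h has_field_derivative 0) (at s)" for s
  proof -
   have dF: "((%s. F a (flow M y s)) has_field_derivative - (\<Sum>i\<in>UNIV. M i a * F i (flow M y s))) (at s)" for a
    using polyf_curve[where z = "%i s. flow M y s i", OF flow_deriv pF[of a], of s] E[of "flow M y s" a] by (simp add: mv_def)
   have dZ: "((%s. flow M (unitv i) (s - t) a) has_field_derivative dotp (M a) (flow M (unitv i) (s - t))) (at s)" for a
    using DERIV_chain2[OF flow_deriv DERIV_diff[OF DERIV_ident DERIV_const]] by simp
   have "(h has_field_derivative (\<Sum>a\<in>UNIV. - (\<Sum>i\<in>UNIV. M i a * F i (flow M y s)) * flow M (unitv i) (s - t) a
     + dotp (M a) (flow M (unitv i) (s - t)) * F a (flow M y s))) (at s)"
    unfolding h_def by (intro DERIV_sum DERIV_mult dF dZ)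
   moreover have "(\<Sum>a\<in>UNIV. (\<Sum>i\<in>UNIV. M i a * F i x) * z a) = (\<Sum>a\<in>UNIV. dotp (M a) z * F a x)" for x z
    unfolding dotp_def sum_distrib_right by (subst sum.swap) (simp add: mult_ac)
   ultimately show ?thesis by (simp add: sum_subtractf)
  qed
  hence "\<exists>c. \<forall>s\<in>UNIV. h s = c" by (intro has_field_derivative_zero_constant convex_UNIV)
  hence "h t = h 0" by auto
  moreover have "h t = F i (flow M y t)"
   using dotp_unitv[of i "%a. F a (flow M y t)"] by (simp add: h_def flow_0 dotp_def mult.commute)
  ultimately show ?thesis by (simp add: h_def flow_0)
 qed
 define N where "N = (%t. Max (range (%(j, i). norm (flow M (unitv j) t i))))"
 have Nge: "norm (flow M (unitv j) t i) \<le> N t" for t i j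
 proof -
  have "norm (flow M (unitv j) t i) \<in> range (%(j, i). norm (flow M (unitv j) t i))" by (rule image_eqI[of _ _ "(j, i)"]) auto
  thus ?thesis unfolding N_def by (intro Max_ge) auto
 qed
 obtain c where c: "c > 0" "\<And>x i. c * norm (x i) ^ e \<le> (\<Sum>a\<in>UNIV. norm (F a x))"
  using forms_proper[of e F, OF F _ nz] e unfolding F_def by auto
 define C where "C = (\<Sum>a\<in>UNIV. \<Sum>j\<in>UNIV. norm (F a (unitv j)))"
 define D where "D = real CARD('v) * (real CARD('v) * C) / c"
 have C: "norm (F a (unitv j)) \<le> C" for a j
  using member_le_sum[of j UNIV "%j. norm (F a (unitv j))"] member_le_sum[of a UNIV "%a. \<Sum>j\<in>UNIV. norm (F a (unitv j))"]
  by (simp add: C_def sum_nonneg)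
 have C0: "C \<ge> 0" by (simp add: C_def sum_nonneg)
 have N0: "N t \<ge> 0" for t using Nge[of undefined t undefined] norm_ge_zero order.trans by blast
 have ND: "N t ^ e \<le> D * N (- t)" for t
 proof -
  have "N t \<in> range (%(j, i). norm (flow M (unitv j) t i))" unfolding N_def by (rule Max_in) auto
  then obtain j i where ji: "N t = norm (flow M (unitv j) t i)" by auto
  have "norm (F k (flow M (unitv j) t)) \<le> real CARD('v) * C * N (- t)" for k
  proof -
   have "norm (F k (flow M (unitv j) t)) \<le> (\<Sum>a\<in>(UNIV :: 'v set). C * N (- t))"
    unfolding dual by (rule sum_norm_le) (simp add: norm_mult mult_mono C Nge C0)
   thus ?thesis by simp
  qed
  hence "c * N t ^ e \<le> (\<Sum>a\<in>(UNIV :: 'v set). real CARD('v) * C * N (- t))"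
   unfolding ji by (intro order.trans[OF c(2)] sum_mono)
  thus ?thesis using c(1) by (simp add: D_def field_simps)
 qed
 have "N t \<le> max 1 (D ^ Suc e)" for t
 proof (cases "N t \<ge> 1")
  case True
  have D0: "D \<ge> 0" using C0 c(1) by (simp add: D_def)
  \<comment> \<open>Using \<open>ND\<close> at \<open>t\<close> and at \<open>- t\<close> bounds
    \<open>N t ^ (e * e)\<close> by a multiple of \<open>N t\<close>. As \<open>e * e\<close> is at
    least two, \<open>N t\<close> stays bounded.\<close>
  have "N t ^ 2 \<le> N t ^ (e * e)" using True e mult_le_mono[OF e e] by (intro power_increasing) auto
  also have "\<dots> \<le> (D * N (- t)) ^ e" unfolding power_mult by (intro power_mono ND) (simp add: N0)
  also have "\<dots> \<le> D ^ e * (D * N t)" unfolding power_mult_distrib using ND[of "- t"] D0 by (intro mult_left_mono) auto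
  finally have "N t * N t \<le> D ^ Suc e * N t" by (simp add: power2_eq_square mult_ac)
  thus ?thesis using True by simp
 qed simp
 hence bd: "norm (flow M (unitv j) t i) \<le> max 1 (D ^ Suc e)" for t i j using Nge order.trans by blast
 have "M i j = 0" for i j
 proof -
  have "(%t. flow M (unitv j) t i) holomorphic_on UNIV"
   unfolding holomorphic_on_def field_differentiable_def using flow_deriv by fast
  moreover have "bounded (range (%t. flow M (unitv j) t i))" unfolding bounded_iff using bd by blast
  ultimately have "(%t. flow M (unitv j) t i) constant_on UNIV" by (rule Liouville_theorem)
  then obtain k where "\<And>t. flow M (unitv j) t i = k" by (auto simp: constant_on_def)
  hence "((%t. flow M (unitv j) t i) has_field_derivative 0) (at 0)" by simp
  from DERIV_unique[OF flow_deriv this] have "dotp (M i) (unitv j) = 0" by (simp add: flow_0)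
  thus ?thesis using dotp_unitv[of j "M i"] by (simp add: dotp_commute[of "M i"])
 qed
 thus ?thesis by (intro ext)
qed

text \<open>Differentiating the relation with respect to \<open>x k\<close> and evaluating at the
  point \<open>w\<close> itself gives, by Euler's formula, \<open>e\<close> times
  \<open>pd k f w\<close>; so the gradient vanishes at \<open>w\<close>.\<close>

lemma no_constant_symmetry:
 fixes f :: "'v::finite cfun"
 assumes f: "form (Suc e) f" and e: "e \<ge> 1" and nz: "\<And>x. (\<And>i. pd i f x = 0) \<Longrightarrow> x = zv"
  and inv: "\<And>x. dotp w (%i. pd i f x) = 0"
 shows "w = zv"
proof (rule nz)
 fix k
 have pF: "polyf (pd i f)" for i by (rule polyf_pd_polyf[OF form_polyf[OF f]])
 have "(%x. \<Sum>i\<in>UNIV. w i * pd i f x) = zv" using inv by (simp add: dotp_def)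
 hence "0 = pd k (%x. \<Sum>i\<in>UNIV. w i * pd i f x) w" using pd_const[of k 0 w] by simp
 also have "\<dots> = (\<Sum>i\<in>UNIV. w i * pd k (pd i f) w)"
  by (simp add: pd_sum polyf_mult polyf_const pF pd_scale)
 also have "\<dots> = dotp w (%i. pd i (pd k f) w)"
  by (simp add: dotp_def pd_commute[OF form_polyf[OF f], of k])
 also have "\<dots> = of_nat e * pd k f w" by (rule euler[OF form_pd[OF f]])
 finally show "pd k f w = 0" using e by simp
qed

section \<open>Syzygies of the gradient along a general plane\<close>

context jets
begin

text \<open>The dimension of the kernel of 1-jets is minimized first, then that of 2-jets among the
  planes so found. By semicontinuity both remain minimal near such a plane in every pencil, which is
  the condition for deforming kernel elements.\<close>

lemma jker_generic:
 obtains S where "S \<noteq> {}" "\<And>a a'. a \<in> S \<Longrightarrow> \<forall>\<^sub>F t in at 0. (%k. a k + t * a' k) \<in> S"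
  "\<And>r a b. r = 1 \<or> r = 2 \<Longrightarrow> a \<in> S \<Longrightarrow> b \<in> S \<Longrightarrow> vec.dim (jker \<phi> r a) = vec.dim (jker \<phi> r b)"
  "\<And>r a a' M. r = 1 \<or> r = 2 \<Longrightarrow> a \<in> S \<Longrightarrow> M \<in> jker \<phi> r a \<Longrightarrow>
   \<exists>M'. \<forall>i<r. \<forall>x. of_nat (Suc i) * dotp a' x * sc (comb \<phi> M) a x (Suc i) + sc (comb \<phi> M') a x i = 0"
proof -
 define d where "d = (%r a. vec.dim (jker \<phi> r a))"
 define a1 where "a1 = arg_min (d 1) (%_. True)"
 have a1: "d 1 a1 \<le> d 1 a" for a unfolding a1_def by (rule arg_min_nat_le[where m = "d 1" and P = "%_. True"]) simp
 define a2 where "a2 = arg_min (d 2) (%a. d 1 a = d 1 a1)"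
 have a2: "d 1 a2 = d 1 a1" unfolding a2_def by (rule arg_min_natI[where m = "d 2" and P = "%a. d 1 a = d 1 a1" and k = a1]) simp
 have a2': "d 2 a2 \<le> d 2 a" if "d 1 a = d 1 a1" for a unfolding a2_def
  by (rule arg_min_nat_le[where m = "d 2" and P = "%a. d 1 a = d 1 a1"]) (rule that)
 define S where "S = {a. d 1 a = d 1 a1 \<and> d 2 a = d 2 a2}"
 have op: "\<forall>\<^sub>F t in at 0. (%k. a k + t * a' k) \<in> S" if "a \<in> S" for a a'
  using jker_semicont[of 1 a a'] jker_semicont[of 2 a a']
 proof eventually_elim
  case (elim t)
  have "d 1 (%k. a k + t * a' k) = d 1 a1" using elim(1) that a1[of "%k. a k + t * a' k"] by (simp add: S_def d_def)
  moreover from this have "d 2 (%k. a k + t * a' k) = d 2 a2"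
   using elim(2) that a2'[of "%k. a k + t * a' k"] by (simp add: S_def d_def)
  ultimately show ?case by (simp add: S_def)
 qed
 have dim: "vec.dim (jker \<phi> r a) = vec.dim (jker \<phi> r b)" if "r = 1 \<or> r = 2" "a \<in> S" "b \<in> S" for r a b
  using that by (auto simp: S_def d_def)
 have "\<exists>M'. \<forall>i<r. \<forall>x. of_nat (Suc i) * dotp a' x * sc (comb \<phi> M) a x (Suc i) + sc (comb \<phi> M') a x i = 0"
  if r: "r = 1 \<or> r = 2" and a: "a \<in> S" and "M \<in> jker \<phi> r a" for r a a' M
 proof (rule jker_deform)
  show "\<forall>\<^sub>F t in at 0. vec.dim (jker \<phi> r a) \<le> vec.dim (jker \<phi> r (%k. a k + t * a' k))"
   using op[OF a, of a'] by eventually_elim (use dim[OF r a] in simp)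
 qed (rule that)
 moreover have "a2 \<in> S" using a2 by (simp add: S_def)
 ultimately show ?thesis using that[of S] op dim by blast
qed

end

lemma form_grad_emb4:
 assumes "form (Suc e) f" shows "form e (%x. pd i f (emb4 a x 0))"
 by (rule form_compose_lin[OF form_pd[OF assms]]) (intro form_gform, use gform_emb4_var[of a] in simp)

lemma grad_emb4_nonzero:
 assumes "\<And>y. (\<And>i. pd i f y = 0) \<Longrightarrow> y = zv" "\<And>i. pd i f (emb4 a x 0) = 0"
 shows "x = zv"
 using assms(1)[OF assms(2)] by (rule emb4_zero)

text \<open>For constant vector fields 1-jets suffice: the deformation puts all products of the
  variables with the first normal derivative into the span of the \<open>F i\<close>, so
  \<open>no_cone_in_span\<close> makes that derivative zero and the relation extends to the whole
  space.\<close>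

lemma generic_polars_independent:
 assumes f: "form (Suc e) f" and e: "e \<ge> 2" and nz: "\<And>y :: 4 cvec. (\<And>i. pd i f y = 0) \<Longrightarrow> y = zv"
 shows "\<exists>a. \<forall>w. (\<forall>x. dotp w (%i. pd i f (emb4 a x 0)) = 0) \<longrightarrow> w = zv"
proof -
 define \<phi> where "\<phi> = (%i. pd i f)"
 have pF: "polyf (pd i f)" for i by (rule polyf_pd_polyf[OF form_polyf[OF f]])
 interpret jets \<phi> by standard (simp add: \<phi>_def pF)
 have cb: "comb \<phi> M y = dotp (%i. M $ i) (%i. pd i f y)" for M y
  by (simp add: comb_def \<phi>_def dotp_def)
 obtain S where S: "S \<noteq> {}" "\<And>a a'. a \<in> S \<Longrightarrow> \<forall>\<^sub>F t in at 0. (%k. a k + t * a' k) \<in> S"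
  "\<And>r a b. r = 1 \<or> r = 2 \<Longrightarrow> a \<in> S \<Longrightarrow> b \<in> S \<Longrightarrow> vec.dim (jker \<phi> r a) = vec.dim (jker \<phi> r b)"
  "\<And>r a a' M. r = 1 \<or> r = 2 \<Longrightarrow> a \<in> S \<Longrightarrow> M \<in> jker \<phi> r a \<Longrightarrow>
   \<exists>M'. \<forall>i<r. \<forall>x. of_nat (Suc i) * dotp a' x * sc (comb \<phi> M) a x (Suc i) + sc (comb \<phi> M') a x i = 0"
  by (rule jker_generic) blast
 have sc0: "sc (comb \<phi> M) a x 0 = dotp (%i. M $ i) (%i. pd i f (emb4 a x 0))" for M a x
  by (simp add: sc_0[OF polyf_comb] cb)
 have sub: "jker \<phi> 1 a \<subseteq> jker \<phi> (Suc 1) a" if a: "a \<in> S" for a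
 proof
  fix M assume M: "M \<in> jker \<phi> 1 a"
  have fM: "form e (comb \<phi> M)" unfolding cb by (intro form_dotp form_pd[OF f])
  have "(%x. sc (comb \<phi> M) a x 1) = zv"
  proof (rule no_cone_in_span[where F = "%i x. pd i f (emb4 a x 0)" and e = e and z = "int e - 1"])
   show "x = zv" if "\<And>i. pd i f (emb4 a x 0) = 0" for x using grad_emb4_nonzero[OF nz that] .
   show "gform (int e - 1) (%x. sc (comb \<phi> M) a x 1)" using gform_sc[OF fM, of 1 a] by simp
   show "\<exists>w. \<forall>x. x j * sc (comb \<phi> M) a x 1 = dotp w (%i. pd i f (emb4 a x 0))" for j
   proof -
    obtain M' where M': "\<And>i x. i < 1 \<Longrightarrow> of_nat (Suc i) * dotp (unitv j) x * sc (comb \<phi> M) a x (Suc i) + sc (comb \<phi> M') a x i = 0"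
     using S(4)[OF _ a M, of "unitv j"] by blast
    have "x j * sc (comb \<phi> M) a x 1 = dotp (%i. - 1 * M' $ i) (%i. pd i f (emb4 a x 0))" for x
     using M'[of 0 x] unfolding dotp_scale_left by (simp add: dotp_unitv sc0 eq_neg_iff_add_eq_0)
    thus ?thesis by blast
   qed
  qed (use e form_grad_emb4[OF f] in auto)
  hence "sc (comb \<phi> M) a x 1 = 0" for x by metis
  thus "M \<in> jker \<phi> (Suc 1) a" using M by (auto simp: jker_iff less_Suc_eq)
 qed
 obtain a where a: "a \<in> S" using S(1) by blast
 have "w = zv" if w: "\<And>x. dotp w (%i. pd i f (emb4 a x 0)) = 0" for w
 proof -
  define M :: "complex^4" where "M = (\<chi> i. w i)"
  have "M \<in> jker \<phi> 1 a" by (simp add: jker_iff sc0 M_def w)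
  from jker_stable[of S 1, OF S(2) S(3) _ sub a this] have "comb \<phi> M y = 0" for y by simp
  hence "dotp w (%i. pd i f y) = 0" for y by (simp add: cb M_def)
  from no_constant_symmetry[OF f _ nz this] show ?thesis using e by simp
 qed
 thus ?thesis by blast
qed

text \<open>For linear vector fields the deformation puts only products with the first normal
  derivative into the linear multiples of the \<open>F i\<close>, whence the socle lemma places the
  derivative itself into their span. This is the input for the second normal derivative, to which
  \<open>no_cone_in_span\<close> applies.\<close>

lemma generic_no_linear_syzygy:
 assumes f: "form (Suc e) f" and e: "e \<ge> 3" and nz: "\<And>y :: 4 cvec. (\<And>i. pd i f y = 0) \<Longrightarrow> y = zv"
 shows "\<exists>a. \<forall>N :: 4 \<Rightarrow> 3 cvec. (\<forall>x. dotp (%i. dotp (N i) x) (%i. pd i f (emb4 a x 0)) = 0) \<longrightarrow> N = (%_ _. 0)"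
proof -
 define \<phi> where "\<phi> = (%(i :: 4, j :: 4) (y :: 4 cvec). y j * pd i f y)"
 have pF: "polyf (pd i f)" for i by (rule polyf_pd_polyf[OF form_polyf[OF f]])
 have f\<phi>: "form (Suc e) (\<phi> k)" for k
  using form_step[OF form_pd[OF f], of "snd k" "fst k"] by (simp add: \<phi>_def split_beta)
 interpret jets \<phi> by standard (rule form_polyf[OF f\<phi>])
 have cb: "comb \<phi> M y = dotp (mv (%i j. M $ (i, j)) y) (%i. pd i f y)" for M y
 proof -
  have "comb \<phi> M y = (\<Sum>k\<in>UNIV \<times> UNIV. M $ k * (y (snd k) * pd (fst k) f y))"
   by (simp add: comb_def \<phi>_def split_beta)
  also have "\<dots> = (\<Sum>i\<in>UNIV. \<Sum>j\<in>UNIV. M $ (i, j) * (y j * pd i f y))"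
   unfolding sum.cartesian_product by (simp add: split_beta)
  finally show ?thesis by (simp add: dotp_def mv_def sum_distrib_right mult.assoc)
 qed
 have fM: "form (Suc e) (comb \<phi> M)" for M
  unfolding comb_def[abs_def] by (intro form_sum form_scale f\<phi>)
 obtain S where S: "S \<noteq> {}" "\<And>a a'. a \<in> S \<Longrightarrow> \<forall>\<^sub>F t in at 0. (%k. a k + t * a' k) \<in> S"
  "\<And>r a b. r = 1 \<or> r = 2 \<Longrightarrow> a \<in> S \<Longrightarrow> b \<in> S \<Longrightarrow> vec.dim (jker \<phi> r a) = vec.dim (jker \<phi> r b)"
  "\<And>r a a' M. r = 1 \<or> r = 2 \<Longrightarrow> a \<in> S \<Longrightarrow> M \<in> jker \<phi> r a \<Longrightarrow>
   \<exists>M'. \<forall>i<r. \<forall>x. of_nat (Suc i) * dotp a' x * sc (comb \<phi> M) a x (Suc i) + sc (comb \<phi> M') a x i = 0"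
  by (rule jker_generic) blast
 define io where "io = (%i::3. if i = 1 then 1 else if i = 2 then 2 else (3::4))"
 define oi where "oi = (%i::4. if i = 1 then 1 else if i = 2 then 2 else (3::3))"
 \<comment> \<open>The restriction of the vector field \<open>M\<close> to the plane; off the plane
   the last column of \<open>M\<close> is added with factor \<open>s\<close>.\<close>
 define A where "A = (%(M :: complex^(4\<times>4)) a i k. M $ (i, io k) + M $ (i, 4) * a k)"
 have cbe: "comb \<phi> M (emb4 a x s) = (\<Sum>i\<in>UNIV. (dotp (A M a i) x + s * M $ (i, 4)) * pd i f (emb4 a x s))" for M a x s
 proof -
  have "mv (%i j. M $ (i, j)) (emb4 a x s) i = dotp (A M a i) x + s * M $ (i, 4)" for i
   by (simp add: mv_def dotp_def sum_4 sum_3 emb4_simps A_def io_def algebra_simps)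
  thus ?thesis unfolding cb by (simp add: dotp_def[of "mv _ _"])
 qed
 have slc: "sl (comb \<phi> M) a x = (\<Sum>i\<in>UNIV. [:dotp (A M a i) x, M $ (i, 4):] * sl (pd i f) a x)" for M a x
  by (rule sl_eqI[OF polyf_comb]) (simp add: cbe poly_sum poly_sl[OF pF, symmetric] distrib_right mult.assoc)
 have sc0: "sc (comb \<phi> M) a x 0 = dotp (%i. dotp (A M a i) x) (%i. pd i f (emb4 a x 0))" for M a x
  by (simp add: sc_0[OF polyf_comb] cbe dotp_def[of "%i. dotp (A M a i) x"])
 have sc1: "sc (comb \<phi> M) a x 1 = (\<Sum>i\<in>UNIV. dotp (A M a i) x * sc (pd i f) a x 1) + dotp (%i. M $ (i, 4)) (%i. pd i f (emb4 a x 0))" for M a x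
 proof -
  have "coeff (sl (pd i f) a x) 0 = pd i f (emb4 a x 0)" for i using sc_0[OF pF] by (simp add: sc_def)
  thus ?thesis
   by (simp add: sc_def[of "comb _ _"] slc coeff_sum coeff_linear_mult sum.distrib sc_def[of "pd _ _"] dotp_def[of "%i. M $ (i, 4)"])
 qed
 have deform: "\<exists>M'. (r = 2 \<longrightarrow> M' \<in> jker \<phi> 1 a) \<and> (\<forall>x. x j * sc (comb \<phi> M) a x r = - sc (comb \<phi> M') a x (r - 1) / of_nat r)"
  if r: "r = 1 \<or> r = 2" and a: "a \<in> S" and M: "M \<in> jker \<phi> r a" for r a M j
 proof -
  obtain M' where M': "\<And>i x. i < r \<Longrightarrow> of_nat (Suc i) * x j * sc (comb \<phi> M) a x (Suc i) + sc (comb \<phi> M') a x i = 0"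
   using S(4)[OF r a M, of "unitv j"] unfolding dotp_unitv by blast
  have "x j * sc (comb \<phi> M) a x r = - sc (comb \<phi> M') a x (r - 1) / of_nat r" for x
   using M'[of "r - 1" x] r by (auto simp: field_simps eq_neg_iff_add_eq_0)
  moreover have "M' \<in> jker \<phi> 1 a" if "r = 2"
   using M'[of 0] M that by (simp add: jker_iff)
  ultimately show ?thesis by blast
 qed
 \<comment> \<open>If \<open>A M a\<close> is nonzero, it is the linear syzygy that
   \<open>socle_of_syzygy\<close> asks for, and the deformations in the three coordinate directions
   supply the socle equations. If it is zero, the formula \<open>sc1\<close> shows the claim
   directly.\<close>
 have alpha: "\<exists>w. \<forall>x. sc (comb \<phi> M) a x 1 = dotp w (%i. pd i f (emb4 a x 0))" if a: "a \<in> S" and M: "M \<in> jker \<phi> 1 a" for a M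
 proof (cases "\<exists>i0. A M a i0 \<noteq> zv")
  case True
  then obtain i0 where i0: "A M a i0 \<noteq> zv" by blast
  have "\<forall>j. \<exists>M'. \<forall>x. x j * sc (comb \<phi> M) a x 1 = - sc (comb \<phi> M') a x 0" using deform[OF _ a M] by auto
  from choice[OF this] obtain M' where M': "\<And>j x. x j * sc (comb \<phi> M) a x 1 = - sc (comb \<phi> (M' j)) a x 0" by blast
  have "\<exists>w. (%x. sc (comb \<phi> M) a x 1) = (%x. dotp w (%i. pd i f (emb4 a x 0)))"
  proof (rule socle_of_syzygy[where e = e and N = "A M a" and ?i0.0 = i0 and C = "%j i k. -1 * A (M' j) a i k"])
   show "x = zv" if "\<And>i. pd i f (emb4 a x 0) = 0" for x using grad_emb4_nonzero[OF nz that] .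
   show "dotp (%i. dotp (A M a i) x) (%i. pd i f (emb4 a x 0)) = 0" for x
    using M sc0[of M a x] by (simp add: jker_iff)
   show "form e (%x. sc (comb \<phi> M) a x 1)" using gform_sc[OF fM, of 1 M a] by (intro form_gform) simp
   show "x j * sc (comb \<phi> M) a x 1 = dotp (%i. dotp (%k. -1 * A (M' j) a i k) x) (%i. pd i f (emb4 a x 0))" for j x
    unfolding dotp_scale_left using M'[of x j] by (simp add: sc0)
  qed (use e i0 form_grad_emb4[OF f] in auto)
  thus ?thesis by metis
 next
  case False
  hence "dotp (A M a i) x = 0" for i x by (simp add: dotp_zero_left)
  thus ?thesis by (intro exI[of _ "%i. M $ (i, 4)"]) (simp only: sc1, simp)
 qed
 have sub: "jker \<phi> 2 a \<subseteq> jker \<phi> (Suc 2) a" if a: "a \<in> S" for a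
 proof
  fix M assume M: "M \<in> jker \<phi> 2 a"
  have "(%x. sc (comb \<phi> M) a x 2) = zv"
  proof (rule no_cone_in_span[where F = "%i x. pd i f (emb4 a x 0)" and e = e and z = "int e - 1"])
   show "x = zv" if "\<And>i. pd i f (emb4 a x 0) = 0" for x using grad_emb4_nonzero[OF nz that] .
   show "gform (int e - 1) (%x. sc (comb \<phi> M) a x 2)" using gform_sc[OF fM, of 2 M a] by simp
   show "\<exists>w. \<forall>x. x j * sc (comb \<phi> M) a x 2 = dotp w (%i. pd i f (emb4 a x 0))" for j
   proof -
    obtain M' where M': "M' \<in> jker \<phi> 1 a" "\<And>x. x j * sc (comb \<phi> M) a x 2 = - sc (comb \<phi> M') a x 1 / 2"
     using deform[OF _ a M, of j] by auto
    obtain w where "\<And>x. sc (comb \<phi> M') a x 1 = dotp w (%i. pd i f (emb4 a x 0))" using alpha[OF a M'(1)] by blast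
    hence "x j * sc (comb \<phi> M) a x 2 = dotp (%i. (- 1 / 2) * w i) (%i. pd i f (emb4 a x 0))" for x
     unfolding dotp_scale_left using M'(2) by simp
    thus ?thesis by blast
   qed
  qed (use e form_grad_emb4[OF f] in auto)
  hence "sc (comb \<phi> M) a x 2 = 0" for x by metis
  thus "M \<in> jker \<phi> (Suc 2) a" unfolding jker_iff less_Suc_eq using M[unfolded jker_iff] by blast
 qed
 obtain a where a: "a \<in> S" using S(1) by blast
 have "N = (%_ _. 0)" if N: "\<And>x. dotp (%i. dotp (N i) x) (%i. pd i f (emb4 a x 0)) = 0" for N :: "4 \<Rightarrow> 3 cvec"
 proof -
  \<comment> \<open>The lifts of \<open>N\<close> to a 4 by 4 matrix differ in their last column
    \<open>w\<close>, which adds \<open>w\<close> paired with the gradient to the coefficient of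
    order one. By \<open>alpha\<close> this coefficient can thus be cancelled, and the lift gets
    into the kernel of 2-jets.\<close>
  define bld :: "4 cvec \<Rightarrow> complex^(4\<times>4)"
   where "bld w = (\<chi> p. if snd p = 4 then w (fst p) else N (fst p) (oi (snd p)) - w (fst p) * a (oi (snd p)))" for w
  have bld4: "bld w $ (i, 4) = w i" for w i by (simp add: bld_def)
  have Ab: "A (bld w) a = N" for w
  proof (intro ext)
   show "A (bld w) a i k = N i k" for i k
    using exhaust_3[of k] by (auto simp: A_def bld_def io_def oi_def)
  qed
  have b1: "bld w \<in> jker \<phi> 1 a" for w using N by (simp add: jker_iff sc0 Ab)
  obtain w where w: "\<And>x. sc (comb \<phi> (bld zv)) a x 1 = dotp w (%i. pd i f (emb4 a x 0))" using alpha[OF a b1] by blast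
  define M where "M = bld (%i. - 1 * w i)"
  have "sc (comb \<phi> M) a x 1 = 0" for x
  proof -
   have "sc (comb \<phi> M) a x 1 = (\<Sum>i\<in>UNIV. dotp (N i) x * sc (pd i f) a x 1) - dotp w (%i. pd i f (emb4 a x 0))"
    unfolding sc1 M_def bld4 Ab dotp_scale_left by simp
   moreover have "(\<Sum>i\<in>UNIV. dotp (N i) x * sc (pd i f) a x 1) = dotp w (%i. pd i f (emb4 a x 0))"
    using w[of x] unfolding sc1 bld4 Ab by (simp add: dotp_zero_left)
   ultimately show ?thesis by simp
  qed
  hence "M \<in> jker \<phi> 2 a" using b1[of "%i. - 1 * w i"] by (auto simp: jker_iff M_def less_Suc_eq numeral_2_eq_2)
  from jker_stable[of S 2, OF S(2) S(3) _ sub a this] have "comb \<phi> M y = 0" for y by simp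
  hence "dotp (mv (%i j. M $ (i, j)) y) (%i. pd i f y) = 0" for y by (simp add: cb)
  from no_linear_symmetry[OF f _ nz this] have "(%i j. M $ (i, j)) = (%_ _. 0)" using e by simp
  hence "M $ (i, j) = 0" for i j by metis
  hence "A M a i k = 0" for i k by (simp add: A_def)
  thus ?thesis by (simp add: M_def Ab fun_eq_iff)
 qed
 thus ?thesis by blast
qed

subsection \<open>Polynomials as functions\<close>

definition monomv :: "('v \<Rightarrow>\<^sub>0 nat) \<Rightarrow> 'v cfun" where
 "monomv m x = (\<Prod>v\<in>keys m. x v ^ lookup m v)"

definition mdeg :: "('v \<Rightarrow>\<^sub>0 nat) \<Rightarrow> nat" where
 "mdeg m = (\<Sum>v\<in>keys m. lookup m v)"

lemma monomv_superset: "finite K \<Longrightarrow> keys m \<subseteq> K \<Longrightarrow> monomv m x = (\<Prod>v\<in>K. x v ^ lookup m v)"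
 unfolding monomv_def by (rule prod.mono_neutral_left) (auto simp: in_keys_iff)

lemma monomv_add: "monomv (m + n) x = monomv m x * monomv n x"
proof -
 let ?K = "keys m \<union> keys n"
 show ?thesis
  using monomv_superset[of ?K "m + n" x] monomv_superset[of ?K m x] monomv_superset[of ?K n x] keys_add[of m n]
  by (simp add: lookup_add power_add prod.distrib)
qed

lemma mpoly_eval_superset:
 "finite K \<Longrightarrow> keys p \<subseteq> K \<Longrightarrow> mpoly_eval p x = (\<Sum>m\<in>K. lookup p m * monomv m x)"
 unfolding mpoly_eval_def monomv_def by (rule sum.mono_neutral_left) (auto simp: in_keys_iff)

lemma mpoly_eval_add: "mpoly_eval (p + q) x = mpoly_eval p x + mpoly_eval q x"
proof -
 let ?K = "keys p \<union> keys q"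
 show ?thesis
  using mpoly_eval_superset[of ?K "p + q" x] mpoly_eval_superset[of ?K p x] mpoly_eval_superset[of ?K q x] keys_add[of p q]
  by (simp add: lookup_add distrib_right sum.distrib)
qed

lemma mpoly_eval_0: "mpoly_eval 0 x = 0" by (simp add: mpoly_eval_def)

lemma mpoly_eval_single: "mpoly_eval (Poly_Mapping.single m c) x = c * monomv m x"
 by (simp add: mpoly_eval_def monomv_def)

lemma mpoly_eval_sum: "mpoly_eval (\<Sum>i\<in>I. p i) x = (\<Sum>i\<in>I. mpoly_eval (p i) x)"
 by (induction I rule: infinite_finite_induct) (simp_all add: mpoly_eval_0 mpoly_eval_add)

lemma mpoly_eval_1: "mpoly_eval 1 x = 1"
 using mpoly_eval_single[of 0 1 x] by (simp add: monomv_def)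

lemma sum_singles: "(\<Sum>m\<in>keys p. Poly_Mapping.single m (lookup p m)) = p"
 by (rule poly_mapping_eqI) (simp add: lookup_sum lookup_single when_def in_keys_iff)

lemma mpoly_eval_mult: "mpoly_eval (p * q) x = mpoly_eval p x * mpoly_eval q x" for p q :: "'v mpoly"
proof -
 have "mpoly_eval (p * q) x = mpoly_eval ((\<Sum>m\<in>keys p. Poly_Mapping.single m (lookup p m)) *
   (\<Sum>n\<in>keys q. Poly_Mapping.single n (lookup q n))) x"
  by (simp only: sum_singles)
 also have "\<dots> = (\<Sum>m\<in>keys p. \<Sum>n\<in>keys q.
   (lookup p m * monomv m x) * (lookup q n * monomv n x))"
  by (simp add: sum_product mpoly_eval_sum mult_single mpoly_eval_single monomv_add mult_ac)
 also have "\<dots> = mpoly_eval p x * mpoly_eval q x"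
  by (simp add: mpoly_eval_def monomv_def sum_product)
 finally show ?thesis .
qed

lemma mpoly_eval_prod: "mpoly_eval (\<Prod>i\<in>I. p i) x = (\<Prod>i\<in>I. mpoly_eval (p i) x)"
 by (induction I rule: infinite_finite_induct) (simp_all add: mpoly_eval_1 mpoly_eval_mult)

lemma mpoly_eval_power: "mpoly_eval (p ^ k) x = mpoly_eval p x ^ k"
 by (induction k) (simp_all add: mpoly_eval_1 mpoly_eval_mult)

text \<open>Matrices are families indexed by pairs, so that their entries can serve as the variables
  of forms.\<close>

definition ap :: "('v \<times> 'w::finite \<Rightarrow> complex) \<Rightarrow> 'w cvec \<Rightarrow> 'v cvec" where
 "ap z x = (%v. \<Sum>w\<in>UNIV. z (v, w) * x w)"

definition ent :: "complex^'w^'v \<Rightarrow> 'v \<times> 'w \<Rightarrow> complex" where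
 "ent A = (%k. A $ fst k $ snd k)"

lemma mpoly_eval_lin_subst: "mpoly_eval (lin_subst A p) y = mpoly_eval p (ap (ent A) y)"
proof -
 have "mpoly_eval (\<Sum>w\<in>UNIV. Poly_Mapping.single (Poly_Mapping.single w 1) (A $ v $ w)) y = ap (ent A) y v" for v
  by (simp add: mpoly_eval_sum mpoly_eval_single monomv_def ap_def ent_def)
 thus ?thesis
  by (simp add: lin_subst_def mpoly_subst_def mpoly_eval_sum mpoly_eval_mult mpoly_eval_prod mpoly_eval_power
    mpoly_eval_single monomv_def) (simp add: mpoly_eval_def)
qed

lemma form_monomv: "form (mdeg m) (monomv m)"
 unfolding mdeg_def monomv_def[abs_def]
proof (rule form_prod)
 show "form (lookup m v) (%x. x v ^ lookup m v)" for v
  using form_power[OF form_var, of "lookup m v" v] by simp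
qed

lemma form_mpoly_eval: "homogeneous n F \<Longrightarrow> form n (mpoly_eval F)"
 unfolding mpoly_eval_def[abs_def] monomv_def[symmetric] homogeneous_def mdeg_def[symmetric]
 by (intro form_sum form_scale) (metis form_monomv)

lemma mdeg_add_single: "mdeg (m + Poly_Mapping.single v 1) = Suc (mdeg m)"
proof -
 have *: "mdeg n = (\<Sum>w\<in>insert v (keys m). lookup n w)"
  if "keys n \<subseteq> insert v (keys m)" for n
  unfolding mdeg_def by (rule sum.mono_neutral_left) (use that in \<open>auto simp: in_keys_iff\<close>)
 have "keys (m + Poly_Mapping.single v 1) \<subseteq> insert v (keys m)"
  using keys_add[of m "Poly_Mapping.single v (1::nat)"] by auto
 from *[OF this] have "mdeg (m + Poly_Mapping.single v 1) =
   (\<Sum>w\<in>insert v (keys m). lookup m w + (if w = v then 1 else 0))"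
  by (simp add: lookup_add lookup_single when_def) (rule sum.cong, auto)
 also have "\<dots> = Suc (mdeg m)" by (subst *[of m]) (auto simp: sum.distrib)
 finally show ?thesis .
qed

lemma form_mpoly: "form n p \<Longrightarrow> \<exists>F. homogeneous n F \<and> mpoly_eval F = p"
proof (induction rule: form.induct)
 case (form_const c)
 show ?case
  by (rule exI[of _ "Poly_Mapping.single 0 c"])
   (auto simp: homogeneous_def mpoly_eval_single monomv_def fun_eq_iff)
next
 case (form_step n p v)
 then obtain F where F: "homogeneous n F" "mpoly_eval F = p" by blast
 define G where "G = (\<Sum>m\<in>keys F. Poly_Mapping.single (m + Poly_Mapping.single v 1) (lookup F m))"
 have "mpoly_eval G x = x v * p x" for x
 proof -
  have "monomv (Poly_Mapping.single v 1) x = x v" by (simp add: monomv_def)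
  hence "mpoly_eval G x = (\<Sum>m\<in>keys F. x v * (lookup F m * monomv m x))"
   by (simp only: G_def mpoly_eval_sum mpoly_eval_single monomv_add mult_ac)
  thus ?thesis by (simp only: F(2)[symmetric] mpoly_eval_def monomv_def sum_distrib_left)
 qed
 moreover have "homogeneous (Suc n) G"
  unfolding homogeneous_def mdeg_def[symmetric]
 proof
  fix m assume "m \<in> keys G"
  hence "m \<in> (\<Union>k\<in>keys F. {k + Poly_Mapping.single v 1})"
   using keys_sum[of "%m. Poly_Mapping.single (m + Poly_Mapping.single v 1) (lookup F m)" "keys F"]
   unfolding G_def by (force split: if_splits)
  thus "mdeg m = Suc n" using F(1) by (auto simp: mdeg_add_single homogeneous_def mdeg_def[symmetric] simp del: One_nat_def)
 qed
 ultimately show ?case by blast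
next
 case (form_add n p q)
 then obtain F G where "homogeneous n F" "mpoly_eval F = p" "homogeneous n G" "mpoly_eval G = q" by blast
 thus ?case
  by (intro exI[of _ "F + G"]) (use keys_add[of F G] in \<open>auto simp: homogeneous_def mpoly_eval_add fun_eq_iff\<close>)
qed

text \<open>The inverse of a Vandermonde matrix: \<open>u i j\<close> is the \<open>i\<close>-th
  coefficient of the Lagrange polynomial of the node \<open>j\<close> among
  \<open>0, ..., d\<close>.\<close>

lemma dual_points: "\<exists>u :: nat \<Rightarrow> nat cvec. \<forall>i\<le>d. \<forall>k\<le>d. (\<Sum>j\<le>d. u i j * of_nat j ^ k) = (if i = k then 1 else 0)"
proof -
 define L :: "nat \<Rightarrow> complex poly" where "L j = smult (inverse (\<Prod>k\<in>{..d} - {j}. of_nat j - of_nat k)) (\<Prod>k\<in>{..d} - {j}. [:- of_nat k, 1:])" for j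
 have degL: "degree (L j) \<le> d" if "j \<le> d" for j
 proof -
  have "degree (\<Prod>k\<in>{..d} - {j}. [:- of_nat k, 1::complex:]) \<le> (\<Sum>k\<in>{..d} - {j}. 1)"
   using degree_prod_sum_le[of "{..d} - {j}" "%k. [:- of_nat k, 1::complex:]"] by simp
  thus ?thesis using that by (simp add: L_def)
 qed
 have Lv: "poly (L j) (of_nat k) = (if j = k then 1 else 0)" if "k \<le> d" for j k
  using that by (auto simp: L_def poly_prod)
 have "(\<Sum>j\<le>d. coeff (L j) i * of_nat j ^ k) = (if i = k then 1 else 0)" if "i \<le> d" "k \<le> d" for i k
 proof -
  define q where "q = (\<Sum>j\<le>d. smult (of_nat j ^ k) (L j)) - monom 1 k"
  have "degree q \<le> d" unfolding q_def
   by (intro degree_diff_le degree_sum_le finite_atMost) (use degL that degree_monom_le[of "1::complex" k] in \<open>auto intro: order.trans[OF degree_smult_le]\<close>)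
  have "poly q (of_nat j) = 0" if "j \<le> d" for j
  proof -
   have "poly q (of_nat j) = (\<Sum>i\<le>d. if i = j then of_nat i ^ k else 0) - of_nat j ^ k"
    unfolding q_def by (simp add: poly_sum Lv[OF that] poly_monom if_distrib[of "%z. _ * z"] cong: if_cong)
   thus ?thesis using that by simp
  qed
  hence sub: "of_nat ` {..d} \<subseteq> {x. poly q x = 0}" by auto
  have "card (of_nat ` {..d} :: complex set) = Suc d" by (subst card_image) (auto simp: inj_on_def)
  hence "q = 0"
   using card_mono[OF poly_roots_finite sub] card_poly_roots_bound[of q] \<open>degree q \<le> d\<close> by linarith
  hence "coeff (\<Sum>j\<le>d. smult (of_nat j ^ k) (L j)) i = coeff (monom 1 k) i" by (simp add: q_def)
  thus ?thesis by (simp add: coeff_sum mult.commute if_distrib eq_commute)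
 qed
 thus ?thesis by (intro exI[of _ "%i j. coeff (L j) i"]) auto
qed

lemma lookup_le_mdeg: "lookup m v \<le> mdeg m"
 unfolding mdeg_def by (cases "v \<in> keys m") (auto intro: member_le_sum simp: in_keys_iff)

text \<open>Applying \<open>dual_points\<close> in each variable recovers a coefficient from the
  values on a grid. Weights and grid do not depend on \<open>g\<close>, so polynomials in the
  coefficients become polynomials in finitely many values.\<close>

lemma coeff_extract:
 fixes d :: nat
 shows "\<exists>u X. finite X \<and> (\<forall>g :: 'v::finite mpoly. (\<forall>m\<in>keys g. \<forall>v. lookup m v \<le> d) \<longrightarrow>
  (\<forall>m. (\<forall>v. lookup m v \<le> d) \<longrightarrow> lookup g m = (\<Sum>x\<in>X. u m x * mpoly_eval g x)))"
proof -
 obtain l :: "nat \<Rightarrow> nat cvec" where l: "\<And>i k. i \<le> d \<Longrightarrow> k \<le> d \<Longrightarrow> (\<Sum>j\<le>d. l i j * of_nat j ^ k) = (if i = k then 1 else 0)"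
  using dual_points[of d] by blast
 define Y :: "('v \<Rightarrow> nat) set" where "Y = (UNIV \<rightarrow>\<^sub>E {..d})"
 define x :: "('v \<Rightarrow> nat) \<Rightarrow> 'v cvec" where "x y = (%v. of_nat (y v))" for y
 have inj: "inj_on x Y" by (auto simp: inj_on_def x_def fun_eq_iff)
 define u where "u m z = (\<Prod>v\<in>UNIV. l (lookup m v) (inv_into Y x z v))" for m :: "'v \<Rightarrow>\<^sub>0 nat" and z
 have fin: "finite Y" unfolding Y_def by (intro finite_PiE) auto
 have "lookup g m = (\<Sum>x\<in>x ` Y. u m x * mpoly_eval g x)"
  if g: "\<And>m v. m \<in> keys g \<Longrightarrow> lookup m v \<le> d" and m: "\<And>v. lookup m v \<le> d" for g :: "'v mpoly" and m
 proof -
  have "(\<Sum>y\<in>Y. u m (x y) * monomv n (x y)) = (if n = m then 1 else 0)" if n: "n \<in> keys g" for n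
  proof -
   have "u m (x y) = (\<Prod>v\<in>UNIV. l (lookup m v) (y v))" if "y \<in> Y" for y
    unfolding u_def inv_into_f_f[OF inj that] ..
   hence "(\<Sum>y\<in>Y. u m (x y) * monomv n (x y)) = (\<Sum>y\<in>Y. \<Prod>v\<in>UNIV. l (lookup m v) (y v) * of_nat (y v) ^ lookup n v)"
    by (intro sum.cong) (simp_all add: monomv_superset[of UNIV n] prod.distrib, simp add: x_def)
   also have "\<dots> = (\<Prod>v\<in>UNIV. \<Sum>j\<le>d. l (lookup m v) j * of_nat j ^ lookup n v)"
    unfolding Y_def by (rule prod_sum_PiE[symmetric]) auto
   also have "\<dots> = (\<Prod>v\<in>UNIV. if lookup m v = lookup n v then 1 else 0)"
    by (intro prod.cong) (simp_all add: l m g[OF n])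
   also have "\<dots> = (if n = m then 1 else 0)"
   proof (cases "n = m")
    case False
    then obtain v where "lookup m v \<noteq> lookup n v" by (metis poly_mapping_eqI)
    hence "\<exists>v\<in>UNIV. (if lookup m v = lookup n v then 1 else 0::complex) = 0" by auto
    thus ?thesis using False by (simp add: prod_zero_iff)
   qed simp
   finally show ?thesis .
  qed
  hence "(\<Sum>n\<in>keys g. lookup g n * (\<Sum>y\<in>Y. u m (x y) * monomv n (x y))) =
    (\<Sum>n\<in>keys g. if n = m then lookup g m else 0)"
   by (intro sum.cong) auto
  also have "\<dots> = lookup g m" by (simp add: in_keys_iff)
  finally have "lookup g m = (\<Sum>n\<in>keys g. \<Sum>y\<in>Y. u m (x y) * (lookup g n * monomv n (x y)))"
   by (simp add: sum_distrib_left mult_ac)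
  also have "\<dots> = (\<Sum>y\<in>Y. u m (x y) * mpoly_eval g (x y))"
   by (subst sum.swap) (simp add: mpoly_eval_def monomv_def sum_distrib_left)
  finally show ?thesis by (simp add: sum.reindex[OF inj])
 qed
 thus ?thesis using fin by (intro exI[of _ u] exI[of _ "x ` Y"]) blast
qed

lemma mpoly_eval_inj:
 fixes p q :: "'v::finite mpoly"
 assumes "mpoly_eval p = mpoly_eval q" shows "p = q"
proof (rule poly_mapping_eqI)
 fix m
 define d where "d = (\<Sum>n\<in>insert m (keys p \<union> keys q). mdeg n)"
 have d: "lookup n v \<le> d" if "n \<in> insert m (keys p \<union> keys q)" for n v
  unfolding d_def using that by (intro order.trans[OF lookup_le_mdeg[of n v]] member_le_sum) auto
 obtain u X where "\<forall>g :: 'v mpoly. (\<forall>m\<in>keys g. \<forall>v. lookup m v \<le> d) \<longrightarrow>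
  (\<forall>m. (\<forall>v. lookup m v \<le> d) \<longrightarrow> lookup g m = (\<Sum>x\<in>X. u m x * mpoly_eval g x))"
  using coeff_extract[of d, where 'v = 'v] by blast
 hence "lookup p m = (\<Sum>x\<in>X. u m x * mpoly_eval p x)" "lookup q m = (\<Sum>x\<in>X. u m x * mpoly_eval q x)"
  using d by simp_all
 thus "lookup p m = lookup q m" using assms by simp
qed

lemma homogeneous_eval_iff:
 fixes F :: "'v::finite mpoly" shows "homogeneous n F \<longleftrightarrow> form n (mpoly_eval F)"
 using form_mpoly_eval form_mpoly mpoly_eval_inj by metis

lemma homogeneous_coeffs:
 fixes n :: nat
 shows "\<exists>u X. finite X \<and> (\<forall>(g :: 'v::finite mpoly) m. homogeneous n g \<longrightarrow> lookup g m = (\<Sum>x\<in>X. u m x * mpoly_eval g x))"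
proof -
 obtain u and X :: "'v cvec set" where u: "finite X" "\<forall>g :: 'v mpoly. (\<forall>m\<in>keys g. \<forall>v. lookup m v \<le> n) \<longrightarrow>
  (\<forall>m. (\<forall>v. lookup m v \<le> n) \<longrightarrow> lookup g m = (\<Sum>x\<in>X. u m x * mpoly_eval g x))"
  using coeff_extract[of n, where 'v = 'v] by blast
 define u' where "u' m x = (if mdeg m = n then u m x else 0)" for m x
 have "lookup g m = (\<Sum>x\<in>X. u' m x * mpoly_eval g x)" if g: "homogeneous n g" for g :: "'v mpoly" and m
 proof (cases "mdeg m = n")
  case True
  have "lookup k v \<le> n" if "k \<in> keys g" for k v
   using g that lookup_le_mdeg[of k v] by (simp add: homogeneous_def mdeg_def)
  moreover have "lookup m v \<le> n" for v using lookup_le_mdeg[of m v] True by simp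
  ultimately show ?thesis using u(2) True by (simp add: u'_def)
 next
  case False
  hence "m \<notin> keys g" using g by (auto simp: homogeneous_def mdeg_def)
  thus ?thesis using False by (simp add: in_keys_iff u'_def)
 qed
 thus ?thesis using u(1) by blast
qed

lemma mpoly_eval_partial: "mpoly_eval (mpoly_partial v p) x = pd v (mpoly_eval p) x" for p :: "'v::finite mpoly"
proof -
 have mu: "monomv m x = x v ^ lookup m v * (\<Prod>w\<in>UNIV - {v}. x w ^ lookup m w)" for m and x :: "'v cvec"
  unfolding monomv_superset[of UNIV m x, OF finite subset_UNIV] by (rule prod.remove) auto
 have pm: "pd v (monomv m) x = of_nat (lookup m v) * monomv (m - Poly_Mapping.single v 1) x" for m
 proof (rule pd_eqI)
  have "(\<Prod>w\<in>UNIV - {v}. x w ^ lookup (m - Poly_Mapping.single v 1) w) = (\<Prod>w\<in>UNIV - {v}. x w ^ lookup m w)"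
   by (intro prod.cong) (auto simp: lookup_minus lookup_single_not_eq)
  moreover have "(\<Prod>w\<in>UNIV - {v}. (x(v := t)) w ^ lookup m w) = (\<Prod>w\<in>UNIV - {v}. x w ^ lookup m w)" for t
   by (intro prod.cong) auto
  ultimately show "((%t. monomv m (x(v := t))) has_field_derivative of_nat (lookup m v) * monomv (m - Poly_Mapping.single v 1) x) (at (x v))"
   unfolding mu by (auto intro!: derivative_eq_intros simp: lookup_minus)
 qed
 have "pd v (mpoly_eval p) x = (\<Sum>m\<in>keys p. lookup p m * pd v (monomv m) x)"
  unfolding mpoly_eval_def[abs_def] monomv_def[symmetric]
  by (simp add: pd_sum polyf_mult polyf_const form_polyf[OF form_monomv] pd_scale)
 thus ?thesis
  by (simp add: mpoly_partial_def mpoly_eval_sum mpoly_eval_single pm mult_ac)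
qed

text \<open>By Euler's formula a form of positive degree vanishes wherever its gradient does, so no
  equation \<open>p x = 0\<close> appears.\<close>

definition smoothf :: "'v cfun \<Rightarrow> bool" where
 "smoothf p \<longleftrightarrow> (\<forall>x. (\<forall>i. pd i p x = 0) \<longrightarrow> x = zv)"

lemma smooth_form_iff:
 fixes F :: "'v::finite mpoly"
 assumes "homogeneous n F" "n \<ge> 1"
 shows "smooth_form F \<longleftrightarrow> smoothf (mpoly_eval F)"
proof -
 have "mpoly_eval F x = 0" if "\<And>i. pd i (mpoly_eval F) x = 0" for x
  using euler[OF form_mpoly_eval[OF assms(1)], of x] that assms(2) by (simp add: dotp_def)
 thus ?thesis unfolding smooth_form_def smoothf_def mpoly_eval_partial by blast
qed

subsection \<open>Algebraic dependence and independence\<close>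

text \<open>Powers of the distinguished variable \<open>None\<close> with coefficients in the
  others: the shape in which a relation shows one quantity to be algebraic over the rest.\<close>

lemma form_option_expand:
 fixes P :: "('q option \<Rightarrow> complex) \<Rightarrow> complex"
 assumes "form n P"
 shows "\<exists>R. (\<forall>i. gform (int n - int i) (R i)) \<and> (\<forall>z. P z = (\<Sum>i\<le>n. z None ^ i * R i (%q. z (Some q))))"
 using assms
proof (induction rule: form.induct)
 case (form_const c)
 show ?case
  by (rule exI[of _ "%i _. if i = 0 then c else 0"]) (auto simp: gform_zero gform_const)
next
 case (form_step n p v)
 then obtain R where R: "\<And>i. gform (int n - int i) (R i)" "\<And>z. p z = (\<Sum>i\<le>n. z None ^ i * R i (%q. z (Some q)))"
  by blast
 show ?case
 proof (cases v)
  case None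
  define R' where "R' = (%i. if i = 0 then zv else R (i - 1))"
  have "gform (int (Suc n) - int i) (R' i)" for i
   using R(1)[of "i - 1"] by (cases i) (auto simp: R'_def gform_zero)
  moreover have "z v * p z = (\<Sum>i\<le>Suc n. z None ^ i * R' i (%q. z (Some q)))" for z
   unfolding sum.atMost_Suc_shift by (simp add: R(2) R'_def None sum_distrib_left mult.assoc)
  ultimately show ?thesis by blast
 next
  case (Some q)
  have "gform (int (Suc n) - int i) (%y. y q * R i y)" for i
   by (rule gform_mult[OF gform_var R(1)]) simp
  moreover have "z v * p z = (\<Sum>i\<le>Suc n. z None ^ i * (z (Some q) * R i (%q. z (Some q))))" for z
   using gform_neg[OF R(1), of "Suc n"] by (simp add: R(2) Some sum_distrib_left mult_ac)
  ultimately show ?thesis by (intro exI[of _ "%i y. y q * R i y"]) blast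
 qed
next
 case (form_add n p q)
 then obtain R S where "\<And>i. gform (int n - int i) (R i)" "\<And>z. p z = (\<Sum>i\<le>n. z None ^ i * R i (%q. z (Some q)))"
  "\<And>i. gform (int n - int i) (S i)" "\<And>z. q z = (\<Sum>i\<le>n. z None ^ i * S i (%q. z (Some q)))" by blast
 thus ?case
  by (intro exI[of _ "%i y. R i y + S i y"]) (simp add: gform_add distrib_left sum.distrib)
qed

lemma card_monomial_box:
 "finite {m :: 'v::finite \<Rightarrow>\<^sub>0 nat. \<forall>v. lookup m v \<le> n}"
 "card {m :: 'v::finite \<Rightarrow>\<^sub>0 nat. \<forall>v. lookup m v \<le> n} = Suc n ^ CARD('v)"
proof -
 have "bij_betw lookup {m :: 'v \<Rightarrow>\<^sub>0 nat. \<forall>v. lookup m v \<le> n} (UNIV \<rightarrow>\<^sub>E {..n})"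
 proof (rule bij_betw_imageI)
  show "inj_on lookup {m :: 'v \<Rightarrow>\<^sub>0 nat. \<forall>v. lookup m v \<le> n}"
   by (auto simp: inj_on_def intro: poly_mapping_eqI)
  have "f \<in> lookup ` {m :: 'v \<Rightarrow>\<^sub>0 nat. \<forall>v. lookup m v \<le> n}" if "f \<in> UNIV \<rightarrow>\<^sub>E {..n}" for f
   by (rule image_eqI[of _ _ "Abs_poly_mapping f"]) (use that in \<open>auto simp: Pi_iff\<close>)
  thus "lookup ` {m :: 'v \<Rightarrow>\<^sub>0 nat. \<forall>v. lookup m v \<le> n} = UNIV \<rightarrow>\<^sub>E {..n}" by auto
 qed
 from bij_betw_same_card[OF this] bij_betw_finite[OF this]
 show "finite {m :: 'v \<Rightarrow>\<^sub>0 nat. \<forall>v. lookup m v \<le> n}"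
  "card {m :: 'v \<Rightarrow>\<^sub>0 nat. \<forall>v. lookup m v \<le> n} = Suc n ^ CARD('v)"
  by (simp_all add: card_PiE finite_PiE)
qed

text \<open>More forms than variables are dependent: the number of monomials of exponents at most \<open>n\<close> in
 them grows faster with \<open>n\<close> than the dimension of the space they lie in.\<close>

lemma algebraic_relation:
 fixes y :: "'q::finite \<Rightarrow> 'p::finite cfun"
 assumes y: "\<And>q. form D (y q)" and D: "D \<ge> 1" and card: "CARD('p) < CARD('q)"
 shows "\<exists>n R. form n R \<and> R \<noteq> zv \<and> (\<forall>x. R (%q. y q x) = 0)"
proof -
 \<comment> \<open>With \<open>n\<close> equal to the \<open>CARD('p)\<close>-th power of
   \<open>K\<close>, the set \<open>E\<close> has at most
   \<open>(K * Suc n) ^ CARD('p) = n * Suc n ^ CARD('p)\<close> elements, just below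
   \<open>Suc n ^ Suc CARD('p)\<close>.\<close>
 define K where "K = D * CARD('q) + 1"
 define n where "n = K ^ CARD('p)"
 define J where "J = {m :: 'q \<Rightarrow>\<^sub>0 nat. \<forall>v. lookup m v \<le> n}"
 define E where "E = {m :: 'p \<Rightarrow>\<^sub>0 nat. \<forall>v. lookup m v \<le> CARD('q) * (n * D)}"
 have fin: "finite J" "finite E" unfolding J_def E_def by (rule card_monomial_box)+
 have "card E < card J"
 proof -
  have "CARD('q) * (n * D) + 1 \<le> K * Suc n" by (simp add: K_def algebra_simps)
  hence "card E \<le> (K * Suc n) ^ CARD('p)" by (simp add: E_def card_monomial_box power_mono)
  also have "\<dots> = n * Suc n ^ CARD('p)" unfolding power_mult_distrib n_def[symmetric] ..
  also have "\<dots> < Suc n ^ Suc (CARD('p))" by simp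
  also have "\<dots> \<le> Suc n ^ CARD('q)" by (rule power_increasing) (use card in auto)
  finally show ?thesis by (simp add: J_def card_monomial_box)
 qed
 have "\<forall>m. \<exists>G. homogeneous (\<Sum>q\<in>UNIV. lookup m q * D) G \<and> mpoly_eval G = (%x. monomv m (%q. y q x))"
 proof
  fix m :: "'q \<Rightarrow>\<^sub>0 nat"
  have "form (\<Sum>q\<in>UNIV. lookup m q * D) (%x. monomv m (%q. y q x))"
   unfolding monomv_superset[of UNIV m, OF finite subset_UNIV] by (intro form_prod form_power y)
  thus "\<exists>G. homogeneous (\<Sum>q\<in>UNIV. lookup m q * D) G \<and> mpoly_eval G = (%x. monomv m (%q. y q x))"
   by (rule form_mpoly)
 qed
 from choice[OF this] obtain G where G: "\<And>m. homogeneous (\<Sum>q\<in>UNIV. lookup m q * D) (G m)"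
  "\<And>m. mpoly_eval (G m) = (%x. monomv m (%q. y q x))" by blast
 have GE: "keys (G m) \<subseteq> E" if "m \<in> J" for m
 proof
  fix k assume "k \<in> keys (G m)"
  hence "mdeg k = (\<Sum>q\<in>UNIV. lookup m q * D)" using G(1)[of m] by (simp add: homogeneous_def mdeg_def)
  also have "\<dots> \<le> CARD('q) * (n * D)"
   using sum_bounded_above[of UNIV "%q. lookup m q * D" "n * D"] that by (simp add: J_def)
  finally show "k \<in> E" using lookup_le_mdeg[of k] by (auto simp: E_def intro: order.trans)
 qed
 obtain c where c: "\<exists>m\<in>J. c m \<noteq> 0" "\<And>k. k \<in> E \<Longrightarrow> (\<Sum>m\<in>J. lookup (G m) k * c m) = 0"
  using homog_system[of E J "%k m. lookup (G m) k"] fin \<open>card E < card J\<close> by blast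
 define Q where "Q = (\<Sum>m\<in>J. Poly_Mapping.single m (c m))"
 have Q: "mpoly_eval Q z = (\<Sum>m\<in>J. c m * monomv m z)" for z
  by (simp add: Q_def mpoly_eval_sum mpoly_eval_single)
 have lQ: "lookup Q m = c m" if "m \<in> J" for m
  using that fin by (simp add: Q_def lookup_sum lookup_single when_def)
 have "Q \<noteq> 0" using c(1) lQ by (metis lookup_zero)
 hence Q0: "mpoly_eval Q \<noteq> zv" using mpoly_eval_inj[of Q 0] by (auto simp: mpoly_eval_0 fun_eq_iff)
 have Qy: "mpoly_eval Q (%q. y q x) = 0" for x
 proof -
  have "monomv m (%q. y q x) = (\<Sum>k\<in>E. lookup (G m) k * monomv k x)" if "m \<in> J" for m
   using fun_cong[OF G(2)[of m], of x] mpoly_eval_superset[OF fin(2) GE[OF that], of x] by simp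
  hence "mpoly_eval Q (%q. y q x) = (\<Sum>m\<in>J. \<Sum>k\<in>E. (lookup (G m) k * c m) * monomv k x)"
   by (simp add: Q sum_distrib_left mult_ac)
  also have "\<dots> = (\<Sum>k\<in>E. (\<Sum>m\<in>J. lookup (G m) k * c m) * monomv k x)"
   by (subst sum.swap) (simp add: sum_distrib_right)
  finally show ?thesis by (simp add: c(2))
 qed
 have "polyf (mpoly_eval Q)"
  unfolding Q[abs_def] by (intro polyf_sum polyf_mult polyf_const form_polyf[OF form_monomv])
 from polyf_decomp[OF this] obtain N P where P: "\<And>i. form i (P i)" "mpoly_eval Q = (%z. \<Sum>i\<le>N. P i z)" by blast
 \<comment> \<open>All \<open>y q\<close> have the same positive degree \<open>D\<close>, so scaling
   \<open>x\<close> by \<open>t\<close> separates the homogeneous components of the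
   relation.\<close>
 have Py: "P j (%q. y q x) = 0" if "j \<le> N" for j x
 proof -
  define U where "U = (\<Sum>i\<le>N. monom (P i (%q. y q x)) (D * i))"
  have "poly U t = 0" for t
  proof -
   have "poly U t = (\<Sum>i\<le>N. P i (%q. t ^ D * y q x))"
    by (simp add: U_def poly_sum poly_monom form_homog[OF P(1)] power_mult mult.commute[of _ "P _ _"])
   also have "\<dots> = mpoly_eval Q (%q. y q (%p. t * x p))" by (simp add: P(2) form_homog[OF y])
   finally show ?thesis by (simp add: Qy)
  qed
  hence "U = 0" using poly_all_0_iff_0 by blast
  hence "coeff U (D * j) = 0" by simp
  thus ?thesis using that D by (simp add: U_def coeff_sum)
 qed
 have "\<exists>i\<le>N. P i \<noteq> zv"
 proof (rule ccontr)
  assume "\<not> ?thesis"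
  hence "mpoly_eval Q z = 0" for z unfolding P(2) by (intro sum.neutral) auto
  thus False using Q0 by auto
 qed
 thus ?thesis using P(1) Py by blast
qed

text \<open>The matrix \<open>L\<close> is the identity at \<open>0\<close>, so a vector in its
  kernel is divisible by every power of the variable.\<close>

lemma unitriangular_zero:
 fixes U :: "'q::finite \<Rightarrow> complex poly"
 assumes "\<And>r. (\<Sum>q\<in>UNIV. U q * L r q) = 0" "\<And>r q. poly (L r q) 0 = (if q = r then 1 else 0)"
 shows "U q = 0"
proof -
 have "\<exists>V. \<forall>q. U q = monom 1 j * V q" for j
 proof (induction j)
  case (Suc j)
  then obtain V where V: "\<And>q. U q = monom 1 j * V q" by blast
  have "monom 1 j * (\<Sum>q\<in>UNIV. V q * L r q) = 0" for r
   using assms(1)[of r] by (simp add: V sum_distrib_left mult.assoc)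
  hence "(\<Sum>q\<in>UNIV. V q * L r q) = 0" for r by (simp add: monom_eq_0_iff)
  hence "poly (\<Sum>q\<in>UNIV. V q * L r q) 0 = 0" for r by simp
  hence "poly (V r) 0 = 0" for r
   by (simp add: poly_sum assms(2) if_distrib[of "%z. _ * z"] cong: if_cong)
  hence "\<forall>r. \<exists>W. V r = [:0, 1:] * W" by (metis dvdE neg_equal_0_iff_equal poly_eq_0_iff_dvd minus_zero)
  from choice[OF this] obtain W where W: "\<And>r. V r = [:0, 1:] * W r" by blast
  have "U q = monom 1 (Suc j) * W q" for q
   unfolding V W by (simp add: monom_Suc mult.assoc)
  thus ?case by blast
 qed (rule exI[of _ U], simp add: monom_0)
 from this[of "Suc (degree (U q))"] obtain V where V: "U q = monom 1 (Suc (degree (U q))) * V q" by blast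
 show ?thesis
 proof (rule ccontr)
  assume "U q \<noteq> 0"
  hence "V q \<noteq> 0" using V by auto
  hence "degree (U q) = Suc (degree (U q)) + degree (V q)"
   by (subst V, subst degree_mult_eq) (auto simp: degree_monom_eq monom_eq_0_iff)
  thus False by simp
 qed
qed

text \<open>The gradient of a relation \<open>P\<close>, evaluated at \<open>y\<close>, is annihilated by the Jacobian of \<open>y\<close>, so the
 partial derivatives of \<open>P\<close> are relations of smaller degree.\<close>

lemma algebraically_independent:
 fixes y :: "'q::finite \<Rightarrow> 'p::finite cfun"
 assumes y: "\<And>q. polyf (y q)"
  and N: "\<And>r q. dotp (N r) (%p. pd p (y q) A0) = (if q = r then 1 else 0)"
 shows "form n P \<Longrightarrow> (\<And>A. P (%q. y q A) = 0) \<Longrightarrow> P = zv"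
proof (induction n arbitrary: P)
 case 0
 thus ?case using form_0D[of P] by auto
next
 case (Suc n)
 have pP: "polyf P" by (rule form_polyf[OF Suc.prems(1)])
 have fp: "form n (pd q P)" for q by (rule form_pd[OF Suc.prems(1)])
 have ch: "(\<Sum>q\<in>UNIV. pd q P (%q. y q A) * pd p (y q) A) = 0" for p A
 proof -
  have "((%t. P (%q. y q (A(p := t)))) has_field_derivative dotp (%q. pd p (y q) A) (%q. pd q P (%q. y q (A(p := A p))))) (at (A p))"
   by (rule polyf_curve[OF polyf_pd[OF y] pP])
  moreover have "((%t. P (%q. y q (A(p := t)))) has_field_derivative 0) (at (A p))"
   by (simp add: Suc.prems(2))
  ultimately have "dotp (%q. pd p (y q) A) (%q. pd q P (%q. y q (A(p := A p)))) = 0" by (rule DERIV_unique)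
  thus ?thesis by (simp add: dotp_def mult.commute)
 qed
 \<comment> \<open>Restricted to the line from \<open>A0\<close> to \<open>A1\<close>, the Jacobian
   paired with the fixed directions \<open>N r\<close> is a polynomial matrix that is the identity
   at \<open>A0\<close>; so it annihilates no nonzero polynomial vector.\<close>
 have "pd q P (%q. y q A1) = 0" for q A1
 proof -
  have "\<forall>q. \<exists>U. \<forall>t. pd q P (%q. y q (%v. A0 v + t * (A1 v - A0 v))) = poly U t"
  proof
   show "\<exists>U. \<forall>t. pd q P (%q. y q (%v. A0 v + t * (A1 v - A0 v))) = poly U t" for q
    by (rule polyf_line) (rule polyf_compose[OF form_polyf[OF fp] y])
  qed
  from choice[OF this] obtain U where U: "\<And>q t. pd q P (%q. y q (%v. A0 v + t * (A1 v - A0 v))) = poly (U q) t" by blast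
  have "\<forall>r. \<exists>L. \<forall>q t. dotp (N r) (%p. pd p (y q) (%v. A0 v + t * (A1 v - A0 v))) = poly (L q) t"
  proof
   fix r
   have "\<forall>q. \<exists>L. \<forall>t. dotp (N r) (%p. pd p (y q) (%v. A0 v + t * (A1 v - A0 v))) = poly L t"
   proof
    show "\<exists>L. \<forall>t. dotp (N r) (%p. pd p (y q) (%v. A0 v + t * (A1 v - A0 v))) = poly L t" for q
     by (rule polyf_line[of "%A. dotp (N r) (%p. pd p (y q) A)"])
      (unfold dotp_def, intro polyf_sum polyf_mult polyf_const polyf_pd_polyf y)
   qed
   from choice[OF this] show "\<exists>L. \<forall>q t. dotp (N r) (%p. pd p (y q) (%v. A0 v + t * (A1 v - A0 v))) = poly (L q) t" by blast
  qed
  from choice[OF this] obtain L where L: "\<And>r q t. dotp (N r) (%p. pd p (y q) (%v. A0 v + t * (A1 v - A0 v))) = poly (L r q) t" by blast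
  have "U q = 0"
  proof (rule unitriangular_zero[of U L])
   show "poly (L r q) 0 = (if q = r then 1 else 0)" for r q using L[of r q 0] N by simp
   show "(\<Sum>q\<in>UNIV. U q * L r q) = 0" for r
   proof (rule poly_ext)
    fix t
    define A where "A = (%v. A0 v + t * (A1 v - A0 v))"
    have "poly (\<Sum>q\<in>UNIV. U q * L r q) t = (\<Sum>q\<in>UNIV. \<Sum>p\<in>UNIV. N r p * (pd q P (%q. y q A) * pd p (y q) A))"
     by (simp add: poly_sum U[symmetric] L[symmetric] A_def[symmetric] dotp_def sum_distrib_left mult_ac)
    also have "\<dots> = (\<Sum>p\<in>UNIV. N r p * (\<Sum>q\<in>UNIV. pd q P (%q. y q A) * pd p (y q) A))"
     by (subst sum.swap) (simp add: sum_distrib_left)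
    finally show "poly (\<Sum>q\<in>UNIV. U q * L r q) t = poly 0 t" by (simp add: ch)
   qed
  qed
  thus ?thesis using U[of q 1] by simp
 qed
 hence z: "pd q P = zv" for q using Suc.IH[OF fp] by blast
 have "of_nat (Suc n) * P x = 0" for x
  using euler[OF Suc.prems(1), of x] unfolding z by (simp add: dotp_zero_right)
 thus ?case by (intro ext) (simp del: of_nat_Suc)
qed

text \<open>The points are found one at a time: some nonzero combination of the \<open>g q\<close>
  vanishes at all earlier points, and any point where it does not vanish can be added.\<close>

lemma dual_evaluation_points:
 fixes g :: "'q::finite \<Rightarrow> 'x cvec"
 assumes "\<And>c. (\<And>x. (\<Sum>q\<in>UNIV. c q * g q x) = 0) \<Longrightarrow> c = zv"
 shows "\<exists>X K. \<forall>r s :: 'q. (\<Sum>q\<in>UNIV. K r q * g q (X s)) = (if s = r then 1 else 0)"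
proof -
 have "\<exists>X K. \<forall>r\<in>Q. \<forall>s\<in>Q. (\<Sum>q\<in>UNIV. K r q * g q (X s)) = (if s = r then 1 else 0)" if "finite Q" for Q :: "'q set"
  using that
 proof (induction Q)
  case (insert r0 Q)
  then obtain X K where XK: "\<And>r s. r \<in> Q \<Longrightarrow> s \<in> Q \<Longrightarrow> (\<Sum>q\<in>UNIV. K r q * g q (X s)) = (if s = r then 1 else 0)" by blast
  have "card Q < CARD('q)" using insert.hyps by (intro psubset_card_mono) auto
  then obtain c where c: "\<exists>q\<in>UNIV. c q \<noteq> 0" "\<And>s. s \<in> Q \<Longrightarrow> (\<Sum>q\<in>UNIV. g q (X s) * c q) = 0"
   using homog_system[of Q UNIV "%s q. g q (X s)"] insert.hyps by auto
  obtain x0 where x0: "(\<Sum>q\<in>UNIV. c q * g q x0) \<noteq> 0" using assms[of c] c(1) by blast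
  define h where "h = (\<Sum>q\<in>UNIV. c q * g q x0)"
  define X' where "X' = X(r0 := x0)"
  define C where "C = (%q. c q / h)"
  have CX: "(\<Sum>q\<in>UNIV. C q * g q (X' s)) = (if s = r0 then 1 else 0)" if "s \<in> insert r0 Q" for s
   using x0 c(2)[of s] that insert.hyps
   by (auto simp: C_def X'_def h_def[symmetric] sum_divide_distrib[symmetric] mult.commute)
  define K' where "K' = (%r. if r = r0 then C else (%q. K r q - (\<Sum>q\<in>UNIV. K r q * g q x0) * C q))"
  have "(\<Sum>q\<in>UNIV. K' r q * g q (X' s)) = (if s = r then 1 else 0)" if r: "r \<in> insert r0 Q" and s: "s \<in> insert r0 Q" for r s
  proof (cases "r = r0")
   case True
   thus ?thesis using CX[OF s] by (simp add: K'_def)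
  next
   case False
   have "(\<Sum>q\<in>UNIV. K' r q * g q (X' s)) = (\<Sum>q\<in>UNIV. K r q * g q (X' s)) - (\<Sum>q\<in>UNIV. K r q * g q x0) * (\<Sum>q\<in>UNIV. C q * g q (X' s))"
    using False by (simp add: K'_def left_diff_distrib sum_subtractf sum_distrib_left mult.assoc)
   thus ?thesis using CX[OF s] False r s XK[of r s] by (auto simp: X'_def)
  qed
  thus ?case by blast
 qed auto
 from this[OF finite[of UNIV]] show ?thesis unfolding ball_UNIV .
qed

subsection \<open>Smooth plane sections\<close>

lemma form_ap: "form n p \<Longrightarrow> form n (%x. p (ap z x))"
 unfolding ap_def
 by (rule form_compose_lin[where p = p and h = "%v x. \<Sum>w\<in>UNIV. z (v, w) * x w"]) (assumption, rule form_lin)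

lemma form_ap_entries: "form n p \<Longrightarrow> form n (%z. p (ap z x))"
 unfolding ap_def
 by (rule form_compose_lin[where p = p and h = "%v z. \<Sum>w\<in>UNIV. z (v, w) * x w"])
  (assumption, intro form_sum form_scale_right form_var)

lemma pd_ap:
 fixes p :: "'v::finite cfun"
 assumes "polyf p"
 shows "pd k (%x. p (ap z x)) x = (\<Sum>i\<in>UNIV. z (i, k) * pd i p (ap z x))"
proof (rule pd_eqI)
 have "((%t. ap z (x(k := t)) i) has_field_derivative z (i, k)) (at (x k))" for i
 proof -
  have "ap z (x(k := t)) i = z (i, k) * t + (\<Sum>w\<in>UNIV - {k}. z (i, w) * x w)" for t
   unfolding ap_def by (subst sum.remove[of _ k]) auto
  thus ?thesis by (auto intro!: derivative_eq_intros)
 qed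
 from polyf_curve[where z = "%i t. ap z (x(k := t)) i", OF this assms]
 show "((%t. p (ap z (x(k := t)))) has_field_derivative (\<Sum>i\<in>UNIV. z (i, k) * pd i p (ap z x))) (at (x k))"
  by (simp add: dotp_def)
qed

lemma pd_ap_entries:
 fixes p :: "'v::finite cfun"
 assumes "polyf p"
 shows "pd (i, k) (%z. p (ap z x)) z = x k * pd i p (ap z x)"
proof (rule pd_eqI)
 have "((%t. ap (z((i, k) := t)) x j) has_field_derivative (if j = i then x k else 0)) (at (z (i, k)))" for j
 proof -
  have "ap (z((i, k) := t)) x i = t * x k + (\<Sum>w\<in>UNIV - {k}. z (i, w) * x w)" for t
   unfolding ap_def by (subst sum.remove[of _ k]) auto
  moreover have "j \<noteq> i \<Longrightarrow> ap (z((i, k) := t)) x j = ap z x j" for t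
   unfolding ap_def by simp
  ultimately show ?thesis by (auto intro!: derivative_eq_intros)
 qed
 from polyf_curve[where z = "%j t. ap (z((i, k) := t)) x j", OF this assms]
 show "((%t. p (ap (z((i, k) := t)) x)) has_field_derivative x k * pd i p (ap z x)) (at (z (i, k)))"
  by (simp add: dotp_def if_distrib[of "%z. z * _"] cong: if_cong)
qed

definition ez :: "3 cvec \<Rightarrow> (4 \<times> 3) cvec" where
 "ez a = (%(i, k). emb4 a (unitv k) 0 i)"

lemma ap_ez: "ap (ez a) x = emb4 a x 0"
proof
 fix i :: 4
 show "ap (ez a) x i = emb4 a x 0 i"
  using exhaust_4[of i] by (auto simp: ap_def ez_def emb4_simps sum_3 unitv_def dotp_def)
qed

text \<open>The gradients at points of the surface satisfy an equation \<open>T = 0\<close>, as the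
  dual variety is not the whole dual space. A plane whose coefficient vector \<open>h\<close> has
  \<open>T h \<noteq> 0\<close> is nowhere tangent to the surface.\<close>

lemma generic_section_smooth:
 assumes f: "form (Suc e) f" and e: "e \<ge> 1" and sm: "smoothf f"
 shows "\<exists>z :: (4 \<times> 3) cvec. smoothf (%x. f (ap z x))"
proof -
 have pf: "polyf f" by (rule form_polyf[OF f])
 have f0: "f \<noteq> zv"
 proof
  assume "f = zv"
  hence "pd i f (unitv 1) = 0" for i using pd_const[of i 0] by simp
  hence "unitv 1 = (%_::4. 0)" using sm by (auto simp: smoothf_def)
  from fun_cong[OF this, of 1] show False by (simp add: unitv_def)
 qed
 \<comment> \<open>Five forms in four variables, brought to the common degree
   \<open>e * Suc e\<close>.\<close>
 define y where "y = (%q x. case q of None \<Rightarrow> f x ^ e | Some i \<Rightarrow> pd i f x ^ Suc e)"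
 have "form (e * Suc e) (y q)" for q
  using form_power[OF f, of e] form_power[OF form_pd[OF f], of "Suc e"]
  by (cases q) (simp_all add: y_def mult.commute del: mult_Suc mult_Suc_right power_Suc)
 from algebraic_relation[of "e * Suc e" y, OF this] obtain n R
  where R: "form n R" "R \<noteq> zv" "\<And>x. R (%q. y q x) = 0"
  using e by auto
 obtain Rs where Rs: "\<And>i. gform (int n - int i) (Rs i)" "\<And>z. R z = (\<Sum>i\<le>n. z None ^ i * Rs i (%q. z (Some q)))"
  using form_option_expand[OF R(1)] by blast
 \<comment> \<open>Cancelling the highest common power of \<open>f\<close> from the relation leaves
   one in which \<open>Rs j\<close> is the only term without \<open>f\<close>; it therefore vanishes
   on the surface.\<close>
 define j where "j = (LEAST i. Rs i \<noteq> zv)"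
 have ex: "\<exists>i. Rs i \<noteq> zv"
 proof (rule ccontr)
  assume "\<not> ?thesis"
  hence "R z = 0" for z unfolding Rs(2) by (intro sum.neutral) auto
  thus False using R(2) by auto
 qed
 have j: "Rs j \<noteq> zv" unfolding j_def using ex by (rule LeastI_ex)
 have j': "Rs i = zv" if "i < j" for i using not_less_Least[of i "%i. Rs i \<noteq> zv"] that j_def by blast
 have jn: "j \<le> n" using gform_neg[OF Rs(1), of j] j by force
 define g where "g = (%x i. pd i f x ^ Suc e)"
 have pg: "polyf (%x. Rs i (g x))" for i
  unfolding g_def by (rule polyf_compose[OF gform_polyf[OF Rs(1)]]) (intro polyf_power polyf_pd_polyf pf)
 have "(\<Sum>i\<in>{j..n}. f x ^ (e * (i - j)) * Rs i (g x)) = 0" for x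
 proof -
  define q2 where "q2 = (%x. \<Sum>i\<in>{j..n}. f x ^ (e * (i - j)) * Rs i (g x))"
  have "f x ^ (e * j) * q2 x = 0" for x
  proof -
   have "f x ^ (e * j) * q2 x = (\<Sum>i\<in>{j..n}. f x ^ (e * i) * Rs i (g x))"
    unfolding q2_def sum_distrib_left
    by (intro sum.cong) (simp_all add: mult.assoc[symmetric] power_add[symmetric] distrib_left[symmetric])
   also have "\<dots> = (\<Sum>i\<le>n. f x ^ (e * i) * Rs i (g x))"
    by (rule sum.mono_neutral_left) (auto simp: j' not_le)
   also have "\<dots> = R (%q. y q x)" unfolding Rs(2) by (simp add: y_def g_def power_mult)
   finally show ?thesis by (simp add: R(3))
  qed
  moreover have "polyf q2" unfolding q2_def by (intro polyf_sum polyf_mult polyf_power pf pg)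
  ultimately have "(\<forall>x. f x ^ (e * j) = 0) \<or> (\<forall>x. q2 x = 0)"
   by (intro polyf_no_zero_div polyf_power pf)
  moreover have "\<not> (\<forall>x. f x ^ (e * j) = 0)" using f0 by (auto simp: fun_eq_iff)
  ultimately show ?thesis unfolding q2_def by blast
 qed
 hence Rj: "Rs j (g x) = 0" if "f x = 0" for x
 proof -
  have "(\<Sum>i\<in>{j..n}. f x ^ (e * (i - j)) * Rs i (g x)) = (\<Sum>i\<in>{j}. f x ^ (e * (i - j)) * Rs i (g x))"
   by (rule sum.mono_neutral_right) (use jn that e in \<open>auto simp: power_0_left\<close>)
  thus ?thesis using \<open>(\<Sum>i\<in>{j..n}. f x ^ (e * (i - j)) * Rs i (g x)) = 0\<close> by simp
 qed
 have "form (n - j) (Rs j)" using Rs(1)[of j] jn by (intro form_gform) (simp add: of_nat_diff)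
 \<comment> \<open>The substitution undoes the powers taken in \<open>y\<close>, so that
   \<open>T\<close> is an equation for the gradient itself.\<close>
 define T where "T = (%u. Rs j (%i. u i ^ Suc e))"
 have T: "form ((n - j) * Suc e) T" unfolding T_def
  by (rule form_compose[OF \<open>form (n - j) (Rs j)\<close>]) (use form_power[OF form_var, of "Suc e"] in \<open>simp del: power_Suc\<close>)
 obtain v where v: "Rs j v \<noteq> 0" using j by auto
 have "\<forall>i. \<exists>u. u ^ Suc e = v i" using exists_complex_root[of "Suc e"] by (metis nat.distinct(1))
 then obtain u where "\<And>i. u i ^ Suc e = v i" by metis
 hence "T u \<noteq> 0" using v by (simp add: T_def del: power_Suc)
 hence "\<not> (\<forall>u. T u = 0)" by blast
 moreover have "\<not> (\<forall>u :: 4 cvec. u 4 = 0)" by (auto intro: exI[of _ "%_. 1"])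
 ultimately obtain u where u: "T u * u 4 \<noteq> 0"
  using polyf_no_zero_div[OF form_polyf[OF T] polyf_var, of 4] by blast
 \<comment> \<open>As \<open>u 4\<close> is nonzero, the plane with coefficients \<open>u\<close>
   has an equation \<open>y 4 = dotp a x\<close>; the vector \<open>h\<close> is \<open>u\<close>
   rescaled to fourth entry \<open>-1\<close>.\<close>
 define a where "a = (%k::3. - u (if k = 1 then 1 else if k = 2 then 2 else 3) / u 4)"
 define h where "h = (%i. (- 1 / u 4) * u i)"
 have Th: "T h \<noteq> 0" unfolding h_def form_homog[OF T] using u by simp
 have h: "h 1 = a 1" "h 2 = a 2" "h 3 = a 3" "h 4 = -1" using u by (simp_all add: h_def a_def)
 have "x = zv" if x: "\<And>k. pd k (%x. f (ap (ez a) x)) x = 0" for x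
 proof -
  define p where "p = ap (ez a) x"
  have "pd k (%x. f (ap (ez a) x)) x = (\<Sum>i\<in>UNIV. ez a (i, k) * pd i f p)" for k
   unfolding p_def by (rule pd_ap[OF pf])
  hence s: "(\<Sum>i\<in>UNIV. ez a (i, k) * pd i f p) = 0" for k using x by simp
  have "pd i f p = (- pd 4 f p) * h i" for i
   using exhaust_4[of i] s[of 1] s[of 2] s[of 3]
   by (auto simp: h sum_4 ez_def emb4_simps unitv_def dotp_def sum_3 eq_neg_iff_add_eq_0 mult.commute)
  hence d: "(%i. pd i f p) = (%i. (- pd 4 f p) * h i)" by blast
  have "of_nat (Suc e) * f p = 0" unfolding p_def
   using euler[OF form_ap[OF f], of x "ez a"] x by (simp add: dotp_zero_right)
  hence "f p = 0" by (simp del: of_nat_Suc)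
  from Rj[OF this] have "T (%i. pd i f p) = 0" by (simp add: T_def g_def)
  hence "(- pd 4 f p) ^ ((n - j) * Suc e) * T h = 0" unfolding d form_homog[OF T] .
  hence "pd 4 f p = 0" using Th by simp
  hence "pd i f p = 0" for i using fun_cong[OF d, of i] by simp
  hence "p = zv" using sm by (auto simp: smoothf_def)
  thus ?thesis unfolding p_def ap_ez by (rule emb4_zero)
 qed
 thus ?thesis unfolding smoothf_def by blast
qed

subsection \<open>The topology of the moduli space\<close>

definition principal :: "'v cvec set \<Rightarrow> 'v mpoly \<Rightarrow> 'v cvec set set" where
 "principal W F = {P \<in> proj W. \<forall>x\<in>P. mpoly_eval F x \<noteq> 0}"

lemma openin_principal: "homogeneous n F \<Longrightarrow> openin (zariski W) (principal W F)"
 unfolding zariski_def principal_def by (rule topology_generated_by_Basis) blast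

lemma mpoly_of_product:
 assumes "homogeneous m F" "homogeneous n G"
 shows "\<exists>H. homogeneous (m + n) H \<and> (\<forall>x. mpoly_eval H x = mpoly_eval F x * mpoly_eval G x)"
 using form_mpoly[OF form_mult[OF form_mpoly_eval[OF assms(1)] form_mpoly_eval[OF assms(2)]]] by auto

lemma zariski_basis:
 assumes "openin (zariski W) U" "P \<in> U"
 shows "\<exists>n F. homogeneous n F \<and> P \<in> principal W F \<and> principal W F \<subseteq> U"
proof -
 have "generate_topology_on {{P \<in> proj W. \<forall>x\<in>P. mpoly_eval F x \<noteq> 0} | F n. homogeneous n F} U"
  using assms(1) by (simp add: zariski_def openin_topology_generated_by_iff)
 thus ?thesis using assms(2)
 proof (induction U)
  case (Int U V)
  then obtain m F n G where F: "homogeneous m F" "P \<in> principal W F" "principal W F \<subseteq> U"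
   and G: "homogeneous n G" "P \<in> principal W G" "principal W G \<subseteq> V" by blast
  obtain H where "homogeneous (m + n) H" "\<And>x. mpoly_eval H x = mpoly_eval F x * mpoly_eval G x"
   using mpoly_of_product[OF F(1) G(1)] by blast
  moreover from this have "principal W H = principal W F \<inter> principal W G" by (auto simp: principal_def)
  ultimately show ?case using F G by (intro exI[of _ "m + n"] exI[of _ H]) auto
 next
  case (UN K)
  thus ?case by (meson Union_iff Union_upper order.trans)
 next
  case (Basis s)
  thus ?case unfolding principal_def by blast
 qed simp
qed

lemma topspace_zariski: "topspace (zariski W) = proj W"
proof -
 have "homogeneous 0 (Poly_Mapping.single 0 1 :: 'a mpoly)" by (simp add: homogeneous_def)
 moreover have "principal W (Poly_Mapping.single 0 1) = proj W"
  by (auto simp: principal_def mpoly_eval_1)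
 ultimately have "openin (zariski W) (proj W)" using openin_principal by metis
 hence "proj W \<subseteq> topspace (zariski W)" by (rule openin_subset)
 moreover have "topspace (zariski W) \<subseteq> proj W"
  using zariski_basis[OF openin_topspace] by (force simp: principal_def)
 ultimately show ?thesis by blast
qed

definition pol :: "'v cfun \<Rightarrow> 'v mpoly" where
 "pol g = (SOME F. mpoly_eval F = g)"

lemma pol_mpoly_eval: "pol (mpoly_eval F) = F" for F :: "'v::finite mpoly"
 unfolding pol_def by (rule some_equality) (auto intro: mpoly_eval_inj)

lemma mpoly_eval_pol: "form n g \<Longrightarrow> mpoly_eval (pol g) = g"
 unfolding pol_def using form_mpoly[of n g] by (metis (mono_tags, lifting) someI_ex)

lemma homogeneous_pol: "form n g \<Longrightarrow> homogeneous n (pol g)" for g :: "'v::finite cfun"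
 by (simp add: homogeneous_eval_iff mpoly_eval_pol)

lemma lookup_scaled:
 assumes "lookup G' = (%m. c * lookup G m)"
 shows "mpoly_eval G' x = c * mpoly_eval G x" and "homogeneous n G \<Longrightarrow> homogeneous n G'"
proof -
 have k: "keys G' \<subseteq> keys G" by (auto simp: in_keys_iff assms)
 show "mpoly_eval G' x = c * mpoly_eval G x"
  using mpoly_eval_superset[OF _ k, of x] by (simp add: assms mpoly_eval_def monomv_def sum_distrib_left mult.assoc)
 show "homogeneous n G \<Longrightarrow> homogeneous n G'" using k by (auto simp: homogeneous_def)
qed

lemma scaled_lookup:
 fixes G :: "'v::finite mpoly"
 assumes "homogeneous n G" "homogeneous n G'" "mpoly_eval G' = (%x. c * mpoly_eval G x)"
 shows "lookup G' = (%m. c * lookup G m)"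
proof -
 obtain u and X :: "'v cvec set" where u: "\<And>(g :: 'v mpoly) m. homogeneous n g \<Longrightarrow> lookup g m = (\<Sum>x\<in>X. u m x * mpoly_eval g x)"
  using homogeneous_coeffs[of n, where 'v = 'v] by blast
 show ?thesis by (rule ext) (simp add: u[OF assms(1)] u[OF assms(2)] assms(3) sum_distrib_left mult_ac)
qed

lemma in_curve_iff:
 assumes "form d g" "form d h"
 shows "lookup (pol h) \<in> curve (pol g) \<longleftrightarrow> (\<exists>c. c \<noteq> 0 \<and> h = (%x. c * g x))"
proof
 assume "lookup (pol h) \<in> curve (pol g)"
 then obtain c where "c \<noteq> 0" "lookup (pol h) = (%m. c * lookup (pol g) m)"
  by (auto simp: curve_def proj_pt_def)
 thus "\<exists>c. c \<noteq> 0 \<and> h = (%x. c * g x)"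
  using lookup_scaled(1)[of "pol h" c "pol g"] mpoly_eval_pol[OF assms(1)] mpoly_eval_pol[OF assms(2)] by auto
next
 assume "\<exists>c. c \<noteq> 0 \<and> h = (%x. c * g x)"
 then obtain c where c: "c \<noteq> 0" "h = (%x. c * g x)" by blast
 have "lookup (pol h) = (%m. c * lookup (pol g) m)"
  by (rule scaled_lookup[OF homogeneous_pol[OF assms(1)] homogeneous_pol[OF assms(2)]])
   (unfold mpoly_eval_pol[OF assms(1)] mpoly_eval_pol[OF assms(2)], rule c(2))
 thus "lookup (pol h) \<in> curve (pol g)" using c(1) by (auto simp: curve_def proj_pt_def)
qed

section \<open>Coordinate changes and orbits\<close>

definition inv_ap :: "('v::finite \<times> 'v \<Rightarrow> complex) \<Rightarrow> ('v \<times> 'v \<Rightarrow> complex) \<Rightarrow> bool" where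
 "inv_ap z w \<longleftrightarrow> (\<forall>x. ap z (ap w x) = x) \<and> (\<forall>x. ap w (ap z x) = x)"

lemma inv_apD: "inv_ap z w \<Longrightarrow> ap z (ap w x) = x" "inv_ap z w \<Longrightarrow> ap w (ap z x) = x"
 by (simp_all add: inv_ap_def)

lemma inv_ap_sym: "inv_ap z w \<Longrightarrow> inv_ap w z" by (simp add: inv_ap_def)

definition matr :: "('v::finite \<times> 'w::finite \<Rightarrow> complex) \<Rightarrow> complex^'w^'v" where
 "matr z = (\<chi> i k. z (i, k))"

lemma ent_matr: "ent (matr z) = z" by (simp add: ent_def matr_def fun_eq_iff)

lemma matrix_vector_ap: "A *v x = (\<chi> i. ap (ent A) (%k. x $ k) i)"
 by (simp add: vec_eq_iff matrix_vector_mult_def ap_def ent_def)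

lemma ap_comp: "ap z (ap w x) = ap (%(i, k). \<Sum>j\<in>UNIV. z (i, j) * w (j, k)) x"
proof
 fix i
 have "ap z (ap w x) i = (\<Sum>j\<in>UNIV. \<Sum>k\<in>UNIV. z (i, j) * w (j, k) * x k)"
  by (simp add: ap_def sum_distrib_left mult.assoc)
 also have "\<dots> = ap (%(i, k). \<Sum>j\<in>UNIV. z (i, j) * w (j, k)) x i"
  by (subst sum.swap) (simp add: ap_def sum_distrib_right)
 finally show "ap z (ap w x) i = ap (%(i, k). \<Sum>j\<in>UNIV. z (i, j) * w (j, k)) x i" .
qed

lemma inv_ap_comp:
 assumes "inv_ap z z'" "inv_ap w w'"
 shows "\<exists>u u'. inv_ap u u' \<and> (\<forall>x. ap z (ap w x) = ap u x)"
proof -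
 define u where "u = (%(i, k). \<Sum>j\<in>UNIV. z (i, j) * w (j, k))"
 define u' where "u' = (%(i, k). \<Sum>j\<in>UNIV. w' (i, j) * z' (j, k))"
 have "inv_ap u u'"
  unfolding inv_ap_def u_def u'_def ap_comp[symmetric] using inv_apD[OF assms(1)] inv_apD[OF assms(2)] by simp
 thus ?thesis unfolding u_def ap_comp by blast
qed

lemma ap_id: "ap (%(i, k). if i = k then 1 else 0) x = x"
 by (rule ext) (simp add: ap_def if_distrib[of "%z. z * _"] cong: if_cong)

lemma ap_scale: "ap (%k. c * z k) x = (%i. c * ap z x i)"
 by (simp add: ap_def sum_distrib_left mult.assoc)

lemma ap_scale_right: "ap z (%i. c * x i) = (%i. c * ap z x i)"
 by (simp add: ap_def sum_distrib_left mult_ac)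

lemma ap_zero: "ap z zv = zv" by (simp add: ap_def)

lemma ap_diff: "ap z (%i. x i - y i) = (%i. ap z x i - ap z y i)"
 by (simp add: ap_def right_diff_distrib sum_subtractf)

lemma ap_unitv: "ap z (unitv k) i = z (i, k)"
 by (simp add: ap_def unitv_def if_distrib[of "%z. _ * z"] cong: if_cong)

lemma inv_ap_id: "inv_ap (%(i, k). if i = k then 1 else 0) (%(i, k). if i = k then 1 else 0)"
 by (simp add: inv_ap_def ap_id)

lemma inv_ap_scale: "c \<noteq> 0 \<Longrightarrow> inv_ap z w \<Longrightarrow> inv_ap (%k. c * z k) (%k. (1 / c) * w k)"
 unfolding inv_ap_def ap_scale ap_scale_right by simp

lemma invertible_iff_inv_ap: "invertible A \<longleftrightarrow> (\<exists>w. inv_ap (ent A) w)"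
proof
 have a: "ap (ent A) (ap (ent B) x) = x" if "A ** B = mat 1" for A B :: "complex^'a^'a" and x
 proof -
  have "A *v (B *v (\<chi> i. x i)) = (\<chi> i. x i)" by (simp add: matrix_vector_mul_assoc that matrix_vector_mul_lid)
  thus ?thesis by (simp add: matrix_vector_ap vec_eq_iff fun_eq_iff)
 qed
 assume "invertible A"
 then obtain B where "A ** B = mat 1" "B ** A = mat 1"
  by (auto simp: invertible_def)
 thus "\<exists>w. inv_ap (ent A) w" using a by (intro exI[of _ "ent B"]) (simp add: inv_ap_def)
next
 assume "\<exists>w. inv_ap (ent A) w"
 then obtain w where w: "inv_ap (ent A) w" by blast
 have "A *v (matr w *v x) = x" "matr w *v (A *v x) = x" for x
  using inv_apD[OF w, of "%i. x $ i"] by (simp_all add: matrix_vector_ap ent_matr vec_eq_iff fun_eq_iff)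
 hence "(A ** matr w) *v x = mat 1 *v x" "(matr w ** A) *v x = mat 1 *v x" for x
  by (simp_all add: matrix_vector_mul_assoc[symmetric] matrix_vector_mul_lid)
 hence "A ** matr w = mat 1" "matr w ** A = mat 1"
  by (metis matrix_eq)+
 thus "invertible A" by (auto simp: invertible_def)
qed

definition orb :: "3 cfun \<Rightarrow> ((3 \<Rightarrow>\<^sub>0 nat) \<Rightarrow> complex) set set" where
 "orb g = pgl_orbit (curve (pol g))"

definition equivf :: "3 cfun \<Rightarrow> 3 cfun \<Rightarrow> bool" where
 "equivf g h \<longleftrightarrow> (\<exists>z w c. inv_ap z w \<and> c \<noteq> 0 \<and> h = (%x. c * g (ap z x)))"

lemma equivf_scale: "c \<noteq> 0 \<Longrightarrow> equivf g (%x. c * g x)"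
 unfolding equivf_def
 by (rule_tac x = "%(i, k). if i = k then 1 else 0" in exI, rule_tac x = "%(i, k). if i = k then 1 else 0" in exI, rule exI[of _ c])
  (simp add: inv_ap_id ap_id)

lemma equivf_refl: "equivf g g"
 using equivf_scale[of 1 g] by simp

lemma equivf_sym: assumes "equivf g h" shows "equivf h g"
proof -
 obtain z w c where z: "inv_ap z w" "c \<noteq> 0" "h = (%x. c * g (ap z x))" using assms by (auto simp: equivf_def)
 have "g = (%x. (1 / c) * h (ap w x))" using z(2) by (simp add: z(3) inv_apD[OF z(1)])
 moreover have "1 / c \<noteq> 0" using z(2) by simp
 ultimately show ?thesis unfolding equivf_def using inv_ap_sym[OF z(1)] by blast
qed

lemma equivf_trans: assumes "equivf g h" "equivf h k" shows "equivf g k"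
proof -
 obtain z w c where z: "inv_ap z w" "c \<noteq> 0" "h = (%x. c * g (ap z x))" using assms(1) by (auto simp: equivf_def)
 obtain z' w' c' where z': "inv_ap z' w'" "c' \<noteq> 0" "k = (%x. c' * h (ap z' x))" using assms(2) by (auto simp: equivf_def)
 obtain u u' where u: "inv_ap u u'" "\<And>x. ap z (ap z' x) = ap u x" using inv_ap_comp[OF z(1) z'(1)] by blast
 have "k = (%x. (c' * c) * g (ap u x))" by (simp add: z(3) z'(3) u(2) mult.assoc)
 moreover have "c' * c \<noteq> 0" using z(2) z'(2) by simp
 ultimately show ?thesis unfolding equivf_def using u(1) by blast
qed

lemma equivf_form: "equivf g h \<Longrightarrow> form d g \<Longrightarrow> form d h"
 unfolding equivf_def by (auto intro!: form_scale form_ap)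

lemma orb_image:
 assumes "form d g"
 shows "orb g = (%h. curve (pol h)) ` {h. equivf g h}"
proof (intro equalityI subsetI)
 fix C assume "C \<in> orb g"
 then obtain G A where G: "C = curve (lin_subst A G)" "lookup G \<in> curve (pol g)" "invertible A"
  by (auto simp: orb_def pgl_orbit_def)
 then obtain c where c: "c \<noteq> 0" "lookup G = (%m. c * lookup (pol g) m)"
  by (auto simp: curve_def proj_pt_def)
 define h where "h = mpoly_eval (lin_subst A G)"
 have "h = (%x. c * g (ap (ent A) x))"
  unfolding h_def by (simp add: mpoly_eval_lin_subst lookup_scaled(1)[OF c(2)] mpoly_eval_pol[OF assms] fun_eq_iff)
 hence "equivf g h" unfolding equivf_def using G(3) c(1) invertible_iff_inv_ap by blast
 moreover have "C = curve (pol h)" by (simp add: G(1) h_def pol_mpoly_eval)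
 ultimately show "C \<in> (%h. curve (pol h)) ` {h. equivf g h}" by blast
next
 fix C assume "C \<in> (%h. curve (pol h)) ` {h. equivf g h}"
 then obtain h where h: "equivf g h" "C = curve (pol h)" by blast
 then obtain z w c where z: "inv_ap z w" "c \<noteq> 0" "h = (%x. c * g (ap z x))" by (auto simp: equivf_def)
 define G where "G = pol (%x. c * g x)"
 have fG: "form d (%x. c * g x)" by (rule form_scale[OF assms])
 have "lookup G \<in> curve (pol g)" unfolding G_def in_curve_iff[OF assms fG] using z(2) by blast
 moreover have "h = mpoly_eval (lin_subst (matr z) G)"
  by (simp add: mpoly_eval_lin_subst G_def mpoly_eval_pol[OF fG] ent_matr z(3) fun_eq_iff)
 moreover from this have "C = curve (lin_subst (matr z) G)" by (simp add: h(2) pol_mpoly_eval)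
 moreover have "invertible (matr z)" using z(1) by (auto simp: invertible_iff_inv_ap ent_matr)
 ultimately show "C \<in> orb g" unfolding orb_def pgl_orbit_def by blast
qed

lemma orb_eq_iff:
 assumes "form d g" "form d h"
 shows "orb g = orb h \<longleftrightarrow> equivf g h"
proof
 assume "equivf g h"
 hence "equivf g k \<longleftrightarrow> equivf h k" for k using equivf_trans equivf_sym by blast
 thus "orb g = orb h" by (simp add: orb_image[OF assms(1)] orb_image[OF assms(2)])
next
 assume o: "orb g = orb h"
 have "curve (pol h) \<in> orb h" unfolding orb_image[OF assms(2)] using equivf_refl by blast
 then obtain k where k: "equivf g k" "curve (pol h) = curve (pol k)" unfolding o[symmetric] orb_image[OF assms(1)] by blast
 have fk: "form d k" by (rule equivf_form[OF k(1) assms(1)])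
 have "lookup (pol h) \<in> curve (pol h)" unfolding in_curve_iff[OF assms(2,2)] by (intro exI[of _ 1]) simp
 then obtain c where c: "c \<noteq> 0" "h = (%x. c * k x)" unfolding k(2) in_curve_iff[OF fk assms(2)] by blast
 hence "equivf k h" using equivf_scale[of c k] by simp
 thus "equivf g h" using k(1) equivf_trans by blast
qed

lemma smoothf_equivf:
 assumes "equivf g h" "smoothf g" "form d g" shows "smoothf h"
 unfolding smoothf_def
proof (intro allI impI)
 obtain z w c where z: "inv_ap z w" "c \<noteq> 0" "h = (%x. c * g (ap z x))" using assms(1) by (auto simp: equivf_def)
 fix x assume x: "\<forall>k. pd k h x = 0"
 have pg: "polyf g" by (rule form_polyf[OF assms(3)])
 have s: "(\<Sum>i\<in>UNIV. z (i, k) * pd i g (ap z x)) = 0" for k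
 proof -
  have "pd k h x = c * (\<Sum>i\<in>UNIV. z (i, k) * pd i g (ap z x))"
   unfolding z(3) pd_scale[OF form_polyf[OF form_ap[OF assms(3)]]] pd_ap[OF pg] ..
  thus ?thesis using x z(2) by simp
 qed
 have "pd j g (ap z x) = 0" for j
 proof -
  have "(\<Sum>k\<in>UNIV. w (k, j) * (\<Sum>i\<in>UNIV. z (i, k) * pd i g (ap z x))) = (\<Sum>i\<in>UNIV. pd i g (ap z x) * ap z (ap w (unitv j)) i)"
   unfolding ap_unitv[abs_def] ap_def[of z] sum_distrib_left by (subst sum.swap) (simp add: mult_ac)
  also have "\<dots> = pd j g (ap z x)"
   by (simp add: inv_apD[OF z(1)] unitv_def if_distrib[of "%z. _ * z"] cong: if_cong)
  finally show ?thesis by (simp add: s)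
 qed
 hence "ap z x = zv" using assms(2) by (auto simp: smoothf_def)
 thus "x = zv" using inv_apD(2)[OF z(1), of x] by (simp add: ap_zero)
qed

section \<open>Open sets of the moduli space\<close>

definition SC :: "nat \<Rightarrow> 3 cfun set" where
 "SC d = {g. form d g \<and> smoothf g}"

lemma smoothf_nonzero: "smoothf g \<Longrightarrow> g \<noteq> zv" for g :: "'v::finite cfun"
proof
 assume g: "smoothf g" "g = zv"
 have "pd i g (%_. 1) = 0" for i by (simp add: g(2) pd_const)
 hence "(%_::'v. 1::complex) = zv" using g(1) unfolding smoothf_def by blast
 thus False by (metis zero_neq_one)
qed

lemma smooth_curves_set:
 assumes "d \<ge> 1"
 shows "{curve g | g. homogeneous d g \<and> smooth_form g} = (%g. curve (pol g)) ` SC d" (is "?L = ?R")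
proof (intro equalityI subsetI)
 fix C assume "C \<in> ?L"
 then obtain g where g: "C = curve g" "homogeneous d g" "smooth_form g" by blast
 hence "mpoly_eval g \<in> SC d" using form_mpoly_eval smooth_form_iff[OF g(2) assms] by (simp add: SC_def)
 moreover have "C = curve (pol (mpoly_eval g))" by (simp add: g(1) pol_mpoly_eval)
 ultimately show "C \<in> ?R" by blast
next
 fix C assume "C \<in> ?R"
 then obtain g where g: "C = curve (pol g)" "form d g" "smoothf g" by (auto simp: SC_def)
 thus "C \<in> ?L" using homogeneous_pol[OF g(2)] smooth_form_iff[OF homogeneous_pol[OF g(2)] assms] mpoly_eval_pol[OF g(2)] by auto
qed

lemma curve_in_principal:
 assumes "homogeneous n F" "form d g" "g \<noteq> zv"
 shows "curve (pol g) \<in> principal (ternary_forms d) F \<longleftrightarrow> mpoly_eval F (lookup (pol g)) \<noteq> 0"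
proof -
 have "lookup (pol g) \<noteq> zv"
 proof
  assume "lookup (pol g) = zv"
  hence "pol g = 0" by (intro poly_mapping_eqI) simp
  hence "g = zv" using mpoly_eval_pol[OF assms(2)] by (simp add: mpoly_eval_0 fun_eq_iff)
  thus False using assms(3) by simp
 qed
 moreover have "lookup (pol g) \<in> ternary_forms d"
  using homogeneous_pol[OF assms(2)] by (auto simp: ternary_forms_def)
 ultimately have "curve (pol g) \<in> proj (ternary_forms d)" by (auto simp: proj_def curve_def)
 moreover have "(\<forall>x\<in>curve (pol g). mpoly_eval F x \<noteq> 0) \<longleftrightarrow> mpoly_eval F (lookup (pol g)) \<noteq> 0"
  using exI[of "%c. c \<noteq> (0::complex)" 1] by (auto simp: curve_def proj_pt_def form_homog[OF form_mpoly_eval[OF assms(1)]])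
 ultimately show ?thesis by (simp add: principal_def)
qed

lemma topspace_smooth_curves: "d \<ge> 1 \<Longrightarrow> topspace (smooth_curves d) = (%g. curve (pol g)) ` SC d"
proof -
 assume d: "d \<ge> 1"
 have "curve (pol g) \<in> proj (ternary_forms d)" if "g \<in> SC d" for g
  using curve_in_principal[of 0 "Poly_Mapping.single 0 1" d g] that smoothf_nonzero[of g]
  by (auto simp: SC_def principal_def homogeneous_def mpoly_eval_1)
 thus ?thesis
  unfolding smooth_curves_def topspace_subtopology topspace_zariski smooth_curves_set[OF d] by blast
qed

lemma topspace_moduli: "d \<ge> 1 \<Longrightarrow> topspace (moduli d) = orb ` SC d"
 unfolding moduli_def topspace_quotient_top by (simp add: topspace_smooth_curves image_image orb_def)

text \<open>Polynomial conditions on the coefficients of a form are the same as polynomial conditions on its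
 values at finitely many points: below, \<open>P\<close> is a form whose variables are the points of \<open>\<complex>\<^sup>3\<close>.\<close>

lemma moduli_openD:
 assumes d: "d \<ge> 1" and U: "openin (moduli d) U" and g0: "g0 \<in> SC d" "orb g0 \<in> U"
 shows "\<exists>n P. form n P \<and> P g0 \<noteq> 0 \<and> (\<forall>g\<in>SC d. P g \<noteq> 0 \<longrightarrow> orb g \<in> U)"
proof -
 define V where "V = {C \<in> topspace (smooth_curves d). pgl_orbit C \<in> U}"
 have "openin (smooth_curves d) V" using U by (simp add: moduli_def openin_quotient_top V_def)
 then obtain T where T: "openin (zariski (ternary_forms d)) T" "V = T \<inter> (%g. curve (pol g)) ` SC d"
  unfolding smooth_curves_def openin_subtopology smooth_curves_set[OF d] by blast
 have "curve (pol g0) \<in> V" using g0 by (simp add: V_def topspace_smooth_curves[OF d] orb_def)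
 then obtain n F where F: "homogeneous n F" "curve (pol g0) \<in> principal (ternary_forms d) F" "principal (ternary_forms d) F \<subseteq> T"
  using zariski_basis[OF T(1)] T(2) by blast
 obtain u X where u: "\<And>(g :: 3 mpoly) m. homogeneous d g \<Longrightarrow> lookup g m = (\<Sum>x\<in>X. u m x * mpoly_eval g x)"
  using homogeneous_coeffs[of d, where 'v = 3] by blast
 define P where "P = (%g. mpoly_eval F (%m. \<Sum>x\<in>X. u m x * g x))"
 have Pe: "P g = mpoly_eval F (lookup (pol g))" if "g \<in> SC d" for g
 proof -
  have "lookup (pol g) = (%m. \<Sum>x\<in>X. u m x * g x)"
   using that u[OF homogeneous_pol[of d g]] by (intro ext) (simp add: SC_def mpoly_eval_pol[of d g])
  thus ?thesis by (simp add: P_def)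
 qed
 have cp: "curve (pol g) \<in> principal (ternary_forms d) F \<longleftrightarrow> P g \<noteq> 0" if "g \<in> SC d" for g
  using curve_in_principal[OF F(1), of d g] smoothf_nonzero[of g] Pe[OF that] that by (simp add: SC_def)
 have "form n P" unfolding P_def
  by (rule form_compose_lin[where p = "mpoly_eval F", OF form_mpoly_eval[OF F(1)]]) (rule form_lin)
 moreover have "P g0 \<noteq> 0" using F(2) cp[OF g0(1)] by simp
 moreover have "orb g \<in> U" if "g \<in> SC d" "P g \<noteq> 0" for g
 proof -
  have "curve (pol g) \<in> V" using T(2) F(3) cp[OF that(1)] that by blast
  thus ?thesis by (simp add: V_def orb_def)
 qed
 ultimately show ?thesis by blast
qed

text \<open>The condition \<open>P g \<noteq> 0\<close> need not be invariant. Letting it range over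
  all coordinate changes makes the set saturated, and it remains a union of principal open
  sets.\<close>

lemma moduli_openI:
 assumes d: "d \<ge> 1" and P: "form n P"
 shows "openin (moduli d) (orb ` {g \<in> SC d. \<exists>z w. inv_ap z w \<and> P (%x. g (ap z x)) \<noteq> 0})" (is "openin _ (orb ` ?S)")
proof -
 define M where "M = {m :: 3 \<Rightarrow>\<^sub>0 nat. \<forall>v. lookup m v \<le> d}"
 have ev: "g x = (\<Sum>m\<in>M. lookup (pol g) m * monomv m x)" if "form d g" for g x
 proof -
  have "lookup m v \<le> d" if "m \<in> keys (pol g)" for m v
   using homogeneous_pol[OF \<open>form d g\<close>] lookup_le_mdeg[of m v] that by (simp add: homogeneous_def mdeg_def[symmetric])
  hence "keys (pol g) \<subseteq> M" by (auto simp: M_def)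
  hence "mpoly_eval (pol g) x = (\<Sum>m\<in>M. lookup (pol g) m * monomv m x)"
   by (intro mpoly_eval_superset) (simp_all add: M_def card_monomial_box)
  thus ?thesis by (simp add: mpoly_eval_pol[OF that])
 qed
 have "\<forall>z :: 3 \<times> 3 \<Rightarrow> complex. \<exists>F. homogeneous n F \<and> mpoly_eval F = (%c. P (%x. \<Sum>m\<in>M. monomv m (ap z x) * c m))"
 proof
  fix z :: "3 \<times> 3 \<Rightarrow> complex"
  show "\<exists>F. homogeneous n F \<and> mpoly_eval F = (%c. P (%x. \<Sum>m\<in>M. monomv m (ap z x) * c m))"
   by (rule form_mpoly) (rule form_compose_lin[where p = P, OF P], rule form_lin)
 qed
 from choice[OF this] obtain F where F: "\<And>z :: 3 \<times> 3 \<Rightarrow> complex. homogeneous n (F z)"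
  "\<And>z. mpoly_eval (F z) = (%c. P (%x. \<Sum>m\<in>M. monomv m (ap z x) * c m))" by blast
 have cF: "curve (pol g) \<in> principal (ternary_forms d) (F z) \<longleftrightarrow> P (%x. g (ap z x)) \<noteq> 0" if "g \<in> SC d" for g z
  using that curve_in_principal[OF F(1), of d g z] smoothf_nonzero[of g] ev[of g]
  by (simp add: SC_def F(2) mult.commute)
 define T where "T = (\<Union>z\<in>{z. \<exists>w. inv_ap z w}. principal (ternary_forms d) (F z))"
 have T: "openin (zariski (ternary_forms d)) T" unfolding T_def using openin_principal[OF F(1)] by (intro openin_Union) blast
 have sat: "g \<in> ?S" if g: "g \<in> SC d" and h: "h \<in> ?S" "orb g = orb h" for g h
 proof -
  obtain z w where z: "inv_ap z w" "P (%x. h (ap z x)) \<noteq> 0" using h by blast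
  have "equivf g h" using orb_eq_iff[of d g h] g h by (simp add: SC_def)
  then obtain z' w' c where z': "inv_ap z' w'" "c \<noteq> 0" "h = (%x. c * g (ap z' x))" by (auto simp: equivf_def)
  obtain u u' where u: "inv_ap u u'" "\<And>x. ap z' (ap z x) = ap u x" using inv_ap_comp[OF z'(1) z(1)] by blast
  have "P (%x. h (ap z x)) = c ^ n * P (%x. g (ap u x))" by (simp add: z'(3) u(2) form_homog[OF P])
  thus ?thesis using z(2) u(1) g by auto
 qed
 have "{C \<in> topspace (smooth_curves d). pgl_orbit C \<in> orb ` ?S} = T \<inter> (%g. curve (pol g)) ` SC d" (is "?L = ?R")
 proof (intro equalityI subsetI)
  fix C assume "C \<in> ?L"
  then obtain g where g: "g \<in> SC d" "C = curve (pol g)" and "pgl_orbit C \<in> orb ` ?S"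
   unfolding topspace_smooth_curves[OF d] by blast
  hence "orb g \<in> orb ` ?S" by (simp only: orb_def)
  then obtain h where h: "h \<in> ?S" "orb g = orb h" by (elim imageE)
  from sat[OF g(1) h] cF[OF g(1)] show "C \<in> ?R" using g(1,2) by (auto simp: T_def)
 next
  fix C assume "C \<in> ?R"
  then obtain g z w where "g \<in> SC d" "C = curve (pol g)" "inv_ap z w" "curve (pol g) \<in> principal (ternary_forms d) (F z)"
   by (auto simp: T_def)
  thus "C \<in> ?L" using cF[of g z] by (auto simp: topspace_smooth_curves[OF d] orb_def[symmetric])
 qed
 moreover have "orb ` ?S \<subseteq> pgl_orbit ` topspace (smooth_curves d)"
  by (auto simp: topspace_smooth_curves[OF d] orb_def)
 ultimately show ?thesis
  unfolding moduli_def openin_quotient_top smooth_curves_def openin_subtopology smooth_curves_set[OF d, symmetric]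
  using T by auto
qed

subsection \<open>Hyperplanes and their parametrizations\<close>

definition par :: "(4 \<times> 3) cvec \<Rightarrow> 4 cvec \<Rightarrow> bool" where
 "par z h \<longleftrightarrow> (\<forall>x. ap z x = zv \<longrightarrow> x = zv) \<and> (\<forall>y. dotp h y = 0 \<longleftrightarrow> (\<exists>x. y = ap z x))"

lemma par_inj: assumes "par z h" "ap z x = ap z y" shows "x = y"
proof -
 have "ap z (%i. x i - y i) = zv" by (simp add: ap_diff assms(2))
 hence "(%i. x i - y i) = zv" using assms(1) by (simp add: par_def)
 thus ?thesis by (simp add: fun_eq_iff)
qed

lemma par_mem: "par z h \<Longrightarrow> dotp h (ap z x) = 0" by (auto simp: par_def)

lemma par_ex: "par z h \<Longrightarrow> dotp h y = 0 \<Longrightarrow> \<exists>x. y = ap z x" by (auto simp: par_def)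

lemma parametrizes_iff: "parametrizes A (proj_pt h) \<longleftrightarrow> par (ent A) h"
proof -
 have "{x. \<forall>h'\<in>proj_pt h. (\<Sum>i\<in>UNIV. h' i * x $ i) = 0} = {x. dotp h (%i. x $ i) = 0}"
 proof (intro equalityI subsetI)
  fix x assume x: "x \<in> {x. \<forall>h'\<in>proj_pt h. (\<Sum>i\<in>UNIV. h' i * x $ i) = 0}"
  have "h \<in> proj_pt h" unfolding proj_pt_def by (auto intro: exI[of _ 1])
  thus "x \<in> {x. dotp h (%i. x $ i) = 0}" using x by (auto simp: dotp_def)
 next
  fix x assume "x \<in> {x. dotp h (%i. x $ i) = 0}"
  thus "x \<in> {x. \<forall>h'\<in>proj_pt h. (\<Sum>i\<in>UNIV. h' i * x $ i) = 0}"
   by (auto simp: proj_pt_def dotp_def mult.assoc sum_distrib_left[symmetric])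
 qed
 moreover have "inj ((*v) A) \<longleftrightarrow> (\<forall>x. ap (ent A) x = zv \<longrightarrow> x = zv)"
 proof
  assume i: "inj ((*v) A)"
  show "\<forall>x. ap (ent A) x = zv \<longrightarrow> x = zv"
  proof (intro allI impI)
   fix x assume "ap (ent A) x = zv"
   hence "A *v (\<chi> i. x i) = A *v 0" by (simp add: matrix_vector_ap ap_zero vec_eq_iff)
   hence "(\<chi> i. x i) = 0" using i by (simp add: inj_def)
   thus "x = zv" by (simp add: vec_eq_iff fun_eq_iff)
  qed
 next
  assume k: "\<forall>x. ap (ent A) x = zv \<longrightarrow> x = zv"
  show "inj ((*v) A)"
  proof (rule injI)
   fix x y assume "A *v x = A *v y"
   hence "ap (ent A) (%i. x $ i - y $ i) = zv" by (simp add: ap_diff matrix_vector_ap vec_eq_iff fun_eq_iff)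
   hence "(%i. x $ i - y $ i) = zv" using k by blast
   thus "x = y" by (simp add: vec_eq_iff fun_eq_iff)
  qed
 qed
 moreover have "range ((*v) A) = {x. dotp h (%i. x $ i) = 0} \<longleftrightarrow> (\<forall>y. dotp h y = 0 \<longleftrightarrow> (\<exists>x. y = ap (ent A) x))"
 proof -
  have r: "y \<in> range ((*v) A) \<longleftrightarrow> (\<exists>x. (%i. y $ i) = ap (ent A) x)" for y
  proof
   assume "y \<in> range ((*v) A)"
   thus "\<exists>x. (%i. y $ i) = ap (ent A) x" by (auto simp: matrix_vector_ap)
  next
   assume "\<exists>x. (%i. y $ i) = ap (ent A) x"
   then obtain x where "(%i. y $ i) = ap (ent A) x" by blast
   hence "y = A *v (\<chi> i. x i)" by (simp add: matrix_vector_ap vec_eq_iff fun_eq_iff)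
   thus "y \<in> range ((*v) A)" by blast
  qed
  have "(\<forall>y. dotp h y = 0 \<longleftrightarrow> (\<exists>x. y = ap (ent A) x)) \<longleftrightarrow> (\<forall>y :: complex^4. dotp h (%i. y $ i) = 0 \<longleftrightarrow> (\<exists>x. (%i. y $ i) = ap (ent A) x))"
   (is "?L \<longleftrightarrow> ?R")
  proof
   assume r: ?R
   show ?L
   proof
    fix y
    show "dotp h y = 0 \<longleftrightarrow> (\<exists>x. y = ap (ent A) x)" using spec[OF r, of "\<chi> i. y i"] by simp
   qed
  qed blast
  thus ?thesis using r by (auto simp: set_eq_iff)
 qed
 ultimately show ?thesis unfolding parametrizes_def par_def by simp
qed

lemma par_exists:
 assumes "h \<noteq> zv" shows "\<exists>z. par z h"
proof -
 obtain i0 where i0: "h i0 \<noteq> 0" using assms by auto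
 have "card (UNIV - {i0} :: 4 set) = 3" by simp
 then obtain r :: "3 \<Rightarrow> 4" where r: "bij_betw r UNIV (UNIV - {i0})"
  using finite_same_card_bij[of "UNIV :: 3 set" "UNIV - {i0}"] by auto
 define z where "z = (%(i, k). if i = r k then 1 else if i = i0 then - h (r k) / h i0 else 0)"
 have rk: "r k \<noteq> i0" "r k = r l \<longleftrightarrow> k = l" for k l
  using r by (auto simp: bij_betw_def inj_on_def)
 have zr: "ap z x (r l) = x l" for x l
  by (simp add: ap_def z_def rk if_distrib[of "%z. z * _"] cong: if_cong)
 have z0: "ap z x i0 = - (\<Sum>k\<in>UNIV. h (r k) * x k) / h i0" for x
  unfolding ap_def z_def using rk(1) by (simp add: sum_negf sum_divide_distrib eq_commute[of i0])
 have split: "dotp h y = h i0 * y i0 + (\<Sum>k\<in>UNIV. h (r k) * y (r k))" for y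
  unfolding dotp_def by (subst sum.remove[of _ i0]) (auto simp: sum.reindex_bij_betw[OF r, symmetric])
 have ker: "dotp h y = 0 \<longleftrightarrow> (\<exists>x. y = ap z x)" for y
 proof
  assume y: "dotp h y = 0"
  have "y i = ap z (%k. y (r k)) i" for i
  proof (cases "i = i0")
   case True
   have "h i0 * y i0 = - (\<Sum>k\<in>UNIV. h (r k) * y (r k))" using y split[of y] by (simp add: eq_neg_iff_add_eq_0)
   thus ?thesis using i0 by (simp add: True z0 field_simps)
  next
   case False
   then obtain k where "i = r k" using r by (auto simp: bij_betw_def)
   thus ?thesis by (simp add: zr)
  qed
  thus "\<exists>x. y = ap z x" by blast
 next
  assume "\<exists>x. y = ap z x"
  then obtain x where "y = ap z x" by blast
  thus "dotp h y = 0" using i0 by (simp add: split z0 zr)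
 qed
 have "x = zv" if "ap z x = zv" for x
  using that zr[of x] by (auto simp: fun_eq_iff)
 hence "par z h" using ker by (simp add: par_def)
 thus ?thesis by blast
qed

lemma par_exists_hyperplane:
 assumes inj: "\<And>x. ap z x = zv \<Longrightarrow> x = zv"
 shows "\<exists>h. h \<noteq> zv \<and> par z h"
proof -
 obtain h where h0: "\<exists>i\<in>UNIV. h i \<noteq> 0" and h: "\<And>k :: 3. (\<Sum>i\<in>UNIV. z (i, k) * h i) = 0"
  using homog_system[of "UNIV :: 3 set" "UNIV :: 4 set" "%k i. z (i, k)"] by auto
 obtain i0 where i0: "h i0 \<noteq> 0" using h0 by blast
 have im: "dotp h (ap z x) = 0" for x
 proof -
  have "dotp h (ap z x) = (\<Sum>k\<in>UNIV. x k * (\<Sum>i\<in>UNIV. z (i, k) * h i))"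
   unfolding dotp_def ap_def sum_distrib_left by (subst sum.swap) (simp add: mult_ac)
  thus ?thesis by (simp add: h)
 qed
 have "\<exists>x. y = ap z x" if y: "dotp h y = 0" for y
 proof -
  have c: "card (UNIV - {i0} :: 4 set) < card (UNIV :: 3 option set)" by simp
  obtain c where c0: "\<exists>k\<in>UNIV. c k \<noteq> 0"
   and c: "\<And>i. i \<noteq> i0 \<Longrightarrow> (\<Sum>k\<in>UNIV. (case k of None \<Rightarrow> y i | Some k \<Rightarrow> z (i, k)) * c k) = 0"
   using homog_system[OF _ _ c, of "%i k. case k of None \<Rightarrow> y i | Some k \<Rightarrow> z (i, k)"] by auto
  define v where "v = (%i. y i * c None + ap z (%k. c (Some k)) i)"
  have vi: "v i = 0" if "i \<noteq> i0" for i
  proof -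
   have "v i = (\<Sum>k\<in>UNIV. (case k of None \<Rightarrow> y i | Some k \<Rightarrow> z (i, k)) * c k)"
    by (simp add: v_def ap_def UNIV_option_conv sum.reindex)
   thus ?thesis using c[OF that] by simp
  qed
  have "dotp h v = c None * dotp h y + dotp h (ap z (%k. c (Some k)))"
   unfolding v_def dotp_add_right using dotp_scale_right[of h "c None" y] by (simp add: mult.commute)
  hence "dotp h v = 0" using y im by simp
  moreover have "dotp h v = h i0 * v i0"
   unfolding dotp_def by (subst sum.remove[of _ i0]) (auto simp: vi)
  ultimately have "v i0 = 0" using i0 by simp
  hence v: "y i * c None + ap z (%k. c (Some k)) i = 0" for i
   using vi[of i] by (cases "i = i0") (auto simp: v_def)
  have cN: "c None \<noteq> 0"
  proof
   assume n: "c None = 0"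
   hence "ap z (%k. c (Some k)) = zv" using v by auto
   hence "(%k. c (Some k)) = zv" by (rule inj)
   hence "c k = 0" for k using n by (cases k) (auto simp: fun_eq_iff)
   thus False using c0 by blast
  qed
  have "y = ap z (%k. (- 1 / c None) * c (Some k))"
   unfolding ap_scale_right using v cN by (intro ext) (simp add: field_simps eq_neg_iff_add_eq_0)
  thus ?thesis by blast
 qed
 hence "par z h" using im inj by (auto simp: par_def)
 thus ?thesis using i0 by (intro exI[of _ h]) auto
qed

lemma par_unique:
 assumes "par z h" "par z h'" "h \<noteq> zv" "h' \<noteq> zv"
 shows "proj_pt h = proj_pt h'"
proof -
 obtain i0 where i0: "h i0 \<noteq> 0" using assms(3) by auto
 have e: "h i0 * h' i = h i * h' i0" for i
 proof -
  define y where "y = (%j. h i0 * unitv i j - h i * unitv i0 j)"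
  have d: "dotp g y = h i0 * g i - h i * g i0" for g
  proof -
   have "dotp g y = h i0 * dotp (unitv i) g - h i * dotp (unitv i0) g"
    by (simp add: dotp_def y_def right_diff_distrib sum_subtractf sum_distrib_left mult_ac)
   thus ?thesis by (simp add: dotp_unitv)
  qed
  have "dotp h y = 0" by (simp add: d)
  hence "dotp h' y = 0" using assms(1,2) by (auto simp: par_def)
  thus ?thesis by (simp add: d)
 qed
 define c where "c = h' i0 / h i0"
 have h': "h' = (%i. c * h i)" using e i0 by (simp add: c_def fun_eq_iff field_simps)
 hence c0: "c \<noteq> 0" using assms(4) by auto
 show ?thesis
 proof (intro equalityI subsetI)
  fix x assume "x \<in> proj_pt h"
  then obtain b where "b \<noteq> 0" "x = (%v. b * h v)" by (auto simp: proj_pt_def)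
  thus "x \<in> proj_pt h'" unfolding proj_pt_def h' using c0 by (auto intro!: exI[of _ "b / c"])
 next
  fix x assume "x \<in> proj_pt h'"
  then obtain b where "b \<noteq> 0" "x = (%v. b * (c * h v))" by (auto simp: proj_pt_def h')
  thus "x \<in> proj_pt h" unfolding proj_pt_def using c0 by (auto intro!: exI[of _ "b * c"])
 qed
qed

lemma par_factor:
 assumes "par z h" "par z' h" shows "\<exists>w. \<forall>x. ap z' x = ap z (ap w x)"
proof -
 have "\<forall>k. \<exists>u. ap z' (unitv k) = ap z u" using par_ex[OF assms(1) par_mem[OF assms(2)]] by blast
 from choice[OF this] obtain u where u: "\<And>k. ap z' (unitv k) = ap z (u k)" by blast
 have "z' = (%(i, k). \<Sum>j\<in>UNIV. z (i, j) * u k j)"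
 proof (rule ext)
  fix p :: "4 \<times> 3"
  show "z' p = (%(i, k). \<Sum>j\<in>UNIV. z (i, j) * u k j) p"
   using fun_cong[OF u[of "snd p"], of "fst p"] unfolding ap_unitv by (cases p) (simp add: ap_def)
 qed
 hence "ap z' x = ap z (ap (%(j, k). u k j) x)" for x unfolding ap_comp by simp
 thus ?thesis by blast
qed

lemma par_equiv:
 assumes "par z h" "par z' h" shows "\<exists>w w'. inv_ap w w' \<and> (\<forall>x. ap z' x = ap z (ap w x))"
proof -
 obtain w where w: "\<And>x. ap z' x = ap z (ap w x)" using par_factor[OF assms] by blast
 obtain w' where w': "\<And>x. ap z x = ap z' (ap w' x)" using par_factor[OF assms(2,1)] by blast
 have "ap z (ap w (ap w' x)) = ap z x" "ap z' (ap w' (ap w x)) = ap z' x" for x using w w' by metis+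
 hence "inv_ap w w'" unfolding inv_ap_def using par_inj[OF assms(1)] par_inj[OF assms(2)] by blast
 thus ?thesis using w by blast
qed

lemma par_comp:
 assumes "par z h" "inv_ap w w'" "\<And>x. ap z' x = ap z (ap w x)" shows "par z' h"
 unfolding par_def
proof (intro conjI allI impI)
 fix x assume "ap z' x = zv"
 hence "ap w x = zv" using assms(1,3) by (simp add: par_def)
 thus "x = zv" using inv_apD(2)[OF assms(2), of x] by (simp add: ap_zero)
next
 fix y
 show "dotp h y = 0 \<longleftrightarrow> (\<exists>x. y = ap z' x)"
 proof
  assume "dotp h y = 0"
  then obtain x where "y = ap z x" using par_ex[OF assms(1)] by blast
  hence "y = ap z' (ap w' x)" by (simp add: assms(3) inv_apD[OF assms(2)])
  thus "\<exists>x. y = ap z' x" by blast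
 qed (auto simp: assms(3) par_mem[OF assms(1)])
qed

section \<open>Sections of a smooth surface\<close>

locale surface =
 fixes f :: "4 mpoly" and e :: nat
 assumes hom: "homogeneous (Suc e) f" and smooth: "smooth_form f" and e: "e \<ge> 1"
begin

definition sec :: "(4 \<times> 3) cvec \<Rightarrow> 3 cfun" where
 "sec z = (%x. mpoly_eval f (ap z x))"

lemma form_f: "form (Suc e) (mpoly_eval f)" by (rule form_mpoly_eval[OF hom])

lemma smoothf_f: "smoothf (mpoly_eval f)" using smooth_form_iff[OF hom] smooth by simp

lemma form_sec: "form (Suc e) (sec z)" unfolding sec_def by (rule form_ap[OF form_f])

lemma form_sec_entries: "form (Suc e) (%z. sec z x)" unfolding sec_def by (rule form_ap_entries[OF form_f])

lemma pd_sec: "pd k (sec z) x = (\<Sum>i\<in>UNIV. z (i, k) * pd i (mpoly_eval f) (ap z x))"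
 unfolding sec_def by (rule pd_ap[OF form_polyf[OF form_f]])

lemma SC_sec: "smoothf (sec z) \<Longrightarrow> sec z \<in> SC (Suc e)" by (simp add: SC_def form_sec)

lemma sec_equiv: assumes "par z h" "par z' h" shows "equivf (sec z) (sec z')"
proof -
 obtain w w' where w: "inv_ap w w'" "\<And>x. ap z' x = ap z (ap w x)" using par_equiv[OF assms] by blast
 have "inv_ap w w' \<and> (1 :: complex) \<noteq> 0 \<and> sec z' = (%x. 1 * sec z (ap w x))" by (simp add: sec_def w)
 thus ?thesis unfolding equivf_def by blast
qed

text \<open>Two parametrizations of a plane differ by a coordinate change, so any \<open>z\<close>
  may replace the matrix picked by \<open>SOME\<close> in \<open>plane_section\<close>.\<close>

lemma section_par:
 assumes "h \<noteq> zv" "par z h"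
 shows "\<Phi> f (proj_pt h) = orb (sec z)" "proj_pt h \<in> smooth_sections f \<longleftrightarrow> smoothf (sec z)"
proof -
 define A where "A = (SOME A. parametrizes A (proj_pt h))"
 have "parametrizes (matr z) (proj_pt h)" unfolding parametrizes_iff ent_matr by (rule assms(2))
 hence "parametrizes A (proj_pt h)" unfolding A_def by (rule someI)
 hence eq: "equivf (sec (ent A)) (sec z)" unfolding parametrizes_iff by (rule sec_equiv[OF _ assms(2)])
 have ps: "plane_section f (proj_pt h) = lin_subst A f" by (simp add: plane_section_def A_def)
 have ev: "mpoly_eval (lin_subst A f) = sec (ent A)" by (simp add: sec_def mpoly_eval_lin_subst fun_eq_iff)
 hence pol: "pol (sec (ent A)) = lin_subst A f" using pol_mpoly_eval by metis
 show "\<Phi> f (proj_pt h) = orb (sec z)"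
  using orb_eq_iff[OF form_sec form_sec, of "ent A" z] eq by (simp add: \<Phi>_def ps orb_def pol)
 have "homogeneous (Suc e) (lin_subst A f)" by (simp add: homogeneous_eval_iff ev form_sec)
 hence "smooth_form (plane_section f (proj_pt h)) \<longleftrightarrow> smoothf (sec (ent A))"
  using smooth_form_iff[of "Suc e" "lin_subst A f"] by (simp add: ps ev)
 also have "\<dots> \<longleftrightarrow> smoothf (sec z)"
  using smoothf_equivf[OF eq _ form_sec] smoothf_equivf[OF equivf_sym[OF eq] _ form_sec] by blast
 finally show "proj_pt h \<in> smooth_sections f \<longleftrightarrow> smoothf (sec z)"
  using assms(1) by (auto simp: smooth_sections_def topspace_zariski proj_def)
qed

lemma smooth_section_cases:
 assumes "H \<in> smooth_sections f"
 obtains z h where "h \<noteq> zv" "H = proj_pt h" "par z h" "smoothf (sec z)" "\<Phi> f H = orb (sec z)"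
proof -
 obtain h where h: "h \<noteq> zv" "H = proj_pt h"
  using assms by (auto simp: smooth_sections_def topspace_zariski proj_def)
 obtain z where z: "par z h" using par_exists[OF h(1)] by blast
 show thesis using that[OF h z] section_par[OF h(1) z] assms h(2) by simp
qed

text \<open>The gradient of \<open>f\<close> vanishes at the origin, so a nonzero kernel vector of
  \<open>z\<close> would be a singular point of \<open>sec z\<close>. Hence a smooth
  \<open>sec z\<close> always belongs to an actual plane.\<close>

lemma smooth_sec_inj:
 assumes "smoothf (sec z)" "ap z x = zv" shows "x = zv"
proof -
 have "pd i (mpoly_eval f) zv = 0" for i using form_at_0[OF form_pd[OF form_f]] e by simp
 hence "pd k (sec z) x = 0" for k by (simp add: pd_sec assms(2))
 thus ?thesis using assms(1) by (simp add: smoothf_def)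
qed

lemma smooth_section_exists:
 assumes "smoothf (sec z)"
 obtains h where "h \<noteq> zv" "par z h" "proj_pt h \<in> smooth_sections f" "\<Phi> f (proj_pt h) = orb (sec z)"
proof -
 obtain h where h: "h \<noteq> zv" "par z h"
  using par_exists_hyperplane[of z] smooth_sec_inj[OF assms] by blast
 thus thesis using that section_par[OF h] assms by blast
qed

lemma image_sections: "\<Phi> f ` smooth_sections f = {orb (sec z) | z. smoothf (sec z)}"
proof (intro equalityI subsetI)
 fix c assume "c \<in> \<Phi> f ` smooth_sections f"
 then obtain H where H: "c = \<Phi> f H" "H \<in> smooth_sections f" by blast
 from H(2) show "c \<in> {orb (sec z) | z. smoothf (sec z)}" by (rule smooth_section_cases) (auto simp: H(1))
next
 fix c assume "c \<in> {orb (sec z) | z. smoothf (sec z)}"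
 then obtain z where z: "c = orb (sec z)" "smoothf (sec z)" by blast
 from z(2) obtain h where h: "proj_pt h \<in> smooth_sections f" "\<Phi> f (proj_pt h) = orb (sec z)" by (rule smooth_section_exists)
 show "c \<in> \<Phi> f ` smooth_sections f" using imageI[OF h(1), of "\<Phi> f"] by (simp only: h(2) z(1))
qed

lemma topspace_im: "topspace (im_\<Phi> (Suc e) f) = {orb (sec z) | z. smoothf (sec z)}"
 unfolding im_\<Phi>_def topspace_subtopology image_sections using SC_sec by (auto simp: topspace_moduli)

end

context surface
begin

text \<open>Singular points of sections near \<open>z0\<close> would accumulate, on the unit sphere, at one of the
 section of \<open>z0\<close>.\<close>

lemma smooth_nbhd:
 assumes "smoothf (sec z0)"
 shows "\<exists>\<epsilon>>0. \<forall>z. (\<forall>k. norm (z k - z0 k) < \<epsilon>) \<longrightarrow> smoothf (sec z)"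
proof (rule ccontr)
 assume "\<not> ?thesis"
 hence "\<forall>n. \<exists>z. (\<forall>k. norm (z k - z0 k) < 1 / real (Suc n)) \<and> \<not> smoothf (sec z)"
  by (metis of_nat_0_less_iff zero_less_Suc zero_less_divide_1_iff)
 from choice[OF this] obtain z where z: "\<And>n k. norm (z n k - z0 k) < 1 / real (Suc n)" "\<And>n. \<not> smoothf (sec (z n))" by blast
 have "\<forall>n. \<exists>v :: complex^3. v \<in> sphere 0 1 \<and> (\<forall>k. pd k (sec (z n)) (%i. v $ i) = 0)"
 proof
  fix n
  obtain x where x: "\<And>k. pd k (sec (z n)) x = 0" "x \<noteq> zv" using z(2)[of n] by (auto simp: smoothf_def)
  define u :: "complex^3" where "u = (\<chi> i. x i)"
  have "u \<noteq> 0" using x(2) by (auto simp: u_def vec_eq_iff)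
  define v :: "complex^3" where "v = (\<chi> i. complex_of_real (1 / norm u) * x i)"
  have "v = (1 / norm u) *\<^sub>R u"
   by (simp only: v_def vec_eq_iff vector_scaleR_component vec_lambda_beta scaleR_conv_of_real[where 'a = complex]) (simp add: u_def)
  hence "v \<in> sphere 0 1" using \<open>u \<noteq> 0\<close> by simp
  moreover have "pd k (sec (z n)) (%i. v $ i) = 0" for k
   unfolding v_def vec_lambda_beta form_homog[OF form_pd[OF form_sec]] x(1) by simp
  ultimately show "\<exists>v :: complex^3. v \<in> sphere 0 1 \<and> (\<forall>k. pd k (sec (z n)) (%i. v $ i) = 0)" by blast
 qed
 from choice[OF this] obtain v :: "nat \<Rightarrow> complex^3" where v: "\<And>n. v n \<in> sphere 0 1" "\<And>n k. pd k (sec (z n)) (%i. v n $ i) = 0" by blast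
 obtain l r where l: "l \<in> sphere 0 1" "strict_mono r" "(v \<circ> r) \<longlonglongrightarrow> l"
  using compact_sphere[of "0 :: complex^3" 1] v(1) unfolding compact_def by metis
 have zl: "(%n. z (r n) k) \<longlonglongrightarrow> z0 k" for k
 proof -
  have "(%n. z n k - z0 k) \<longlonglongrightarrow> 0"
  proof (rule tendsto_norm_zero_cancel, rule tendsto_sandwich[OF _ _ tendsto_const])
   show "(%n. 1 / real (Suc n)) \<longlonglongrightarrow> 0" by (rule LIMSEQ_Suc[OF lim_1_over_n])
   show "\<forall>\<^sub>F n in sequentially. norm (z n k - z0 k) \<le> 1 / real (Suc n)" using z(1) less_imp_le by (intro always_eventually) blast
  qed simp
  hence "(%n. z n k) \<longlonglongrightarrow> z0 k" by (simp add: LIM_zero_iff)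
  from LIMSEQ_subseq_LIMSEQ[OF this l(2)] show ?thesis by (simp add: o_def)
 qed
 have vl: "(%n. v (r n) $ k) \<longlonglongrightarrow> l $ k" for k using tendsto_vec_nth[OF l(3)] by (simp add: o_def)
 have "pd k (sec z0) (%i. l $ i) = 0" for k
 proof -
  have "(%n. ap (z (r n)) (%i. v (r n) $ i) j) \<longlonglongrightarrow> ap z0 (%i. l $ i) j" for j
   unfolding ap_def by (intro tendsto_sum tendsto_mult zl vl)
  from polyf_tendsto[where x = "%n. ap (z (r n)) (%i. v (r n) $ i)", OF this polyf_pd_polyf[OF form_polyf[OF form_f]]]
  have "(%n. pd k (sec (z (r n))) (%i. v (r n) $ i)) \<longlonglongrightarrow> pd k (sec z0) (%i. l $ i)"
   unfolding pd_sec by (intro tendsto_sum tendsto_mult zl)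
  thus ?thesis using v(2) by (simp add: LIMSEQ_const_iff)
 qed
 hence "(%i. l $ i) = zv" using assms by (auto simp: smoothf_def)
 hence "l = 0" by (simp add: vec_eq_iff fun_eq_iff)
 thus False using l(1) by simp
qed

text \<open>The line from \<open>z0\<close> to \<open>z1\<close> meets the zeros of \<open>p\<close>
  in finitely many points, so it contains points arbitrarily close to \<open>z0\<close> off them,
  where smoothness persists.\<close>

lemma smooth_generic:
 assumes "smoothf (sec z0)" "polyf p" "p z1 \<noteq> 0"
 shows "\<exists>z. smoothf (sec z) \<and> p z \<noteq> 0"
proof -
 obtain \<epsilon> where \<epsilon>: "\<epsilon> > 0" "\<And>z. (\<And>k. norm (z k - z0 k) < \<epsilon>) \<Longrightarrow> smoothf (sec z)" using smooth_nbhd[OF assms(1)] by blast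
 obtain q where q: "\<And>t. p (%k. z0 k + t * (z1 k - z0 k)) = poly q t"
  using polyf_line[OF assms(2), of z0 "%k. z1 k - z0 k"] by blast
 have "poly q 1 \<noteq> 0" using q[of 1] assms(3) by simp
 hence fin: "finite {t. poly q t = 0}" by (intro poly_roots_finite) auto
 define B where "B = (\<Sum>k\<in>UNIV. norm (z1 k - z0 k)) + 1"
 have Bk: "norm (z1 k - z0 k) < B" for k
  using member_le_sum[of k UNIV "%k. norm (z1 k - z0 k)"] by (simp add: B_def)
 have B0: "B > 0" using Bk[of undefined] norm_ge_zero by (rule order.strict_trans1[rotated])
 define t where "t = (%n. complex_of_real (\<epsilon> / (B * real (Suc n))))"
 have "inj t" unfolding t_def using \<epsilon>(1) B0 by (auto simp: inj_def field_simps)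
 hence "\<not> range t \<subseteq> {t. poly q t = 0}" using fin finite_subset range_inj_infinite by blast
 then obtain n where n: "poly q (t n) \<noteq> 0" by blast
 have "norm (t n) * norm (z1 k - z0 k) < \<epsilon>" for k
 proof -
  have "norm (t n) = \<epsilon> / (B * real (Suc n))" unfolding t_def norm_of_real using \<epsilon>(1) B0 by simp
  also have "\<dots> \<le> \<epsilon> / B" using \<epsilon>(1) B0 by (intro divide_left_mono) auto
  finally have "norm (t n) \<le> \<epsilon> / B" .
  hence "norm (t n) * norm (z1 k - z0 k) \<le> \<epsilon> / B * norm (z1 k - z0 k)" by (rule mult_right_mono) simp
  also have "\<dots> < \<epsilon> / B * B" by (rule mult_strict_left_mono[OF Bk]) (use \<epsilon>(1) B0 in simp)
  finally show ?thesis using B0 by simp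
 qed
 hence "smoothf (sec (%k. z0 k + t n * (z1 k - z0 k)))" by (intro \<epsilon>(2)) (simp add: norm_mult)
 thus ?thesis using q[of "t n"] n by metis
qed

end

subsection \<open>Degree at least four\<close>

context surface
begin

text \<open>The form with index \<open>q\<close> in the hypothesis is the derivative of
  \<open>sec z x\<close> at \<open>ez a\<close> in the direction \<open>N q\<close>. Evaluation
  points dual to these forms give the values \<open>sec z (X q)\<close> a Jacobian of full
  rank.\<close>

lemma values_independent:
 fixes N :: "'q::finite \<Rightarrow> 4 \<Rightarrow> 3 cvec"
 assumes "\<And>c. (\<And>x. (\<Sum>q\<in>UNIV. c q * dotp (%i. dotp (N q i) x) (%i. pd i (mpoly_eval f) (emb4 a x 0))) = 0) \<Longrightarrow> c = zv"
 shows "\<exists>X K. (\<forall>r s :: 'q. (\<Sum>q\<in>UNIV. K r q * dotp (%i. dotp (N q i) (X s)) (%i. pd i (mpoly_eval f) (emb4 a (X s) 0))) = (if s = r then 1 else 0)) \<and>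
  (\<forall>n P. form n P \<longrightarrow> (\<forall>z. P (%q. sec z (X q)) = 0) \<longrightarrow> P = zv)"
proof -
 define g where "g = (%q x. dotp (%i. dotp (N q i) x) (%i. pd i (mpoly_eval f) (emb4 a x 0)))"
 obtain X K where XK: "\<And>r s :: 'q. (\<Sum>q\<in>UNIV. K r q * g q (X s)) = (if s = r then 1 else 0)"
  using dual_evaluation_points[of g] assms unfolding g_def by blast
 have pf: "polyf (mpoly_eval f)" by (rule form_polyf[OF form_f])
 define D where "D = (%r (p :: 4 \<times> 3). \<Sum>q\<in>UNIV. K r q * N q (fst p) (snd p))"
 have "P = zv" if P: "form n P" "\<And>z. P (%q. sec z (X q)) = 0" for n P
 proof (rule algebraically_independent[where y = "%q z. sec z (X q)" and N = D and ?A0.0 = "ez a" and n = n])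
  show "polyf (%z. sec z (X q))" for q by (rule form_polyf[OF form_sec_entries])
  show "dotp (D r) (%p. pd p (%z. sec z (X q)) (ez a)) = (if q = r then 1 else 0)" for r q
  proof -
   define G where "G = (%i. pd i (mpoly_eval f) (emb4 a (X q) 0))"
   have "pd p (%z. sec z (X q)) (ez a) = X q (snd p) * G (fst p)" for p
    using pd_ap_entries[OF pf, of "fst p" "snd p" "X q" "ez a"] by (simp add: sec_def ap_ez G_def)
   moreover have gX: "(\<Sum>p\<in>UNIV \<times> UNIV. N s (fst p) (snd p) * X q (snd p) * G (fst p)) = g s (X q)" for s
    unfolding g_def G_def dotp_def sum_distrib_right sum.cartesian_product by (simp add: split_beta)
   ultimately have "dotp (D r) (%p. pd p (%z. sec z (X q)) (ez a)) =
     (\<Sum>p\<in>UNIV \<times> UNIV. \<Sum>s\<in>UNIV. K r s * (N s (fst p) (snd p) * X q (snd p) * G (fst p)))"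
    by (simp add: dotp_def D_def sum_distrib_right mult.assoc)
   also have "\<dots> = (\<Sum>s\<in>UNIV. K r s * g s (X q))"
    unfolding gX[symmetric] sum_distrib_left by (rule sum.swap)
   finally show ?thesis by (simp add: XK)
  qed
 qed (rule P)+
 thus ?thesis using XK unfolding g_def by blast
qed

end

lemma polyf_prod_nonzero:
 assumes "finite I" "\<And>i. i \<in> I \<Longrightarrow> polyf (p i)" "\<And>i. i \<in> I \<Longrightarrow> \<exists>x. p i x \<noteq> 0"
 shows "\<exists>x. (\<Prod>i\<in>I. p i x) \<noteq> 0"
 using assms
proof (induction I)
 case (insert i I)
 have "\<exists>x. p i x * (\<Prod>i\<in>I. p i x) \<noteq> 0"
 proof (rule ccontr)
  assume "\<not> ?thesis"
  hence "\<And>x. p i x * (\<Prod>i\<in>I. p i x) = 0" by blast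
  moreover have "polyf (p i)" "polyf (%x. \<Prod>i\<in>I. p i x)" using insert.prems(1) by (auto intro: polyf_prod)
  ultimately have "(\<forall>x. p i x = 0) \<or> (\<forall>x. (\<Prod>i\<in>I. p i x) = 0)" by (intro polyf_no_zero_div)
  thus False using insert by blast
 qed
 thus ?case using insert.hyps by simp
qed simp

lemma finite_root_set:
 fixes q :: "complex poly"
 assumes "q \<noteq> 0" "d \<ge> 1" shows "finite {t. poly q (t ^ d) = 0}"
proof -
 have "pcompose q (monom 1 d) \<noteq> 0" using assms pcompose_eq_0[of q "monom 1 d"] by (auto simp: degree_monom_eq)
 hence "finite {t. poly (pcompose q (monom 1 d)) t = 0}" by (rule poly_roots_finite)
 thus ?thesis by (simp add: poly_pcompose poly_monom)
qed

context surface
begin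

text \<open>Since the values \<open>y\<close> of a section at twelve suitable points are algebraically independent, every
 entry of the parametrizing matrix is algebraic over them. Where the relations do not degenerate,
 the section determines its plane up to finitely many choices.\<close>

lemma generically_finite_if_no_syzygies:
 assumes a: "\<And>N :: 4 \<Rightarrow> 3 cvec. (\<And>x. dotp (%i. dotp (N i) x) (%i. pd i (mpoly_eval f) (emb4 a x 0)) = 0) \<Longrightarrow> N = (%_ _. 0)"
 shows "generically_finite (Suc e) f"
proof -
 define d where "d = Suc e"
 have d: "d \<ge> 1" by (simp add: d_def)
 define N :: "4 \<times> 3 \<Rightarrow> 4 \<Rightarrow> 3 cvec" where "N = (%q i k. if q = (i, k) then 1 else 0)"
 have ind: "c = zv"
  if c: "\<And>x. (\<Sum>q\<in>UNIV. c q * dotp (%i. dotp (N q i) x) (%i. pd i (mpoly_eval f) (emb4 a x 0))) = 0" for c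
 proof -
  have "(\<Sum>q\<in>UNIV. c q * dotp (%i. dotp (N q i) x) G) = dotp (%i. dotp (%k. c (i, k)) x) G" for x G
  proof -
   have "(\<Sum>q\<in>UNIV. c q * N q i k) = c (i, k)" for i k
    by (simp add: N_def if_distrib[of "%z. _ * z"] cong: if_cong)
   hence "dotp (%i. dotp (%k. c (i, k)) x) G = (\<Sum>i\<in>UNIV. \<Sum>k\<in>UNIV. \<Sum>q\<in>UNIV. c q * N q i k * x k * G i)"
    by (simp add: dotp_def sum_distrib_right[symmetric])
   also have "\<dots> = (\<Sum>i\<in>UNIV. \<Sum>q\<in>UNIV. \<Sum>k\<in>UNIV. c q * N q i k * x k * G i)"
    by (intro sum.cong refl sum.swap)
   also have "\<dots> = (\<Sum>q\<in>UNIV. \<Sum>i\<in>UNIV. \<Sum>k\<in>UNIV. c q * N q i k * x k * G i)" by (rule sum.swap)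
   also have "\<dots> = (\<Sum>q\<in>UNIV. c q * dotp (%i. dotp (N q i) x) G)"
    by (simp add: dotp_def sum_distrib_left sum_distrib_right mult.assoc)
   finally show ?thesis ..
  qed
  hence "(%i k. c (i, k)) = (%_ _. 0)" using c by (intro a) simp
  thus ?thesis by (metis surj_pair ext)
 qed
 obtain X :: "4 \<times> 3 \<Rightarrow> 3 cvec" where X: "\<And>n P. form n P \<Longrightarrow> (\<And>z. P (%q. sec z (X q)) = 0) \<Longrightarrow> P = zv"
  using values_independent[of N a, OF ind] by blast
 define y where "y = (%z q. sec z (X q))"
 have "\<forall>k. \<exists>P Q m. form m P \<and> (\<exists>\<eta>. P \<eta> \<noteq> 0) \<and> (\<forall>\<eta>. P \<eta> \<noteq> 0 \<longrightarrow> Q \<eta> \<noteq> 0) \<and> (\<forall>z. poly (Q (y z)) (z k ^ d) = 0)"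
 proof
  fix k :: "4 \<times> 3"
  \<comment> \<open>The entry is taken to the power \<open>d\<close>, so that it has the same degree
    in \<open>z\<close> as the values, as \<open>algebraic_relation\<close> requires.\<close>
  define w where "w = (%q (z :: (4 \<times> 3) cvec). case q of None \<Rightarrow> z k ^ d | Some q \<Rightarrow> y z q)"
  have "form d (w q)" for q
   using form_power[OF form_var, of d k] form_sec_entries by (cases q) (simp_all add: w_def y_def d_def)
  from algebraic_relation[of d w, OF this d] obtain n R where R: "form n R" "R \<noteq> zv" "\<And>z. R (%q. w q z) = 0"
   by auto
  obtain Rs where Rs: "\<And>i. gform (int n - int i) (Rs i)" "\<And>z. R z = (\<Sum>i\<le>n. z None ^ i * Rs i (%q. z (Some q)))"
   using form_option_expand[OF R(1)] by blast
  have "\<exists>j\<le>n. Rs j \<noteq> zv"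
  proof (rule ccontr)
   assume "\<not> ?thesis"
   hence "R z = 0" for z unfolding Rs(2) by (intro sum.neutral) auto
   thus False using R(2) by auto
  qed
  then obtain j where j: "j \<le> n" "Rs j \<noteq> zv" by blast
  define Q where "Q = (%\<eta>. \<Sum>i\<le>n. monom (Rs i \<eta>) i)"
  have "coeff (Q \<eta>) j = Rs j \<eta>" for \<eta> using j(1) by (simp add: Q_def coeff_sum)
  hence "\<forall>\<eta>. Rs j \<eta> \<noteq> 0 \<longrightarrow> Q \<eta> \<noteq> 0" by (metis coeff_0)
  moreover have "poly (Q (y z)) (z k ^ d) = 0" for z
  proof -
   have "poly (Q (y z)) (z k ^ d) = R (%q. w q z)"
    unfolding Rs(2) by (simp add: Q_def poly_sum poly_monom w_def mult.commute)
   thus ?thesis by (simp add: R(3))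
  qed
  moreover have "form (n - j) (Rs j)" using Rs(1)[of j] j(1) by (intro form_gform) (simp add: of_nat_diff)
  moreover have "\<exists>\<eta>. Rs j \<eta> \<noteq> 0" using j(2) by auto
  ultimately show "\<exists>P Q m. form m P \<and> (\<exists>\<eta>. P \<eta> \<noteq> 0) \<and> (\<forall>\<eta>. P \<eta> \<noteq> 0 \<longrightarrow> Q \<eta> \<noteq> 0) \<and> (\<forall>z. poly (Q (y z)) (z k ^ d) = 0)" by blast
 qed
 from choice[OF this] obtain P where P: "\<forall>k. \<exists>Q m. form m (P k) \<and> (\<exists>\<eta>. P k \<eta> \<noteq> 0) \<and> (\<forall>\<eta>. P k \<eta> \<noteq> 0 \<longrightarrow> Q \<eta> \<noteq> 0) \<and> (\<forall>z. poly (Q (y z)) (z k ^ d) = 0)" by blast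
 from choice[OF P] obtain Q where Q: "\<forall>k. \<exists>m. form m (P k) \<and> (\<exists>\<eta>. P k \<eta> \<noteq> 0) \<and> (\<forall>\<eta>. P k \<eta> \<noteq> 0 \<longrightarrow> Q k \<eta> \<noteq> 0) \<and> (\<forall>z. poly (Q k (y z)) (z k ^ d) = 0)" by blast
 from choice[OF Q] obtain m where mP: "\<And>k. form (m k) (P k)" and Pn: "\<And>k. \<exists>\<eta>. P k \<eta> \<noteq> 0"
  and PQ: "\<And>k \<eta>. P k \<eta> \<noteq> 0 \<Longrightarrow> Q k \<eta> \<noteq> 0" and Qy: "\<And>k z. poly (Q k (y z)) (z k ^ d) = 0" by blast
 define G where "G = (%\<eta>. \<Prod>k\<in>UNIV. P k \<eta>)"
 have G: "form (\<Sum>k\<in>UNIV. m k) G" unfolding G_def by (intro form_prod mP)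
 obtain \<eta>0 where "G \<eta>0 \<noteq> 0"
  using polyf_prod_nonzero[of UNIV P] form_polyf[OF mP] Pn unfolding G_def by auto
 \<comment> \<open>Algebraic independence: a nonzero form in the values does not vanish for all
   matrices.\<close>
 then obtain z1 where z1: "G (y z1) \<noteq> 0" using X[OF G] unfolding y_def by auto
 define G' where "G' = (%g :: 3 cfun. G (%q. g (X q)))"
 have G': "form (\<Sum>k\<in>UNIV. m k) G'" unfolding G'_def
  by (rule form_compose_lin[where p = G, OF G]) (rule form_var)
 define V0 where "V0 = orb ` {g \<in> SC d. \<exists>u w. inv_ap u w \<and> G' (%x. g (ap u x)) \<noteq> 0}"
 have V0: "openin (moduli d) V0" unfolding V0_def by (rule moduli_openI[OF d G'])
 define V where "V = V0 \<inter> \<Phi> f ` smooth_sections f"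
 have oV: "openin (im_\<Phi> d f) V" unfolding im_\<Phi>_def V_def using V0 by (auto simp: openin_subtopology)
 have ts: "topspace (im_\<Phi> d f) = \<Phi> f ` smooth_sections f" unfolding d_def topspace_im image_sections ..
 have "im_\<Phi> d f closure_of V = topspace (im_\<Phi> d f)"
  unfolding dense_intersects_open
 proof (intro allI impI)
  fix T assume T: "openin (im_\<Phi> d f) T \<and> T \<noteq> {}"
  then obtain U where U: "openin (moduli d) U" "T = U \<inter> \<Phi> f ` smooth_sections f"
   by (auto simp: im_\<Phi>_def openin_subtopology)
  obtain c0 where "c0 \<in> T" using T by blast
  then obtain z0 where z0: "smoothf (sec z0)" "orb (sec z0) \<in> U" using U(2) by (auto simp: image_sections)
  obtain n p where p: "form n p" "p (sec z0) \<noteq> 0" "\<And>g. g \<in> SC d \<Longrightarrow> p g \<noteq> 0 \<Longrightarrow> orb g \<in> U"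
   using moduli_openD[OF d U(1) _ z0(2)] SC_sec[OF z0(1)] unfolding d_def by blast
  have pp: "polyf (%z. p (sec z))" by (rule polyf_compose[OF form_polyf[OF p(1)]]) (rule form_polyf[OF form_sec_entries])
  have pG: "polyf (%z. G (y z))" unfolding y_def
   by (rule polyf_compose[OF form_polyf[OF G]]) (rule form_polyf[OF form_sec_entries])
  \<comment> \<open>Membership in the open set and nondegeneracy are both polynomial conditions on
    the matrix, so they hold together for some matrix, and then also for one with smooth
    section.\<close>
  obtain z2 where z2: "p (sec z2) * G (y z2) \<noteq> 0" using polyf_no_zero_div[OF pp pG] p(2) z1 by blast
  obtain z where z: "smoothf (sec z)" "p (sec z) * G (y z) \<noteq> 0"
   using smooth_generic[OF z0(1) polyf_mult[OF pp pG] z2] by blast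
  have s: "sec z \<in> SC d" using SC_sec[OF z(1)] by (simp add: d_def)
  have "orb (sec z) \<in> U" using p(3)[OF s] z(2) by simp
  moreover have "orb (sec z) \<in> V0"
  proof -
   have "G' (%x. sec z (ap (%(i, k). if i = k then 1 else 0) x)) \<noteq> 0" using z(2) by (simp add: ap_id G'_def y_def)
   thus ?thesis unfolding V0_def using s inv_ap_id by blast
  qed
  moreover have "orb (sec z) \<in> \<Phi> f ` smooth_sections f" unfolding image_sections using z(1) by blast
  ultimately show "V \<inter> T \<noteq> {}" unfolding U(2) V_def by blast
 qed
 moreover have "finite {H \<in> smooth_sections f. \<Phi> f H = c}" if c: "c \<in> V" for c
 proof -
  obtain g u w where g: "g \<in> SC d" "c = orb g" "inv_ap u w" "G' (%x. g (ap u x)) \<noteq> 0"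
   using c by (auto simp: V_def V0_def)
  define g1 where "g1 = (%x. g (ap u x))"
  define \<eta> where "\<eta> = (%q. g1 (X q))"
  have fg: "form d g" using g(1) by (simp add: SC_def)
  have fg1: "form d g1" unfolding g1_def by (rule form_ap[OF fg])
  have "equivf g g1"
  proof -
   have "inv_ap u w \<and> (1 :: complex) \<noteq> 0 \<and> g1 = (%x. 1 * g (ap u x))" using g(3) by (simp add: g1_def)
   thus ?thesis unfolding equivf_def by blast
  qed
  hence c1: "c = orb g1" using orb_eq_iff[OF fg fg1] g(2) by simp
  have Pk: "P k \<eta> \<noteq> 0" for k
  proof
   assume "P k \<eta> = 0"
   hence "G \<eta> = 0" unfolding G_def by (intro prod_zero[OF finite] bexI[of _ k]) auto
   thus False using g(4) by (simp add: G'_def \<eta>_def g1_def)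
  qed
  define Z where "Z = {z :: (4 \<times> 3) cvec. \<forall>k. z k \<in> {t. poly (Q k \<eta>) (t ^ d) = 0}}"
  have "Z = (\<Pi>\<^sub>E k\<in>UNIV. {t. poly (Q k \<eta>) (t ^ d) = 0})" unfolding Z_def PiE_UNIV_domain by auto
  moreover have "finite (\<Pi>\<^sub>E k\<in>UNIV. {t. poly (Q k \<eta>) (t ^ d) = 0})"
   by (rule finite_PiE[OF finite]) (rule finite_root_set[OF PQ[OF Pk] d])
  ultimately have Zf: "finite Z" by simp
  have "\<forall>H\<in>{H \<in> smooth_sections f. \<Phi> f H = c}. \<exists>z. z \<in> Z \<and> (\<exists>h. h \<noteq> zv \<and> H = proj_pt h \<and> par z h)"
  proof
   fix H assume H: "H \<in> {H \<in> smooth_sections f. \<Phi> f H = c}"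
   hence "H \<in> smooth_sections f" by simp
   then obtain z h where z: "h \<noteq> zv" "H = proj_pt h" "par z h" "\<Phi> f H = orb (sec z)"
    by (rule smooth_section_cases)
   hence "orb (sec z) = orb g1" using H c1 by simp
   hence "equivf (sec z) g1" using orb_eq_iff[of d "sec z" g1] form_sec fg1 by (simp add: d_def)
   then obtain v v' b where v: "inv_ap v v'" "b \<noteq> 0" "g1 = (%x. b * sec z (ap v x))" by (auto simp: equivf_def)
   \<comment> \<open>A \<open>d\<close>-th root moves the scalar \<open>b\<close> into the matrix.
     The section of \<open>z'\<close> is then exactly \<open>g1\<close>, so the entries of
     \<open>z'\<close> are roots of the fixed polynomials belonging to the values of
     \<open>g1\<close>.\<close>
   obtain r where r: "r \<noteq> 0" "b = r ^ d" using exists_complex_root_nonzero[OF v(2), of d] d by auto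
   define z' where "z' = (%(i, k). \<Sum>j\<in>UNIV. z (i, j) * (r * v (j, k)))"
   have z': "ap z' x = ap z (ap (%k. r * v k) x)" for x unfolding z'_def ap_comp by simp
   have "par z' h" by (rule par_comp[OF z(3) inv_ap_scale[OF r(1) v(1)] z'])
   moreover have "g1 x = sec z' x" for x
    using form_homog[OF form_f, of r "ap z (ap v x)"]
    by (simp add: v(3) r(2) sec_def z' ap_scale ap_scale_right d_def del: power_Suc)
   hence "y z' = \<eta>" by (simp add: y_def \<eta>_def)
   hence "z' \<in> Z" using Qy[of _ z'] by (simp add: Z_def)
   ultimately show "\<exists>z. z \<in> Z \<and> (\<exists>h. h \<noteq> zv \<and> H = proj_pt h \<and> par z h)" using z(1,2) by blast
  qed
  from bchoice[OF this] obtain zz where zz: "\<And>H. H \<in> {H \<in> smooth_sections f. \<Phi> f H = c} \<Longrightarrow>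
   zz H \<in> Z \<and> (\<exists>h. h \<noteq> zv \<and> H = proj_pt h \<and> par (zz H) h)" by blast
  have "inj_on zz {H \<in> smooth_sections f. \<Phi> f H = c}"
  proof (rule inj_onI)
   fix H H' assume H: "H \<in> {H \<in> smooth_sections f. \<Phi> f H = c}" "H' \<in> {H \<in> smooth_sections f. \<Phi> f H = c}" and e: "zz H = zz H'"
   obtain h where h: "h \<noteq> zv" "H = proj_pt h" "par (zz H) h" using zz[OF H(1)] by blast
   obtain h' where h': "h' \<noteq> zv" "H' = proj_pt h'" "par (zz H) h'" using zz[OF H(2)] e by auto
   show "H = H'" using par_unique[OF h(3) h'(3) h(1) h'(1)] h(2) h'(2) by simp
  qed
  thus ?thesis using inj_on_finite[OF _ _ Zf] zz by blast
 qed
 ultimately show ?thesis unfolding generically_finite_def d_def[symmetric] using oV by blast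
qed

lemma generically_finite_quartic:
 assumes "e \<ge> 3" shows "generically_finite (Suc e) f"
proof -
 have nz: "\<And>x. (\<And>i. pd i (mpoly_eval f) x = 0) \<Longrightarrow> x = zv" using smoothf_f by (simp add: smoothf_def)
 obtain a where a: "\<forall>N :: 4 \<Rightarrow> 3 cvec. (\<forall>x. dotp (%i. dotp (N i) x) (%i. pd i (mpoly_eval f) (emb4 a x 0)) = 0) \<longrightarrow> N = (%_ _. 0)"
  using generic_no_linear_syzygy[OF form_f assms nz] by blast
 show ?thesis by (rule generically_finite_if_no_syzygies[of a]) (use a in blast)
qed

end

subsection \<open>Invariants of plane cubics\<close>

text \<open>Weights of the polarization identity
  \<open>24 u v w = (u+v+w)^3 - (u+v-w)^3 - (u-v+w)^3 - (-u+v+w)^3\<close>.\<close>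

definition sg :: "4 cvec" where "sg \<epsilon> = (if \<epsilon> = 1 then 1 else -1) / 24"

definition cmb :: "4 \<Rightarrow> 'v cvec \<Rightarrow> 'v cvec \<Rightarrow> 'v cvec \<Rightarrow> 'v cvec" where
 "cmb \<epsilon> u v w = (%i. (if \<epsilon> = 4 then - u i else u i) + (if \<epsilon> = 3 then - v i else v i) + (if \<epsilon> = 2 then - w i else w i))"

text \<open>The symmetric trilinear form with \<open>pl g v v v = g v\<close>.\<close>

definition pl :: "'v cfun \<Rightarrow> 'v cvec \<Rightarrow> 'v cvec \<Rightarrow> 'v cfun" where
 "pl g u v w = (\<Sum>\<epsilon>\<in>UNIV. sg \<epsilon> * g (cmb \<epsilon> u v w))"

lemma pl_expl: "pl g u v w = (g (%i. u i + v i + w i) - g (%i. u i + v i - w i) - g (%i. u i - v i + w i) - g (%i. - u i + v i + w i)) / 24"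
 by (simp add: pl_def sum_4 sg_def cmb_def diff_divide_distrib)

lemma pl_sym12: "pl g u v w = pl g v u w"
 by (simp add: pl_expl algebra_simps)

lemma pl_sym23: "pl g u v w = pl g u w v"
 by (simp add: pl_expl algebra_simps)

lemma pl_diag: "form 3 g \<Longrightarrow> pl g v v v = g v"
 using form_homog[of 3 g 3 v] by (simp add: pl_expl)

lemma pl_cube: "pl (%x. dotp l x ^ 3) u v w = dotp l u * dotp l v * dotp l w"
proof -
 have *: "dotp l (%i. u i + v i + w i) = dotp l u + dotp l v + dotp l w"
  "dotp l (%i. u i + v i - w i) = dotp l u + dotp l v - dotp l w"
  "dotp l (%i. u i - v i + w i) = dotp l u - dotp l v + dotp l w"
  "dotp l (%i. - u i + v i + w i) = - dotp l u + dotp l v + dotp l w"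
  by (simp_all add: dotp_def algebra_simps sum.distrib sum_subtractf sum_negf)
 show ?thesis unfolding pl_expl * by (simp add: field_simps) algebra
qed

lemma form_decomp:
 fixes p :: "'v::finite cfun"
 assumes "form m p" "m = Suc n"
 shows "\<exists>q. (\<forall>i. form n (q i)) \<and> (\<forall>x. p x = (\<Sum>i\<in>UNIV. x i * q i x))"
 using assms
proof (induction rule: form.induct)
 case (form_step k p v)
 show ?case
 proof (intro exI conjI allI)
  show "form n (if i = v then p else zv)" for i using form_step by (simp add: form_zero)
  have "x i * (if i = v then p else zv) x = (if i = v then x v * p x else 0)" for x i by simp
  thus "x v * p x = (\<Sum>i\<in>UNIV. x i * (if i = v then p else zv) x)" for x by simp
 qed
next
 case (form_add k p q)
 then obtain r s where "\<And>i. form n (r i)" "\<And>x. p x = (\<Sum>i\<in>UNIV. x i * r i x)" "\<And>i. form n (s i)" "\<And>x. q x = (\<Sum>i\<in>UNIV. x i * s i x)"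
  by blast
 thus ?case
  by (intro exI[of _ "%i x. r i x + s i x"]) (auto intro: form.form_add simp: distrib_left sum.distrib)
qed simp

lemma cubic_coeffs:
 fixes g :: "'v::finite cfun"
 assumes "form 3 g" shows "\<exists>a. \<forall>x. g x = (\<Sum>i\<in>UNIV. \<Sum>j\<in>UNIV. \<Sum>k\<in>UNIV. a i j k * (x i * x j * x k))"
proof -
 obtain q where q: "\<And>i. form 2 (q i)" "\<And>x. g x = (\<Sum>i\<in>UNIV. x i * q i x)" using form_decomp[OF assms, of 2] by auto
 have "\<forall>i. \<exists>r. (\<forall>j. form 1 (r j)) \<and> (\<forall>x. q i x = (\<Sum>j\<in>UNIV. x j * r j x))" using form_decomp[OF q(1), of 1] by auto
 from choice[OF this] obtain r where r: "\<And>i j. form 1 (r i j)" "\<And>i x. q i x = (\<Sum>j\<in>UNIV. x j * r i j x)" by blast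
 have "\<forall>i. \<exists>c. \<forall>j. r i j = (%x. \<Sum>k\<in>UNIV. c j k * x k)"
 proof
  fix i
  have "\<forall>j. \<exists>c. r i j = (%x. \<Sum>k\<in>UNIV. c k * x k)" using form_1D[OF r(1)] by blast
  from choice[OF this] show "\<exists>c. \<forall>j. r i j = (%x. \<Sum>k\<in>UNIV. c j k * x k)" .
 qed
 from choice[OF this] obtain c where c: "\<And>i j. r i j = (%x. \<Sum>k\<in>UNIV. c i j k * x k)" by blast
 show ?thesis by (rule exI[of _ c]) (simp add: q(2) r(2) c sum_distrib_left mult_ac)
qed

lemma pl_linear:
 fixes g :: "'v::finite cfun"
 assumes "form 3 g"
 shows "pl g u v (%i. s * w i + t * w' i) = s * pl g u v w + t * pl g u v w'"
proof -
 obtain a where a: "\<And>x. g x = (\<Sum>i\<in>UNIV. \<Sum>j\<in>UNIV. \<Sum>k\<in>UNIV. a i j k * (x i * x j * x k))" using cubic_coeffs[OF assms] by blast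
 have p: "pl g u v w = (\<Sum>i\<in>UNIV. \<Sum>j\<in>UNIV. \<Sum>k\<in>UNIV. a i j k / 6 *
   (u i * v j * w k + u i * w j * v k + v i * u j * w k + v i * w j * u k + w i * u j * v k + w i * v j * u k))" for w
  unfolding pl_expl a sum_subtractf[symmetric] sum_divide_distrib
  by (intro sum.cong refl) (simp add: field_simps)
 show ?thesis
  unfolding p sum_distrib_left sum.distrib[symmetric] by (intro sum.cong refl) (simp add: field_simps)
qed

lemma pl_basis:
 fixes w :: "3 cvec"
 assumes "form 3 g" shows "pl g u v w = (\<Sum>k\<in>UNIV. w k * pl g u v (unitv k))"
proof -
 have "w = (%i. w 1 * unitv 1 i + 1 * (w 2 * unitv 2 i + w 3 * unitv 3 i))"
 proof
  fix i :: 3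
  show "w i = w 1 * unitv 1 i + 1 * (w 2 * unitv 2 i + w 3 * unitv 3 i)"
   using exhaust_3[of i] by (auto simp: unitv_def)
 qed
 hence "pl g u v w = pl g u v (%i. w 1 * unitv 1 i + 1 * (w 2 * unitv 2 i + w 3 * unitv 3 i))" by (rule arg_cong)
 also have "\<dots> = (\<Sum>k\<in>UNIV. w k * pl g u v (unitv k))" unfolding pl_linear[OF assms] by (simp add: sum_3)
 finally show ?thesis .
qed

type_synonym ridx = "3 \<times> 3 \<times> 3 \<times> 4 \<times> 4"

definition rpt :: "ridx \<Rightarrow> 3 cvec" where
 "rpt = (%(i, j, k, \<epsilon>, \<epsilon>'). cmb \<epsilon> (unitv i) (unitv j) (unitv k))"
definition rvec :: "ridx \<Rightarrow> 3 cvec" where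
 "rvec = (%(i, j, k, \<epsilon>, \<epsilon>'). cmb \<epsilon>' (unitv i) (unitv j) (unitv k))"
definition rw :: "ridx \<Rightarrow> complex" where
 "rw = (%(i, j, k, \<epsilon>, \<epsilon>'). sg \<epsilon> * sg \<epsilon>')"

text \<open>Expand \<open>g l\<close> by trilinearity in the unit vectors; the products of
  coordinates of \<open>l\<close> that occur are polarizations of the cube of a linear form. So
  every cubic is a combination of fixed cubes of linear forms, weighted by its values at fixed
  points.\<close>

lemma cube_reproducing:
 assumes g: "form 3 g" shows "g l = (\<Sum>t\<in>UNIV. rw t * g (rpt t) * dotp l (rvec t) ^ 3)"
proof -
 have "g l = (\<Sum>k\<in>UNIV. l k * pl g l l (unitv k))" using pl_diag[OF g, of l] pl_basis[OF g, of l l l] by simp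
 also have "\<dots> = (\<Sum>k\<in>UNIV. l k * (\<Sum>j\<in>UNIV. l j * pl g l (unitv k) (unitv j)))"
  unfolding pl_sym23[of g l l] pl_basis[OF g, of l "unitv _" l] ..
 also have "\<dots> = (\<Sum>k\<in>UNIV. l k * (\<Sum>j\<in>UNIV. l j * (\<Sum>i\<in>UNIV. l i * pl g (unitv k) (unitv j) (unitv i))))"
 proof -
  have "pl g l u v = (\<Sum>i\<in>UNIV. l i * pl g u v (unitv i))" for u v
   using pl_basis[OF g, of u v l] pl_sym12[of g l u v] pl_sym23[of g u l v] by simp
  thus ?thesis by presburger
 qed
 also have "\<dots> = (\<Sum>k\<in>UNIV. \<Sum>j\<in>UNIV. \<Sum>i\<in>UNIV. pl g (unitv k) (unitv j) (unitv i) * pl (%x. dotp l x ^ 3) (unitv k) (unitv j) (unitv i))"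
  unfolding pl_cube by (simp add: dotp_commute[of l] dotp_unitv sum_distrib_left mult_ac)
 also have "\<dots> = (\<Sum>k\<in>UNIV. \<Sum>j\<in>UNIV. \<Sum>i\<in>UNIV. \<Sum>\<epsilon>\<in>UNIV. \<Sum>\<epsilon>'\<in>UNIV.
   sg \<epsilon> * sg \<epsilon>' * g (cmb \<epsilon> (unitv k) (unitv j) (unitv i)) * dotp l (cmb \<epsilon>' (unitv k) (unitv j) (unitv i)) ^ 3)"
  unfolding pl_def sum_product by (simp add: mult_ac)
 also have "\<dots> = (\<Sum>t\<in>UNIV \<times> UNIV \<times> UNIV \<times> UNIV \<times> UNIV. rw t * g (rpt t) * dotp l (rvec t) ^ 3)"
  unfolding sum.cartesian_product by (simp add: rw_def rpt_def rvec_def split_beta)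
 finally show ?thesis by simp
qed

lemma multi_cube_reproducing:
 fixes D :: "('k::finite \<Rightarrow> 3 cvec) \<Rightarrow> complex"
 assumes D: "\<And>L k. form 3 (%l. D (L(k := l)))"
 shows "D L = (\<Sum>\<sigma>\<in>UNIV \<rightarrow>\<^sub>E UNIV. (\<Prod>k\<in>UNIV. rw (\<sigma> k) * dotp (L k) (rvec (\<sigma> k)) ^ 3) * D (%k. rpt (\<sigma> k)))"
proof -
 have "D L = (\<Sum>\<sigma>\<in>K \<rightarrow>\<^sub>E UNIV. (\<Prod>k\<in>K. rw (\<sigma> k) * dotp (L k) (rvec (\<sigma> k)) ^ 3) * D (%k. if k \<in> K then rpt (\<sigma> k) else L k))"
  if "finite K" for K
  using that
 proof (induction K)
  case (insert k0 K)
  have st: "D (%k. if k \<in> K then rpt (\<sigma> k) else L k) =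
    (\<Sum>t\<in>UNIV. rw t * dotp (L k0) (rvec t) ^ 3 * D (%k. if k \<in> insert k0 K then rpt ((\<sigma>(k0 := t)) k) else L k))" for \<sigma>
  proof -
   define M where "M = (%k. if k \<in> K then rpt (\<sigma> k) else L k)"
   have "M(k0 := L k0) = M" using insert.hyps by (auto simp: M_def fun_eq_iff)
   hence "D M = D (M(k0 := L k0))" by simp
   also have "\<dots> = (\<Sum>t\<in>UNIV. rw t * D (M(k0 := rpt t)) * dotp (L k0) (rvec t) ^ 3)"
    using cube_reproducing[OF D[of M k0], of "L k0"] .
   also have "\<dots> = (\<Sum>t\<in>UNIV. rw t * dotp (L k0) (rvec t) ^ 3 * D (M(k0 := rpt t)))" by (simp add: mult_ac)
   finally have DM: "D M = (\<Sum>t\<in>UNIV. rw t * dotp (L k0) (rvec t) ^ 3 * D (M(k0 := rpt t)))" .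
   have "M(k0 := rpt t) = (%k. if k \<in> insert k0 K then rpt ((\<sigma>(k0 := t)) k) else L k)" for t
    by (auto simp: M_def)
   thus ?thesis using DM unfolding M_def by presburger
  qed
  have pr: "(\<Prod>k\<in>insert k0 K. rw ((\<sigma>(k0 := t)) k) * dotp (L k) (rvec ((\<sigma>(k0 := t)) k)) ^ 3) =
    rw t * dotp (L k0) (rvec t) ^ 3 * (\<Prod>k\<in>K. rw (\<sigma> k) * dotp (L k) (rvec (\<sigma> k)) ^ 3)" for \<sigma> t
  proof -
   have "(\<Prod>k\<in>K. rw ((\<sigma>(k0 := t)) k) * dotp (L k) (rvec ((\<sigma>(k0 := t)) k)) ^ 3) = (\<Prod>k\<in>K. rw (\<sigma> k) * dotp (L k) (rvec (\<sigma> k)) ^ 3)"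
    using insert.hyps by (intro prod.cong) auto
   thus ?thesis using insert.hyps by simp
  qed
  have "D L = (\<Sum>\<sigma>\<in>K \<rightarrow>\<^sub>E UNIV. \<Sum>t\<in>UNIV. (\<Prod>k\<in>insert k0 K. rw ((\<sigma>(k0 := t)) k) * dotp (L k) (rvec ((\<sigma>(k0 := t)) k)) ^ 3) *
    D (%k. if k \<in> insert k0 K then rpt ((\<sigma>(k0 := t)) k) else L k))"
   unfolding insert.IH st pr sum_distrib_left by (simp add: mult_ac)
  also have "\<dots> = (\<Sum>p\<in>UNIV \<times> (K \<rightarrow>\<^sub>E UNIV). (\<Prod>k\<in>insert k0 K. rw (((snd p)(k0 := fst p)) k) * dotp (L k) (rvec (((snd p)(k0 := fst p)) k)) ^ 3) *
    D (%k. if k \<in> insert k0 K then rpt (((snd p)(k0 := fst p)) k) else L k))"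
   by (subst sum.swap) (simp add: sum.cartesian_product split_beta)
  also have "\<dots> = (\<Sum>\<sigma>\<in>insert k0 K \<rightarrow>\<^sub>E UNIV. (\<Prod>k\<in>insert k0 K. rw (\<sigma> k) * dotp (L k) (rvec (\<sigma> k)) ^ 3) *
    D (%k. if k \<in> insert k0 K then rpt (\<sigma> k) else L k))"
   unfolding PiE_insert_eq
   by (subst sum.reindex[OF inj_combinator[OF insert.hyps(2)]], unfold o_def split_beta, rule refl)
  finally show ?case .
 qed simp
 from this[OF finite[of UNIV]] show ?thesis by simp
qed

text \<open>The symbolic method: \<open>D\<close> is a symbol, cubic in each slot, and
  \<open>inv_of D\<close> is the associated form in the values of \<open>g\<close>. On a sum of
  cubes it is obtained by inserting the linear forms into the slots in all ways, see
  \<open>inv_of_power_sum\<close>.\<close>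

definition inv_of :: "(('k::finite \<Rightarrow> 3 cvec) \<Rightarrow> complex) \<Rightarrow> 3 cfun \<Rightarrow> complex" where
 "inv_of D g = (\<Sum>\<sigma>\<in>UNIV \<rightarrow>\<^sub>E UNIV. (\<Prod>k\<in>UNIV. rw (\<sigma> k) * g (rvec (\<sigma> k))) * D (%k. rpt (\<sigma> k)))"

lemma form_inv_of: "form (CARD('k)) (inv_of (D :: ('k::finite \<Rightarrow> 3 cvec) \<Rightarrow> complex))"
proof -
 have "form (\<Sum>k\<in>(UNIV :: 'k set). 1) (%g. \<Prod>k\<in>UNIV. rw (\<sigma> k) * g (rvec (\<sigma> k)))" for \<sigma> :: "'k \<Rightarrow> ridx"
  by (intro form_prod form_scale form_var)
 thus ?thesis unfolding inv_of_def[abs_def] by (intro form_sum form_scale_right) simp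
qed

lemma inv_of_power_sum:
 fixes D :: "('k::finite \<Rightarrow> 3 cvec) \<Rightarrow> complex"
 assumes D: "\<And>L k. form 3 (%l. D (L(k := l)))" and I: "finite I"
 shows "inv_of D (%x. \<Sum>i\<in>I. c i * dotp (l i) x ^ 3) = (\<Sum>\<tau>\<in>UNIV \<rightarrow>\<^sub>E I. (\<Prod>k\<in>UNIV. c (\<tau> k)) * D (%k. l (\<tau> k)))"
proof -
 have P: "(\<Prod>k\<in>UNIV. \<Sum>i\<in>I. F k i) = (\<Sum>\<tau>\<in>UNIV \<rightarrow>\<^sub>E I. \<Prod>k\<in>UNIV. F k (\<tau> k))" for F :: "'k \<Rightarrow> _ \<Rightarrow> complex"
  by (rule prod_sum_PiE) (use I in auto)
 have "inv_of D (%x. \<Sum>i\<in>I. c i * dotp (l i) x ^ 3) =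
   (\<Sum>\<sigma>\<in>UNIV \<rightarrow>\<^sub>E UNIV. \<Sum>\<tau>\<in>UNIV \<rightarrow>\<^sub>E I. (\<Prod>k\<in>UNIV. rw (\<sigma> k) * (c (\<tau> k) * dotp (l (\<tau> k)) (rvec (\<sigma> k)) ^ 3)) * D (%k. rpt (\<sigma> k)))"
  by (simp only: inv_of_def sum_distrib_left P sum_distrib_right)
 also have "\<dots> = (\<Sum>\<tau>\<in>UNIV \<rightarrow>\<^sub>E I. (\<Prod>k\<in>UNIV. c (\<tau> k)) *
   (\<Sum>\<sigma>\<in>UNIV \<rightarrow>\<^sub>E UNIV. (\<Prod>k\<in>UNIV. rw (\<sigma> k) * dotp (l (\<tau> k)) (rvec (\<sigma> k)) ^ 3) * D (%k. rpt (\<sigma> k))))"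
  unfolding sum_distrib_left by (subst sum.swap) (simp add: prod.distrib mult_ac)
 finally show ?thesis unfolding multi_cube_reproducing[OF D, of "%k. l (_ k)", symmetric] .
qed

definition tr :: "(3 \<times> 3 \<Rightarrow> complex) \<Rightarrow> 3 cvec \<Rightarrow> 3 cvec" where
 "tr z l = (%j. \<Sum>i\<in>UNIV. z (i, j) * l i)"

lemma dotp_tr: "dotp (tr z l) x = dotp l (ap z x)"
proof -
 have "dotp (tr z l) x = (\<Sum>j\<in>UNIV. \<Sum>i\<in>UNIV. z (i, j) * l i * x j)" by (simp add: dotp_def tr_def sum_distrib_right)
 also have "\<dots> = dotp l (ap z x)" by (subst sum.swap) (simp add: dotp_def ap_def sum_distrib_left mult_ac)
 finally show ?thesis .
qed

text \<open>Writing \<open>g\<close> as a sum of cubes of linear forms, the substitution acts on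
  these forms by the transpose, and the factor \<delta> of the symbol passes to every term.\<close>

lemma inv_of_ap:
 fixes D :: "('k::finite \<Rightarrow> 3 cvec) \<Rightarrow> complex"
 assumes D: "\<And>L k. form 3 (%l. D (L(k := l)))" and z: "\<And>L. D (%k. tr z (L k)) = \<delta> * D L" and g: "form 3 g"
 shows "inv_of D (%x. g (ap z x)) = \<delta> * inv_of D g"
proof -
 define c where "c = (%t. rw t * g (rpt t))"
 have g': "g x = (\<Sum>t\<in>UNIV. c t * dotp (rvec t) x ^ 3)" for x
  unfolding c_def dotp_commute[of "rvec _"] by (rule cube_reproducing[OF g])
 have "(%x. g (ap z x)) = (%x. \<Sum>t\<in>UNIV. c t * dotp (tr z (rvec t)) x ^ 3)" unfolding g' dotp_tr ..
 moreover have "g = (%x. \<Sum>t\<in>UNIV. c t * dotp (rvec t) x ^ 3)" using g' by blast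
 ultimately show ?thesis
  using inv_of_power_sum[OF D finite[of UNIV], of c "%t. tr z (rvec t)"] inv_of_power_sum[OF D finite[of UNIV], of c rvec]
  by (simp add: z sum_distrib_left mult_ac)
qed

text \<open>The bracket of classical invariant theory, the determinant with rows \<open>a\<close>,
  \<open>b\<close>, \<open>c\<close>.\<close>

definition br :: "3 cvec \<Rightarrow> 3 cvec \<Rightarrow> 3 cfun" where
 "br a b c = a 1 * (b 2 * c 3 - b 3 * c 2) - a 2 * (b 1 * c 3 - b 3 * c 1) + a 3 * (b 1 * c 2 - b 2 * c 1)"

definition dt :: "(3 \<times> 3 \<Rightarrow> complex) \<Rightarrow> complex" where
 "dt z = br (%j. z (1, j)) (%j. z (2, j)) (%j. z (3, j))"

lemma br_tr: "br (tr z a) (tr z b) (tr z c) = dt z * br a b c"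
 unfolding br_def tr_def dt_def sum_3 by algebra

lemma br_scale: "br (%i. s * a i) b c = s * br a b c" "br a (%i. s * b i) c = s * br a b c" "br a b (%i. s * c i) = s * br a b c"
 by (simp_all add: br_def algebra_simps)

text \<open>The symbols of the Aronhold invariants of degrees four and six.\<close>

definition D4 :: "(4 \<Rightarrow> 3 cvec) \<Rightarrow> complex" where
 "D4 L = br (L 1) (L 2) (L 3) * br (L 1) (L 2) (L 4) * br (L 1) (L 3) (L 4) * br (L 2) (L 3) (L 4)"

definition D6 :: "(3 \<times> 2 \<Rightarrow> 3 cvec) \<Rightarrow> complex" where
 "D6 L = br (L (1, 1)) (L (2, 1)) (L (3, 1)) * br (L (1, 1)) (L (2, 1)) (L (3, 2)) * br (L (2, 1)) (L (3, 1)) (L (1, 2)) *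
   br (L (3, 1)) (L (1, 1)) (L (2, 2)) * br (L (1, 2)) (L (2, 2)) (L (3, 2)) ^ 2"

lemma polyf_slot: "polyf (%l. (L(k := l)) j i)"
 by (cases "j = k") (simp_all add: polyf_var polyf_const)

lemma polyf_br_slot: "polyf (%l. br ((L(k := l)) a) ((L(k := l)) b) ((L(k := l)) c))"
 unfolding br_def by (intro polyf_add polyf_diff polyf_mult polyf_slot)

lemma form_D4: "form 3 (%l. D4 (L(k := l)))"
proof (rule polyf_homog_form)
 show "polyf (%l. D4 (L(k := l)))" unfolding D4_def by (intro polyf_mult polyf_br_slot)
 show "D4 (L(k := %v. s * l v)) = s ^ 3 * D4 (L(k := l))" for s l
  using exhaust_4[of k] by (auto simp: D4_def br_scale power3_eq_cube)
qed

lemma form_D6: "form 3 (%l. D6 (L(k := l)))"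
proof (rule polyf_homog_form)
 show "polyf (%l. D6 (L(k := l)))" unfolding D6_def by (intro polyf_mult polyf_power polyf_br_slot)
 obtain i j where k: "k = (i, j)" by fastforce
 show "D6 (L(k := %v. s * l v)) = s ^ 3 * D6 (L(k := l))" for s l
  using exhaust_3[of i] exhaust_2[of j] unfolding k by (elim disjE) (simp_all add: D6_def br_scale power3_eq_cube power2_eq_square)
qed

definition iS :: "3 cfun \<Rightarrow> complex" where "iS = inv_of D4"
definition iT :: "3 cfun \<Rightarrow> complex" where "iT = inv_of D6"

lemma form_iS: "form 4 iS" using form_inv_of[of D4] by (simp add: iS_def)
lemma form_iT: "form 6 iT" using form_inv_of[of D6] by (simp add: iT_def)

lemma iS_ap: "form 3 g \<Longrightarrow> iS (%x. g (ap z x)) = dt z ^ 4 * iS g"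
 unfolding iS_def by (rule inv_of_ap[OF form_D4]) (simp_all add: D4_def br_tr power_def)

lemma iT_ap: "form 3 g \<Longrightarrow> iT (%x. g (ap z x)) = dt z ^ 6 * iT g"
 unfolding iT_def by (rule inv_of_ap[OF form_D6]) (simp_all add: D6_def br_tr eval_nat_numeral)

lemma dt_nonzero: assumes "inv_ap z w" shows "dt z \<noteq> 0"
proof -
 have "tr w (tr z l) j = l j" for l j
 proof -
  have "dotp (tr w (tr z l)) (unitv j) = dotp l (unitv j)" unfolding dotp_tr inv_apD[OF assms] ..
  thus ?thesis by (simp add: dotp_commute[of _ "unitv j"] dotp_unitv)
 qed
 hence "tr w (tr z l) = l" for l by blast
 hence "dt w * (dt z * br (unitv 1) (unitv 2) (unitv 3)) = br (unitv 1) (unitv 2) (unitv 3)"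
  unfolding br_tr[symmetric] by simp
 moreover have "br (unitv 1) (unitv 2) (unitv 3) = 1" by (simp add: br_def unitv_def)
 ultimately show ?thesis by auto
qed

subsection \<open>Weierstrass normal form\<close>

lemma pl_expand:
 fixes u v w :: "'v::finite cvec"
 assumes g: "form 3 g"
 shows "g (%i. x * u i + y * v i + z * w i) = x ^ 3 * pl g u u u + y ^ 3 * pl g v v v + z ^ 3 * pl g w w w
  + 3 * x ^ 2 * y * pl g u u v + 3 * x ^ 2 * z * pl g u u w + 3 * x * y ^ 2 * pl g u v v + 3 * y ^ 2 * z * pl g v v w
  + 3 * x * z ^ 2 * pl g u w w + 3 * y * z ^ 2 * pl g v w w + 6 * x * y * z * pl g u v w"
proof -
 define A where "A = (%i. x * u i + y * v i + z * w i)"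
 have A: "A = (%i. 1 * (x * u i + y * v i) + z * w i)" by (simp add: A_def)
 have L3: "pl g a b A = x * pl g a b u + y * pl g a b v + z * pl g a b w" for a b
  unfolding A pl_linear[OF g] by simp
 have L2: "pl g a A b = x * pl g a u b + y * pl g a v b + z * pl g a w b" for a b
  using L3[of a b] by (simp only: pl_sym23[of g a _ b])
 have L1: "pl g A a b = x * pl g u a b + y * pl g v a b + z * pl g w a b" for a b
  using L2[of a b] by (simp only: pl_sym12[of g _ a b])
 have "g A = pl g A A A" by (simp only: pl_diag[OF g])
 hence "g A = x ^ 3 * pl g u u u + y ^ 3 * pl g v v v + z ^ 3 * pl g w w w
  + 3 * x ^ 2 * y * pl g u u v + 3 * x ^ 2 * z * pl g u u w + 3 * x * y ^ 2 * pl g u v v + 3 * y ^ 2 * z * pl g v v w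
  + 3 * x * z ^ 2 * pl g u w w + 3 * y * z ^ 2 * pl g v w w + 6 * x * y * z * pl g u v w"
  unfolding L1 L2 L3
  using pl_sym12[of g u v u] pl_sym12[of g u w u] pl_sym12[of g u v v] pl_sym12[of g v w v] pl_sym12[of g u w w] pl_sym12[of g v w w]
   pl_sym23[of g u v u] pl_sym23[of g u w u] pl_sym23[of g v u v] pl_sym23[of g v w v] pl_sym23[of g w u w] pl_sym23[of g w v w]
   pl_sym23[of g u v w] pl_sym12[of g u v w] pl_sym12[of g u w v] pl_sym23[of g v u w] pl_sym23[of g w u v]
  by algebra
 thus ?thesis by (simp only: A_def)
qed

lemma pd_pl:
 fixes v :: "'v::finite cvec"
 assumes g: "form 3 g" shows "pd i g v = 3 * pl g v v (unitv i)"
proof (rule pd_eqI)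
 have "g (v(i := t)) = pl g v v v + 3 * (t - v i) * pl g v v (unitv i) + 3 * (t - v i) ^ 2 * pl g v (unitv i) (unitv i)
   + (t - v i) ^ 3 * pl g (unitv i) (unitv i) (unitv i)" for t
 proof -
  have "v(i := t) = (%j. 1 * v j + (t - v i) * unitv i j + 0 * v j)" by (auto simp: unitv_def fun_eq_iff)
  thus ?thesis by (simp only: pl_expand[OF g]) (simp add: power2_eq_square)
 qed
 thus "((%t. g (v(i := t))) has_field_derivative 3 * pl g v v (unitv i)) (at (v i))"
  by (auto intro!: derivative_eq_intros)
qed

lemma br_kernel:
 assumes "br a b c = 0" shows "\<exists>k. k \<noteq> zv \<and> dotp a k = 0 \<and> dotp b k = 0 \<and> dotp c k = 0"
proof -
 define M :: "complex^3^3" where "M = (\<chi> i j. if i = 1 then a j else if i = 2 then b j else c j)"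
 have "det M = 0" using assms by (simp add: M_def det_3 br_def algebra_simps)
 hence "\<not> (\<exists>B. B ** M = mat 1)" using invertible_det_nz[of M] invertible_left_inverse[of M] by blast
 then obtain x where x: "M *v x = 0" "x \<noteq> 0" unfolding matrix_left_invertible_ker by blast
 have "dotp (%j. M $ i $ j) (%j. x $ j) = 0" for i
  using x(1) by (simp add: vec_eq_iff matrix_vector_mult_def dotp_def)
 from this[of 1] this[of 2] this[of 3]
 have "dotp a (%j. x $ j) = 0" "dotp b (%j. x $ j) = 0" "dotp c (%j. x $ j) = 0" by (simp_all add: M_def)
 moreover have "(%j. x $ j) \<noteq> zv" using x(2) by (auto simp: vec_eq_iff fun_eq_iff)
 ultimately show ?thesis by blast
qed

lemma inv_ap_of_inj:
 fixes z :: "'v::finite \<times> 'v \<Rightarrow> complex"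
 assumes "\<And>x. ap z x = zv \<Longrightarrow> x = zv" shows "\<exists>w. inv_ap z w"
proof -
 have "x = 0" if "matr z *v x = 0" for x
 proof -
  have "ap z (%k. x $ k) = zv" using that by (simp add: matrix_vector_ap ent_matr vec_eq_iff fun_eq_iff)
  from assms[OF this] show ?thesis by (simp add: vec_eq_iff fun_eq_iff)
 qed
 hence "invertible (matr z)" unfolding invertible_left_inverse matrix_left_invertible_ker by blast
 thus ?thesis by (simp add: invertible_iff_inv_ap ent_matr)
qed

text \<open>The point \<open>unitv 2\<close> is a flex with tangent \<open>x 3 = 0\<close>.\<close>

definition Wf :: "complex \<Rightarrow> complex \<Rightarrow> 3 cfun" where
 "Wf a b = (%x. x 2 ^ 2 * x 3 + x 1 ^ 3 + a * (x 1 * x 3 ^ 2) + b * x 3 ^ 3)"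

text \<open>A zero \<open>p\<close> of the cubic and its Hessian is a flex: if \<open>k\<close> spans the kernel of the Hessian matrix
 at \<open>p\<close>, then the cubic vanishes to third order at \<open>p\<close> on the line through \<open>p\<close> and \<open>k\<close>.\<close>

lemma weierstrass:
 assumes "g \<in> SC 3" shows "\<exists>a b z w. inv_ap z w \<and> (%x. g (ap z x)) = Wf a b"
proof -
 have g: "form 3 g" and sm: "smoothf g" using assms by (auto simp: SC_def)
 define G where "G = pl g"
 have s12: "G u v w = G v u w" and s23: "G u v w = G u w v" for u v w
  unfolding G_def by (rule pl_sym12, rule pl_sym23)
 have bas: "G u v w = (\<Sum>k\<in>UNIV. w k * G u v (unitv k))" for u v w unfolding G_def by (rule pl_basis[OF g])
 have lin: "G u v (%i. s * w i + t * w' i) = s * G u v w + t * G u v w'" for u v s w t w'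
  unfolding G_def by (rule pl_linear[OF g])
 have sing: "v = zv" if "\<And>i. G v v (unitv i) = 0" for v
  using sm that unfolding smoothf_def pd_pl[OF g] G_def by simp
 have Gx: "G x u v = dotp (%k. G u v (unitv k)) x" for x u v
  using bas[of u v x] s12[of x u v] s23[of u x v] by (simp add: dotp_def mult.commute)
 \<comment> \<open>The Hessian determinant of \<open>g\<close>, up to a constant factor.\<close>
 define h where "h = (%x. br (%j. G x (unitv 1) (unitv j)) (%j. G x (unitv 2) (unitv j)) (%j. G x (unitv 3) (unitv j)))"
 have "form 3 h"
 proof (rule polyf_homog_form)
  have "(%x. G x u v) = dotp (%k. G u v (unitv k))" for u v using Gx[of _ u v] by blast
  hence "polyf (%x. G x u v)" for u v using form_polyf[OF form_dotp_var[of "%k. G u v (unitv k)"]] by simp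
  thus "polyf h" unfolding h_def br_def by (intro polyf_add polyf_diff polyf_mult)
  have "G (%v. s * x v) u v = s * G x u v" for s x u v
   by (simp only: Gx[of "%v. s * x v" u v] Gx[of x u v] dotp_scale_right)
  thus "h (%v. s * x v) = s ^ 3 * h x" for s x unfolding h_def by (simp add: br_scale power3_eq_cube)
 qed
 then obtain p where p: "p \<noteq> zv" "g p = 0" "h p = 0" using two_forms_zero[OF g, of 3 h] by auto
 obtain k where k: "k \<noteq> zv" "dotp (%j. G p (unitv 1) (unitv j)) k = 0" "dotp (%j. G p (unitv 2) (unitv j)) k = 0"
  "dotp (%j. G p (unitv 3) (unitv j)) k = 0"
  using br_kernel p(3) unfolding h_def by blast
 have "G p (unitv i) k = 0" for i
  using exhaust_3[of i] k(2-4) bas[of p "unitv i" k] by (auto simp: dotp_def mult.commute)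
 hence pku: "G p k u = 0" for u using bas[of p k u] s23[of p k] by simp
 have ppp: "G p p p = 0" using pl_diag[OF g, of p] p(2) by (simp add: G_def)
 obtain i where "G p p (unitv i) \<noteq> 0" using sing[of p] p(1) by blast
 then obtain m0 where m0: "G p p m0 \<noteq> 0" by blast
 have ppk: "G p p k = 0" using pku[of p] s23[of p p k] by simp
 have zero: "G u v zv = 0" for u v using lin[of u v 0 "%_. 0" 0 "%_. 0"] by simp
 have lin3: "G u v (%i. x * a i + y * b i + z * c i) = x * G u v a + y * G u v b + z * G u v c" for u v x y z a b c
  using lin[of u v 1 "%i. x * a i + y * b i" z c] by (simp add: lin)
 have indep: "x = 0 \<and> y = 0 \<and> z = 0" if e: "(%i. x * k i + y * p i + z * m i) = zv" and m: "G p p m \<noteq> 0" for x y z m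
 proof -
  have z: "z = 0" using lin3[of p p x k y p z m] ppk ppp m zero by (simp add: e)
  have "x * G p m k + y * G p m p + z * G p m m = 0" using lin3[of p m x k y p z m] zero by (simp add: e)
  hence y: "y = 0" using z pku[of m] s23[of p m k] s23[of p m p] m by simp
  have "x * k i = 0" for i using fun_cong[OF e, of i] y z by simp
  thus ?thesis using y z k(1) by (auto simp: fun_eq_iff)
 qed
 \<comment> \<open>Otherwise \<open>g\<close> would vanish on the whole line through
   \<open>p\<close> and \<open>k\<close>, and the square root \<open>y\<close> would single out a
   singular point \<open>k + y p\<close> on it.\<close>
 have kkk: "G k k k \<noteq> 0"
 proof
  assume kkk: "G k k k = 0"
  define y where "y = csqrt (- G k k m0 / G p p m0)"
  have y2: "y ^ 2 * G p p m0 = - G k k m0" unfolding y_def power2_csqrt using m0 by simp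
  define v where "v = (%i. 1 * k i + y * p i)"
  have vv: "G v v u = G k k u + 2 * y * G p k u + y ^ 2 * G p p u" for u
  proof -
   have "G v v u = G v u k + y * G v u p" using lin[of v u 1 k y p] s23[of v v u] by (simp add: v_def)
   also have "G v u k = G k u k + y * G k u p" using lin[of k u 1 k y p] s12[of v u k] s23[of u v k] s12[of u k v]
    by (simp add: v_def)
   also have "G v u p = G p u k + y * G p u p" using lin[of p u 1 k y p] s12[of v u p] s23[of u v p] s12[of u p v]
     by (simp add: v_def)
   also have "G k u k = G k k u" by (rule s23)
   also have "G k u p = G p k u" by (metis s12 s23)
   also have "G p u k = G p k u" by (rule s23)
   also have "G p u p = G p p u" by (rule s23)
   finally show ?thesis by (simp add: algebra_simps power2_eq_square)
  qed
  define z where "z = (%(i, j). if j = (1::3) then k i else if j = 2 then p i else m0 i)"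
  have z: "ap z x = (%i. x 1 * k i + x 2 * p i + x 3 * m0 i)" for x by (simp add: ap_def z_def sum_3 mult.commute)
  have "x = zv" if "ap z x = zv" for x
  proof
   fix i show "x i = 0" using indep[of "x 1" "x 2" "x 3" m0] that m0 exhaust_3[of i] unfolding z by auto
  qed
  then obtain w where w: "inv_ap z w" using inv_ap_of_inj by blast
  have "G v v u = 0" for u
  proof -
   define x where "x = ap w u"
   have "u = (%i. x 1 * k i + x 2 * p i + x 3 * m0 i)" using inv_apD(1)[OF w, of u] unfolding z x_def by simp
   hence "G v v u = x 1 * G v v k + x 2 * G v v p + x 3 * G v v m0" using lin3 by metis
   moreover have "G v v k = 0" using vv[of k] kkk pku[of k] ppk by simp
   moreover have "G v v p = 0" using vv[of p] ppp pku[of p] pku[of k] s12[of k k p] s23[of k k p] s12[of k p k] by simp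
   moreover have "G v v m0 = 0" using vv[of m0] pku[of m0] y2 by simp
   ultimately show ?thesis by simp
  qed
  hence "v = zv" by (rule sing)
  hence "(%i. 1 * k i + y * p i + 0 * m0 i) = zv" by (simp add: v_def)
  from indep[OF this m0] show False by simp
 qed
 obtain r where r: "r ^ 3 * G k k k = 1"
 proof -
  obtain r where "1 / G k k k = r ^ 3" using exists_complex_root[of 3 "1 / G k k k"] by auto
  thus thesis using that[of r] kkk by (simp add: field_simps)
 qed
 define q where "q = (%i. r * k i)"
 have sc: "G u v q = r * G u v k" for u v using lin[of u v r k 0 k] by (simp add: q_def)
 have qqq: "G q q q = 1"
 proof -
  have "G q q k = r * G q k k" using sc[of q k] s23[of q q k] by simp
  moreover have "G q k k = r * G k k k" using sc[of k k] s12[of q k k] s23[of k q k] by simp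
  ultimately show ?thesis using sc[of q q] r by (simp add: power3_eq_cube mult.assoc)
 qed
 have pqu: "G p q u = 0" for u using sc[of p u] pku[of u] s23[of p u k] s23[of p q u] by simp
 \<comment> \<open>The factor makes the coefficient of \<open>x 2 ^ 2 * x 3\<close>, which is
   \<open>3 * G p p m\<close>, equal to one. Adding multiples of \<open>p\<close> and
   \<open>q\<close> then completes the square in \<open>x 2\<close> and the cube in
   \<open>x 1\<close>.\<close>
 define m1 where "m1 = (%i. 1 / (3 * G p p m0) * m0 i + 0 * p i)"
 have ppm1: "G p p m1 = 1 / 3" unfolding m1_def lin using m0 by simp
 define l where "l = - 3 / 2 * G p m1 m1"
 define \<mu> where "\<mu> = - G q q m1"
 define m where "m = (%i. 1 * m1 i + l * p i + \<mu> * q i)"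
 have Gm: "G u v m = G u v m1 + l * G u v p + \<mu> * G u v q" for u v unfolding m_def lin3 by simp
 have ppq: "G p p q = 0" using pqu[of p] s23[of p p q] by simp
 have ppm: "G p p m = 1 / 3" by (simp add: Gm ppm1 ppp ppq)
 have qqp: "G q q p = 0" using pqu[of q] s23[of q q p] s12[of q p q] by simp
 have qqm: "G q q m = 0" by (simp add: Gm qqp qqq \<mu>_def)
 have pmm: "G p m m = 0"
 proof -
  have "G p m m = G p m m1 + l * G p m p" using pqu[of m] s23[of p m q] by (simp add: Gm[of p m])
  also have "G p m m1 = G p m1 m1 + l * (1 / 3)"
   using Gm[of p m1] s23[of p m m1] pqu[of m1] s23[of p m1 q] ppm1 s23[of p m1 p] by simp
  also have "G p m p = 1 / 3" using ppm s23[of p m p] by simp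
  finally show ?thesis by (simp add: l_def)
 qed
 define z where "z = (%(i, j). if j = (1::3) then q i else if j = 2 then p i else m i)"
 have z: "ap z x = (%i. x 1 * q i + x 2 * p i + x 3 * m i)" for x by (simp add: ap_def z_def sum_3 mult.commute)
 have "x = zv" if "ap z x = zv" for x
 proof
  have "(%i. (x 1 * r) * k i + x 2 * p i + x 3 * m i) = zv" using that by (simp add: z q_def mult.assoc)
  from indep[OF this] have "x 1 * r = 0" "x 2 = 0" "x 3 = 0" using ppm by simp_all
  moreover have "r \<noteq> 0" using r by auto
  ultimately show "x i = 0" for i using exhaust_3[of i] by auto
 qed
 then obtain w where w: "inv_ap z w" using inv_ap_of_inj by blast
 have "g (ap z x) = Wf (3 * G q m m) (G m m m) x" for x
 proof -
  have "G q p p = 0" "G q p m = 0" using pqu s12[of q p] by simp_all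
  thus ?thesis
   unfolding z pl_expand[OF g] G_def[symmetric] qqq ppp qqp qqm ppm pmm by (simp add: Wf_def)
 qed
 thus ?thesis using w by blast
qed

lemma Wf_equiv: assumes "g \<in> SC 3" shows "\<exists>a b. equivf g (Wf a b) \<and> Wf a b \<in> SC 3"
proof -
 obtain a b z w where z: "inv_ap z w" "(%x. g (ap z x)) = Wf a b" using weierstrass[OF assms] by blast
 have "inv_ap z w \<and> (1 :: complex) \<noteq> 0 \<and> Wf a b = (%x. 1 * g (ap z x))" using z by simp
 hence "equivf g (Wf a b)" unfolding equivf_def by blast
 thus ?thesis using assms smoothf_equivf equivf_form unfolding SC_def by blast
qed

lemma form_Wf: "form 3 (Wf a b)"
proof -
 have "polyf (Wf a b)" unfolding Wf_def
  by (intro polyf_add polyf_mult polyf_power polyf_var polyf_const)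
 thus ?thesis by (rule polyf_homog_form) (simp add: Wf_def algebra_simps power2_eq_square power3_eq_cube)
qed

lemma pd_Wf:
 "pd 1 (Wf a b) x = 3 * x 1 ^ 2 + a * x 3 ^ 2" "pd 2 (Wf a b) x = 2 * x 2 * x 3"
 "pd 3 (Wf a b) x = x 2 ^ 2 + 2 * a * x 1 * x 3 + 3 * b * x 3 ^ 2"
 by (rule pd_eqI, auto simp: Wf_def intro!: derivative_eq_intros)+

lemma Wf_smooth:
 assumes "4 * a ^ 3 + 27 * b ^ 2 \<noteq> 0" shows "Wf a b \<in> SC 3"
proof -
 have "x = zv" if x: "\<And>i. pd i (Wf a b) x = 0" for x
 proof -
  have e: "3 * x 1 ^ 2 + a * x 3 ^ 2 = 0" "2 * x 2 * x 3 = 0" "x 2 ^ 2 + 2 * a * x 1 * x 3 + 3 * b * x 3 ^ 2 = 0"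
   using x[of 1] x[of 2] x[of 3] by (simp_all add: pd_Wf)
  have x3: "x 3 = 0"
  proof (rule ccontr)
   assume x3: "x 3 \<noteq> 0"
   hence x2: "x 2 = 0" using e(2) by simp
   have "(2 * a * x 1 + 3 * b * x 3) * x 3 = 0" using e(3) x2 by (simp add: algebra_simps power2_eq_square)
   hence l: "2 * a * x 1 + 3 * b * x 3 = 0" using x3 by simp
   have "(4 * a ^ 3 + 27 * b ^ 2) * x 3 ^ 2 = 0" using e(1) l by algebra
   thus False using assms x3 by simp
  qed
  have "x 1 = 0" using e(1) x3 by simp
  moreover have "x 2 = 0" using e(3) x3 by simp
  ultimately show ?thesis using x3 by (intro ext) (metis exhaust_3)
 qed
 thus ?thesis using form_Wf by (auto simp: SC_def smoothf_def)
qed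

lemma Wf_not_cuspidal: assumes "Wf a b \<in> SC 3" shows "a \<noteq> 0 \<or> b \<noteq> 0"
proof (rule ccontr)
 assume "\<not> ?thesis"
 hence "pd i (Wf a b) (unitv 3) = 0" for i using exhaust_3[of i] by (auto simp: pd_Wf unitv_def)
 hence "unitv 3 = (%_::3. 0)" using assms by (auto simp: SC_def smoothf_def)
 from fun_cong[OF this, of 3] show False by (simp add: unitv_def)
qed

text \<open>The diagonal substitution for which \<open>a\<close> and \<open>b\<close> have the
  weights four and six.\<close>

definition zs :: "complex \<Rightarrow> 3 \<times> 3 \<Rightarrow> complex" where
 "zs s = (%(i, j). if i = j then (if i = 1 then s ^ 2 else if i = 2 then s ^ 3 else 1) else 0)"

lemma ap_zs: "ap (zs s) x = (%i. (if i = 1 then s ^ 2 else if i = 2 then s ^ 3 else 1) * x i)"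
proof
 fix i :: 3
 have "zs s (i, k) * x k = (if k = i then (if i = 1 then s ^ 2 else if i = 2 then s ^ 3 else 1) * x i else 0)" for k
  by (auto simp: zs_def)
 thus "ap (zs s) x i = (if i = 1 then s ^ 2 else if i = 2 then s ^ 3 else 1) * x i" by (simp add: ap_def)
qed

lemma inv_ap_zs: "s \<noteq> 0 \<Longrightarrow> inv_ap (zs s) (zs (1 / s))"
 by (auto simp: inv_ap_def ap_zs fun_eq_iff power_divide)

lemma dt_zs: "dt (zs s) = s ^ 5"
 by (simp add: dt_def br_def zs_def power_add[symmetric])

lemma Wf_zs: "Wf (s ^ 4 * a) (s ^ 6 * b) (ap (zs s) x) = s ^ 6 * Wf a b x"
 unfolding Wf_def ap_zs by simp algebra

lemma Wf_scale: assumes "s \<noteq> 0" shows "equivf (Wf (s ^ 4 * a) (s ^ 6 * b)) (Wf a b)"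
proof -
 have "inv_ap (zs s) (zs (1 / s)) \<and> 1 / s ^ 6 \<noteq> 0 \<and> Wf a b = (%x. 1 / s ^ 6 * Wf (s ^ 4 * a) (s ^ 6 * b) (ap (zs s) x))"
  using inv_ap_zs[OF assms] assms by (simp add: Wf_zs)
 thus ?thesis unfolding equivf_def by blast
qed

text \<open>As a function of \<open>a\<close> and \<open>b\<close> the value is a polynomial;
  comparing powers of \<open>s\<close> leaves the monomials of weight \<open>w\<close>. For small
  \<open>w\<close> hardly any exist, which determines an invariant up to a constant.\<close>

lemma weighted_form:
 assumes P: "form n P" and sc: "\<And>s a b. s \<noteq> 0 \<Longrightarrow> P (%x. Wf (s ^ 4 * a) (s ^ 6 * b) x) = s ^ w * P (%x. Wf a b x)"
 shows "\<exists>c M. finite M \<and> (\<forall>a b. P (Wf a b) = (\<Sum>m\<in>M. if 4 * fst m + 6 * snd m = w then c m * a ^ fst m * b ^ snd m else 0))"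
proof -
 define R where "R = (%y :: 3 cvec. P (%x. y 1 * (x 2 ^ 2 * x 3 + x 1 ^ 3) + y 2 * (x 1 * x 3 ^ 2) + y 3 * x 3 ^ 3))"
 have "form n R" unfolding R_def
  by (rule form_compose_lin[where p = P, OF P]) (intro form_add form_scale_right form_var)
 then obtain F where F: "mpoly_eval F = R" using form_mpoly by blast
 define e where "e = (%m :: 3 \<Rightarrow>\<^sub>0 nat. (lookup m 2, lookup m 3))"
 define K where "K = keys F"
 define c where "c = (%p. \<Sum>m\<in>{m \<in> K. e m = p}. lookup F m)"
 have PR: "P (Wf a b) = (\<Sum>p\<in>e ` K. c p * a ^ fst p * b ^ snd p)" for a b
 proof -
  define y where "y = (%i::3. if i = 1 then 1 else if i = 2 then a else b)"
  have my: "monomv m y = a ^ fst (e m) * b ^ snd (e m)" for m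
  proof -
   have "monomv m y = (\<Prod>v\<in>{1, 2, 3}. y v ^ lookup m v)"
    by (rule monomv_superset) (simp, use exhaust_3 in blast)
   thus ?thesis by (simp add: y_def e_def)
  qed
  have "P (Wf a b) = R y" by (simp add: R_def y_def Wf_def)
  also have "\<dots> = (\<Sum>m\<in>K. lookup F m * monomv m y)"
   unfolding F[symmetric] K_def by (simp add: mpoly_eval_def monomv_def)
  also have "\<dots> = (\<Sum>m\<in>K. lookup F m * (a ^ fst (e m) * b ^ snd (e m)))"
   unfolding my ..
  also have "\<dots> = (\<Sum>p\<in>e ` K. \<Sum>m\<in>{m \<in> K. e m = p}. lookup F m * (a ^ fst (e m) * b ^ snd (e m)))"
   by (rule sum.image_gen) (simp add: K_def)
  also have "\<dots> = (\<Sum>p\<in>e ` K. c p * a ^ fst p * b ^ snd p)"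
   by (intro sum.cong refl) (simp add: c_def sum_distrib_right mult.assoc)
  finally show ?thesis .
 qed
 have "P (Wf a b) = (\<Sum>m\<in>e ` K. if 4 * fst m + 6 * snd m = w then c m * a ^ fst m * b ^ snd m else 0)" for a b
 proof -
  define U where "U = (\<Sum>p\<in>e ` K. monom (c p * a ^ fst p * b ^ snd p) (4 * fst p + 6 * snd p)) - monom (P (Wf a b)) w"
  have "poly U s = 0" if "s \<noteq> 0" for s
  proof -
   have t: "c p * (s ^ 4 * a) ^ fst p * (s ^ 6 * b) ^ snd p = c p * a ^ fst p * b ^ snd p * s ^ (4 * fst p + 6 * snd p)" for p
    unfolding power_mult_distrib power_add power_mult by (simp only: mult_ac)
   have "poly U s = P (Wf (s ^ 4 * a) (s ^ 6 * b)) - s ^ w * P (Wf a b)"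
    unfolding PR[of "s ^ 4 * a" "s ^ 6 * b"] t by (simp add: U_def poly_sum poly_monom mult.commute[of "s ^ w"])
   thus ?thesis using sc[OF that, of a b] by simp
  qed
  \<comment> \<open>The extra factor takes care of the excluded value \<open>s = 0\<close>.\<close>
  hence "poly (U * [:0, 1:]) s = poly 0 s" for s by (cases "s = 0") auto
  hence "U * [:0, 1:] = 0" by (rule poly_ext)
  hence "U = 0" by simp
  hence "coeff U w = 0" by simp
  thus ?thesis by (simp add: U_def coeff_sum)
 qed
 moreover have "finite (e ` K)" by (simp add: K_def)
 ultimately show ?thesis by blast
qed

text \<open>The substitution \<open>zs s\<close> contributes the fourth power of its determinant
  \<open>s ^ 5\<close>, and the factor \<open>s ^ 6\<close> in \<open>Wf_zs\<close> contributes
  \<open>s ^ 24\<close>. The difference of the exponents is the weight four, and \<open>a\<close> is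
  the only monomial of this weight.\<close>

lemma iS_Wf: "\<exists>\<sigma>. \<forall>a b. iS (Wf a b) = \<sigma> * a"
proof -
 have "iS (Wf (s ^ 4 * a) (s ^ 6 * b)) = s ^ 4 * iS (Wf a b)" if "s \<noteq> 0" for s a b
 proof -
  have "s ^ 20 * iS (Wf (s ^ 4 * a) (s ^ 6 * b)) = iS (%x. Wf (s ^ 4 * a) (s ^ 6 * b) (ap (zs s) x))"
   unfolding iS_ap[OF form_Wf] dt_zs power_mult[symmetric] by simp
  also have "\<dots> = s ^ 24 * iS (Wf a b)" unfolding Wf_zs form_homog[OF form_iS] power_mult[symmetric] by simp
  also have "\<dots> = s ^ 20 * (s ^ 4 * iS (Wf a b))" by (simp add: power_add[symmetric] mult.assoc[symmetric])
  finally have eq: "s ^ 20 * iS (Wf (s ^ 4 * a) (s ^ 6 * b)) = s ^ 20 * (s ^ 4 * iS (Wf a b))" .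
  have "s ^ 20 \<noteq> 0" using that by simp
  thus ?thesis by (rule iffD1[OF mult_left_cancel eq])
 qed
 from weighted_form[OF form_iS, of 4] this obtain c M where c: "finite M"
  "\<And>a b. iS (Wf a b) = (\<Sum>m\<in>M. if 4 * fst m + 6 * snd m = 4 then c m * a ^ fst m * b ^ snd m else 0)" by auto
 have *: "4 * i + 6 * j = 4 \<longleftrightarrow> i = 1 \<and> j = 0" for i j :: nat by presburger
 have "iS (Wf a b) = (\<Sum>m\<in>M. if 4 * fst m + 6 * snd m = 4 then c m else 0) * a" for a b
  unfolding c(2) sum_distrib_right by (intro sum.cong) (auto simp: *)
 thus ?thesis by blast
qed

lemma iT_Wf: "\<exists>\<tau>. \<forall>a b. iT (Wf a b) = \<tau> * b"
proof -
 have "iT (Wf (s ^ 4 * a) (s ^ 6 * b)) = s ^ 6 * iT (Wf a b)" if "s \<noteq> 0" for s a b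
 proof -
  have "s ^ 30 * iT (Wf (s ^ 4 * a) (s ^ 6 * b)) = iT (%x. Wf (s ^ 4 * a) (s ^ 6 * b) (ap (zs s) x))"
   unfolding iT_ap[OF form_Wf] dt_zs power_mult[symmetric] by simp
  also have "\<dots> = s ^ 36 * iT (Wf a b)" unfolding Wf_zs form_homog[OF form_iT] power_mult[symmetric] by simp
  also have "\<dots> = s ^ 30 * (s ^ 6 * iT (Wf a b))" by (simp add: power_add[symmetric] mult.assoc[symmetric])
  finally have eq: "s ^ 30 * iT (Wf (s ^ 4 * a) (s ^ 6 * b)) = s ^ 30 * (s ^ 6 * iT (Wf a b))" .
  have "s ^ 30 \<noteq> 0" using that by simp
  thus ?thesis by (rule iffD1[OF mult_left_cancel eq])
 qed
 from weighted_form[OF form_iT, of 6] this obtain c M where c: "finite M"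
  "\<And>a b. iT (Wf a b) = (\<Sum>m\<in>M. if 4 * fst m + 6 * snd m = 6 then c m * a ^ fst m * b ^ snd m else 0)" by auto
 have *: "4 * i + 6 * j = 6 \<longleftrightarrow> i = 0 \<and> j = 1" for i j :: nat by presburger
 have "iT (Wf a b) = (\<Sum>m\<in>M. if 4 * fst m + 6 * snd m = 6 then c m else 0) * b" for a b
  unfolding c(2) sum_distrib_right by (intro sum.cong) (auto simp: *)
 thus ?thesis by blast
qed

text \<open>All nonzero terms agree and cannot cancel; this shows that an invariant is nonzero at a
  form without evaluating it.\<close>

lemma sum_two_values_nonzero:
 fixes F :: "'a cvec"
 assumes "finite A" "\<And>x. x \<in> A \<Longrightarrow> F x = 0 \<or> F x = c" "x0 \<in> A" "F x0 = c" "c \<noteq> 0"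
 shows "sum F A \<noteq> 0"
proof -
 have "sum F A = (\<Sum>x\<in>A. if F x = c then c else 0)" using assms(2) by (intro sum.cong) auto
 also have "\<dots> = of_nat (card {x \<in> A. F x = c}) * c" using assms(1) by (simp add: sum.If_cases Int_def)
 finally show ?thesis using assms by auto
qed

definition l4 :: "4 \<Rightarrow> 3 cvec" where
 "l4 i = (if i = 1 then unitv 1 else if i = 2 then unitv 2 else if i = 3 then unitv 3 else (%_. 1))"

lemma br_alt: "br b a c = - br a b c" "br a c b = - br a b c" "br a a c = 0" "br a b a = 0" "br a b b = 0"
 by (simp_all add: br_def algebra_simps)

lemma br_unitv: "br (unitv 1) (unitv 2) (unitv 3) = 1" "br (unitv 1) (unitv 2) (%_. 1) = 1"
 "br (unitv 1) (unitv 3) (%_. 1) = - 1" "br (unitv 2) (unitv 3) (%_. 1) = 1"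
 by (simp_all add: br_def unitv_def)

lemma D4_values: "D4 (%k. l4 (\<tau> k)) = 0 \<or> D4 (%k. l4 (\<tau> k)) = - 1"
proof -
 have t: "br (l4 1) (l4 2) (l4 3) = 1" "br (l4 1) (l4 2) (l4 4) = 1" "br (l4 1) (l4 3) (l4 4) = - 1" "br (l4 2) (l4 3) (l4 4) = 1"
  by (simp_all add: l4_def br_unitv)
 have p: "br (l4 1) (l4 3) (l4 2) = - 1" "br (l4 2) (l4 1) (l4 3) = - 1" "br (l4 2) (l4 3) (l4 1) = 1" "br (l4 3) (l4 1) (l4 2) = 1" "br (l4 3) (l4 2) (l4 1) = - 1"
  "br (l4 1) (l4 4) (l4 2) = - 1" "br (l4 2) (l4 1) (l4 4) = - 1" "br (l4 2) (l4 4) (l4 1) = 1" "br (l4 4) (l4 1) (l4 2) = 1" "br (l4 4) (l4 2) (l4 1) = - 1"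
  "br (l4 1) (l4 4) (l4 3) = 1" "br (l4 3) (l4 1) (l4 4) = 1" "br (l4 3) (l4 4) (l4 1) = - 1" "br (l4 4) (l4 1) (l4 3) = - 1" "br (l4 4) (l4 3) (l4 1) = 1"
  "br (l4 2) (l4 4) (l4 3) = - 1" "br (l4 3) (l4 2) (l4 4) = - 1" "br (l4 3) (l4 4) (l4 2) = 1" "br (l4 4) (l4 2) (l4 3) = 1" "br (l4 4) (l4 3) (l4 2) = - 1"
  by (simp_all add: l4_def br_def unitv_def)
 have "\<forall>a b c d. br (l4 a) (l4 b) (l4 c) * br (l4 a) (l4 b) (l4 d) * br (l4 a) (l4 c) (l4 d) * br (l4 b) (l4 c) (l4 d) \<in> {0, - 1}"
  unfolding forall_4 by (simp add: t p br_alt(3-5))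
 thus ?thesis unfolding D4_def by blast
qed

text \<open>The test form is a sum of four cubes in general position, for which every term of the
  symbolic sum is \<open>0\<close> or \<open>-1\<close>. It is smooth, so transporting it to
  Weierstrass form excludes \<open>\<sigma> = 0\<close>.\<close>

lemma iS_Wf_nonzero: "\<exists>\<sigma>. \<sigma> \<noteq> 0 \<and> (\<forall>a b. iS (Wf a b) = \<sigma> * a)"
proof -
 obtain \<sigma> where \<sigma>: "\<And>a b. iS (Wf a b) = \<sigma> * a" using iS_Wf by blast
 define g where "g = (%x :: 3 cvec. \<Sum>i\<in>(UNIV :: 4 set). 1 * dotp (l4 i) x ^ 3)"
 have ge: "g x = x 1 ^ 3 + x 2 ^ 3 + x 3 ^ 3 + (x 1 + x 2 + x 3) ^ 3" for x
  by (simp add: g_def sum_4 l4_def dotp_unitv) (simp add: dotp_def sum_3)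
 have "form 3 (%x. 1 * dotp (l4 i) x ^ 3)" for i
  using form_power[OF form_dotp_var, of 3] by simp
 hence g: "form 3 g" unfolding g_def by (intro form_sum)
 have "iS g = (\<Sum>\<tau>\<in>UNIV \<rightarrow>\<^sub>E UNIV. (\<Prod>k\<in>(UNIV :: 4 set). 1) * D4 (%k. l4 (\<tau> k)))"
  unfolding iS_def g_def by (rule inv_of_power_sum[OF form_D4]) simp
 also have "\<dots> \<noteq> 0"
 proof (rule sum_two_values_nonzero[where c = "- 1" and ?x0.0 = "%k. k"])
  show "(\<Prod>k\<in>(UNIV :: 4 set). 1) * D4 (%k. l4 (\<tau> k)) = 0 \<or> (\<Prod>k\<in>(UNIV :: 4 set). 1) * D4 (%k. l4 (\<tau> k)) = - 1" for \<tau>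
   using D4_values[of \<tau>] by simp
 qed (auto intro: finite_PiE simp: D4_def l4_def br_unitv)
 finally have nz: "iS g \<noteq> 0" .
 have "x = zv" if x: "\<And>i. pd i g x = 0" for x
 proof -
  define t where "t = x 1 + x 2 + x 3"
  have "pd 1 g x = 3 * x 1 ^ 2 + 3 * t ^ 2" "pd 2 g x = 3 * x 2 ^ 2 + 3 * t ^ 2" "pd 3 g x = 3 * x 3 ^ 2 + 3 * t ^ 2"
   by (rule pd_eqI, auto simp: ge t_def intro!: derivative_eq_intros)+
  hence z: "3 * x 1 ^ 2 + 3 * t ^ 2 = 0" "3 * x 2 ^ 2 + 3 * t ^ 2 = 0" "3 * x 3 ^ 2 + 3 * t ^ 2 = 0"
   using x by simp_all
  have e: "x 1 ^ 2 = - (t ^ 2)" using z(1) by algebra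
  have "x 2 ^ 2 = x 1 ^ 2" using z(1,2) by algebra
  moreover have "x 3 ^ 2 = x 1 ^ 2" using z(1,3) by algebra
  ultimately have "x 2 = x 1 \<or> x 2 = - x 1" "x 3 = x 1 \<or> x 3 = - x 1" by (simp_all add: power2_eq_iff)
  hence "t ^ 2 = 9 * x 1 ^ 2 \<or> t ^ 2 = x 1 ^ 2"
   unfolding t_def by (elim disjE) (simp_all add: power2_eq_square)
  hence "x 1 = 0" using e by (elim disjE) simp_all
  thus ?thesis using \<open>x 2 ^ 2 = x 1 ^ 2\<close> \<open>x 3 ^ 2 = x 1 ^ 2\<close> by (intro ext) (metis exhaust_3 power2_eq_iff minus_zero)
 qed
 hence "g \<in> SC 3" using g by (auto simp: SC_def smoothf_def)
 from weierstrass[OF this] obtain a b z w where z: "inv_ap z w" "(%x. g (ap z x)) = Wf a b" by blast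
 have "\<sigma> * a = dt z ^ 4 * iS g" unfolding \<sigma>[symmetric, of a b] z(2)[symmetric] by (rule iS_ap[OF g])
 hence "\<sigma> \<noteq> 0" using nz dt_nonzero[OF z(1)] by auto
 thus ?thesis using \<sigma> by blast
qed

lemma D6_values: "D6 (%k. unitv (\<tau> k)) = 0 \<or> D6 (%k. unitv (\<tau> k)) = 1"
proof -
 have p: "br (unitv 1) (unitv 2) (unitv 3) = 1" "br (unitv 1) (unitv 3) (unitv 2) = - 1" "br (unitv 2) (unitv 1) (unitv 3) = - 1" "br (unitv 2) (unitv 3) (unitv 1) = 1"
  "br (unitv 3) (unitv 1) (unitv 2) = 1" "br (unitv 3) (unitv 2) (unitv 1) = - 1"
  by (simp_all add: br_def unitv_def)
 have "\<forall>a b c. br (unitv a) (unitv b) (unitv c) = 0 \<or> (\<forall>x y z.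
   br (unitv a) (unitv b) (unitv c) * br (unitv a) (unitv b) (unitv z) * br (unitv b) (unitv c) (unitv x) *
   br (unitv c) (unitv a) (unitv y) * br (unitv x) (unitv y) (unitv z) ^ 2 \<in> {0, 1})"
  unfolding forall_3 by (simp add: p br_alt(3-5))
 thus ?thesis unfolding D6_def by (metis insertE mult_zero_left singletonD)
qed

text \<open>Here the Fermat cubic is the test form; every term of its symbolic sum is
  \<open>0\<close> or \<open>1\<close>.\<close>

lemma iT_Wf_nonzero: "\<exists>\<tau>. \<tau> \<noteq> 0 \<and> (\<forall>a b. iT (Wf a b) = \<tau> * b)"
proof -
 obtain \<tau> where \<tau>: "\<And>a b. iT (Wf a b) = \<tau> * b" using iT_Wf by blast
 define g where "g = (%x :: 3 cvec. \<Sum>i\<in>(UNIV :: 3 set). 1 * dotp (unitv i) x ^ 3)"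
 have ge: "g x = x 1 ^ 3 + x 2 ^ 3 + x 3 ^ 3" for x
  by (simp add: g_def sum_3 dotp_unitv)
 have "form 3 (%x. 1 * dotp (unitv i) x ^ 3)" for i :: 3
  using form_power[OF form_dotp_var, of 3] by simp
 hence g: "form 3 g" unfolding g_def by (intro form_sum)
 have "iT g = (\<Sum>\<tau>\<in>UNIV \<rightarrow>\<^sub>E UNIV. (\<Prod>k\<in>(UNIV :: (3 \<times> 2) set). 1) * D6 (%k. unitv (\<tau> k)))"
  unfolding iT_def g_def by (rule inv_of_power_sum[OF form_D6]) simp
 also have "\<dots> \<noteq> 0"
 proof (rule sum_two_values_nonzero[where c = 1 and ?x0.0 = fst])
  show "(\<Prod>k\<in>(UNIV :: (3 \<times> 2) set). 1) * D6 (%k. unitv (\<tau> k)) = 0 \<or> (\<Prod>k\<in>(UNIV :: (3 \<times> 2) set). 1) * D6 (%k. unitv (\<tau> k)) = 1" for \<tau>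
   using D6_values[of \<tau>] by simp
 qed (auto intro: finite_PiE simp: D6_def br_def unitv_def)
 finally have nz: "iT g \<noteq> 0" .
 have "x = zv" if x: "\<And>i. pd i g x = 0" for x
 proof -
  have "pd 1 g x = 3 * x 1 ^ 2" "pd 2 g x = 3 * x 2 ^ 2" "pd 3 g x = 3 * x 3 ^ 2"
   by (rule pd_eqI, auto simp: ge intro!: derivative_eq_intros)+
  hence "x 1 = 0" "x 2 = 0" "x 3 = 0" using x[of 1] x[of 2] x[of 3] by simp_all
  thus ?thesis by (intro ext) (metis exhaust_3)
 qed
 hence "g \<in> SC 3" using g by (auto simp: SC_def smoothf_def)
 from weierstrass[OF this] obtain a b z w where z: "inv_ap z w" "(%x. g (ap z x)) = Wf a b" by blast
 have "\<tau> * b = dt z ^ 6 * iT g" unfolding \<tau>[symmetric, of b a] z(2)[symmetric] by (rule iT_ap[OF g])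
 hence "\<tau> \<noteq> 0" using nz dt_nonzero[OF z(1)] by auto
 thus ?thesis using \<tau> by blast
qed

subsection \<open>The moduli space of plane cubics\<close>

text \<open>Compares the ratios of \<open>iS ^ 3\<close> to \<open>iT ^ 2\<close>, which amounts to
  comparing \<open>j\<close>-invariants; cleared of denominators, it is a form in the values of
  \<open>h\<close>.\<close>

definition dis :: "3 cfun \<Rightarrow> 3 cfun \<Rightarrow> complex" where
 "dis g h = iT g ^ 2 * iS h ^ 3 - iS g ^ 3 * iT h ^ 2"

lemma form_dis: "form 12 (dis g)"
 unfolding dis_def using form_power[OF form_iS, of 3] form_power[OF form_iT, of 2]
 by (intro form_diff form_scale) simp_all

lemma equivf_invariants:
 assumes "equivf g h" "form 3 g"
 shows "\<exists>u. iS h = u ^ 4 * iS g \<and> iT h = u ^ 6 * iT g"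
proof -
 obtain z w c where z: "inv_ap z w" "c \<noteq> 0" "h = (%x. c * g (ap z x))" using assms(1) by (auto simp: equivf_def)
 have "iS h = (c * dt z) ^ 4 * iS g" unfolding z(3) form_homog[OF form_iS] iS_ap[OF assms(2)] by (simp add: power_mult_distrib)
 moreover have "iT h = (c * dt z) ^ 6 * iT g" unfolding z(3) form_homog[OF form_iT] iT_ap[OF assms(2)] by (simp add: power_mult_distrib)
 ultimately show ?thesis by blast
qed

lemma Wf_separated:
 assumes W: "Wf a b \<in> SC 3" "Wf a0 b0 \<in> SC 3" and e: "b0 ^ 2 * a ^ 3 = a0 ^ 3 * b ^ 2"
 shows "equivf (Wf a b) (Wf a0 b0)"
proof -
 have n: "a \<noteq> 0 \<or> b \<noteq> 0" "a0 \<noteq> 0 \<or> b0 \<noteq> 0" using Wf_not_cuspidal W by blast+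
 have "\<exists>s. s \<noteq> 0 \<and> a = s ^ 4 * a0 \<and> b = s ^ 6 * b0"
 proof (cases "a0 = 0")
  case True
  hence "b0 \<noteq> 0" "a = 0" "b \<noteq> 0" using n e by auto
  moreover obtain s where "s \<noteq> 0" "b / b0 = s ^ 6" using exists_complex_root_nonzero[of "b / b0" 6] calculation by auto
  ultimately show ?thesis using True by (intro exI[of _ s]) (simp add: field_simps)
 next
  case a0: False
  show ?thesis
  proof (cases "b0 = 0")
   case True
   hence "b = 0" "a \<noteq> 0" using n e a0 by auto
   moreover obtain s where "s \<noteq> 0" "a / a0 = s ^ 4" using exists_complex_root_nonzero[of "a / a0" 4] calculation a0 by auto
   ultimately show ?thesis using True a0 by (intro exI[of _ s]) (simp add: field_simps)
  next
   case b0: False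
   have a: "a \<noteq> 0" using n e a0 b0 by auto
   have b: "b \<noteq> 0" using a e a0 b0 by auto
   \<comment> \<open>Since \<open>a\<close> and \<open>b\<close> have weights four and six, the
     quotient of \<open>b / b0\<close> by \<open>a / a0\<close> has to be
     \<open>s ^ 2\<close>.\<close>
   define r where "r = (b * a0) / (b0 * a)"
   have "r \<noteq> 0" using a b a0 b0 by (simp add: r_def)
   then obtain s where s: "s \<noteq> 0" "r = s ^ 2" using exists_complex_root_nonzero[of r 2] by auto
   have "r ^ 2 * a0 * (b0 ^ 2 * a ^ 2) = a * (b0 ^ 2 * a ^ 2)"
   proof -
    have "r ^ 2 * a0 * (b0 ^ 2 * a ^ 2) = a0 ^ 3 * b ^ 2"
     using a b0 by (simp add: r_def power_divide power_mult_distrib power2_eq_square power3_eq_cube)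
    also have "\<dots> = b0 ^ 2 * a ^ 3" using e by simp
    also have "\<dots> = a * (b0 ^ 2 * a ^ 2)" by (simp add: power2_eq_square power3_eq_cube)
    finally show ?thesis .
   qed
   hence r2: "r ^ 2 * a0 = a" using a b0 by simp
   have "r ^ 3 * b0 = r * (r ^ 2 * a0) * b0 / a0" using a0 by (simp add: power2_eq_square power3_eq_cube)
   also have "\<dots> = b" unfolding r2 using a a0 b0 by (simp add: r_def)
   finally have r3: "r ^ 3 * b0 = b" .
   have "a = s ^ 4 * a0" "b = s ^ 6 * b0" using r2 r3 by (simp_all add: s(2) power_mult[symmetric])
   thus ?thesis using s(1) by blast
  qed
 qed
 thus ?thesis using Wf_scale by blast
qed

lemma dis_eq_0_iff:
 assumes "g \<in> SC 3" "h \<in> SC 3" shows "dis g h = 0 \<longleftrightarrow> equivf g h"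
proof
 have fg: "form 3 g" and fh: "form 3 h" using assms by (auto simp: SC_def)
 show "dis g h = 0" if eq: "equivf g h"
 proof -
  obtain u where "iS h = u ^ 4 * iS g" "iT h = u ^ 6 * iT g" using equivf_invariants[OF eq fg] by blast
  thus ?thesis by (simp add: dis_def power_mult_distrib power_mult[symmetric])
 qed
 assume d: "dis g h = 0"
 obtain a0 b0 where W0: "equivf g (Wf a0 b0)" "Wf a0 b0 \<in> SC 3" using Wf_equiv[OF assms(1)] by blast
 obtain a b where W: "equivf h (Wf a b)" "Wf a b \<in> SC 3" using Wf_equiv[OF assms(2)] by blast
 obtain \<sigma> where \<sigma>: "\<sigma> \<noteq> 0" "\<And>a b. iS (Wf a b) = \<sigma> * a" using iS_Wf_nonzero by blast
 obtain \<tau> where \<tau>: "\<tau> \<noteq> 0" "\<And>a b. iT (Wf a b) = \<tau> * b" using iT_Wf_nonzero by blast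
 obtain u where u: "\<sigma> * a0 = u ^ 4 * iS g" "\<tau> * b0 = u ^ 6 * iT g" using equivf_invariants[OF W0(1) fg] \<sigma>(2) \<tau>(2) by metis
 obtain v where v: "\<sigma> * a = v ^ 4 * iS h" "\<tau> * b = v ^ 6 * iT h" using equivf_invariants[OF W(1) fh] \<sigma>(2) \<tau>(2) by metis
 have "(\<tau> ^ 2 * \<sigma> ^ 3) * (b0 ^ 2 * a ^ 3) = (\<tau> * b0) ^ 2 * (\<sigma> * a) ^ 3" by (simp add: power_mult_distrib)
 also have "\<dots> = (u * v) ^ 12 * (iT g ^ 2 * iS h ^ 3)" unfolding u v by (simp add: power_mult_distrib power_mult[symmetric])
 also have "\<dots> = (u * v) ^ 12 * (iS g ^ 3 * iT h ^ 2)" using d by (simp add: dis_def)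
 also have "\<dots> = (\<sigma> * a0) ^ 3 * (\<tau> * b) ^ 2" unfolding u v by (simp add: power_mult_distrib power_mult[symmetric])
 also have "\<dots> = (\<tau> ^ 2 * \<sigma> ^ 3) * (a0 ^ 3 * b ^ 2)" by (simp add: power_mult_distrib)
 finally have "b0 ^ 2 * a ^ 3 = a0 ^ 3 * b ^ 2" using \<sigma>(1) \<tau>(1) by simp
 from Wf_separated[OF W(2) W0(2) this] show "equivf g h" using W0(1) W(1) equivf_sym equivf_trans by blast
qed

text \<open>The complement of the point is the open set defined by \<open>dis g\<close>, whose
  vanishing depends on the orbit only.\<close>

lemma moduli_closed_point:
 assumes g: "g \<in> SC 3" shows "closedin (moduli 3) {orb g}"
proof -
 have fm: "form 3 h" if "h \<in> SC 3" for h using that by (simp add: SC_def)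
 have "{h \<in> SC 3. \<exists>z w. inv_ap z w \<and> dis g (%x. h (ap z x)) \<noteq> 0} = {h \<in> SC 3. \<not> equivf g h}"
 proof -
  have "(\<exists>z w. inv_ap z w \<and> dis g (%x. h (ap z x)) \<noteq> 0) \<longleftrightarrow> \<not> equivf g h" if h: "h \<in> SC 3" for h
  proof
   assume "\<exists>z w. inv_ap z w \<and> dis g (%x. h (ap z x)) \<noteq> 0"
   then obtain z w where z: "inv_ap z w" "dis g (%x. h (ap z x)) \<noteq> 0" by blast
   have "inv_ap z w \<and> (1 :: complex) \<noteq> 0 \<and> (%x. h (ap z x)) = (%x. 1 * h (ap z x))" using z(1) by simp
   hence e: "equivf h (%x. h (ap z x))" unfolding equivf_def by blast
   hence "(%x. h (ap z x)) \<in> SC 3" using h smoothf_equivf equivf_form unfolding SC_def by blast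
   thus "\<not> equivf g h" using dis_eq_0_iff[OF g] z(2) e equivf_trans by blast
  next
   assume "\<not> equivf g h"
   hence "dis g (%x. h (ap (%(i, k). if i = k then 1 else 0) x)) \<noteq> 0" using dis_eq_0_iff[OF g h] by (simp add: ap_id)
   thus "\<exists>z w. inv_ap z w \<and> dis g (%x. h (ap z x)) \<noteq> 0" using inv_ap_id by blast
  qed
  thus ?thesis by blast
 qed
 hence "openin (moduli 3) (orb ` {h \<in> SC 3. \<not> equivf g h})" using moduli_openI[of 3, OF _ form_dis[of g]] by simp
 moreover have "orb ` {h \<in> SC 3. \<not> equivf g h} = topspace (moduli 3) - {orb g}"
  using orb_eq_iff[OF fm fm, OF g] equivf_refl by (auto simp: topspace_moduli image_iff)
 ultimately show ?thesis using g by (simp add: closedin_def topspace_moduli)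
qed

lemma Wf_normalized:
 assumes "Wf a b \<in> SC 3"
 shows "b \<noteq> 0 \<Longrightarrow> \<exists>a'. equivf (Wf a b) (Wf a' 1)" "b = 0 \<Longrightarrow> equivf (Wf a b) (Wf 1 0)"
proof -
 assume "b \<noteq> 0"
 then obtain s where s: "s \<noteq> 0" "b = s ^ 6" using exists_complex_root_nonzero[of b 6] by auto
 thus "\<exists>a'. equivf (Wf a b) (Wf a' 1)" using Wf_scale[OF s(1), of "a / s ^ 4" 1] by (intro exI[of _ "a / s ^ 4"]) simp
next
 assume b: "b = 0"
 hence "a \<noteq> 0" using Wf_not_cuspidal[OF assms] by simp
 then obtain s where s: "s \<noteq> 0" "a = s ^ 4" using exists_complex_root_nonzero[of a 4] by auto
 thus "equivf (Wf a b) (Wf 1 0)" using Wf_scale[OF s(1), of 1 0] b by simp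
qed

lemma SC_equivf: "g \<in> SC d \<Longrightarrow> equivf g h \<Longrightarrow> h \<in> SC d"
 using smoothf_equivf equivf_form unfolding SC_def by blast

lemma orb_equivf: "g \<in> SC d \<Longrightarrow> equivf g h \<Longrightarrow> orb h = orb g"
 using orb_eq_iff[of d g h] SC_equivf[of g d h] by (simp add: SC_def)

text \<open>Apart from the orbit of \<open>Wf 1 0\<close>, all curves occur on the affine line of
  the \<open>Wf t 1\<close>, where a nonempty open condition fails for finitely many
  \<open>t\<close> only.\<close>

lemma moduli_closed_finite:
 assumes C: "closedin (moduli 3) C" shows "C = topspace (moduli 3) \<or> finite C"
proof (cases "topspace (moduli 3) - C = {}")
 case True
 thus ?thesis using closedin_subset[OF C] by blast
next
 case False
 define U where "U = topspace (moduli 3) - C"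
 have U: "openin (moduli 3) U" using C by (simp add: U_def closedin_def)
 have "\<exists>a1. Wf a1 1 \<in> SC 3 \<and> orb (Wf a1 1) \<in> U"
 proof -
  obtain g where g: "g \<in> SC 3" "orb g \<in> U" using False by (auto simp: U_def topspace_moduli)
  obtain a b where ab: "equivf g (Wf a b)" "Wf a b \<in> SC 3" using Wf_equiv[OF g(1)] by blast
  have oU: "orb (Wf a b) \<in> U" using orb_equivf[OF g(1) ab(1)] g(2) by simp
  obtain n P where P: "form n P" "P (Wf a b) \<noteq> 0" "\<And>g. g \<in> SC 3 \<Longrightarrow> P g \<noteq> 0 \<Longrightarrow> orb g \<in> U"
   using moduli_openD[OF _ U ab(2) oU] by auto
  obtain q where q: "\<And>t. P (%x. Wf a 0 x + t * x 3 ^ 3) = poly q t"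
   using polyf_line[OF form_polyf[OF P(1)], of "Wf a 0" "%x. x 3 ^ 3"] by blast
  have qt: "P (Wf a t) = poly q t" for t using q[of t] by (simp add: Wf_def)
  have "q \<noteq> 0" using P(2) qt by auto
  \<comment> \<open>The three factors stand for membership in \<open>U\<close>, for smoothness (the
    discriminant) and for \<open>t \<noteq> 0\<close>; the last allows the normalization to
    \<open>b = 1\<close>.\<close>
  hence "q * [:4 * a ^ 3, 0, 27:] * [:0, 1:] \<noteq> 0" by (intro no_zero_divisors) simp_all
  then obtain t where "poly (q * [:4 * a ^ 3, 0, 27:] * [:0, 1:]) t \<noteq> 0" using poly_all_0_iff_0 by blast
  hence "poly q t * (4 * a ^ 3 + 27 * t ^ 2) * t \<noteq> 0" by (simp add: power2_eq_square algebra_simps)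
  hence t: "poly q t \<noteq> 0" "4 * a ^ 3 + 27 * t ^ 2 \<noteq> 0" "t \<noteq> 0" by auto
  have s: "Wf a t \<in> SC 3" by (rule Wf_smooth[OF t(2)])
  hence "orb (Wf a t) \<in> U" using P(3) qt t(1) by simp
  moreover obtain a' where a': "equivf (Wf a t) (Wf a' 1)" using Wf_normalized(1)[OF s t(3)] by blast
  ultimately show ?thesis using SC_equivf[OF s a'] orb_equivf[OF s a'] by auto
 qed
 then obtain a1 where a1: "Wf a1 1 \<in> SC 3" "orb (Wf a1 1) \<in> U" by blast
 obtain n P where P: "form n P" "P (Wf a1 1) \<noteq> 0" "\<And>g. g \<in> SC 3 \<Longrightarrow> P g \<noteq> 0 \<Longrightarrow> orb g \<in> U"
  using moduli_openD[OF _ U a1] by auto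
 obtain q where q: "\<And>t. P (%x. Wf 0 1 x + t * (x 1 * x 3 ^ 2)) = poly q t"
  using polyf_line[OF form_polyf[OF P(1)], of "Wf 0 1" "%x. x 1 * x 3 ^ 2"] by blast
 have "(%x. Wf 0 1 x + t * (x 1 * x 3 ^ 2)) = Wf t 1" for t by (simp add: Wf_def fun_eq_iff)
 hence qt: "P (Wf t 1) = poly q t" for t using q[of t] by simp
 have "q \<noteq> 0" using P(2) qt by auto
 hence fin: "finite {t. poly q t = 0}" by (rule poly_roots_finite)
 have "C \<subseteq> insert (orb (Wf 1 0)) ((%t. orb (Wf t 1)) ` {t. poly q t = 0})"
 proof
  fix c assume c: "c \<in> C"
  then obtain g where g: "g \<in> SC 3" "c = orb g" using closedin_subset[OF C] by (auto simp: topspace_moduli)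
  obtain a b where ab: "equivf g (Wf a b)" "Wf a b \<in> SC 3" using Wf_equiv[OF g(1)] by blast
  have co: "c = orb (Wf a b)" using orb_equivf[OF g(1) ab(1)] g(2) by simp
  show "c \<in> insert (orb (Wf 1 0)) ((%t. orb (Wf t 1)) ` {t. poly q t = 0})"
  proof (cases "b = 0")
   case True
   thus ?thesis using orb_equivf[OF ab(2) Wf_normalized(2)[OF ab(2)]] co by simp
  next
   case False
   then obtain a' where a': "equivf (Wf a b) (Wf a' 1)" using Wf_normalized(1)[OF ab(2)] by blast
   have co': "c = orb (Wf a' 1)" using orb_equivf[OF ab(2) a'] co by simp
   moreover have "poly q a' = 0" using P(3)[OF SC_equivf[OF ab(2) a']] c co' by (auto simp: qt U_def)
   ultimately show ?thesis by blast
  qed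
 qed
 thus ?thesis using fin finite_subset by blast
qed

text \<open>A finite irreducible closed set is a point because points are closed, and the whole
  space is irreducible because it is infinite. So the longest chains lead from a point to the whole
  space.\<close>

lemma krull_dim_curve:
 assumes pts: "\<And>x. x \<in> topspace X \<Longrightarrow> closedin X {x}" and inf: "infinite (topspace X)"
  and fin: "\<And>C. closedin X C \<Longrightarrow> C = topspace X \<or> finite C"
 shows "krull_dim X = 1"
proof -
 have irr: "irreducible_closed X (topspace X)"
  unfolding irreducible_closed_def
 proof (intro conjI allI impI)
  show "topspace X \<noteq> {}" using inf by auto
  fix A B assume "closedin X A \<and> closedin X B \<and> topspace X \<subseteq> A \<union> B"
  thus "topspace X \<subseteq> A \<or> topspace X \<subseteq> B" using fin[of A] fin[of B] inf finite_subset[of "topspace X" "A \<union> B"] by auto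
 qed simp
 have single: "\<exists>x. Z = {x}" if Z: "irreducible_closed X Z" "Z \<noteq> topspace X" for Z
 proof -
  have cZ: "closedin X Z" and ne: "Z \<noteq> {}" and ir: "\<And>A B. closedin X A \<Longrightarrow> closedin X B \<Longrightarrow> Z \<subseteq> A \<union> B \<Longrightarrow> Z \<subseteq> A \<or> Z \<subseteq> B"
   using Z(1) by (auto simp: irreducible_closed_def)
  have fZ: "finite Z" using fin[OF cZ] Z(2) by blast
  obtain x where x: "x \<in> Z" using ne by blast
  have sub: "Z \<subseteq> topspace X" by (rule closedin_subset[OF cZ])
  have "closedin X (\<Union>y\<in>Z - {x}. {y})" using fZ pts sub by (intro closedin_Union) auto
  hence "closedin X (Z - {x})" by simp
  moreover have "closedin X {x}" using pts x sub by blast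
  ultimately have "Z \<subseteq> {x} \<or> Z \<subseteq> Z - {x}" by (intro ir) auto
  thus ?thesis using x by blast
 qed
 obtain x where x: "x \<in> topspace X" using inf by fastforce
 have ix: "irreducible_closed X {x}" using pts[OF x] by (auto simp: irreducible_closed_def)
 show ?thesis
  unfolding krull_dim_def
 proof (intro antisym Sup_least Sup_upper)
  have "{x} \<noteq> topspace X" using inf by (metis finite.emptyI finite.insertI)
  hence "{x} \<subset> topspace X" using x by blast
  thus "1 \<in> {enat n | n. \<exists>Z. (\<forall>i\<le>n. irreducible_closed X (Z i)) \<and> (\<forall>i<n. Z i \<subset> Z (Suc i))}"
   using irr ix by (auto intro!: exI[of _ "1 :: nat"] exI[of _ "%i :: nat. if i = 0 then {x} else topspace X"] simp: one_enat_def)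
  fix k assume "k \<in> {enat n | n. \<exists>Z. (\<forall>i\<le>n. irreducible_closed X (Z i)) \<and> (\<forall>i<n. Z i \<subset> Z (Suc i))}"
  then obtain n Z where n: "k = enat n" "\<And>i. i \<le> n \<Longrightarrow> irreducible_closed X (Z i)" "\<And>i. i < n \<Longrightarrow> Z i \<subset> Z (Suc i)" by blast
  have "n \<le> 1"
  proof (rule ccontr)
   assume "\<not> n \<le> 1"
   hence s: "Z 0 \<subset> Z 1" "Z 1 \<subset> Z 2" and i: "irreducible_closed X (Z 0)" "irreducible_closed X (Z 1)" "irreducible_closed X (Z 2)"
    using n(2)[of 0] n(2)[of 1] n(2)[of 2] n(3)[of 0] n(3)[of 1] by (auto simp: numeral_2_eq_2)
   have "Z 2 \<subseteq> topspace X" using i(3) closedin_subset by (auto simp: irreducible_closed_def)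
   then obtain y where "Z 1 = {y}" using single[OF i(2)] s(2) by blast
   hence "Z 0 = {}" using s(1) by (auto simp: psubset_eq subset_singleton_iff)
   thus False using i(1) by (simp add: irreducible_closed_def)
  qed
  thus "k \<le> 1" by (simp add: n(1) one_enat_def)
 qed
qed

subsection \<open>Zeros of polynomials in several variables\<close>

lemma polyf_line_bound: "polyf p \<Longrightarrow> \<exists>N. \<forall>u w. \<exists>q. degree q \<le> N \<and> (\<forall>t. p (%v. u v + t * w v) = poly q t)"
proof (induction rule: polyf.induct)
 case (polyf_const c)
 show ?case by (intro exI[of _ 0] allI exI[of _ "[:c:]"]) simp
next
 case (polyf_var v)
 show ?case by (rule exI[of _ 1], intro allI, rule_tac x = "[:u v, w v:]" in exI) simp
next
 case (polyf_add p q)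
 then obtain M N where MN: "\<And>u w. \<exists>r. degree r \<le> M \<and> (\<forall>t. p (%v. u v + t * w v) = poly r t)"
  "\<And>u w. \<exists>r. degree r \<le> N \<and> (\<forall>t. q (%v. u v + t * w v) = poly r t)" by blast
 show ?case
 proof (intro exI[of _ "max M N"] allI)
  fix u w
  obtain r s where "degree r \<le> M" "\<And>t. p (%v. u v + t * w v) = poly r t" "degree s \<le> N" "\<And>t. q (%v. u v + t * w v) = poly s t"
   using MN by meson
  thus "\<exists>r. degree r \<le> max M N \<and> (\<forall>t. p (%v. u v + t * w v) + q (%v. u v + t * w v) = poly r t)"
   using degree_add_le_max[of r s] by (intro exI[of _ "r + s"]) auto
 qed
next
 case (polyf_mult p q)
 then obtain M N where MN: "\<And>u w. \<exists>r. degree r \<le> M \<and> (\<forall>t. p (%v. u v + t * w v) = poly r t)"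
  "\<And>u w. \<exists>r. degree r \<le> N \<and> (\<forall>t. q (%v. u v + t * w v) = poly r t)" by blast
 show ?case
 proof (intro exI[of _ "M + N"] allI)
  fix u w
  obtain r s where "degree r \<le> M" "\<And>t. p (%v. u v + t * w v) = poly r t" "degree s \<le> N" "\<And>t. q (%v. u v + t * w v) = poly s t"
   using MN by meson
  thus "\<exists>r. degree r \<le> M + N \<and> (\<forall>t. p (%v. u v + t * w v) * q (%v. u v + t * w v) = poly r t)"
   using degree_mult_le[of r s] by (intro exI[of _ "r * s"]) auto
 qed
qed

text \<open>A linear factor with root \<open>r\<close> of norm at least \<delta> grows from
  \<open>0\<close> to \<open>t\<close> by a factor of at most
  \<open>1 + norm t / \<delta>\<close>.\<close>

lemma no_roots_growth:
 fixes q :: "complex poly"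
 assumes "\<And>t. norm t < \<delta> \<Longrightarrow> poly q t \<noteq> 0" "degree q \<le> N" "\<delta> > 0"
 shows "norm (poly q t) \<le> norm (poly q 0) * (1 + norm t / \<delta>) ^ N"
 using assms(1,2)
proof (induction N arbitrary: q)
 case 0
 then obtain c where "q = [:c:]" using degree_eq_zeroE[of q] by auto
 thus ?case by simp
next
 case (Suc N)
 show ?case
 proof (cases "degree q = 0")
  case True
  then obtain c where q: "q = [:c:]" by (rule degree_eq_zeroE)
  have "1 \<le> (1 + norm t / \<delta>) ^ Suc N" using assms(3) by (intro one_le_power) simp
  thus ?thesis using mult_left_mono[of 1 _ "norm c"] by (simp add: q)
 next
  case False
  then obtain r where r: "poly q r = 0" using fundamental_theorem_of_algebra[of q] constant_degree[of q] by auto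
  hence rd: "\<delta> \<le> norm r" using Suc.prems(1)[of r] by (meson not_less)
  obtain q1 where q1: "q = [:- r, 1:] * q1" using r poly_eq_0_iff_dvd by (metis dvdE)
  have "q1 \<noteq> 0" using False q1 by auto
  hence "degree q = Suc (degree q1)" unfolding q1 by (subst degree_mult_eq) simp_all
  moreover have "poly q1 t \<noteq> 0" if "norm t < \<delta>" for t using Suc.prems(1)[OF that] q1 by simp
  ultimately have IH: "norm (poly q1 t) \<le> norm (poly q1 0) * (1 + norm t / \<delta>) ^ N"
   using Suc.IH[of q1] Suc.prems(2) by simp
  have r0: "norm r > 0" using rd assms(3) by linarith
  have "norm (t - r) \<le> norm r * (1 + norm t / norm r)" using norm_triangle_ineq4[of t r] r0 by (simp add: distrib_left add.commute)
  also have "\<dots> \<le> norm r * (1 + norm t / \<delta>)" using rd r0 assms(3) by (intro mult_left_mono add_left_mono divide_left_mono) auto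
  finally have "norm (t - r) * norm (poly q1 t) \<le> (norm r * (1 + norm t / \<delta>)) * (norm (poly q1 0) * (1 + norm t / \<delta>) ^ N)"
   using IH by (rule mult_mono) (use assms(3) r0 in simp_all)
  moreover have "norm (poly q t) = norm (t - r) * norm (poly q1 t)"
   unfolding norm_mult[symmetric] by (simp add: q1 algebra_simps)
  moreover have "norm (poly q 0) = norm r * norm (poly q1 0)" by (simp add: q1 norm_mult)
  ultimately show ?thesis by (simp add: mult_ac)
 qed
qed

text \<open>If \<open>Q\<close> had no zero near \<open>0\<close> on the line parallel to the first axis through \<open>s\<close>, its values on that
 line would be bounded in terms of \<open>Q s\<close>, which tends to \<open>0\<close> with \<open>s\<close>.\<close>

lemma zeros_near_infinite:
 fixes Q :: "3 cfun"
 assumes Q: "polyf Q" "Q zv = 0" and d: "\<delta> > 0"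
 shows "infinite {a. Q a = 0 \<and> (\<forall>k. norm (a k) < \<delta>)}" (is "infinite ?Z")
proof -
 have pts: "\<exists>c. range c \<subseteq> {t :: complex. norm t < \<rho>} \<and> inj (c :: nat cvec)" if "\<rho> > 0" for \<rho>
 proof -
  have "inj (%n. complex_of_real (\<rho> / (real n + 2)))" using that by (auto simp: inj_def field_simps)
  moreover have "norm (complex_of_real (\<rho> / (real n + 2))) < \<rho>" for n
   unfolding norm_of_real using that by (simp add: field_simps add_pos_nonneg)
  ultimately show ?thesis by (intro exI[of _ "%n. complex_of_real (\<rho> / (real n + 2))"]) auto
 qed
 define L where "L = (%s t (i :: 3). s * unitv 2 i + t * unitv 1 i)"
 have LZ: "L s t \<in> ?Z" if "Q (L s t) = 0" "norm s < \<delta>" "norm t < \<delta>" for s t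
  using that d by (auto simp: L_def unitv_def)
 have L12: "L s t 1 = t" "L s t 2 = s" for s t by (simp_all add: L_def unitv_def)
 show ?thesis
 proof (cases "\<forall>t. Q (L 0 t) = 0")
  case True
  obtain c :: "nat cvec" where c: "range c \<subseteq> {t. norm t < \<delta>}" "inj c" using pts[OF d] by blast
  have "inj (%n. L 0 (c n))" using L12(1)[of 0] by (intro injI injD[OF c(2)]) metis
  moreover have "range (%n. L 0 (c n)) \<subseteq> ?Z" using c(1) True d by (intro image_subsetI LZ) auto
  ultimately show ?thesis using range_inj_infinite finite_subset by blast
 next
  case False
  then obtain t1 where t1: "Q (L 0 t1) \<noteq> 0" by blast
  obtain N where N: "\<And>u w. \<exists>q. degree q \<le> N \<and> (\<forall>t. Q (%v. u v + t * w v) = poly q t)" using polyf_line_bound[OF Q(1)] by blast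
  have "\<exists>\<rho>>0. \<forall>s. norm s < \<rho> \<longrightarrow> (\<exists>t. norm t < \<delta> \<and> Q (L s t) = 0)"
  proof (rule ccontr)
   assume "\<not> ?thesis"
   hence "\<forall>n. \<exists>s. norm s < 1 / real (Suc n) \<and> (\<forall>t. norm t < \<delta> \<longrightarrow> Q (L s t) \<noteq> 0)"
    by (metis of_nat_0_less_iff zero_less_Suc zero_less_divide_1_iff)
   from choice[OF this] obtain s where s: "\<And>n. norm (s n) < 1 / real (Suc n)" "\<And>n t. norm t < \<delta> \<Longrightarrow> Q (L (s n) t) \<noteq> 0" by blast
   have "s \<longlonglongrightarrow> 0"
   proof (rule tendsto_norm_zero_cancel, rule tendsto_sandwich[OF _ _ tendsto_const])
    show "(%n. 1 / real (Suc n)) \<longlonglongrightarrow> 0" by (rule LIMSEQ_Suc[OF lim_1_over_n])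
    show "\<forall>\<^sub>F n in sequentially. norm (s n) \<le> 1 / real (Suc n)" using s(1) less_imp_le by (intro always_eventually) blast
   qed simp
   hence "(%n. L (s n) t v) \<longlonglongrightarrow> L 0 t v" for t v unfolding L_def by (intro tendsto_intros)
   hence lim: "(%n. Q (L (s n) t)) \<longlonglongrightarrow> Q (L 0 t)" for t by (rule polyf_tendsto[OF _ Q(1)])
   have "norm (Q (L (s n) t1)) \<le> norm (Q (L (s n) 0)) * (1 + norm t1 / \<delta>) ^ N" for n
   proof -
    obtain q where q: "degree q \<le> N" "\<And>t. Q (L (s n) t) = poly q t" using N[of "%v. s n * unitv 2 v" "unitv 1"] by (auto simp: L_def)
    have "poly q t \<noteq> 0" if "norm t < \<delta>" for t using s(2)[OF that, of n] q(2)[of t] by simp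
    from no_roots_growth[OF this q(1) d] show ?thesis by (simp add: q(2))
   qed
   moreover have "(%n. norm (Q (L (s n) t1))) \<longlonglongrightarrow> norm (Q (L 0 t1))" by (rule tendsto_norm[OF lim])
   moreover have "(%n. norm (Q (L (s n) 0)) * (1 + norm t1 / \<delta>) ^ N) \<longlonglongrightarrow> norm (Q (L 0 0)) * (1 + norm t1 / \<delta>) ^ N"
    by (intro tendsto_intros lim)
   ultimately have "norm (Q (L 0 t1)) \<le> norm (Q (L 0 0)) * (1 + norm t1 / \<delta>) ^ N" by (intro LIMSEQ_le) auto
   thus False using t1 Q(2) by (simp add: L_def)
  qed
  then obtain \<rho> where \<rho>: "\<rho> > 0" "\<forall>s. \<exists>t. norm s < \<rho> \<longrightarrow> norm t < \<delta> \<and> Q (L s t) = 0" by blast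
  from choice[OF \<rho>(2)] obtain t where t: "\<And>s. norm s < \<rho> \<Longrightarrow> norm (t s) < \<delta> \<and> Q (L s (t s)) = 0" by blast
  obtain c :: "nat cvec" where c: "range c \<subseteq> {t. norm t < min \<delta> \<rho>}" "inj c" using pts[of "min \<delta> \<rho>"] d \<rho>(1) by auto
  have "inj (%n. L (c n) (t (c n)))" using L12(2) by (intro injI injD[OF c(2)]) metis
  moreover have "range (%n. L (c n) (t (c n))) \<subseteq> ?Z" using c(1) t by (intro image_subsetI LZ) auto
  ultimately show ?thesis using range_inj_infinite finite_subset by blast
 qed
qed

subsection \<open>Degree three\<close>

text \<open>There are ten cubic monomials in three variables, so \<open>g\<close> and the ten forms
  \<open>E q\<close> are dependent; evaluation at the points \<open>X s\<close> yields the
  coefficients.\<close>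

lemma cubic_interpolation:
 fixes E :: "'q::finite \<Rightarrow> 3 cfun"
 assumes card: "CARD('q) = 10" and E: "\<And>q. form 3 (E q)" "\<And>r s. E r (X s) = (if s = r then 1 else 0)" and g: "form 3 g"
 shows "g x = (\<Sum>q\<in>UNIV. g (X q) * E q x)"
proof -
 define M where "M = {m :: 3 \<Rightarrow>\<^sub>0 nat. mdeg m = 3}"
 have md: "mdeg m = lookup m 1 + lookup m 2 + lookup m 3" for m :: "3 \<Rightarrow>\<^sub>0 nat"
 proof -
  have "mdeg m = (\<Sum>v\<in>UNIV. lookup m v)" unfolding mdeg_def by (rule sum.mono_neutral_left) (auto simp: in_keys_iff)
  thus ?thesis by (simp add: sum_3)
 qed
 have i: "inj_on (%m. (lookup m 1, lookup m 2)) M"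
 proof (rule inj_onI)
  fix m n assume mn: "m \<in> M" "n \<in> M" "(lookup m 1, lookup m 2) = (lookup n 1, lookup n 2)"
  show "m = n"
  proof (rule poly_mapping_eqI)
   show "lookup m k = lookup n k" for k using mn exhaust_3[of k] by (auto simp: M_def md)
  qed
 qed
 have s: "(%m. (lookup m 1, lookup m 2)) ` M \<subseteq> (SIGMA i:{..3}. {..3 - i})" by (auto simp: M_def md)
 have c: "card (SIGMA i:{..3::nat}. {..3 - i}) = 10" by (simp add: atMost_Suc eval_nat_numeral)
 have M: "finite M" "card M \<le> 10" using inj_on_finite[OF i s] card_inj_on_le[OF i s] c by simp_all
 define F where "F = (%q. case q of None \<Rightarrow> g | Some q \<Rightarrow> E q)"
 have F: "form 3 (F q)" for q using E(1) g by (cases q) (simp_all add: F_def)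
 have "card M < card (UNIV :: 'q option set)" using M(2) card by (simp add: card_option)
 then obtain c where c: "\<exists>q\<in>UNIV. c q \<noteq> 0" "\<And>m. m \<in> M \<Longrightarrow> (\<Sum>q\<in>UNIV. lookup (pol (F q)) m * c q) = 0"
  using homog_system[of M UNIV "%m q. lookup (pol (F q)) m"] M(1) by auto
 have "(\<Sum>q\<in>UNIV. c q * F q x) = 0" for x
 proof -
  have "F q x = (\<Sum>m\<in>M. lookup (pol (F q)) m * monomv m x)" for q
  proof -
   have "keys (pol (F q)) \<subseteq> M" using homogeneous_pol[OF F[of q]] by (auto simp: homogeneous_def M_def mdeg_def)
   thus ?thesis using mpoly_eval_superset[OF M(1), of "pol (F q)" x] by (simp add: mpoly_eval_pol[OF F])
  qed
  hence "(\<Sum>q\<in>UNIV. c q * F q x) = (\<Sum>q\<in>UNIV. \<Sum>m\<in>M. lookup (pol (F q)) m * c q * monomv m x)"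
   by (simp add: sum_distrib_left mult_ac)
  also have "\<dots> = (\<Sum>m\<in>M. (\<Sum>q\<in>UNIV. lookup (pol (F q)) m * c q) * monomv m x)"
   by (subst sum.swap) (simp add: sum_distrib_right)
  finally show ?thesis using c(2) by simp
 qed
 hence rel: "c None * g x + (\<Sum>q\<in>UNIV. c (Some q) * E q x) = 0" for x
  by (simp add: UNIV_option_conv sum.reindex F_def)
 have cS: "c (Some s) = - (c None * g (X s))" for s
  using rel[of "X s"] by (simp add: E(2) eq_neg_iff_add_eq_0 add.commute if_distrib[of "%z. _ * z"] cong: if_cong)
 have "c None \<noteq> 0"
 proof
  assume n: "c None = 0"
  have "c q = 0" for q using n cS by (cases q) simp_all
  thus False using c(1) by blast
 qed
 moreover have "c None * g x = c None * (\<Sum>q\<in>UNIV. g (X q) * E q x)"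
  using rel[of x] by (simp add: cS sum_negf sum_distrib_left mult.assoc)
 ultimately show ?thesis by simp
qed

context surface
begin

text \<open>With finitely many orbits the product \<open>P\<close> of the corresponding
  \<open>dis\<close> would vanish on all smooth sections and, by density, on all sections. A cubic
  is determined by ten values that are algebraically independent on sections, so \<open>P\<close>
  would vanish on every cubic.\<close>

lemma cubic_image_infinite:
 assumes e2: "e = 2" shows "infinite (topspace (im_\<Phi> 3 f))"
proof
 define Fx where "Fx = (%a i x. pd i (mpoly_eval f) (emb4 a x 0))"
 have fs: "form 3 (sec z)" for z using form_sec[of z] by (simp add: e2)
 have nz: "\<And>x. (\<And>i. pd i (mpoly_eval f) x = 0) \<Longrightarrow> x = zv" using smoothf_f by (simp add: smoothf_def)
 obtain a where a: "\<And>w. (\<And>x. dotp w (%i. Fx a i x) = 0) \<Longrightarrow> w = zv"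
  using generic_polars_independent[OF form_f _ nz] e2 unfolding Fx_def by auto
 have fF: "form 2 (Fx a i)" for i using form_grad_emb4[OF form_f, of i a] by (simp add: Fx_def e2)
 obtain N :: "(3 \<times> 3) option \<Rightarrow> 4 \<Rightarrow> 3 cvec" where
  N: "\<forall>c. (\<forall>x. (\<Sum>k\<in>UNIV. c k * dotp (%i. dotp (N k i) x) (%i. Fx a i x)) = 0) \<longrightarrow> c = zv"
  using quadrics_generate_cubics[of "Fx a", OF fF _ a] grad_emb4_nonzero[OF nz] unfolding Fx_def by blast
 have "c = zv"
  if "\<And>x. (\<Sum>q\<in>UNIV. c q * dotp (%i. dotp (N q i) x) (%i. pd i (mpoly_eval f) (emb4 a x 0))) = 0" for c
  using N that unfolding Fx_def by blast
 from values_independent[of N a, OF this] obtain X K where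
  X: "\<And>r s :: (3 \<times> 3) option. (\<Sum>q\<in>UNIV. K r q * dotp (%i. dotp (N q i) (X s)) (%i. Fx a i (X s))) = (if s = r then 1 else 0)"
  and ind: "\<And>n P. form n P \<Longrightarrow> (\<And>z. P (%q. sec z (X q)) = 0) \<Longrightarrow> P = zv"
  unfolding Fx_def by blast
 define E where "E = (%r x. \<Sum>q\<in>UNIV. K r q * dotp (%i. dotp (N q i) x) (%i. Fx a i x))"
 have E: "form 3 (E r)" for r
  unfolding E_def dotp_def[of "%i. dotp (N _ i) _"]
  using form_mult[OF form_dotp_var fF] by (intro form_sum form_scale) (simp add: eval_nat_numeral)
 have interp: "g x = (\<Sum>q\<in>UNIV. g (X q) * E q x)" if "form 3 g" for g x
  by (rule cubic_interpolation[OF _ E _ that]) (simp_all add: E_def X card_option)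
 assume "finite (topspace (im_\<Phi> 3 f))"
 hence "finite {orb (sec z) | z. smoothf (sec z)}" using topspace_im by (simp add: e2)
 hence "finite ((%z. orb (sec z)) ` {z. smoothf (sec z)})" by (simp add: setcompr_eq_image)
 then obtain Z where Z: "finite Z" "Z \<subseteq> {z. smoothf (sec z)}" "(%z. orb (sec z)) ` {z. smoothf (sec z)} = (%z. orb (sec z)) ` Z"
  by (meson finite_subset_image order_refl)
 have SCs: "sec z \<in> SC 3" if "smoothf (sec z)" for z using SC_sec[OF that] by (simp add: e2)
 define P where "P = (%g. \<Prod>z\<in>Z. dis (sec z) g)"
 have fP: "form (\<Sum>z\<in>Z. 12) P" unfolding P_def by (intro form_prod form_dis)
 have Ps: "P (sec z) = 0" if z: "smoothf (sec z)" for z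
 proof -
  obtain z' where z': "z' \<in> Z" "orb (sec z) = orb (sec z')" using Z(3) z by blast
  have "equivf (sec z') (sec z)" using orb_eq_iff[OF fs fs, of z' z] z'(2) by simp
  hence "dis (sec z') (sec z) = 0" using dis_eq_0_iff SCs z z'(1) Z(2) by blast
  thus ?thesis unfolding P_def using Z(1) z'(1) by (intro prod_zero) auto
 qed
 obtain z0 where z0: "smoothf (sec z0)" using generic_section_smooth[OF form_f e smoothf_f] unfolding sec_def by blast
 have pP: "polyf (%z. P (sec z))"
  by (rule polyf_compose[OF form_polyf[OF fP]]) (rule form_polyf[OF form_sec_entries])
 have all0: "P (sec z) = 0" for z using smooth_generic[OF z0 pP] Ps by blast
 define R where "R = (%\<eta>. P (%x. \<Sum>q\<in>UNIV. \<eta> q * E q x))"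
 have fR: "form (\<Sum>z\<in>Z. 12) R" unfolding R_def
  by (rule form_compose_lin[where p = P, OF fP]) (intro form_sum form_scale_right form_var)
 have RX: "R (%q. g (X q)) = P g" if "form 3 g" for g
 proof -
  have "(%x. \<Sum>q\<in>UNIV. g (X q) * E q x) = g" using interp[OF that] by (intro ext) (rule sym)
  thus ?thesis by (simp only: R_def)
 qed
 have "R (%q. sec z (X q)) = 0" for z using RX[OF fs] all0 by simp
 hence R0: "R = zv" by (rule ind[OF fR])
 have Pg: "P g = 0" if "form 3 g" for g
  using RX[OF that] by (simp add: R0)
 have "\<exists>c :: 2 cvec. (\<Prod>z\<in>Z. dis (sec z) (Wf (c 1) (c 2))) \<noteq> 0"
 proof (rule polyf_prod_nonzero[OF Z(1)])
  fix z assume z: "z \<in> Z"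
  show "polyf (%c :: 2 cvec. dis (sec z) (Wf (c 1) (c 2)))"
   by (rule polyf_compose[OF form_polyf[OF form_dis]])
    (unfold Wf_def, intro polyf_add polyf_mult polyf_const polyf_var)
  obtain \<sigma> where \<sigma>: "\<sigma> \<noteq> 0" "\<And>a b. iS (Wf a b) = \<sigma> * a" using iS_Wf_nonzero by blast
  obtain \<tau> where \<tau>: "\<tau> \<noteq> 0" "\<And>a b. iT (Wf a b) = \<tau> * b" using iT_Wf_nonzero by blast
  have s: "sec z \<in> SC 3" using SCs z Z(2) by blast
  obtain a b where ab: "equivf (sec z) (Wf a b)" "Wf a b \<in> SC 3" using Wf_equiv[OF s] by blast
  obtain u where u: "\<sigma> * a = u ^ 4 * iS (sec z)" "\<tau> * b = u ^ 6 * iT (sec z)"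
   using equivf_invariants[OF ab(1) fs] \<sigma>(2) \<tau>(2) by metis
  hence "iS (sec z) \<noteq> 0 \<or> iT (sec z) \<noteq> 0" using Wf_not_cuspidal[OF ab(2)] \<sigma>(1) \<tau>(1) by auto
  \<comment> \<open>At \<open>Wf 1 0\<close> only the term with \<open>iT (sec z)\<close> survives,
    at \<open>Wf 0 1\<close> only the one with \<open>iS (sec z)\<close>. So no factor of
    \<open>P\<close> vanishes on all Weierstrass forms, and neither does the product.\<close>
  hence "dis (sec z) (Wf 1 0) \<noteq> 0 \<or> dis (sec z) (Wf 0 1) \<noteq> 0" using \<sigma> \<tau> by (auto simp: dis_def)
  thus "\<exists>c :: 2 cvec. dis (sec z) (Wf (c 1) (c 2)) \<noteq> 0"
  proof
   assume "dis (sec z) (Wf 1 0) \<noteq> 0"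
   thus ?thesis by (intro exI[of _ "%i. if i = 1 then 1 else 0"]) simp
  next
   assume "dis (sec z) (Wf 0 1) \<noteq> 0"
   thus ?thesis by (intro exI[of _ "%i. if i = 1 then 0 else 1"]) simp
  qed
 qed
 thus False using Pg[OF form_Wf] unfolding P_def by blast
qed

lemma cubic_fibre_infinite:
 assumes e2: "e = 2" and z0: "smoothf (sec z0)"
 shows "infinite {H \<in> smooth_sections f. \<Phi> f H = orb (sec z0)}" (is "infinite ?F")
proof
 assume fin: "finite ?F"
 have fs: "form 3 (sec z)" for z using form_sec[of z] by (simp add: e2)
 have SCs: "sec z \<in> SC 3" if "smoothf (sec z)" for z using SC_sec[OF that] by (simp add: e2)
 obtain h where h: "h \<noteq> zv" "par z0 h" using smooth_section_exists[OF z0] by blast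
 obtain b where b: "dotp h b \<noteq> 0" using dotp_nonzero[OF h(1)] by blast
 define B where "B = (\<Sum>i\<in>UNIV. norm (b i)) + 1"
 have Bi: "norm (b i) < B" for i
  using member_le_sum[of i UNIV "%i. norm (b i)"] by (simp add: B_def)
 have B0: "B > 0" using Bi[of 1] norm_ge_zero[of "b 1"] by linarith
 \<comment> \<open>The vector \<open>b\<close> lies off the plane of \<open>z0\<close>, so moving
   the points of that plane by multiples of \<open>b\<close> gives pairwise different planes for
   different \<open>a\<close>: an affine chart of the dual space around the given plane.\<close>
 define z where "z = (%(a :: 3 cvec) (k :: 4 \<times> 3). z0 k + b (fst k) * a (snd k))"
 have apz: "ap (z a) x i = ap z0 x i + b i * dotp a x" for a x i
  by (simp add: ap_def z_def dotp_def distrib_right sum.distrib sum_distrib_left mult.assoc)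
 obtain \<epsilon> where \<epsilon>: "\<epsilon> > 0" "\<And>y. (\<And>k. norm (y k - z0 k) < \<epsilon>) \<Longrightarrow> smoothf (sec y)" using smooth_nbhd[OF z0] by blast
 define A where "A = {a. dis (sec z0) (sec (z a)) = 0 \<and> (\<forall>k. norm (a k) < \<epsilon> / B)}"
 have sm: "smoothf (sec (z a))" if "a \<in> A" for a
 proof (rule \<epsilon>(2))
  fix k :: "4 \<times> 3"
  have "norm (a (snd k)) < \<epsilon> / B" using that by (simp add: A_def)
  hence "B * norm (a (snd k)) < \<epsilon>" using B0 by (simp add: field_simps)
  moreover have "norm (b (fst k)) * norm (a (snd k)) \<le> B * norm (a (snd k))"
   using less_imp_le[OF Bi] by (rule mult_right_mono) simp
  ultimately show "norm (z a k - z0 k) < \<epsilon>" by (simp add: z_def norm_mult)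
 qed
 have "polyf (%a. dis (sec z0) (sec (z a)))"
 proof (rule polyf_compose[OF form_polyf[OF form_dis]])
  have "polyf (%a. z a k)" for k unfolding z_def by (intro polyf_add polyf_mult polyf_const polyf_var)
  thus "polyf (%a. sec (z a) x)" for x
   by (rule polyf_compose[where p = "%z. sec z x" and h = "%k a. z a k", OF form_polyf[OF form_sec_entries]])
 qed
 moreover have "dis (sec z0) (sec (z zv)) = 0" by (simp add: z_def dis_def)
 ultimately have infA: "infinite A" unfolding A_def using zeros_near_infinite \<epsilon>(1) B0 by simp
 have "\<forall>a. \<exists>H. a \<in> A \<longrightarrow> H \<in> ?F \<and> (\<exists>h. H = proj_pt h \<and> par (z a) h)"
 proof
  fix a
  show "\<exists>H. a \<in> A \<longrightarrow> H \<in> ?F \<and> (\<exists>h. H = proj_pt h \<and> par (z a) h)"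
  proof (cases "a \<in> A")
   case True
   obtain h where h: "par (z a) h" "proj_pt h \<in> smooth_sections f" "\<Phi> f (proj_pt h) = orb (sec (z a))"
    using smooth_section_exists[OF sm[OF True]] by blast
   have "dis (sec z0) (sec (z a)) = 0" using True by (simp add: A_def)
   hence "equivf (sec z0) (sec (z a))" using dis_eq_0_iff[OF SCs[OF z0] SCs[OF sm[OF True]]] by blast
   hence "proj_pt h \<in> ?F" using orb_equivf[OF SCs[OF z0]] h by simp
   thus ?thesis using h(1) by blast
  qed simp
 qed
 from choice[OF this] obtain H where H: "\<And>a. a \<in> A \<Longrightarrow> H a \<in> ?F \<and> (\<exists>h. H a = proj_pt h \<and> par (z a) h)" by blast
 have "inj_on H A"
 proof (rule inj_onI)
  fix a a' assume a: "a \<in> A" "a' \<in> A" "H a = H a'"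
  obtain k where k: "H a = proj_pt k" "par (z a) k" using H[OF a(1)] by blast
  obtain k' where k': "H a = proj_pt k'" "par (z a') k'" using H[OF a(2)] a(3) by auto
  have "k \<in> proj_pt k" unfolding proj_pt_def by (auto intro: exI[of _ 1])
  then obtain c where c: "c \<noteq> 0" "k = (%v. c * k' v)" using k(1) k'(1) by (auto simp: proj_pt_def)
  have "dotp a x = dotp a' x" for x
  proof -
   have "dotp k' (ap (z a) x) = 0" using par_mem[OF k(2), of x] c(1) by (simp add: c(2) dotp_scale_left)
   then obtain x' where "ap (z a) x = ap (z a') x'" using par_ex[OF k'(2)] by blast
   hence e: "ap z0 x i + b i * dotp a x = ap z0 x' i + b i * dotp a' x'" for i using fun_cong apz by metis
   have hb: "dotp h (%i. ap z0 x i + b i * t) = t * dotp h b" for x t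
    using par_mem[OF h(2), of x] dotp_scale_right[of h t b] by (simp add: dotp_add_right mult.commute)
   have "dotp h (%i. ap z0 x i + b i * dotp a x) = dotp h (%i. ap z0 x' i + b i * dotp a' x')" using e by presburger
   hence d: "dotp a x = dotp a' x'" unfolding hb using b by simp
   hence "ap z0 x = ap z0 x'" using e by (intro ext) simp
   thus ?thesis using par_inj[OF h(2)] d by metis
  qed
  hence "dotp a (unitv i) = dotp a' (unitv i)" for i by blast
  thus "a = a'" by (simp add: dotp_commute[of _ "unitv _"] dotp_unitv fun_eq_iff)
 qed
 hence "infinite (H ` A)" using infA finite_imageD by blast
 moreover have "H ` A \<subseteq> ?F" using H by blast
 ultimately show False using fin finite_subset by blast
qed

text \<open>Image and moduli space are both infinite with finite proper closed subsets, so both have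
  dimension one, which is also the minimum with three. A dense open set of the image is nonempty,
  and its fibres are infinite.\<close>

lemma cubic_case:
 assumes e2: "e = 2" shows "maximal_rank 3 f \<and> \<not> generically_finite 3 f"
proof
 have im: "topspace (im_\<Phi> 3 f) \<subseteq> topspace (moduli 3)" by (auto simp: im_\<Phi>_def topspace_subtopology)
 have infm: "infinite (topspace (moduli 3))" using cubic_image_infinite[OF e2] im finite_subset by blast
 have pt: "closedin (moduli 3) {c}" if "c \<in> topspace (moduli 3)" for c
  using that moduli_closed_point by (auto simp: topspace_moduli)
 have "krull_dim (moduli 3) = 1" by (rule krull_dim_curve[OF pt infm moduli_closed_finite])
 moreover have "krull_dim (im_\<Phi> 3 f) = 1"
 proof (rule krull_dim_curve[OF _ cubic_image_infinite[OF e2]])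
  fix c assume c: "c \<in> topspace (im_\<Phi> 3 f)"
  hence "{c} = {c} \<inter> \<Phi> f ` smooth_sections f" by (auto simp: im_\<Phi>_def topspace_subtopology)
  moreover have "closedin (moduli 3) {c}" using pt c im by blast
  ultimately show "closedin (im_\<Phi> 3 f) {c}" unfolding im_\<Phi>_def closedin_subtopology by blast
 next
  fix C assume "closedin (im_\<Phi> 3 f) C"
  then obtain T where T: "closedin (moduli 3) T" "C = T \<inter> \<Phi> f ` smooth_sections f" by (auto simp: im_\<Phi>_def closedin_subtopology)
  thus "C = topspace (im_\<Phi> 3 f) \<or> finite C"
   using moduli_closed_finite[OF T(1)] by (auto simp: im_\<Phi>_def topspace_subtopology)
 qed
 ultimately show "maximal_rank 3 f" unfolding maximal_rank_def by (simp add: min_def one_enat_def numeral_eq_enat)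
 show "\<not> generically_finite 3 f"
 proof
  assume "generically_finite 3 f"
  then obtain V where V: "openin (im_\<Phi> 3 f) V" "im_\<Phi> 3 f closure_of V = topspace (im_\<Phi> 3 f)"
   "\<And>c. c \<in> V \<Longrightarrow> finite {H \<in> smooth_sections f. \<Phi> f H = c}" unfolding generically_finite_def by blast
  have "V \<noteq> {}" using V(2) cubic_image_infinite[OF e2] by auto
  then obtain c where c: "c \<in> V" by blast
  hence "c \<in> topspace (im_\<Phi> 3 f)" using openin_subset[OF V(1)] by blast
  then obtain z where "c = orb (sec z)" "smoothf (sec z)" using topspace_im by (auto simp: e2)
  thus False using V(3)[OF c] cubic_fibre_infinite[OF e2] by simp
 qed
qed

end

theorem theorem5p2:
  fixes f :: "4 mpoly" and d :: nat
  assumes "d \<ge> 3" and "homogeneous d f" and "smooth_form f"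
  shows "(d = 3 \<longrightarrow> maximal_rank d f \<and> \<not> generically_finite d f) \<and>
         (d \<ge> 4 \<longrightarrow> generically_finite d f)"
proof -
 obtain e where d: "d = Suc e" using assms(1) by (cases d) auto
 interpret surface f e by standard (use assms d in auto)
 show ?thesis using cubic_case generically_finite_quartic d by auto
qed

end
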